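(* (Maximality of $\mathbf h^{\rm I}_m$.) In the setting of the context, fix $\mathcal C\in\mathbf H\Lambda_{\mathcal B}^{\{\mathbf h_m\}}$ of $S$-socle type $\mathbf t$. Then $\mathbf h_m(p)\le\mathbf h^{\rm I}_m(p)$ for all $m$ and $p$; also $\mathrm{rank}(\Lambda^m\mathcal C)\le\beta^{\rm I}_m$, with equality if and only if $\mathbf h_m=\mathbf h^{\rm I}_m$.
   Context: $S$ is a nonempty Noetherian scheme; $\mathcal A=\bigoplus_{p\ge0}\mathcal A_p$ is a finitely generated, graded, quasi-coherent $\mathcal O_S$-algebra with $\mathcal A_0=\mathcal O_S$ and $\mathcal A_p$ locally free of constant rank $\mathbf a(p)$ for all $p$; $\mathcal B=\bigoplus_p\mathcal B_p$ is a graded, locally finitely generated $\mathcal A$-module with $\mathcal B_p$ locally free of constant rank $\mathbf b(p)$, indexed so that $\inf\{p:\mathbf b(p)\ne0\}=0$. For graded $\mathcal C$, $\mathcal C^*:=\mathcal Hom(\mathcal C,\mathcal O_S)$ with $(\mathcal C^* )_q=(\mathcal C_{-q})^*$ and adjoint $\mathcal A$-action. Let $\mathcal C$ be a homogeneous quotient of $\mathcal B$, locally free of finite rank in each degree and nonzero in finitely many degrees. Put $\mathcal D:=\mathcal C^*$, let $\Delta^m\mathcal D$ be the $\mathcal A$-submodule of $\mathcal D$ generated by $\bigoplus_{j\ge m}\mathcal D_{-j}$, and $\Lambda^m\mathcal C:=(\Delta^m\mathcal D)^*$. Given functions $\mathbf h_m\colon\mathbb Z\to\mathbb Z$ ($m\in\mathbb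 Z$), $\mathbf H\Lambda_{\mathcal B}^{\{\mathbf h_m\}}$ is the set of such $\mathcal C$ with $(\Delta^m\mathcal D)_{-p}$ locally free of rank $\mathbf h_m(p)$ and $\mathcal D/\Delta^m\mathcal D$ flat over $\mathcal O_S$ for all $m,p$. $\mathcal C$ is of $S$-socle type $\mathbf t$ if $(\mathcal C^*\otimes_{\mathcal A}\mathcal O_S)_{-p}$ is locally free of rank $\mathbf t(p)$ for all $p$, where $\mathcal O_S=\mathcal A/\bigoplus_{p>0}\mathcal A_p$. $\mathbf t\colon\mathbb Z\to\mathbb Z$ is a fixed nonzero function with finitely many nonzero values and $\mathbf t(p)\ge0$; $s:=\sup\{p:\mathbf t(p)\ne0\}$; $\mathbf g_m(p):=\sum_{q=m}^s\mathbf t(q)\mathbf a(q-p)$; $\mathbf h^{\rm I}_m(p):=\min\{\mathbf g_m(p),\mathbf b(p)\}$; $\beta^{\rm I}_m:=\sum_p\mathbf h^{\rm I}_m(p)$. *)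

theory Defs
  imports "HOL-Algebra.Ring_Divisibility" "HOL-Algebra.QuotRing" "HOL-Algebra.Module"
    "HOL-Algebra.Free_Abelian_Groups" "HOL-Analysis.Abstract_Topology"
begin

text \<open>
  Sections of a sheaf over the various open sets all live in one type; the carriers depend on the
  open set.  A graded sheaf is given by the family of its homogeneous pieces, indexed by \<^typ>\<open>int\<close>.
\<close>

section \<open>Germs\<close>

definition germ :: "'x topology \<Rightarrow> ('x set \<Rightarrow> 's set) \<Rightarrow> ('x set \<Rightarrow> 'x set \<Rightarrow> 's \<Rightarrow> 's)
    \<Rightarrow> 'x \<Rightarrow> 'x set \<Rightarrow> 's \<Rightarrow> ('x set \<times> 's) set" where
  "germ T S \<rho> x U s = {(V, t). openin T V \<and> x \<in> V \<and> t \<in> S V \<and>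
     (\<exists>W. openin T W \<and> x \<in> W \<and> W \<subseteq> U \<inter> V \<and> \<rho> U W s = \<rho> V W t)}"

definition germs :: "'x topology \<Rightarrow> ('x set \<Rightarrow> 's set) \<Rightarrow> ('x set \<Rightarrow> 'x set \<Rightarrow> 's \<Rightarrow> 's)
    \<Rightarrow> 'x \<Rightarrow> ('x set \<times> 's) set set" where
  "germs T S \<rho> x = {germ T S \<rho> x U s | U s. openin T U \<and> x \<in> U \<and> s \<in> S U}"

definition germ_op :: "'x topology \<Rightarrow> ('x set \<Rightarrow> 's set) \<Rightarrow> ('x set \<Rightarrow> 'x set \<Rightarrow> 's \<Rightarrow> 's)
    \<Rightarrow> ('x set \<Rightarrow> 's \<Rightarrow> 's \<Rightarrow> 's) \<Rightarrow> 'x \<Rightarrow> ('x set \<times> 's) set \<Rightarrow> ('x set \<times> 's) set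
    \<Rightarrow> ('x set \<times> 's) set" where
  "germ_op T S \<rho> f x K L = (\<Union>(U, s)\<in>K. \<Union>(V, t)\<in>L.
     germ T S \<rho> x (U \<inter> V) (f (U \<inter> V) (\<rho> U (U \<inter> V) s) (\<rho> V (U \<inter> V) t)))"

definition glues :: "'x topology \<Rightarrow> ('x set \<Rightarrow> 's set) \<Rightarrow> ('x set \<Rightarrow> 'x set \<Rightarrow> 's \<Rightarrow> 's) \<Rightarrow> bool" where
  "glues T S \<rho> \<longleftrightarrow> (\<forall>\<U> \<sigma>. (\<forall>U\<in>\<U>. openin T U \<and> \<sigma> U \<in> S U) \<and>
     (\<forall>U\<in>\<U>. \<forall>V\<in>\<U>. \<rho> U (U \<inter> V) (\<sigma> U) = \<rho> V (U \<inter> V) (\<sigma> V))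
     \<longrightarrow> (\<exists>!s. s \<in> S (\<Union>\<U>) \<and> (\<forall>U\<in>\<U>. \<rho> (\<Union>\<U>) U s = \<sigma> U)))"

definition functorial :: "'x topology \<Rightarrow> ('x set \<Rightarrow> 's set) \<Rightarrow> ('x set \<Rightarrow> 'x set \<Rightarrow> 's \<Rightarrow> 's) \<Rightarrow> bool" where
  "functorial T S \<rho> \<longleftrightarrow>
     (\<forall>U V. openin T U \<and> openin T V \<and> V \<subseteq> U \<longrightarrow> \<rho> U V \<in> S U \<rightarrow> S V) \<and>
     (\<forall>U s. openin T U \<and> s \<in> S U \<longrightarrow> \<rho> U U s = s) \<and>
     (\<forall>U V W s. openin T U \<and> openin T V \<and> openin T W \<and> W \<subseteq> V \<and> V \<subseteq> U \<and> s \<in> S U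
        \<longrightarrow> \<rho> V W (\<rho> U V s) = \<rho> U W s)"


section \<open>Ringed spaces\<close>

record ('x, 'r) ringed_space =
  top_of :: "'x topology"
  O_sec :: "'x set \<Rightarrow> 'r ring"
  O_res :: "'x set \<Rightarrow> 'x set \<Rightarrow> 'r \<Rightarrow> 'r"

abbreviation points :: "('x, 'r) ringed_space \<Rightarrow> 'x set" where
  "points S \<equiv> topspace (top_of S)"

abbreviation opens :: "('x, 'r) ringed_space \<Rightarrow> 'x set \<Rightarrow> 'x set set" where
  "opens S U \<equiv> {V. openin (top_of S) V \<and> V \<subseteq> U}"

definition is_ringed_space :: "('x, 'r) ringed_space \<Rightarrow> bool" where
  "is_ringed_space S \<longleftrightarrow>
     (\<forall>U. openin (top_of S) U \<longrightarrow> cring (O_sec S U)) \<and>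
     (\<forall>U V. openin (top_of S) U \<and> V \<in> opens S U \<longrightarrow> O_res S U V \<in> ring_hom (O_sec S U) (O_sec S V)) \<and>
     functorial (top_of S) (\<lambda>U. carrier (O_sec S U)) (O_res S) \<and>
     glues (top_of S) (\<lambda>U. carrier (O_sec S U)) (O_res S)"

abbreviation O_germ :: "('x, 'r) ringed_space \<Rightarrow> 'x \<Rightarrow> 'x set \<Rightarrow> 'r \<Rightarrow> ('x set \<times> 'r) set" where
  "O_germ S \<equiv> germ (top_of S) (\<lambda>U. carrier (O_sec S U)) (O_res S)"

abbreviation O_germ_op :: "('x, 'r) ringed_space \<Rightarrow> ('x set \<Rightarrow> 'r \<Rightarrow> 'r \<Rightarrow> 'r) \<Rightarrow> 'x
    \<Rightarrow> ('x set \<times> 'r) set \<Rightarrow> ('x set \<times> 'r) set \<Rightarrow> ('x set \<times> 'r) set" where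
  "O_germ_op S \<equiv> germ_op (top_of S) (\<lambda>U. carrier (O_sec S U)) (O_res S)"

definition O_stalk :: "('x, 'r) ringed_space \<Rightarrow> 'x \<Rightarrow> ('x set \<times> 'r) set ring" where
  "O_stalk S x = \<lparr>
     carrier = germs (top_of S) (\<lambda>U. carrier (O_sec S U)) (O_res S) x,
     monoid.mult = O_germ_op S (\<lambda>U. monoid.mult (O_sec S U)) x,
     monoid.one = O_germ S x (points S) (monoid.one (O_sec S (points S))),
     ring.zero = O_germ S x (points S) (ring.zero (O_sec S (points S))),
     ring.add = O_germ_op S (\<lambda>U. ring.add (O_sec S U)) x\<rparr>"

definition local_ring :: "('r, 'k) ring_scheme \<Rightarrow> bool" where
  "local_ring R \<longleftrightarrow> cring R \<and> (\<exists>!I. maximalideal I R)"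

definition locally_ringed_space :: "('x, 'r) ringed_space \<Rightarrow> bool" where
  "locally_ringed_space S \<longleftrightarrow> is_ringed_space S \<and> (\<forall>x\<in>points S. local_ring (O_stalk S x))"

definition open_subspace :: "('x, 'r) ringed_space \<Rightarrow> 'x set \<Rightarrow> ('x, 'r) ringed_space" where
  "open_subspace S U = S\<lparr>top_of := subtopology (top_of S) U\<rparr>"

text \<open>An isomorphism of ringed spaces is automatically local on stalks.\<close>

definition ringed_space_iso :: "('x, 'r) ringed_space \<Rightarrow> ('y, 'q) ringed_space
    \<Rightarrow> ('x \<Rightarrow> 'y) \<Rightarrow> ('y set \<Rightarrow> 'q \<Rightarrow> 'r) \<Rightarrow> bool" where
  "ringed_space_iso S Y f \<phi> \<longleftrightarrow> homeomorphic_map (top_of S) (top_of Y) f \<and>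
     (\<forall>V. openin (top_of Y) V \<longrightarrow> \<phi> V \<in> ring_iso (O_sec Y V) (O_sec S {x \<in> points S. f x \<in> V})) \<and>
     (\<forall>V. openin (top_of Y) V \<longrightarrow> (\<forall>W\<in>opens Y V. \<forall>s\<in>carrier (O_sec Y V).
        \<phi> W (O_res Y V W s) = O_res S {x \<in> points S. f x \<in> V} {x \<in> points S. f x \<in> W} (\<phi> V s)))"


section \<open>Spectra and schemes\<close>

definition fraction :: "'r ring \<Rightarrow> 'r set \<Rightarrow> 'r \<Rightarrow> 'r \<Rightarrow> ('r \<times> 'r) set" where
  "fraction R P a f = {(b, g). b \<in> carrier R \<and> g \<in> carrier R - P \<and>
     (\<exists>u\<in>carrier R - P. u \<otimes>\<^bsub>R\<^esub> ((a \<otimes>\<^bsub>R\<^esub> g) \<ominus>\<^bsub>R\<^esub> (b \<otimes>\<^bsub>R\<^esub> f)) = \<zero>\<^bsub>R\<^esub>)}"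

definition localization_at :: "'r ring \<Rightarrow> 'r set \<Rightarrow> ('r \<times> 'r) set ring" where
  "localization_at R P = \<lparr>
     carrier = {fraction R P a f | a f. a \<in> carrier R \<and> f \<in> carrier R - P},
     monoid.mult = (\<lambda>K L. \<Union>(a, f)\<in>K. \<Union>(b, g)\<in>L. fraction R P (a \<otimes>\<^bsub>R\<^esub> b) (f \<otimes>\<^bsub>R\<^esub> g)),
     monoid.one = fraction R P \<one>\<^bsub>R\<^esub> \<one>\<^bsub>R\<^esub>,
     ring.zero = fraction R P \<zero>\<^bsub>R\<^esub> \<one>\<^bsub>R\<^esub>,
     ring.add = (\<lambda>K L. \<Union>(a, f)\<in>K. \<Union>(b, g)\<in>L.
        fraction R P ((a \<otimes>\<^bsub>R\<^esub> g) \<oplus>\<^bsub>R\<^esub> (b \<otimes>\<^bsub>R\<^esub> f)) (f \<otimes>\<^bsub>R\<^esub> g))\<rparr>"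

definition spec_top :: "'r ring \<Rightarrow> 'r set topology" where
  "spec_top R = topology_generated_by ((\<lambda>f. {P. primeideal P R \<and> f \<notin> P}) ` carrier R)"

definition spec_sections :: "'r ring \<Rightarrow> 'r set set \<Rightarrow> ('r set \<Rightarrow> ('r \<times> 'r) set) ring" where
  "spec_sections R U = \<lparr>
     carrier = {s \<in> (\<Pi>\<^sub>E P\<in>U. carrier (localization_at R P)).
        \<forall>P\<in>U. \<exists>V a f. openin (spec_top R) V \<and> P \<in> V \<and> V \<subseteq> U \<and> a \<in> carrier R \<and> f \<in> carrier R \<and>
          (\<forall>Q\<in>V. f \<notin> Q \<and> s Q = fraction R Q a f)},
     monoid.mult = (\<lambda>s t. \<lambda>P\<in>U. s P \<otimes>\<^bsub>localization_at R P\<^esub> t P),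
     monoid.one = (\<lambda>P\<in>U. \<one>\<^bsub>localization_at R P\<^esub>),
     ring.zero = (\<lambda>P\<in>U. \<zero>\<^bsub>localization_at R P\<^esub>),
     ring.add = (\<lambda>s t. \<lambda>P\<in>U. s P \<oplus>\<^bsub>localization_at R P\<^esub> t P)\<rparr>"

definition Spec :: "'r ring \<Rightarrow> ('r set, 'r set \<Rightarrow> ('r \<times> 'r) set) ringed_space" where
  "Spec R = \<lparr>top_of = spec_top R, O_sec = spec_sections R, O_res = (\<lambda>U V s. restrict s V)\<rparr>"

text \<open>If an open set is isomorphic to the spectrum of some ring, then that ring is isomorphic to the
  ring of sections over it; so nothing is lost by taking the ring with elements in \<^typ>\<open>'r\<close>.\<close>

definition affine_open_of :: "('x, 'r) ringed_space \<Rightarrow> 'x set \<Rightarrow> 'r ring \<Rightarrow> bool" where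
  "affine_open_of S U R \<longleftrightarrow> openin (top_of S) U \<and> cring R \<and>
     (\<exists>f \<phi>. ringed_space_iso (open_subspace S U) (Spec R) f \<phi>)"

definition scheme :: "('x, 'r) ringed_space \<Rightarrow> bool" where
  "scheme S \<longleftrightarrow> locally_ringed_space S \<and> (\<forall>x\<in>points S. \<exists>U R. x \<in> U \<and> affine_open_of S U R)"

definition noetherian_scheme :: "('x, 'r) ringed_space \<Rightarrow> bool" where
  "noetherian_scheme S \<longleftrightarrow> scheme S \<and>
     (\<exists>\<U>. finite \<U> \<and> \<Union>\<U> = points S \<and> (\<forall>U\<in>\<U>. \<exists>R. affine_open_of S U R \<and> noetherian_ring R))"


section \<open>Modules: homomorphisms, tensor products, flatness\<close>

definition mod_hom :: "('r, 'k) ring_scheme \<Rightarrow> ('r, 'm, 'i) module_scheme \<Rightarrow> ('r, 'n, 'j) module_scheme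
    \<Rightarrow> ('m \<Rightarrow> 'n) set" where
  "mod_hom R M N = {f \<in> carrier M \<rightarrow> carrier N.
     (\<forall>x\<in>carrier M. \<forall>y\<in>carrier M. f (x \<oplus>\<^bsub>M\<^esub> y) = f x \<oplus>\<^bsub>N\<^esub> f y) \<and>
     (\<forall>r\<in>carrier R. \<forall>x\<in>carrier M. f (r \<odot>\<^bsub>M\<^esub> x) = r \<odot>\<^bsub>N\<^esub> f x)}"

text \<open>The quotient of the free abelian group on a set \<open>P\<close> by the subgroup generated by \<open>E\<close>; scalars
  act through an action \<open>\<sigma>\<close> on \<open>P\<close>.\<close>

definition frag_class :: "'g set \<Rightarrow> ('g \<Rightarrow>\<^sub>0 int) set \<Rightarrow> ('g \<Rightarrow>\<^sub>0 int) \<Rightarrow> ('g \<Rightarrow>\<^sub>0 int) set" where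
  "frag_class P E u = {v. v - u \<in> generate (free_Abelian_group P) E}"

definition frag_quotient :: "'g set \<Rightarrow> ('g \<Rightarrow>\<^sub>0 int) set \<Rightarrow> ('r \<Rightarrow> 'g \<Rightarrow> 'g)
    \<Rightarrow> ('r, ('g \<Rightarrow>\<^sub>0 int) set) module" where
  "frag_quotient P E \<sigma> = \<lparr>
     carrier = frag_class P E ` carrier (free_Abelian_group P),
     monoid.mult = undefined, monoid.one = undefined,
     ring.zero = frag_class P E 0,
     ring.add = (\<lambda>K L. \<Union>u\<in>K. \<Union>v\<in>L. frag_class P E (u + v)),
     smult = (\<lambda>r K. \<Union>u\<in>K. frag_class P E (frag_extend (\<lambda>g. frag_of (\<sigma> r g)) u))\<rparr>"

definition tensor_rels :: "('r, 'k) ring_scheme \<Rightarrow> ('r, 'm) module \<Rightarrow> ('r, 'n) module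
    \<Rightarrow> ('m \<times> 'n \<Rightarrow>\<^sub>0 int) set" where
  "tensor_rels R M N =
     {frag_of (x \<oplus>\<^bsub>M\<^esub> x', y) - frag_of (x, y) - frag_of (x', y) | x x' y.
        x \<in> carrier M \<and> x' \<in> carrier M \<and> y \<in> carrier N} \<union>
     {frag_of (x, y \<oplus>\<^bsub>N\<^esub> y') - frag_of (x, y) - frag_of (x, y') | x y y'.
        x \<in> carrier M \<and> y \<in> carrier N \<and> y' \<in> carrier N} \<union>
     {frag_of (r \<odot>\<^bsub>M\<^esub> x, y) - frag_of (x, r \<odot>\<^bsub>N\<^esub> y) | r x y.
        r \<in> carrier R \<and> x \<in> carrier M \<and> y \<in> carrier N}"

definition tensor :: "('r, 'k) ring_scheme \<Rightarrow> ('r, 'm) module \<Rightarrow> ('r, 'n) module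
    \<Rightarrow> ('r, ('m \<times> 'n \<Rightarrow>\<^sub>0 int) set) module" where
  "tensor R M N = frag_quotient (carrier M \<times> carrier N) (tensor_rels R M N)
     (\<lambda>r (x, y). (r \<odot>\<^bsub>M\<^esub> x, y))"

definition tensor_map :: "('r, 'k) ring_scheme \<Rightarrow> ('r, 'm) module \<Rightarrow> ('r, 'n) module \<Rightarrow> ('l \<Rightarrow> 'n)
    \<Rightarrow> ('m \<times> 'l \<Rightarrow>\<^sub>0 int) set \<Rightarrow> ('m \<times> 'n \<Rightarrow>\<^sub>0 int) set" where
  "tensor_map R M N f K = (\<Union>u\<in>K. frag_class (carrier M \<times> carrier N) (tensor_rels R M N)
     (frag_extend (\<lambda>(x, y). frag_of (x, f y)) u))"

text \<open>Flatness: tensoring preserves injections.  The test modules range over those with elements in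
  \<^typ>\<open>(nat \<Rightarrow> 'r) set\<close>; up to isomorphism these include all quotients of free modules of
  finite rank, hence all finitely generated modules, and for these the condition implies the
  condition for all modules.\<close>

definition flat_module :: "'r ring \<Rightarrow> ('r, 'm) module \<Rightarrow> bool" where
  "flat_module R M \<longleftrightarrow> module R M \<and>
     (\<forall>(N' :: ('r, (nat \<Rightarrow> 'r) set) module) (N :: ('r, (nat \<Rightarrow> 'r) set) module) f.
        module R N' \<and> module R N \<and> f \<in> mod_hom R N' N \<and> inj_on f (carrier N')
        \<longrightarrow> inj_on (tensor_map R M N f) (carrier (tensor R M N')))"


section \<open>Sheaves of modules\<close>

record ('x, 'r, 'm) mod_sheaf =
  sec :: "'x set \<Rightarrow> ('r, 'm) module"
  res :: "'x set \<Rightarrow> 'x set \<Rightarrow> 'm \<Rightarrow> 'm"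

definition presheaf_of_modules :: "('x, 'r) ringed_space \<Rightarrow> ('x, 'r, 'm) mod_sheaf \<Rightarrow> bool" where
  "presheaf_of_modules S F \<longleftrightarrow>
     (\<forall>U. openin (top_of S) U \<longrightarrow> module (O_sec S U) (sec F U)) \<and>
     functorial (top_of S) (\<lambda>U. carrier (sec F U)) (res F) \<and>
     (\<forall>U. openin (top_of S) U \<longrightarrow> (\<forall>V\<in>opens S U.
        (\<forall>x\<in>carrier (sec F U). \<forall>y\<in>carrier (sec F U).
           res F U V (x \<oplus>\<^bsub>sec F U\<^esub> y) = res F U V x \<oplus>\<^bsub>sec F V\<^esub> res F U V y) \<and>
        (\<forall>r\<in>carrier (O_sec S U). \<forall>x\<in>carrier (sec F U).
           res F U V (r \<odot>\<^bsub>sec F U\<^esub> x) = O_res S U V r \<odot>\<^bsub>sec F V\<^esub> res F U V x)))"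

definition sheaf_of_modules :: "('x, 'r) ringed_space \<Rightarrow> ('x, 'r, 'm) mod_sheaf \<Rightarrow> bool" where
  "sheaf_of_modules S F \<longleftrightarrow> presheaf_of_modules S F \<and>
     glues (top_of S) (\<lambda>U. carrier (sec F U)) (res F)"

abbreviation mod_germ :: "('x, 'r) ringed_space \<Rightarrow> ('x, 'r, 'm) mod_sheaf
    \<Rightarrow> 'x \<Rightarrow> 'x set \<Rightarrow> 'm \<Rightarrow> ('x set \<times> 'm) set" where
  "mod_germ S F \<equiv> germ (top_of S) (\<lambda>U. carrier (sec F U)) (res F)"

definition mod_stalk :: "('x, 'r) ringed_space \<Rightarrow> ('x, 'r, 'm) mod_sheaf \<Rightarrow> 'x
    \<Rightarrow> (('x set \<times> 'r) set, ('x set \<times> 'm) set) module" where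
  "mod_stalk S F x = \<lparr>
     carrier = germs (top_of S) (\<lambda>U. carrier (sec F U)) (res F) x,
     monoid.mult = undefined, monoid.one = undefined,
     ring.zero = mod_germ S F x (points S) (ring.zero (sec F (points S))),
     ring.add = germ_op (top_of S) (\<lambda>U. carrier (sec F U)) (res F) (\<lambda>U. ring.add (sec F U)) x,
     smult = (\<lambda>K L. \<Union>(U, r)\<in>K. \<Union>(V, z)\<in>L. mod_germ S F x (U \<inter> V)
        (O_res S U (U \<inter> V) r \<odot>\<^bsub>sec F (U \<inter> V)\<^esub> res F V (U \<inter> V) z))\<rparr>"

definition sheafification :: "('x, 'r) ringed_space \<Rightarrow> ('x, 'r, 'm) mod_sheaf
    \<Rightarrow> ('x, 'r, 'x \<Rightarrow> ('x set \<times> 'm) set) mod_sheaf" where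
  "sheafification S F = \<lparr>
     sec = (\<lambda>U. \<lparr>
       carrier = {s \<in> (\<Pi>\<^sub>E x\<in>U. carrier (mod_stalk S F x)).
          \<forall>x\<in>U. \<exists>V\<in>opens S U. x \<in> V \<and> (\<exists>z\<in>carrier (sec F V). \<forall>y\<in>V. s y = mod_germ S F y V z)},
       monoid.mult = undefined, monoid.one = undefined,
       ring.zero = (\<lambda>x\<in>U. \<zero>\<^bsub>mod_stalk S F x\<^esub>),
       ring.add = (\<lambda>s t. \<lambda>x\<in>U. s x \<oplus>\<^bsub>mod_stalk S F x\<^esub> t x),
       smult = (\<lambda>r s. \<lambda>x\<in>U. O_germ S x U r \<odot>\<^bsub>mod_stalk S F x\<^esub> s x)\<rparr>),
     res = (\<lambda>U V s. restrict s V)\<rparr>"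

definition flat_sheaf :: "('x, 'r) ringed_space \<Rightarrow> ('x, 'r, 'm) mod_sheaf \<Rightarrow> bool" where
  "flat_sheaf S F \<longleftrightarrow> (\<forall>x\<in>points S. flat_module (O_stalk S x) (mod_stalk S F x))"

text \<open>A list of sections over \<open>U\<close> of length \<open>n\<close> is a basis iff the associated map from the free
  sheaf of rank \<open>n\<close> on \<open>U\<close> to the restriction of \<open>F\<close> is bijective on every open subset of \<open>U\<close>.\<close>

definition basis_on :: "('x, 'r) ringed_space \<Rightarrow> ('x, 'r, 'm) mod_sheaf \<Rightarrow> 'x set \<Rightarrow> 'm list \<Rightarrow> bool" where
  "basis_on S F U es \<longleftrightarrow> set es \<subseteq> carrier (sec F U) \<and>
     (\<forall>V\<in>opens S U. \<forall>z\<in>carrier (sec F V).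
        \<exists>!c. c \<in> {..<length es} \<rightarrow>\<^sub>E carrier (O_sec S V) \<and>
          z = (\<Oplus>\<^bsub>sec F V\<^esub>i\<in>{..<length es}. c i \<odot>\<^bsub>sec F V\<^esub> res F U V (es ! i)))"

definition locally_free_of_rank :: "('x, 'r) ringed_space \<Rightarrow> ('x, 'r, 'm) mod_sheaf \<Rightarrow> int \<Rightarrow> bool" where
  "locally_free_of_rank S F n \<longleftrightarrow>
     (\<forall>x\<in>points S. \<exists>U es. openin (top_of S) U \<and> x \<in> U \<and> basis_on S F U es \<and> int (length es) = n)"

definition locally_free_of_finite_rank :: "('x, 'r) ringed_space \<Rightarrow> ('x, 'r, 'm) mod_sheaf \<Rightarrow> bool" where
  "locally_free_of_finite_rank S F \<longleftrightarrow>
     (\<forall>x\<in>points S. \<exists>U es. openin (top_of S) U \<and> x \<in> U \<and> basis_on S F U es)"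

definition sheaf_rank :: "('x, 'r) ringed_space \<Rightarrow> ('x, 'r, 'm) mod_sheaf \<Rightarrow> int" where
  "sheaf_rank S F = (THE n. locally_free_of_rank S F n)"

text \<open>Quasi-coherence: locally there is a presentation, given by a set \<open>E\<close> of generating sections and
  a set \<open>J\<close> of finitely supported relations among them.\<close>

definition coefficients :: "('x, 'r) ringed_space \<Rightarrow> 'm set \<Rightarrow> 'x set \<Rightarrow> ('m \<Rightarrow> 'r) set" where
  "coefficients S E V = {c \<in> E \<rightarrow> carrier (O_sec S V). finite {e \<in> E. c e \<noteq> \<zero>\<^bsub>O_sec S V\<^esub>}}"

definition combination :: "('x, 'r) ringed_space \<Rightarrow> ('x, 'r, 'm) mod_sheaf \<Rightarrow> 'x set \<Rightarrow> 'm set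
    \<Rightarrow> 'x set \<Rightarrow> ('m \<Rightarrow> 'r) \<Rightarrow> 'm" where
  "combination S F U E V c =
     (\<Oplus>\<^bsub>sec F V\<^esub>e\<in>{e \<in> E. c e \<noteq> \<zero>\<^bsub>O_sec S V\<^esub>}. c e \<odot>\<^bsub>sec F V\<^esub> res F U V e)"

definition quasi_coherent :: "('x, 'r) ringed_space \<Rightarrow> ('x, 'r, 'm) mod_sheaf \<Rightarrow> bool" where
  "quasi_coherent S F \<longleftrightarrow> (\<forall>x\<in>points S. \<exists>U E J.
     openin (top_of S) U \<and> x \<in> U \<and> E \<subseteq> carrier (sec F U) \<and>
     J \<subseteq> {c \<in> coefficients S E U. combination S F U E U c = \<zero>\<^bsub>sec F U\<^esub>} \<and>
     (\<forall>V\<in>opens S U. \<forall>z\<in>carrier (sec F V). \<forall>y\<in>V. \<exists>W\<in>opens S V. y \<in> W \<and>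
        (\<exists>c\<in>coefficients S E W. res F V W z = combination S F U E W c)) \<and>
     (\<forall>V\<in>opens S U. \<forall>c\<in>coefficients S E V. combination S F U E V c = \<zero>\<^bsub>sec F V\<^esub> \<longrightarrow>
        (\<forall>y\<in>V. \<exists>W\<in>opens S V. y \<in> W \<and>
           (\<exists>K d. finite K \<and> K \<subseteq> J \<and> d \<in> K \<rightarrow> carrier (O_sec S W) \<and>
              (\<forall>e\<in>E. O_res S V W (c e) =
                 (\<Oplus>\<^bsub>O_sec S W\<^esub>r\<in>K. d r \<otimes>\<^bsub>O_sec S W\<^esub> O_res S U W (r e)))))))"

text \<open>The dual sheaf: a section over \<open>U\<close> is a homomorphism from the restriction of \<open>F\<close> to \<open>U\<close> to the
  restricted structure sheaf, i.e. a compatible family of linear maps over the open subsets of \<open>U\<close>.\<close>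

definition O_mod :: "('x, 'r) ringed_space \<Rightarrow> 'x set \<Rightarrow> ('r, 'r) module" where
  "O_mod S U = ring.extend (O_sec S U) (module.fields (monoid.mult (O_sec S U)))"

definition dual_sheaf :: "('x, 'r) ringed_space \<Rightarrow> ('x, 'r, 'm) mod_sheaf
    \<Rightarrow> ('x, 'r, 'x set \<Rightarrow> 'm \<Rightarrow> 'r) mod_sheaf" where
  "dual_sheaf S F = \<lparr>
     sec = (\<lambda>U. \<lparr>
       carrier = {\<phi> \<in> (\<Pi>\<^sub>E V\<in>opens S U.
            mod_hom (O_sec S V) (sec F V) (O_mod S V) \<inter> extensional (carrier (sec F V))).
          \<forall>V\<in>opens S U. \<forall>W\<in>opens S V. \<forall>z\<in>carrier (sec F V).
            \<phi> W (res F V W z) = O_res S V W (\<phi> V z)},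
       monoid.mult = undefined, monoid.one = undefined,
       ring.zero = (\<lambda>V\<in>opens S U. \<lambda>z\<in>carrier (sec F V). \<zero>\<^bsub>O_sec S V\<^esub>),
       ring.add = (\<lambda>\<phi> \<psi>. \<lambda>V\<in>opens S U. \<lambda>z\<in>carrier (sec F V). \<phi> V z \<oplus>\<^bsub>O_sec S V\<^esub> \<psi> V z),
       smult = (\<lambda>r \<phi>. \<lambda>V\<in>opens S U. \<lambda>z\<in>carrier (sec F V). O_res S U V r \<otimes>\<^bsub>O_sec S V\<^esub> \<phi> V z)\<rparr>),
     res = (\<lambda>U W \<phi>. restrict \<phi> (opens S W))\<rparr>"

definition quotient_presheaf :: "('x, 'r, 'm) mod_sheaf \<Rightarrow> ('x, 'r, 'm) mod_sheaf
    \<Rightarrow> ('x, 'r, 'm set) mod_sheaf" where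
  "quotient_presheaf F G = \<lparr>
     sec = (\<lambda>U. \<lparr>
       carrier = a_rcosets\<^bsub>sec F U\<^esub> (carrier (sec G U)),
       monoid.mult = undefined, monoid.one = undefined,
       ring.zero = carrier (sec G U),
       ring.add = set_add (sec F U),
       smult = (\<lambda>r K. \<Union>z\<in>K. carrier (sec G U) +>\<^bsub>sec F U\<^esub> (r \<odot>\<^bsub>sec F U\<^esub> z))\<rparr>),
     res = (\<lambda>U V K. \<Union>z\<in>K. carrier (sec G V) +>\<^bsub>sec F V\<^esub> res F U V z)\<rparr>"

definition quotient_sheaf :: "('x, 'r) ringed_space \<Rightarrow> ('x, 'r, 'm) mod_sheaf \<Rightarrow> ('x, 'r, 'm) mod_sheaf
    \<Rightarrow> ('x, 'r, 'x \<Rightarrow> ('x set \<times> 'm set) set) mod_sheaf" where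
  "quotient_sheaf S F G = sheafification S (quotient_presheaf F G)"

text \<open>The direct sum of the pieces of a graded sheaf.  On a Noetherian scheme the presheaf direct sum
  of sheaves is already a sheaf.\<close>

definition total_sheaf :: "(int \<Rightarrow> ('x, 'r, 'm) mod_sheaf) \<Rightarrow> ('x, 'r, int \<Rightarrow> 'm) mod_sheaf" where
  "total_sheaf F = \<lparr>
     sec = (\<lambda>U. \<lparr>
       carrier = {f. (\<forall>p. f p \<in> carrier (sec (F p) U)) \<and> finite {p. f p \<noteq> \<zero>\<^bsub>sec (F p) U\<^esub>}},
       monoid.mult = undefined, monoid.one = undefined,
       ring.zero = (\<lambda>p. \<zero>\<^bsub>sec (F p) U\<^esub>),
       ring.add = (\<lambda>f g p. f p \<oplus>\<^bsub>sec (F p) U\<^esub> g p),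
       smult = (\<lambda>r f p. r \<odot>\<^bsub>sec (F p) U\<^esub> f p)\<rparr>),
     res = (\<lambda>U V f p. res (F p) U V (f p))\<rparr>"


section \<open>Graded algebras and graded modules\<close>

record ('x, 'r, 'a) graded_alg =
  alg_piece :: "int \<Rightarrow> ('x, 'r, 'a) mod_sheaf"
  alg_mult :: "int \<Rightarrow> int \<Rightarrow> 'x set \<Rightarrow> 'a \<Rightarrow> 'a \<Rightarrow> 'a"
  alg_one :: "'x set \<Rightarrow> 'a"

record ('x, 'r, 'a, 'm) graded_mod =
  piece :: "int \<Rightarrow> ('x, 'r, 'm) mod_sheaf"
  act :: "int \<Rightarrow> int \<Rightarrow> 'x set \<Rightarrow> 'a \<Rightarrow> 'm \<Rightarrow> 'm"

abbreviation alg_sec :: "('x, 'r, 'a) graded_alg \<Rightarrow> int \<Rightarrow> 'x set \<Rightarrow> ('r, 'a) module" where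
  "alg_sec A p U \<equiv> sec (alg_piece A p) U"

abbreviation mod_sec :: "('x, 'r, 'a, 'm) graded_mod \<Rightarrow> int \<Rightarrow> 'x set \<Rightarrow> ('r, 'm) module" where
  "mod_sec M p U \<equiv> sec (piece M p) U"

definition bilinear_pairing :: "('x, 'r) ringed_space \<Rightarrow> ('x, 'r, 'm) mod_sheaf \<Rightarrow> ('x, 'r, 'n) mod_sheaf
    \<Rightarrow> ('x, 'r, 'l) mod_sheaf \<Rightarrow> ('x set \<Rightarrow> 'm \<Rightarrow> 'n \<Rightarrow> 'l) \<Rightarrow> bool" where
  "bilinear_pairing S F G H \<mu> \<longleftrightarrow> (\<forall>U. openin (top_of S) U \<longrightarrow>
     (\<forall>x\<in>carrier (sec F U). \<mu> U x \<in> mod_hom (O_sec S U) (sec G U) (sec H U)) \<and>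
     (\<forall>y\<in>carrier (sec G U). (\<lambda>x. \<mu> U x y) \<in> mod_hom (O_sec S U) (sec F U) (sec H U)) \<and>
     (\<forall>V\<in>opens S U. \<forall>x\<in>carrier (sec F U). \<forall>y\<in>carrier (sec G U).
        res H U V (\<mu> U x y) = \<mu> V (res F U V x) (res G U V y)))"

text \<open>Graded algebras are commutative and concentrated in nonnegative degrees.\<close>

definition graded_algebra :: "('x, 'r) ringed_space \<Rightarrow> ('x, 'r, 'a) graded_alg \<Rightarrow> bool" where
  "graded_algebra S A \<longleftrightarrow>
     (\<forall>p. sheaf_of_modules S (alg_piece A p)) \<and>
     (\<forall>p q. bilinear_pairing S (alg_piece A p) (alg_piece A q) (alg_piece A (p + q)) (alg_mult A p q)) \<and>
     (\<forall>U. openin (top_of S) U \<longrightarrow>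
        (\<forall>p<0. carrier (alg_sec A p U) = {\<zero>\<^bsub>alg_sec A p U\<^esub>}) \<and>
        alg_one A U \<in> carrier (alg_sec A 0 U) \<and>
        (\<forall>V\<in>opens S U. res (alg_piece A 0) U V (alg_one A U) = alg_one A V) \<and>
        (\<forall>p. \<forall>x\<in>carrier (alg_sec A p U). alg_mult A 0 p U (alg_one A U) x = x) \<and>
        (\<forall>p q. \<forall>x\<in>carrier (alg_sec A p U). \<forall>y\<in>carrier (alg_sec A q U).
           alg_mult A p q U x y = alg_mult A q p U y x) \<and>
        (\<forall>p q k. \<forall>x\<in>carrier (alg_sec A p U). \<forall>y\<in>carrier (alg_sec A q U). \<forall>z\<in>carrier (alg_sec A k U).
           alg_mult A (p + q) k U (alg_mult A p q U x y) z =
           alg_mult A p (q + k) U x (alg_mult A q k U y z)))"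

definition degree_zero_is_O :: "('x, 'r) ringed_space \<Rightarrow> ('x, 'r, 'a) graded_alg \<Rightarrow> bool" where
  "degree_zero_is_O S A \<longleftrightarrow> (\<forall>U. openin (top_of S) U \<longrightarrow>
     bij_betw (\<lambda>r. r \<odot>\<^bsub>alg_sec A 0 U\<^esub> alg_one A U) (carrier (O_sec S U)) (carrier (alg_sec A 0 U)))"

text \<open>The homogeneous elements, paired with their degrees, of the subalgebra of the algebra of
  sections over \<open>U\<close> generated by a set of homogeneous sections.\<close>

inductive_set subalgebra_gen :: "('x, 'r) ringed_space \<Rightarrow> ('x, 'r, 'a) graded_alg \<Rightarrow> 'x set
    \<Rightarrow> (int \<times> 'a) set \<Rightarrow> (int \<times> 'a) set"
  for S A U G where
    gen: "(p, x) \<in> G \<Longrightarrow> (p, x) \<in> subalgebra_gen S A U G"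
  | one: "(0, alg_one A U) \<in> subalgebra_gen S A U G"
  | zero: "(p, \<zero>\<^bsub>alg_sec A p U\<^esub>) \<in> subalgebra_gen S A U G"
  | scale: "r \<in> carrier (O_sec S U) \<Longrightarrow> (p, x) \<in> subalgebra_gen S A U G \<Longrightarrow>
      (p, r \<odot>\<^bsub>alg_sec A p U\<^esub> x) \<in> subalgebra_gen S A U G"
  | add: "(p, x) \<in> subalgebra_gen S A U G \<Longrightarrow> (p, y) \<in> subalgebra_gen S A U G \<Longrightarrow>
      (p, x \<oplus>\<^bsub>alg_sec A p U\<^esub> y) \<in> subalgebra_gen S A U G"
  | mult: "(p, x) \<in> subalgebra_gen S A U G \<Longrightarrow> (q, y) \<in> subalgebra_gen S A U G \<Longrightarrow>
      (p + q, alg_mult A p q U x y) \<in> subalgebra_gen S A U G"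

definition finitely_generated_algebra :: "('x, 'r) ringed_space \<Rightarrow> ('x, 'r, 'a) graded_alg \<Rightarrow> bool" where
  "finitely_generated_algebra S A \<longleftrightarrow> (\<forall>x\<in>points S. \<exists>U G.
     openin (top_of S) U \<and> x \<in> U \<and> finite G \<and> (\<forall>(p, g)\<in>G. g \<in> carrier (alg_sec A p U)) \<and>
     (\<forall>V\<in>opens S U. \<forall>p. \<forall>z\<in>carrier (alg_sec A p V). \<forall>y\<in>V. \<exists>W\<in>opens S V. y \<in> W \<and>
        (p, res (alg_piece A p) V W z) \<in>
          subalgebra_gen S A W ((\<lambda>(q, g). (q, res (alg_piece A q) U W g)) ` G)))"

definition graded_module :: "('x, 'r) ringed_space \<Rightarrow> ('x, 'r, 'a) graded_alg
    \<Rightarrow> ('x, 'r, 'a, 'm) graded_mod \<Rightarrow> bool" where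
  "graded_module S A M \<longleftrightarrow>
     (\<forall>p. sheaf_of_modules S (piece M p)) \<and>
     (\<forall>p q. bilinear_pairing S (alg_piece A p) (piece M q) (piece M (p + q)) (act M p q)) \<and>
     (\<forall>U. openin (top_of S) U \<longrightarrow>
        (\<forall>p. \<forall>z\<in>carrier (mod_sec M p U). act M 0 p U (alg_one A U) z = z) \<and>
        (\<forall>p q k. \<forall>x\<in>carrier (alg_sec A p U). \<forall>y\<in>carrier (alg_sec A q U). \<forall>z\<in>carrier (mod_sec M k U).
           act M (p + q) k U (alg_mult A p q U x y) z = act M p (q + k) U x (act M q k U y z)))"

text \<open>The degree \<open>n\<close> part of the submodule of the module of sections over \<open>U\<close> generated by a family
  of homogeneous sections: \<open>G j\<close> is the set of generators of degree \<open>j\<close>.\<close>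

definition submodule_gen :: "('x, 'r, 'a) graded_alg \<Rightarrow> ('x, 'r, 'a, 'm) graded_mod \<Rightarrow> 'x set
    \<Rightarrow> (int \<Rightarrow> 'm set) \<Rightarrow> int \<Rightarrow> 'm set" where
  "submodule_gen A M U G n = generate (add_monoid (mod_sec M n U))
     {act M k j U x z | k j x z. k + j = n \<and> x \<in> carrier (alg_sec A k U) \<and> z \<in> G j}"

definition locally_finitely_generated :: "('x, 'r) ringed_space \<Rightarrow> ('x, 'r, 'a) graded_alg
    \<Rightarrow> ('x, 'r, 'a, 'm) graded_mod \<Rightarrow> bool" where
  "locally_finitely_generated S A M \<longleftrightarrow> (\<forall>x\<in>points S. \<exists>U G.
     openin (top_of S) U \<and> x \<in> U \<and> finite G \<and> (\<forall>(p, g)\<in>G. g \<in> carrier (mod_sec M p U)) \<and>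
     (\<forall>V\<in>opens S U. \<forall>p. \<forall>z\<in>carrier (mod_sec M p V). \<forall>y\<in>V. \<exists>W\<in>opens S V. y \<in> W \<and>
        res (piece M p) V W z \<in>
          submodule_gen A M W (\<lambda>j. {res (piece M j) U W g | g. (j, g) \<in> G}) p))"

definition homogeneous_quotient :: "('x, 'r) ringed_space \<Rightarrow> ('x, 'r, 'a) graded_alg
    \<Rightarrow> ('x, 'r, 'a, 'b) graded_mod \<Rightarrow> ('x, 'r, 'a, 'c) graded_mod \<Rightarrow> bool" where
  "homogeneous_quotient S A B C \<longleftrightarrow> graded_module S A C \<and>
     (\<exists>\<pi>. \<forall>U. openin (top_of S) U \<longrightarrow>
        (\<forall>p. \<pi> p U \<in> mod_hom (O_sec S U) (mod_sec B p U) (mod_sec C p U)) \<and>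
        (\<forall>p q. \<forall>x\<in>carrier (alg_sec A p U). \<forall>z\<in>carrier (mod_sec B q U).
           \<pi> (p + q) U (act B p q U x z) = act C p q U x (\<pi> q U z)) \<and>
        (\<forall>p. \<forall>V\<in>opens S U. \<forall>z\<in>carrier (mod_sec B p U).
           res (piece C p) U V (\<pi> p U z) = \<pi> p V (res (piece B p) U V z)) \<and>
        (\<forall>p. \<forall>w\<in>carrier (mod_sec C p U). \<forall>x\<in>U. \<exists>V\<in>opens S U. x \<in> V \<and>
           (\<exists>z\<in>carrier (mod_sec B p V). res (piece C p) U V w = \<pi> p V z)))"


section \<open>Duals, truncations and tensor products of graded modules\<close>

text \<open>In the adjoint action, an algebra section of degree \<open>p\<close> takes a functional \<open>\<phi>\<close> on the piece
  of degree \<open>-q\<close> to the functional \<open>z \<mapsto> \<phi> (x z)\<close> on the piece of degree \<open>-(p + q)\<close>.\<close>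

definition graded_dual :: "('x, 'r) ringed_space \<Rightarrow> ('x, 'r, 'a) graded_alg \<Rightarrow> ('x, 'r, 'a, 'm) graded_mod
    \<Rightarrow> ('x, 'r, 'a, 'x set \<Rightarrow> 'm \<Rightarrow> 'r) graded_mod" where
  "graded_dual S A M = \<lparr>
     piece = (\<lambda>q. dual_sheaf S (piece M (- q))),
     act = (\<lambda>p q U x \<phi>. \<lambda>V\<in>opens S U. \<lambda>z\<in>carrier (mod_sec M (- (p + q)) V).
        \<phi> V (act M p (- (p + q)) V (res (alg_piece A p) U V x) z))\<rparr>"

text \<open>The submodule of \<open>D\<close> generated by all \<open>D\<^sub>-\<^sub>j\<close> with \<open>m \<le> j\<close>: its sections are those
  that locally lie in the submodule generated by the sections of these pieces.\<close>

definition Delta :: "('x, 'r) ringed_space \<Rightarrow> ('x, 'r, 'a) graded_alg \<Rightarrow> int \<Rightarrow> ('x, 'r, 'a, 'm) graded_mod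
    \<Rightarrow> ('x, 'r, 'a, 'm) graded_mod" where
  "Delta S A m D = D\<lparr>piece := (\<lambda>n. (piece D n)\<lparr>sec := (\<lambda>U. (mod_sec D n U)\<lparr>carrier :=
     {z \<in> carrier (mod_sec D n U). \<forall>x\<in>U. \<exists>V\<in>opens S U. x \<in> V \<and>
        res (piece D n) U V z \<in>
          submodule_gen A D V (\<lambda>i. if m \<le> - i then carrier (mod_sec D i V) else {}) n}\<rparr>)\<rparr>)\<rparr>"

definition Lambda :: "('x, 'r) ringed_space \<Rightarrow> ('x, 'r, 'a) graded_alg \<Rightarrow> int \<Rightarrow> ('x, 'r, 'a, 'c) graded_mod
    \<Rightarrow> ('x, 'r, 'a, 'x set \<Rightarrow> ('x set \<Rightarrow> 'c \<Rightarrow> 'r) \<Rightarrow> 'r) graded_mod" where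
  "Lambda S A m C = graded_dual S A (Delta S A m (graded_dual S A C))"

text \<open>The structure sheaf as the quotient of the algebra by its part of positive degree.\<close>

definition structure_module :: "('x, 'r, 'a) graded_alg \<Rightarrow> ('x, 'r, 'a, 'a) graded_mod" where
  "structure_module A = \<lparr>
     piece = (\<lambda>p. if p = 0 then alg_piece A 0
        else (alg_piece A p)\<lparr>sec := (\<lambda>U. (alg_sec A p U)\<lparr>carrier := {\<zero>\<^bsub>alg_sec A p U\<^esub>}\<rparr>)\<rparr>),
     act = (\<lambda>p q U x z. if p = 0 \<and> q = 0 then alg_mult A 0 0 U x z else \<zero>\<^bsub>alg_sec A (p + q) U\<^esub>)\<rparr>"

text \<open>The degree \<open>n\<close> part of the tensor product over the graded algebra: over each open set it is
  generated by symbols \<open>(i, x, y)\<close> standing for the tensor of \<open>x\<close> of degree \<open>i\<close> and \<open>y\<close> of degree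
  \<open>n - i\<close>.\<close>

definition graded_tensor_gens :: "('x, 'r, 'a, 'm) graded_mod \<Rightarrow> ('x, 'r, 'a, 'n) graded_mod \<Rightarrow> int
    \<Rightarrow> 'x set \<Rightarrow> (int \<times> 'm \<times> 'n) set" where
  "graded_tensor_gens M N n U =
     {(i, x, y). x \<in> carrier (mod_sec M i U) \<and> y \<in> carrier (mod_sec N (n - i) U)}"

definition graded_tensor_rels :: "('x, 'r, 'a) graded_alg \<Rightarrow> ('x, 'r, 'a, 'm) graded_mod
    \<Rightarrow> ('x, 'r, 'a, 'n) graded_mod \<Rightarrow> int \<Rightarrow> 'x set \<Rightarrow> (int \<times> 'm \<times> 'n \<Rightarrow>\<^sub>0 int) set" where
  "graded_tensor_rels A M N n U =
     {frag_of (i, x \<oplus>\<^bsub>mod_sec M i U\<^esub> x', y) - frag_of (i, x, y) - frag_of (i, x', y) | i x x' y.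
        x \<in> carrier (mod_sec M i U) \<and> x' \<in> carrier (mod_sec M i U) \<and>
        y \<in> carrier (mod_sec N (n - i) U)} \<union>
     {frag_of (i, x, y \<oplus>\<^bsub>mod_sec N (n - i) U\<^esub> y') - frag_of (i, x, y) - frag_of (i, x, y') | i x y y'.
        x \<in> carrier (mod_sec M i U) \<and>
        y \<in> carrier (mod_sec N (n - i) U) \<and> y' \<in> carrier (mod_sec N (n - i) U)} \<union>
     {frag_of (k + i, act M k i U a x, y) - frag_of (i, x, act N k (n - (k + i)) U a y) | k i a x y.
        a \<in> carrier (alg_sec A k U) \<and> x \<in> carrier (mod_sec M i U) \<and>
        y \<in> carrier (mod_sec N (n - (k + i)) U)}"

definition graded_tensor_presheaf :: "('x, 'r, 'a) graded_alg \<Rightarrow> ('x, 'r, 'a, 'm) graded_mod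
    \<Rightarrow> ('x, 'r, 'a, 'n) graded_mod \<Rightarrow> int \<Rightarrow> ('x, 'r, (int \<times> 'm \<times> 'n \<Rightarrow>\<^sub>0 int) set) mod_sheaf" where
  "graded_tensor_presheaf A M N n = \<lparr>
     sec = (\<lambda>U. frag_quotient (graded_tensor_gens M N n U) (graded_tensor_rels A M N n U)
        (\<lambda>r (i, x, y). (i, r \<odot>\<^bsub>mod_sec M i U\<^esub> x, y))),
     res = (\<lambda>U V K. \<Union>u\<in>K. frag_class (graded_tensor_gens M N n V) (graded_tensor_rels A M N n V)
        (frag_extend (\<lambda>(i, x, y). frag_of (i, res (piece M i) U V x, res (piece N (n - i)) U V y)) u))\<rparr>"

definition graded_tensor :: "('x, 'r) ringed_space \<Rightarrow> ('x, 'r, 'a) graded_alg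
    \<Rightarrow> ('x, 'r, 'a, 'm) graded_mod \<Rightarrow> ('x, 'r, 'a, 'n) graded_mod
    \<Rightarrow> int \<Rightarrow> ('x, 'r, 'x \<Rightarrow> ('x set \<times> (int \<times> 'm \<times> 'n \<Rightarrow>\<^sub>0 int) set) set) mod_sheaf" where
  "graded_tensor S A M N n = sheafification S (graded_tensor_presheaf A M N n)"


section \<open>The sets \<open>H\<Lambda>\<close>, socle types and the bounding functions\<close>

definition HLambda :: "('x, 'r) ringed_space \<Rightarrow> ('x, 'r, 'a) graded_alg \<Rightarrow> ('x, 'r, 'a, 'b) graded_mod
    \<Rightarrow> (int \<Rightarrow> int \<Rightarrow> int) \<Rightarrow> ('x, 'r, 'a, 'c) graded_mod set" where
  "HLambda S A B h = {C. homogeneous_quotient S A B C \<and>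
     (\<forall>p. locally_free_of_finite_rank S (piece C p)) \<and>
     finite {p. \<exists>U. openin (top_of S) U \<and> carrier (mod_sec C p U) \<noteq> {\<zero>\<^bsub>mod_sec C p U\<^esub>}} \<and>
     (let D = graded_dual S A C in
        (\<forall>m p. locally_free_of_rank S (piece (Delta S A m D) (- p)) (h m p)) \<and>
        (\<forall>m. flat_sheaf S (total_sheaf (\<lambda>n. quotient_sheaf S (piece D n) (piece (Delta S A m D) n)))))}"

definition has_socle_type :: "('x, 'r) ringed_space \<Rightarrow> ('x, 'r, 'a) graded_alg
    \<Rightarrow> ('x, 'r, 'a, 'c) graded_mod \<Rightarrow> (int \<Rightarrow> int) \<Rightarrow> bool" where
  "has_socle_type S A C t \<longleftrightarrow>
     (\<forall>p. locally_free_of_rank S (graded_tensor S A (graded_dual S A C) (structure_module A) (- p)) (t p))"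

definition g_fun :: "(int \<Rightarrow> int) \<Rightarrow> (int \<Rightarrow> int) \<Rightarrow> int \<Rightarrow> int \<Rightarrow> int" where
  "g_fun a t m p = (\<Sum>q = m..Max {q. t q \<noteq> 0}. t q * a (q - p))"

definition hI :: "(int \<Rightarrow> int) \<Rightarrow> (int \<Rightarrow> int) \<Rightarrow> (int \<Rightarrow> int) \<Rightarrow> int \<Rightarrow> int \<Rightarrow> int" where
  "hI a b t m p = min (g_fun a t m p) (b p)"

text \<open>The sum over all integers; only finitely many terms are nonzero in the intended situation.\<close>

definition betaI :: "(int \<Rightarrow> int) \<Rightarrow> (int \<Rightarrow> int) \<Rightarrow> (int \<Rightarrow> int) \<Rightarrow> int \<Rightarrow> int" where
  "betaI a b t m = (\<Sum>p | hI a b t m p \<noteq> 0. hI a b t m p)"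

end

(*
  Fix a point x and write D for the dual of C.  Lifting a basis of D \<otimes>_A O near x gives t(q) elements of
  degree -q; since D vanishes in very negative degrees, the graded Nakayama lemma shows that they
  generate D near x.  The part of D generated by the D_{-j} with j >= m is then generated by the lifts
  of degree -q with q >= m, and multiplying these by bases of the A_{q-p} yields g_m(p) elements that
  span it in degree -p.  On the other hand, a functional on C_p is determined by its values on the
  images of a basis of B_p, so that D_{-p} embeds locally into a free module of rank b(p).  Both bounds
  on h_m(p) now follow from the fact that over a nonzero commutative ring a homogeneous linear system
  with more unknowns than equations has a nonzero solution.  The rank of \<Lambda>^m C is the sum of the
  h_m(p), and comparing it termwise with the sum of the h^I_m(p) gives the second assertion.
*)
theory Submission
  imports Defs
begin

section \<open>Homogeneous linear systems over commutative rings\<close>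

text \<open>Ranks are compared over rings of sections on small neighbourhoods rather than over
  residue fields. Local freeness makes a basis independent over every smaller open set, and such a
  ring is nonzero because the stalk at the point is local; linear algebra over nonzero commutative
  rings then takes the place of dimension theory. The other obstacle is locality. A section of a
  truncation lies in the generated submodule only locally, the tensor product is a sheafification,
  and the map from \<open>B\<close> onto \<open>C\<close> is onto only locally. Every statement
  about generation therefore reads "after restriction to a smaller neighbourhood of the point".
  Infinitely many degrees could force infinitely many restrictions; but \<open>t\<close> has finite
  support, so only finitely many degrees carry lifts and these share one neighbourhood, while any
  single section involves finitely many generators. The Nakayama step also records a degree bound: a
  section of degree \<open>n\<close> uses only lifts of degree at most \<open>n\<close>. Without
  this bound one would obtain generators of the whole dual but not of its truncations.\<close>

lemma (in abelian_monoid) hom_finsum_to: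
  assumes "abelian_monoid H" "f \<in> carrier G \<rightarrow> carrier H" "f \<zero> = \<zero>\<^bsub>H\<^esub>"
    "\<And>u v. u \<in> carrier G \<Longrightarrow> v \<in> carrier G \<Longrightarrow> f (u \<oplus> v) = f u \<oplus>\<^bsub>H\<^esub> f v"
    "g \<in> A \<rightarrow> carrier G"
  shows "f (finsum G g A) = finsum H (\<lambda>i. f (g i)) A"
  using \<open>g \<in> A \<rightarrow> carrier G\<close>
proof (induction A rule: infinite_finite_induct)
  case (infinite A)
  then show ?case using assms by (simp add: abelian_monoid.finsum_infinite finsum_infinite)
next
  case empty
  then show ?case using assms by (simp add: abelian_monoid.finsum_empty finsum_empty)
next
  case (insert x F)
  have [simp]: "(\<lambda>i. f (g i)) \<in> F \<rightarrow> carrier H" "f (g x) \<in> carrier H"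
    "g x \<in> carrier G" "g \<in> F \<rightarrow> carrier G" "finsum G g F \<in> carrier G"
    using insert.prems assms(2) by (auto intro!: finsum_closed)
  show ?case using insert
    by (simp add: abelian_monoid.finsum_insert[OF assms(1)] assms(4))
qed

lemma (in abelian_monoid) finsum_swap:
  assumes "finite I" "finite J" "\<And>i j. i \<in> I \<Longrightarrow> j \<in> J \<Longrightarrow> f i j \<in> carrier G"
  shows "(\<Oplus>i\<in>I. \<Oplus>j\<in>J. f i j) = (\<Oplus>j\<in>J. \<Oplus>i\<in>I. f i j)"
  using assms(1,3)
proof (induction I rule: finite_induct)
  case empty
  then show ?case by (simp add: finsum_zero)
next
  case (insert x F)
  have "(\<Oplus>j\<in>J. \<Oplus>i\<in>insert x F. f i j) = (\<Oplus>j\<in>J. f x j \<oplus> (\<Oplus>i\<in>F. f i j))"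
    using insert by (intro finsum_cong') (auto intro!: finsum_closed finsum_insert)
  also have "\<dots> = (\<Oplus>j\<in>J. f x j) \<oplus> (\<Oplus>j\<in>J. \<Oplus>i\<in>F. f i j)"
    using insert by (intro finsum_addf) (auto intro!: finsum_closed)
  finally show ?case using insert by (subst finsum_insert) (auto intro!: finsum_closed)
qed

text \<open>Zorn's lemma is applied to the multiplicative sets avoiding zero. For \<open>a\<close>
  outside a maximal one, adjoining \<open>a\<close> must produce zero, which is the last property.
  Such a set is the complement of a minimal prime ideal, and the property says that every non-unit
  of the localization is nilpotent.\<close>

lemma (in cring) maximal_multiplicative_set:
  assumes "\<one> \<noteq> \<zero>"
  obtains T where "T \<subseteq> carrier R" "\<one> \<in> T" "\<zero> \<notin> T" "\<And>s t. s \<in> T \<Longrightarrow> t \<in> T \<Longrightarrow> s \<otimes> t \<in> T"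
    "\<And>a. a \<in> carrier R \<Longrightarrow> a \<notin> T \<Longrightarrow> \<exists>s\<in>T. \<exists>n::nat. s \<otimes> a [^] n = \<zero>"
proof -
  define \<T> where "\<T> = {T. T \<subseteq> carrier R \<and> \<one> \<in> T \<and> \<zero> \<notin> T \<and> (\<forall>s\<in>T. \<forall>t\<in>T. s \<otimes> t \<in> T)}"
  have "{\<one>} \<in> \<T>" using assms by (auto simp: \<T>_def)
  moreover have "\<Union>\<C> \<in> \<T>" if "\<C> \<noteq> {}" "subset.chain \<T> \<C>" for \<C>
  proof -
    have "s \<otimes> t \<in> \<Union>\<C>" if "s \<in> X" "X \<in> \<C>" "t \<in> Y" "Y \<in> \<C>" for s t X Y
    proof -
      have "X \<subseteq> Y \<or> Y \<subseteq> X" using \<open>subset.chain \<T> \<C>\<close> that by (auto simp: subset.chain_def)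
      moreover have "X \<in> \<T>" "Y \<in> \<T>" using \<open>subset.chain \<T> \<C>\<close> that by (auto simp: subset.chain_def)
      ultimately show ?thesis using that unfolding \<T>_def by blast
    qed
    moreover have "\<C> \<subseteq> \<T>" using that by (auto simp: subset.chain_def)
    ultimately show ?thesis using \<open>\<C> \<noteq> {}\<close> unfolding \<T>_def by blast
  qed
  ultimately obtain T where T: "T \<in> \<T>" and max: "\<And>X. X \<in> \<T> \<Longrightarrow> T \<subseteq> X \<Longrightarrow> X = T"
    using subset_Zorn_nonempty[of \<T>] by blast
  have TR: "T \<subseteq> carrier R" using T by (auto simp: \<T>_def)
  have "\<exists>s\<in>T. \<exists>n::nat. s \<otimes> a [^] n = \<zero>" if a: "a \<in> carrier R" "a \<notin> T" for a
  proof (rule ccontr)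
    assume neg: "\<not> ?thesis"
    \<comment> \<open>\<open>X\<close> is the multiplicative set generated by \<open>T\<close> and
      \<open>a\<close>. The negated claim says exactly that it avoids zero, so maximality forces
      \<open>X = T\<close>, although \<open>a\<close> belongs to \<open>X\<close> and not to
      \<open>T\<close>.\<close>
    define X where "X = {s \<otimes> a [^] n | s n. s \<in> T \<and> (n::nat) \<in> UNIV}"
    have "s \<in> X" if "s \<in> T" for s
      unfolding X_def using that TR by (auto intro!: exI[of _ s] exI[of _ "0::nat"])
    moreover have "\<one> \<otimes> a [^] (1::nat) \<in> X" unfolding X_def using T by (fastforce simp: \<T>_def)
    moreover have "s \<otimes> a [^] n \<otimes> (t \<otimes> a [^] m) \<in> X" if "s \<in> T" "t \<in> T" for s t and n m :: nat
    proof -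
      have "s \<otimes> a [^] n \<otimes> (t \<otimes> a [^] m) = (s \<otimes> t) \<otimes> a [^] (n + m)"
        using that TR a by (simp add: nat_pow_mult[symmetric] m_ac subset_eq)
      then show ?thesis using that T unfolding X_def \<T>_def by blast
    qed
    ultimately have "X \<in> \<T>" using neg T TR a unfolding \<T>_def X_def
      by (auto 0 3)
    then have "X = T" using max \<open>\<And>s. s \<in> T \<Longrightarrow> s \<in> X\<close> by blast
    then show False using \<open>\<one> \<otimes> a [^] (1::nat) \<in> X\<close> a by simp
  qed
  with T show ?thesis by (intro that[of T]) (auto simp: \<T>_def)
qed

text \<open>With respect to a maximal multiplicative set \<open>T\<close>, every element is either invertible or
  nilpotent in the localization at \<open>T\<close>; this makes Gaussian elimination possible.\<close>

theorem (in cring) homogeneous_system_nonzero_solution: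
  assumes "\<one> \<noteq> \<zero>" "finite I" "finite J" "card I < card J"
    "\<And>i j. i \<in> I \<Longrightarrow> j \<in> J \<Longrightarrow> M i j \<in> carrier R"
  obtains v where "v \<in> J \<rightarrow> carrier R" "\<exists>j\<in>J. v j \<noteq> \<zero>"
    "\<And>i. i \<in> I \<Longrightarrow> (\<Oplus>j\<in>J. M i j \<otimes> v j) = \<zero>"
proof -
  obtain T where TR: "T \<subseteq> carrier R" and T1: "\<one> \<in> T" and T0: "\<zero> \<notin> T"
    and Tm: "\<And>s t. s \<in> T \<Longrightarrow> t \<in> T \<Longrightarrow> s \<otimes> t \<in> T"
    and Tn: "\<And>a. a \<in> carrier R \<Longrightarrow> a \<notin> T \<Longrightarrow> \<exists>s\<in>T. \<exists>n::nat. s \<otimes> a [^] n = \<zero>"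
    using maximal_multiplicative_set[OF assms(1)] by blast
  \<comment> \<open>\<open>nz w\<close> says that \<open>w\<close> stays nonzero in the localization
    at \<open>T\<close>. The induction carries this instead of \<open>w \<noteq> \<zero>\<close>
    because it survives multiplication by pivots, which lie in \<open>T\<close>.\<close>
  define nz where "nz w \<longleftrightarrow> (\<forall>s\<in>T. s \<otimes> w \<noteq> \<zero>)" for w
  \<comment> \<open>Elements outside \<open>T\<close> become nilpotent in the localization; finitely
    many of them have a common annihilator that is still nonzero there.\<close>
  have kill: "\<exists>u\<in>carrier R. nz u \<and> (\<forall>a\<in>F. u \<otimes> a = \<zero>)" if "finite F" "F \<subseteq> carrier R - T" for F
    using that
  proof (induction F)
    case empty
    then show ?case using T0 TR by (intro bexI[of _ \<one>]) (auto simp: nz_def subset_eq)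
  next
    case (insert a F)
    then obtain u where u: "u \<in> carrier R" "nz u" "\<forall>a\<in>F. u \<otimes> a = \<zero>" by auto
    have a: "a \<in> carrier R" using insert by auto
    obtain s n where s: "s \<in> T" "s \<otimes> a [^] (n::nat) = \<zero>" using Tn insert.prems by blast
    have "s \<otimes> (u \<otimes> a [^] n) = \<zero>" using s u a TR m_lcomm[of s u "a [^] n"] by auto
    then have "\<not> nz (u \<otimes> a [^] n)" using s by (auto simp: nz_def)
    moreover have "nz (u \<otimes> a [^] (0::nat))" using u by simp
    \<comment> \<open>\<open>k\<close> is the last exponent for which \<open>u\<close> times the
      power of \<open>a\<close> survives in the localization. The element \<open>s'\<close> of
      \<open>T\<close> kills the next power already in the ring, so \<open>w\<close> below
      annihilates \<open>a\<close> on the nose.\<close>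
    ultimately have "\<exists>k. nz (u \<otimes> a [^] (k::nat)) \<and> \<not> nz (u \<otimes> a [^] Suc k)"
      using nat_induct[of "\<lambda>k. nz (u \<otimes> a [^] k)" n] by blast
    then obtain k s' where k: "nz (u \<otimes> a [^] (k::nat))" "s' \<in> T" "s' \<otimes> (u \<otimes> a [^] Suc k) = \<zero>"
      by (auto simp: nz_def)
    have s'R: "s' \<in> carrier R" using k TR by auto
    define w where "w = s' \<otimes> (u \<otimes> a [^] k)"
    have "nz w" unfolding nz_def
    proof
      fix t assume t: "t \<in> T"
      have "t \<otimes> w = (t \<otimes> s') \<otimes> (u \<otimes> a [^] k)"
        unfolding w_def using t TR s'R u a by (simp add: m_assoc subset_eq)
      then show "t \<otimes> w \<noteq> \<zero>" using k Tm[OF t k(2)] by (simp add: nz_def)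
    qed
    moreover have "w \<otimes> a = \<zero>" using k s'R u a by (simp add: w_def m_assoc)
    moreover have "w \<otimes> b = \<zero>" if "b \<in> F" for b
    proof -
      have "b \<in> carrier R" using insert that by auto
      then have "w \<otimes> b = s' \<otimes> a [^] k \<otimes> (u \<otimes> b)" unfolding w_def using s'R u a by (simp add: m_ac)
      then show ?thesis using u that s'R a by simp
    qed
    moreover have "w \<in> carrier R" using s'R u a by (simp add: w_def)
    ultimately show ?case by blast
  qed
  have "\<exists>v\<in>J \<rightarrow> carrier R. (\<exists>j\<in>J. nz (v j)) \<and> (\<forall>i\<in>I. (\<Oplus>j\<in>J. M i j \<otimes> v j) = \<zero>)"
    using assms(2-5)
  proof (induction "card I" arbitrary: I J M rule: less_induct)
    case less
    have MR: "\<And>i j. i \<in> I \<Longrightarrow> j \<in> J \<Longrightarrow> M i j \<in> carrier R" by (fact less.prems(4))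
    show ?case
    proof (cases "\<exists>i\<in>I. \<exists>j\<in>J. M i j \<in> T")
      \<comment> \<open>With no coefficient in \<open>T\<close> there is no pivot, but then all
        coefficients are nilpotent in the localization and have a common annihilator
        \<open>u\<close>; the constant vector \<open>u\<close> solves the system.\<close>
      case False
      have "finite ((\<lambda>(i, j). M i j) ` (I \<times> J))" using less by blast
      moreover have "(\<lambda>(i, j). M i j) ` (I \<times> J) \<subseteq> carrier R - T" using False MR by auto
      ultimately obtain u where u: "u \<in> carrier R" "nz u"
        and "\<forall>a\<in>(\<lambda>(i, j). M i j) ` (I \<times> J). u \<otimes> a = \<zero>" using kill by meson
      then have uM: "\<And>i j. i \<in> I \<Longrightarrow> j \<in> J \<Longrightarrow> u \<otimes> M i j = \<zero>" by force
      have "J \<noteq> {}" using less by auto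
      moreover have "(\<Oplus>j\<in>J. M i j \<otimes> u) = \<zero>" if "i \<in> I" for i
        using that uM MR u by (intro add.finprod_one_eqI) (metis m_comm)
      ultimately show ?thesis using u by (intro bexI[of _ "\<lambda>_. u"]) auto
    next
      case True
      then obtain i0 j0 where p: "i0 \<in> I" "j0 \<in> J" "M i0 j0 \<in> T" by blast
      define a where "a = M i0 j0"
      have aT: "a \<in> T" and aR: "a \<in> carrier R" using p TR by (auto simp: a_def)
      define I' J' where "I' = I - {i0}" and "J' = J - {j0}"
      have fin: "finite I'" "finite J'" and IJ: "I = insert i0 I'" "J = insert j0 J'" "i0 \<notin> I'" "j0 \<notin> J'"
        using less.prems p by (auto simp: I'_def J'_def)
      have c: "card I = Suc (card I')" "card J = Suc (card J')" using fin IJ by auto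
      define N where "N i j = a \<otimes> M i j \<ominus> M i j0 \<otimes> M i0 j" for i j
      have "\<exists>v\<in>J' \<rightarrow> carrier R. (\<exists>j\<in>J'. nz (v j)) \<and> (\<forall>i\<in>I'. (\<Oplus>j\<in>J'. N i j \<otimes> v j) = \<zero>)"
        using less.prems c fin aR MR IJ p by (intro less.hyps) (auto simp: N_def)
      then obtain w where w: "w \<in> J' \<rightarrow> carrier R" "\<exists>j\<in>J'. nz (w j)"
        and eq: "\<And>i. i \<in> I' \<Longrightarrow> (\<Oplus>j\<in>J'. N i j \<otimes> w j) = \<zero>" by blast
      from w have wR: "\<And>j. j \<in> J' \<Longrightarrow> w j \<in> carrier R" by auto
      define \<sigma> where "\<sigma> i = (\<Oplus>j\<in>J'. M i j \<otimes> w j)" for i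
      have \<sigma>R: "\<sigma> i \<in> carrier R" if "i \<in> I" for i
        unfolding \<sigma>_def using that MR w IJ by (auto intro!: finsum_closed)
      \<comment> \<open>The solution \<open>w\<close> of the reduced system is scaled by the pivot.
        The value at \<open>j0\<close> makes row \<open>i0\<close> cancel: \<open>a\<close> times
        \<open>\<ominus> \<sigma> i0\<close> against \<open>a \<otimes> \<sigma> i0\<close>.\<close>
      define v where "v j = (if j = j0 then \<ominus> \<sigma> i0 else a \<otimes> w j)" for j
      have "v \<in> J \<rightarrow> carrier R" using IJ w aR \<sigma>R p by (auto simp: v_def Pi_iff)
      moreover have "\<exists>j\<in>J. nz (v j)"
      proof -
        obtain j where j: "j \<in> J'" "nz (w j)" using w by blast
        have "t \<otimes> (a \<otimes> w j) \<noteq> \<zero>" if "t \<in> T" for t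
        proof -
          have "t \<otimes> (a \<otimes> w j) = (t \<otimes> a) \<otimes> w j" using that TR aR w j by (subst m_assoc) auto
          then show ?thesis using j Tm[OF that aT] by (simp add: nz_def)
        qed
        then have "nz (v j)" using j IJ by (auto simp: v_def nz_def)
        then show ?thesis using j IJ by auto
      qed
      moreover have "(\<Oplus>j\<in>J. M i j \<otimes> v j) = \<zero>" if i: "i \<in> I" for i
      proof -
        have "(\<Oplus>j\<in>J. M i j \<otimes> v j) = M i j0 \<otimes> v j0 \<oplus> (\<Oplus>j\<in>J'. M i j \<otimes> v j)"
          unfolding IJ(2) using fin IJ i \<open>v \<in> J \<rightarrow> carrier R\<close> MR
          by (intro finsum_insert) auto
        also have "(\<Oplus>j\<in>J'. M i j \<otimes> v j) = (\<Oplus>j\<in>J'. a \<otimes> (M i j \<otimes> w j))"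
          using fin IJ i MR w aR by (intro finsum_cong') (auto simp: v_def Pi_iff m_lcomm)
        also have "\<dots> = a \<otimes> \<sigma> i" unfolding \<sigma>_def
          using fin IJ i MR w aR by (intro finsum_rdistr[symmetric]) auto
        finally have *: "(\<Oplus>j\<in>J. M i j \<otimes> v j) = M i j0 \<otimes> (\<ominus> \<sigma> i0) \<oplus> a \<otimes> \<sigma> i" by (simp add: v_def)
        show ?thesis
        proof (cases "i = i0")
          case True
          then show ?thesis unfolding * using aR \<sigma>R[OF p(1)] by (simp add: a_def[symmetric] r_minus l_neg)
        next
          case False
          have "(\<Oplus>j\<in>J'. N i j \<otimes> w j) = (\<Oplus>j\<in>J'. a \<otimes> (M i j \<otimes> w j) \<oplus> (\<ominus> M i j0) \<otimes> (M i0 j \<otimes> w j))"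
          proof (intro finsum_cong' refl)
            fix j assume j: "j \<in> J'"
            have R: "M i j \<in> carrier R" "w j \<in> carrier R" "M i j0 \<in> carrier R" "M i0 j \<in> carrier R"
              using i j MR w p IJ by auto
            show "N i j \<otimes> w j = a \<otimes> (M i j \<otimes> w j) \<oplus> (\<ominus> M i j0) \<otimes> (M i0 j \<otimes> w j)"
              unfolding N_def using R aR by (simp add: minus_eq l_distr l_minus m_assoc)
          qed (use i MR wR p IJ aR in auto)
          also have "\<dots> = (\<Oplus>j\<in>J'. a \<otimes> (M i j \<otimes> w j)) \<oplus> (\<Oplus>j\<in>J'. (\<ominus> M i j0) \<otimes> (M i0 j \<otimes> w j))"
            using i MR wR p IJ aR by (intro finsum_addf) auto
          also have "\<dots> = a \<otimes> \<sigma> i \<oplus> (\<ominus> M i j0) \<otimes> \<sigma> i0" unfolding \<sigma>_def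
            using i MR wR p IJ aR fin by (subst (1 2) finsum_rdistr) auto
          finally have "a \<otimes> \<sigma> i \<oplus> (\<ominus> M i j0) \<otimes> \<sigma> i0 = \<zero>" using eq[of i] i False IJ by auto
          moreover have "M i j0 \<otimes> (\<ominus> \<sigma> i0) = (\<ominus> M i j0) \<otimes> \<sigma> i0"
            using \<sigma>R p i MR by (simp add: l_minus r_minus)
          ultimately show ?thesis unfolding * using \<sigma>R p i MR aR by (simp add: a_comm)
        qed
      qed
      ultimately show ?thesis by blast
    qed
  qed
  then obtain v where "v \<in> J \<rightarrow> carrier R" "\<exists>j\<in>J. nz (v j)" "\<And>i. i \<in> I \<Longrightarrow> (\<Oplus>j\<in>J. M i j \<otimes> v j) = \<zero>"
    by blast
  moreover from this have "\<exists>j\<in>J. v j \<noteq> \<zero>" using T1 TR by (metis nz_def r_null subset_eq)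
  ultimately show ?thesis using that by blast
qed

section \<open>Independent families in modules\<close>

text \<open>Families are used instead of sets: restriction may identify distinct sections, and the
  spanning products met later are indexed by triples.\<close>

definition indep :: "('r, 'k) ring_scheme \<Rightarrow> ('r, 'm, 'i) module_scheme \<Rightarrow> 'j set \<Rightarrow> ('j \<Rightarrow> 'm) \<Rightarrow> bool" where
  "indep R M J e \<longleftrightarrow> (\<forall>c\<in>J \<rightarrow> carrier R.
     (\<Oplus>\<^bsub>M\<^esub>j\<in>J. c j \<odot>\<^bsub>M\<^esub> e j) = \<zero>\<^bsub>M\<^esub> \<longrightarrow> (\<forall>j\<in>J. c j = \<zero>\<^bsub>R\<^esub>))"

definition in_span :: "('r, 'k) ring_scheme \<Rightarrow> ('r, 'm, 'i) module_scheme \<Rightarrow> 'j set \<Rightarrow> ('j \<Rightarrow> 'm) \<Rightarrow> 'm \<Rightarrow> bool" where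
  "in_span R M J e z \<longleftrightarrow> (\<exists>c\<in>J \<rightarrow> carrier R. z = (\<Oplus>\<^bsub>M\<^esub>j\<in>J. c j \<odot>\<^bsub>M\<^esub> e j))"

lemma (in module) finsum_reindex_lincomb:
  assumes "bij_betw f J I" "c \<in> I \<rightarrow> carrier R" "e \<in> I \<rightarrow> carrier M"
  shows "(\<Oplus>\<^bsub>M\<^esub>i\<in>I. c i \<odot>\<^bsub>M\<^esub> e i) = (\<Oplus>\<^bsub>M\<^esub>j\<in>J. c (f j) \<odot>\<^bsub>M\<^esub> e (f j))"
  using assms M.finsum_reindex[of "\<lambda>i. c i \<odot>\<^bsub>M\<^esub> e i" f J]
  by (auto simp: bij_betw_def Pi_iff)

lemma (in module) in_span_reindex:
  assumes "bij_betw f J I" "e \<in> I \<rightarrow> carrier M" "in_span R M I e z"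
  shows "in_span R M J (\<lambda>j. e (f j)) z"
proof -
  from assms(3) obtain c where c: "c \<in> I \<rightarrow> carrier R" "z = (\<Oplus>\<^bsub>M\<^esub>i\<in>I. c i \<odot>\<^bsub>M\<^esub> e i)"
    unfolding in_span_def by blast
  have "(\<lambda>j. c (f j)) \<in> J \<rightarrow> carrier R" using c(1) bij_betwE[OF assms(1)] by (simp add: Pi_iff)
  then show ?thesis unfolding in_span_def c(2) finsum_reindex_lincomb[OF assms(1) c(1) assms(2)]
    by (rule bexI[rotated]) (rule refl)
qed

lemma (in module) indep_reindex:
  assumes "bij_betw f J I" "e \<in> I \<rightarrow> carrier M" "indep R M I e"
  shows "indep R M J (\<lambda>j. e (f j))"
  unfolding indep_def
proof (intro ballI impI)
  fix c j assume c: "c \<in> J \<rightarrow> carrier R" "(\<Oplus>\<^bsub>M\<^esub>j\<in>J. c j \<odot>\<^bsub>M\<^esub> e (f j)) = \<zero>\<^bsub>M\<^esub>" and j: "j \<in> J"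
  define d where "d i = c (the_inv_into J f i)" for i
  have df: "d (f j) = c j" if "j \<in> J" for j
    using that assms(1) by (simp add: d_def bij_betw_def the_inv_into_f_f)
  have dR: "d \<in> I \<rightarrow> carrier R"
  proof
    fix i assume "i \<in> I"
    then obtain j where "j \<in> J" "i = f j" using assms(1) by (auto simp: bij_betw_def)
    then show "d i \<in> carrier R" using df c(1) by auto
  qed
  have "(\<Oplus>\<^bsub>M\<^esub>i\<in>I. d i \<odot>\<^bsub>M\<^esub> e i) = (\<Oplus>\<^bsub>M\<^esub>j\<in>J. c j \<odot>\<^bsub>M\<^esub> e (f j))"
    unfolding finsum_reindex_lincomb[OF assms(1) dR assms(2)]
    by (intro M.finsum_cong' refl) (use c(1) assms(2) df bij_betwE[OF assms(1)] in \<open>simp_all add: Pi_iff\<close>)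
  then have "(\<Oplus>\<^bsub>M\<^esub>i\<in>I. d i \<odot>\<^bsub>M\<^esub> e i) = \<zero>\<^bsub>M\<^esub>" by (simp only: c(2))
  then have "d (f j) = \<zero>" using assms(3) dR bij_betwE[OF assms(1)] j unfolding indep_def by blast
  then show "c j = \<zero>" by (simp only: df[OF j])
qed

context module
begin

lemma lincomb_closed:
  assumes "c \<in> J \<rightarrow> carrier R" "e \<in> J \<rightarrow> carrier M"
  shows "(\<Oplus>\<^bsub>M\<^esub>j\<in>J. c j \<odot>\<^bsub>M\<^esub> e j) \<in> carrier M"
  using assms by (auto intro!: M.finsum_closed simp: Pi_iff)

lemma lincomb_restrict:
  assumes "c \<in> J \<rightarrow> carrier R" "e \<in> J \<rightarrow> carrier M"
  shows "(\<Oplus>\<^bsub>M\<^esub>j\<in>J. (restrict c J) j \<odot>\<^bsub>M\<^esub> e j) = (\<Oplus>\<^bsub>M\<^esub>j\<in>J. c j \<odot>\<^bsub>M\<^esub> e j)"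
  by (intro M.finsum_cong' refl) (use assms in \<open>simp_all add: Pi_iff\<close>)

lemma lincomb_add:
  assumes "c \<in> J \<rightarrow> carrier R" "d \<in> J \<rightarrow> carrier R" "e \<in> J \<rightarrow> carrier M"
  shows "(\<Oplus>\<^bsub>M\<^esub>j\<in>J. c j \<odot>\<^bsub>M\<^esub> e j) \<oplus>\<^bsub>M\<^esub> (\<Oplus>\<^bsub>M\<^esub>j\<in>J. d j \<odot>\<^bsub>M\<^esub> e j) =
    (\<Oplus>\<^bsub>M\<^esub>j\<in>J. (c j \<oplus> d j) \<odot>\<^bsub>M\<^esub> e j)"
proof -
  have "(\<Oplus>\<^bsub>M\<^esub>j\<in>J. (c j \<oplus> d j) \<odot>\<^bsub>M\<^esub> e j) = (\<Oplus>\<^bsub>M\<^esub>j\<in>J. c j \<odot>\<^bsub>M\<^esub> e j \<oplus>\<^bsub>M\<^esub> d j \<odot>\<^bsub>M\<^esub> e j)"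
    using assms by (intro M.finsum_cong') (auto simp: Pi_iff smult_l_distr)
  also have "\<dots> = (\<Oplus>\<^bsub>M\<^esub>j\<in>J. c j \<odot>\<^bsub>M\<^esub> e j) \<oplus>\<^bsub>M\<^esub> (\<Oplus>\<^bsub>M\<^esub>j\<in>J. d j \<odot>\<^bsub>M\<^esub> e j)"
    using assms by (intro M.finsum_addf) (auto simp: Pi_iff)
  finally show ?thesis ..
qed

lemma lincomb_smult:
  assumes "finite J" "r \<in> carrier R" "c \<in> J \<rightarrow> carrier R" "e \<in> J \<rightarrow> carrier M"
  shows "r \<odot>\<^bsub>M\<^esub> (\<Oplus>\<^bsub>M\<^esub>j\<in>J. c j \<odot>\<^bsub>M\<^esub> e j) = (\<Oplus>\<^bsub>M\<^esub>j\<in>J. (r \<otimes> c j) \<odot>\<^bsub>M\<^esub> e j)"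
proof -
  have "(\<Oplus>\<^bsub>M\<^esub>j\<in>J. (r \<otimes> c j) \<odot>\<^bsub>M\<^esub> e j) = (\<Oplus>\<^bsub>M\<^esub>j\<in>J. r \<odot>\<^bsub>M\<^esub> (c j \<odot>\<^bsub>M\<^esub> e j))"
    using assms by (intro M.finsum_cong') (auto simp: Pi_iff smult_assoc1)
  then show ?thesis using assms by (subst finsum_smult_ldistr) (auto simp: Pi_iff)
qed

lemma lincomb_minus:
  assumes "finite J" "c \<in> J \<rightarrow> carrier R" "e \<in> J \<rightarrow> carrier M"
  shows "\<ominus>\<^bsub>M\<^esub> (\<Oplus>\<^bsub>M\<^esub>j\<in>J. c j \<odot>\<^bsub>M\<^esub> e j) = (\<Oplus>\<^bsub>M\<^esub>j\<in>J. (\<ominus> c j) \<odot>\<^bsub>M\<^esub> e j)"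
proof -
  have "\<ominus>\<^bsub>M\<^esub> (\<Oplus>\<^bsub>M\<^esub>j\<in>J. c j \<odot>\<^bsub>M\<^esub> e j) = (\<ominus> \<one>) \<odot>\<^bsub>M\<^esub> (\<Oplus>\<^bsub>M\<^esub>j\<in>J. c j \<odot>\<^bsub>M\<^esub> e j)"
    using lincomb_closed[OF assms(2,3)] by (simp add: smult_l_minus)
  also have "\<dots> = (\<Oplus>\<^bsub>M\<^esub>j\<in>J. (\<ominus> c j) \<odot>\<^bsub>M\<^esub> e j)"
    using assms by (subst lincomb_smult) (auto simp: Pi_iff l_minus intro!: M.finsum_cong')
  finally show ?thesis .
qed

lemma in_span_closed: "in_span R M J e z \<Longrightarrow> e \<in> J \<rightarrow> carrier M \<Longrightarrow> z \<in> carrier M"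
  by (auto simp: in_span_def lincomb_closed)

lemma in_span_add:
  assumes "e \<in> J \<rightarrow> carrier M" "in_span R M J e y" "in_span R M J e z"
  shows "in_span R M J e (y \<oplus>\<^bsub>M\<^esub> z)"
proof -
  from assms(2,3) obtain c d where c: "c \<in> J \<rightarrow> carrier R" "y = (\<Oplus>\<^bsub>M\<^esub>j\<in>J. c j \<odot>\<^bsub>M\<^esub> e j)"
    and d: "d \<in> J \<rightarrow> carrier R" "z = (\<Oplus>\<^bsub>M\<^esub>j\<in>J. d j \<odot>\<^bsub>M\<^esub> e j)"
    by (auto simp: in_span_def)
  have "(\<lambda>j. c j \<oplus> d j) \<in> J \<rightarrow> carrier R" using c d by (simp add: Pi_iff)
  then show ?thesis unfolding in_span_def c(2) d(2) lincomb_add[OF c(1) d(1) assms(1)]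
    by (rule bexI[rotated]) (rule refl)
qed

lemma in_span_minus:
  assumes "finite J" "e \<in> J \<rightarrow> carrier M" "in_span R M J e y"
  shows "in_span R M J e (\<ominus>\<^bsub>M\<^esub> y)"
proof -
  from assms(3) obtain c where c: "c \<in> J \<rightarrow> carrier R" "y = (\<Oplus>\<^bsub>M\<^esub>j\<in>J. c j \<odot>\<^bsub>M\<^esub> e j)"
    by (auto simp: in_span_def)
  have "(\<lambda>j. \<ominus> c j) \<in> J \<rightarrow> carrier R" using c by (simp add: Pi_iff)
  then show ?thesis unfolding in_span_def c(2) lincomb_minus[OF assms(1) c(1) assms(2)]
    by (rule bexI[rotated]) (rule refl)
qed

lemma in_span_zero:
  assumes "e \<in> J \<rightarrow> carrier M"
  shows "in_span R M J e \<zero>\<^bsub>M\<^esub>"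
proof -
  have "(\<Oplus>\<^bsub>M\<^esub>j\<in>J. \<zero> \<odot>\<^bsub>M\<^esub> e j) = \<zero>\<^bsub>M\<^esub>"
    using assms by (intro M.add.finprod_one_eqI[simplified]) (simp add: Pi_iff)
  then show ?thesis unfolding in_span_def by (intro bexI[of _ "\<lambda>_. \<zero>"]) auto
qed

lemma indep_unique:
  assumes "finite J" "e \<in> J \<rightarrow> carrier M" "indep R M J e" "c \<in> J \<rightarrow> carrier R" "d \<in> J \<rightarrow> carrier R"
    "(\<Oplus>\<^bsub>M\<^esub>j\<in>J. c j \<odot>\<^bsub>M\<^esub> e j) = (\<Oplus>\<^bsub>M\<^esub>j\<in>J. d j \<odot>\<^bsub>M\<^esub> e j)" "j \<in> J"
  shows "c j = d j"
proof -
  have d': "(\<lambda>j. \<ominus> d j) \<in> J \<rightarrow> carrier R" using assms by auto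
  have "(\<Oplus>\<^bsub>M\<^esub>j\<in>J. (c j \<oplus> \<ominus> d j) \<odot>\<^bsub>M\<^esub> e j) = \<zero>\<^bsub>M\<^esub>"
    unfolding lincomb_add[OF assms(4) d' assms(2), symmetric] lincomb_minus[OF assms(1) assms(5) assms(2), symmetric]
    unfolding assms(6) by (rule M.r_neg[OF lincomb_closed[OF assms(5,2)]])
  moreover have "(\<lambda>j. c j \<oplus> \<ominus> d j) \<in> J \<rightarrow> carrier R" using assms by (auto simp: Pi_iff)
  ultimately have "c j \<oplus> \<ominus> d j = \<zero>" using assms(3,7) by (auto simp: indep_def)
  moreover have "c j \<in> carrier R" "d j \<in> carrier R" using assms by auto
  ultimately show ?thesis using sum_zero_eq_neg[of "c j" "\<ominus> d j"] by (simp del: minus_equality)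
qed

text \<open>Bases of sheaves are defined through unique extensional coefficient functions, whereas
  rank comparisons take independence from one family and spanning from another. Independence is
  uniqueness of the expansion of zero, tested on coefficient functions restricted to
  \<open>J\<close>.\<close>

lemma unique_coefficients_iff:
  assumes "finite J" "e \<in> J \<rightarrow> carrier M"
  shows "(\<forall>z\<in>carrier M. \<exists>!c. c \<in> J \<rightarrow>\<^sub>E carrier R \<and> z = (\<Oplus>\<^bsub>M\<^esub>j\<in>J. c j \<odot>\<^bsub>M\<^esub> e j)) \<longleftrightarrow>
    indep R M J e \<and> (\<forall>z\<in>carrier M. in_span R M J e z)" (is "?L \<longleftrightarrow> ?R")
proof
  assume L: ?L
  obtain c0 where c0: "\<And>c. c \<in> J \<rightarrow>\<^sub>E carrier R \<Longrightarrow> \<zero>\<^bsub>M\<^esub> = (\<Oplus>\<^bsub>M\<^esub>j\<in>J. c j \<odot>\<^bsub>M\<^esub> e j) \<Longrightarrow> c = c0"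
    using L[rule_format, OF M.zero_closed] by (elim ex1E) blast
  have "indep R M J e" unfolding indep_def
  proof (intro ballI impI)
    fix c j assume c: "c \<in> J \<rightarrow> carrier R" "(\<Oplus>\<^bsub>M\<^esub>j\<in>J. c j \<odot>\<^bsub>M\<^esub> e j) = \<zero>\<^bsub>M\<^esub>" "j \<in> J"
    have "(\<Oplus>\<^bsub>M\<^esub>j\<in>J. (\<lambda>j\<in>J. \<zero>) j \<odot>\<^bsub>M\<^esub> e j) = \<zero>\<^bsub>M\<^esub>"
      using assms by (intro M.add.finprod_one_eqI[simplified]) (simp add: Pi_iff)
    moreover have "(\<Oplus>\<^bsub>M\<^esub>j\<in>J. (restrict c J) j \<odot>\<^bsub>M\<^esub> e j) = \<zero>\<^bsub>M\<^esub>"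
      unfolding lincomb_restrict[OF c(1) assms(2)] by (rule c(2))
    moreover have "(\<lambda>j\<in>J. \<zero>) \<in> J \<rightarrow>\<^sub>E carrier R" "restrict c J \<in> J \<rightarrow>\<^sub>E carrier R"
      using c(1) by auto
    ultimately have "(\<lambda>j\<in>J. \<zero>) = restrict c J"
      using c0[of "\<lambda>j\<in>J. \<zero>"] c0[of "restrict c J"] by metis
    from fun_cong[OF this, of j] show "c j = \<zero>" using c(3) by simp
  qed
  moreover have "in_span R M J e z" if z: "z \<in> carrier M" for z
  proof -
    obtain c where "c \<in> J \<rightarrow>\<^sub>E carrier R" "z = (\<Oplus>\<^bsub>M\<^esub>j\<in>J. c j \<odot>\<^bsub>M\<^esub> e j)" using L[rule_format, OF z]
      by (elim ex1E) blast
    then show ?thesis unfolding in_span_def by (intro bexI[of _ c]) (simp_all add: PiE_iff)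
  qed
  ultimately show ?R by blast
next
  assume R: ?R
  show ?L
  proof
    fix z assume "z \<in> carrier M"
    then obtain c where c: "c \<in> J \<rightarrow> carrier R" "z = (\<Oplus>\<^bsub>M\<^esub>j\<in>J. c j \<odot>\<^bsub>M\<^esub> e j)"
      using R by (auto simp: in_span_def)
    show "\<exists>!c. c \<in> J \<rightarrow>\<^sub>E carrier R \<and> z = (\<Oplus>\<^bsub>M\<^esub>j\<in>J. c j \<odot>\<^bsub>M\<^esub> e j)"
    proof (rule ex1I[of _ "restrict c J"])
      show "restrict c J \<in> J \<rightarrow>\<^sub>E carrier R \<and> z = (\<Oplus>\<^bsub>M\<^esub>j\<in>J. (restrict c J) j \<odot>\<^bsub>M\<^esub> e j)"
        unfolding lincomb_restrict[OF c(1) assms(2)] using c by simp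
    next
      fix d assume d: "d \<in> J \<rightarrow>\<^sub>E carrier R \<and> z = (\<Oplus>\<^bsub>M\<^esub>j\<in>J. d j \<odot>\<^bsub>M\<^esub> e j)"
      show "d = restrict c J"
      proof
        fix j show "d j = restrict c J j"
        proof (cases "j \<in> J")
          case True
          have "d \<in> J \<rightarrow> carrier R" using d by auto
          then show ?thesis
            using indep_unique[OF assms _ _ c(1) _ True, of d] R c(2) d True by simp
        qed (simp add: PiE_arb[OF conjunct1[OF d]])
      qed
    qed
  qed
qed

text \<open>Expressing every \<open>e j\<close> through \<open>g\<close> gives a matrix with
  \<open>card I\<close> rows and \<open>card J\<close> columns. If there were more columns than
  rows, a nonzero vector in its kernel would be a nontrivial relation among the
  \<open>e j\<close>.\<close>

lemma indep_le_span:
  assumes "\<one> \<noteq> \<zero>" "finite I" "finite J" "e \<in> J \<rightarrow> carrier M" "indep R M J e" "g \<in> I \<rightarrow> carrier M"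
    "\<And>j. j \<in> J \<Longrightarrow> in_span R M I g (e j)"
  shows "card J \<le> card I"
proof (rule ccontr)
  assume "\<not> ?thesis"
  then have lt: "card I < card J" by simp
  have "\<forall>j\<in>J. \<exists>q\<in>I \<rightarrow> carrier R. e j = (\<Oplus>\<^bsub>M\<^esub>i\<in>I. q i \<odot>\<^bsub>M\<^esub> g i)" using assms(7) by (simp add: in_span_def)
  then obtain Q where Q: "\<And>j. j \<in> J \<Longrightarrow> Q j \<in> I \<rightarrow> carrier R"
    "\<And>j. j \<in> J \<Longrightarrow> e j = (\<Oplus>\<^bsub>M\<^esub>i\<in>I. Q j i \<odot>\<^bsub>M\<^esub> g i)" by metis
  have QR: "\<And>i j. i \<in> I \<Longrightarrow> j \<in> J \<Longrightarrow> Q j i \<in> carrier R" using Q by auto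
  obtain v where v: "v \<in> J \<rightarrow> carrier R" "\<exists>j\<in>J. v j \<noteq> \<zero>"
    "\<And>i. i \<in> I \<Longrightarrow> (\<Oplus>j\<in>J. Q j i \<otimes> v j) = \<zero>"
    using homogeneous_system_nonzero_solution[OF assms(1-3) lt, of "\<lambda>i j. Q j i"] QR by auto
  have gM: "\<And>i. i \<in> I \<Longrightarrow> g i \<in> carrier M" and vR: "\<And>j. j \<in> J \<Longrightarrow> v j \<in> carrier R"
    using assms(6) v(1) by auto
  have "(\<Oplus>\<^bsub>M\<^esub>j\<in>J. v j \<odot>\<^bsub>M\<^esub> e j) = (\<Oplus>\<^bsub>M\<^esub>j\<in>J. \<Oplus>\<^bsub>M\<^esub>i\<in>I. (Q j i \<otimes> v j) \<odot>\<^bsub>M\<^esub> g i)"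
  proof (intro M.finsum_cong' refl)
    fix j assume j: "j \<in> J"
    show "v j \<odot>\<^bsub>M\<^esub> e j = (\<Oplus>\<^bsub>M\<^esub>i\<in>I. (Q j i \<otimes> v j) \<odot>\<^bsub>M\<^esub> g i)"
      unfolding Q(2)[OF j] lincomb_smult[OF assms(2) vR[OF j] Q(1)[OF j] assms(6)]
      using j vR gM QR by (intro M.finsum_cong' refl) (simp_all add: m_comm Pi_iff)
  qed (use vR gM QR in \<open>auto intro!: M.finsum_closed\<close>)
  also have "\<dots> = (\<Oplus>\<^bsub>M\<^esub>i\<in>I. \<Oplus>\<^bsub>M\<^esub>j\<in>J. (Q j i \<otimes> v j) \<odot>\<^bsub>M\<^esub> g i)"
    using assms(2,3) vR gM QR by (intro M.finsum_swap) auto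
  also have "\<dots> = (\<Oplus>\<^bsub>M\<^esub>i\<in>I. (\<Oplus>j\<in>J. Q j i \<otimes> v j) \<odot>\<^bsub>M\<^esub> g i)"
  proof (intro M.finsum_cong' refl)
    fix i assume i: "i \<in> I"
    show "(\<Oplus>\<^bsub>M\<^esub>j\<in>J. (Q j i \<otimes> v j) \<odot>\<^bsub>M\<^esub> g i) = (\<Oplus>j\<in>J. Q j i \<otimes> v j) \<odot>\<^bsub>M\<^esub> g i"
      using i vR gM QR M.abelian_monoid_axioms
      by (intro R.hom_finsum_to[where f="\<lambda>r. r \<odot>\<^bsub>M\<^esub> g i", symmetric]) (auto simp: smult_l_distr)
  qed (use vR gM QR in \<open>auto intro!: R.finsum_closed\<close>)
  also have "\<dots> = \<zero>\<^bsub>M\<^esub>"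
    using v(3) gM by (intro M.add.finprod_one_eqI[simplified]) simp
  finally have "\<forall>j\<in>J. v j = \<zero>" using assms(5) v(1) unfolding indep_def by blast
  then show False using v(2) by blast
qed

end

section \<open>Ringed spaces and presheaves of modules\<close>

lemma functorial_res:
  assumes "functorial T F \<rho>" "openin T U" "openin T V" "V \<subseteq> U" "s \<in> F U"
  shows "\<rho> U V s \<in> F V"
  using conjunct1[OF assms(1)[unfolded functorial_def], rule_format, of U V] assms(2-5)
  by (simp add: Pi_iff)

lemma functorial_id:
  assumes "functorial T F \<rho>" "openin T U" "s \<in> F U"
  shows "\<rho> U U s = s"
  using conjunct1[OF conjunct2[OF assms(1)[unfolded functorial_def]], rule_format, of U s] assms(2,3)
  by simp

lemma functorial_comp:
  assumes "functorial T F \<rho>" "openin T U" "openin T V" "openin T W" "W \<subseteq> V" "V \<subseteq> U" "s \<in> F U"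
  shows "\<rho> V W (\<rho> U V s) = \<rho> U W s"
  using conjunct2[OF conjunct2[OF assms(1)[unfolded functorial_def]], rule_format, of U V W s] assms(2-7)
  by simp

lemma germ_eqI:
  assumes fn: "functorial T F \<rho>" and U: "openin T U" "s \<in> F U" and V: "openin T V" "t \<in> F V"
    and W: "openin T W" "x \<in> W" "W \<subseteq> U \<inter> V" "\<rho> U W s = \<rho> V W t"
  shows "germ T F \<rho> x U s = germ T F \<rho> x V t"
proof -
  note comp = functorial_comp[OF fn]
  have le: "germ T F \<rho> x U s \<subseteq> germ T F \<rho> x V t"
    if U: "openin T U" "s \<in> F U" and V: "openin T V" "t \<in> F V"
      and W: "W \<subseteq> U \<inter> V" "\<rho> U W s = \<rho> V W t" for U V s t
  proof
    fix k assume "k \<in> germ T F \<rho> x U s"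
    then obtain Y r Z where Y: "k = (Y, r)" "openin T Y" "x \<in> Y" "r \<in> F Y"
      and Z: "openin T Z" "x \<in> Z" "Z \<subseteq> U \<inter> Y" "\<rho> U Z s = \<rho> Y Z r"
      unfolding germ_def by blast
    have o: "openin T (W \<inter> Z)" using \<open>openin T W\<close> Z by blast
    have "\<rho> V (W \<inter> Z) t = \<rho> W (W \<inter> Z) (\<rho> V W t)"
      using comp[OF V(1) \<open>openin T W\<close> o _ _ V(2)] W by auto
    also have "\<dots> = \<rho> U (W \<inter> Z) s"
      using comp[OF U(1) \<open>openin T W\<close> o _ _ U(2)] W by auto
    also have "\<dots> = \<rho> Z (W \<inter> Z) (\<rho> U Z s)"
      using comp[OF U(1) Z(1) o _ _ U(2)] Z by auto
    also have "\<dots> = \<rho> Y (W \<inter> Z) r"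
      using comp[OF Y(2) Z(1) o _ _ Y(4)] Z by auto
    finally show "k \<in> germ T F \<rho> x V t"
      unfolding germ_def using Y o Z W \<open>x \<in> W\<close> by blast
  qed
  show ?thesis using le[OF U V W(3,4)] le[OF V U _ W(4)[symmetric]] W(3) by blast
qed

lemma germ_self:
  assumes "functorial T F \<rho>" "openin T U" "s \<in> F U" "x \<in> U"
  shows "(U, s) \<in> germ T F \<rho> x U s"
  using assms unfolding germ_def by blast

lemma germ_eqD:
  assumes "functorial T F \<rho>" "openin T V" "t \<in> F V" "x \<in> V" "germ T F \<rho> x U s = germ T F \<rho> x V t"
  obtains W where "openin T W" "x \<in> W" "W \<subseteq> U \<inter> V" "\<rho> U W s = \<rho> V W t"
proof -
  have "(V, t) \<in> germ T F \<rho> x U s" using germ_self[OF assms(1-4)] by (simp only: assms(5))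
  then show thesis using that by (auto simp: germ_def)
qed

section \<open>Sections of the structure sheaf\<close>

lemma rs_cring: "is_ringed_space S \<Longrightarrow> openin (top_of S) U \<Longrightarrow> cring (O_sec S U)"
  unfolding is_ringed_space_def by blast

lemma rs_hom: "is_ringed_space S \<Longrightarrow> openin (top_of S) U \<Longrightarrow> openin (top_of S) V \<Longrightarrow> V \<subseteq> U \<Longrightarrow>
    O_res S U V \<in> ring_hom (O_sec S U) (O_sec S V)"
  unfolding is_ringed_space_def by blast

lemma rs_functorial: "is_ringed_space S \<Longrightarrow> functorial (top_of S) (\<lambda>U. carrier (O_sec S U)) (O_res S)"
  unfolding is_ringed_space_def by blast

lemma rs_res: "is_ringed_space S \<Longrightarrow> openin (top_of S) U \<Longrightarrow> openin (top_of S) V \<Longrightarrow> V \<subseteq> U \<Longrightarrow>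
    r \<in> carrier (O_sec S U) \<Longrightarrow> O_res S U V r \<in> carrier (O_sec S V)"
  using ring_hom_closed[OF rs_hom] .

lemma rs_comp: "is_ringed_space S \<Longrightarrow> openin (top_of S) U \<Longrightarrow> openin (top_of S) V \<Longrightarrow> openin (top_of S) W \<Longrightarrow>
    W \<subseteq> V \<Longrightarrow> V \<subseteq> U \<Longrightarrow> r \<in> carrier (O_sec S U) \<Longrightarrow> O_res S V W (O_res S U V r) = O_res S U W r"
  using functorial_comp[OF rs_functorial] .

lemma rs_id: "is_ringed_space S \<Longrightarrow> openin (top_of S) U \<Longrightarrow> r \<in> carrier (O_sec S U) \<Longrightarrow> O_res S U U r = r"
  using functorial_id[OF rs_functorial] .

lemma rs_zero: "is_ringed_space S \<Longrightarrow> openin (top_of S) U \<Longrightarrow> openin (top_of S) V \<Longrightarrow> V \<subseteq> U \<Longrightarrow>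
    O_res S U V \<zero>\<^bsub>O_sec S U\<^esub> = \<zero>\<^bsub>O_sec S V\<^esub>"
  using ring_hom_zero[OF rs_hom] rs_cring cring.axioms(1) by blast

text \<open>Separatedness is contained in the uniqueness half of \<open>glues\<close>. The cover
  consists of all open sets on which \<open>s\<close> and \<open>t\<close> agree; both glue the same
  family over it.\<close>

lemma rs_separated:
  assumes S: "is_ringed_space S" and U: "openin (top_of S) U"
    and st: "s \<in> carrier (O_sec S U)" "t \<in> carrier (O_sec S U)"
    and loc: "\<And>x. x \<in> U \<Longrightarrow> \<exists>V. openin (top_of S) V \<and> V \<subseteq> U \<and> x \<in> V \<and> O_res S U V s = O_res S U V t"
  shows "s = t"
proof -
  let ?F = "\<lambda>U. carrier (O_sec S U)"
  define \<U> where "\<U> = {V. openin (top_of S) V \<and> V \<subseteq> U \<and> O_res S U V s = O_res S U V t}"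
  have Un: "\<Union>\<U> = U" using loc unfolding \<U>_def by blast
  have gl: "glues (top_of S) ?F (O_res S)" using S unfolding is_ringed_space_def by blast
  have c: "O_res S V (V \<inter> W) (O_res S U V s) = O_res S U (V \<inter> W) s" if "V \<in> \<U>" "W \<in> \<U>" for V W
    using that by (intro rs_comp[OF S U _ _ _ _ st(1)]) (auto simp: \<U>_def)
  have c': "O_res S W (V \<inter> W) (O_res S U W s) = O_res S U (V \<inter> W) s" if "V \<in> \<U>" "W \<in> \<U>" for V W
    using that by (intro rs_comp[OF S U _ _ _ _ st(1)]) (auto simp: \<U>_def)
  have "\<exists>!r. r \<in> ?F (\<Union>\<U>) \<and> (\<forall>V\<in>\<U>. O_res S (\<Union>\<U>) V r = O_res S U V s)"
  proof (rule gl[unfolded glues_def, rule_format, of \<U> "\<lambda>V. O_res S U V s"], intro conjI ballI)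
    fix V assume V: "V \<in> \<U>"
    then show "openin (top_of S) V" by (simp add: \<U>_def)
    from V have "V \<subseteq> U" by (simp add: \<U>_def)
    show "O_res S U V s \<in> carrier (O_sec S V)"
      by (rule rs_res[OF S U \<open>openin (top_of S) V\<close> \<open>V \<subseteq> U\<close> st(1)])
    fix W assume W: "W \<in> \<U>"
    show "O_res S V (V \<inter> W) (O_res S U V s) = O_res S W (V \<inter> W) (O_res S U W s)"
      by (simp only: c[OF V W] c'[OF V W])
  qed
  moreover have "\<forall>V\<in>\<U>. O_res S U V t = O_res S U V s" by (auto simp: \<U>_def)
  ultimately show ?thesis using st unfolding Un by blast
qed

text \<open>If one and zero agreed over a neighbourhood of \<open>x\<close>, their germs would
  agree, and the stalk would be the zero ring, which has no maximal ideal. This provides the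
  hypothesis \<open>\<one> \<noteq> \<zero>\<close> whenever linear algebra is done over a
  neighbourhood of a point.\<close>

lemma nontrivial_sections:
  assumes L: "locally_ringed_space S" and U: "openin (top_of S) U" "x \<in> U"
  shows "\<one>\<^bsub>O_sec S U\<^esub> \<noteq> \<zero>\<^bsub>O_sec S U\<^esub>"
proof
  assume eq: "\<one>\<^bsub>O_sec S U\<^esub> = \<zero>\<^bsub>O_sec S U\<^esub>"
  have S: "is_ringed_space S" using L by (simp add: locally_ringed_space_def)
  have UX: "U \<subseteq> points S" using openin_subset[OF U(1)] .
  have loc: "local_ring (O_stalk S x)" using L U UX by (auto simp: locally_ringed_space_def)
  then interpret K: cring "O_stalk S x" by (simp add: local_ring_def)
  interpret X: cring "O_sec S (points S)" using rs_cring[OF S openin_topspace] .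
  have h: "O_res S (points S) U \<in> ring_hom (O_sec S (points S)) (O_sec S U)"
    using rs_hom[OF S openin_topspace U(1) UX] .
  have "O_res S (points S) U \<one>\<^bsub>O_sec S (points S)\<^esub> = O_res S (points S) U \<zero>\<^bsub>O_sec S (points S)\<^esub>"
    unfolding ring_hom_one[OF h] rs_zero[OF S openin_topspace U(1) UX] by (rule eq)
  then have "O_germ S x (points S) \<one>\<^bsub>O_sec S (points S)\<^esub> = O_germ S x (points S) \<zero>\<^bsub>O_sec S (points S)\<^esub>"
    using U UX by (intro germ_eqI[OF rs_functorial[OF S], where W=U]) simp_all
  then have "\<one>\<^bsub>O_stalk S x\<^esub> = \<zero>\<^bsub>O_stalk S x\<^esub>" by (simp add: O_stalk_def)
  then have carr: "carrier (O_stalk S x) = {\<zero>\<^bsub>O_stalk S x\<^esub>}" using K.carrier_one_zero by blast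
  obtain I where I: "maximalideal I (O_stalk S x)" using loc by (auto simp: local_ring_def)
  then have "ideal I (O_stalk S x)" by (simp add: maximalideal_def)
  from ideal.axioms(1)[OF this] have "I \<subseteq> carrier (O_stalk S x)" "\<zero>\<^bsub>O_stalk S x\<^esub> \<in> I"
    by (rule additive_subgroup.a_subset, rule additive_subgroup.zero_closed)
  then have "I = carrier (O_stalk S x)" unfolding carr by (intro equalityI) simp_all
  then show False using maximalideal.I_notcarr[OF I] by simp
qed

section \<open>Presheaves of modules and their restriction maps\<close>

lemma psh_module: "presheaf_of_modules S F \<Longrightarrow> openin (top_of S) U \<Longrightarrow> module (O_sec S U) (sec F U)"
  by (simp add: presheaf_of_modules_def)

lemma psh_functorial: "presheaf_of_modules S F \<Longrightarrow> functorial (top_of S) (\<lambda>U. carrier (sec F U)) (res F)"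
  by (simp add: presheaf_of_modules_def)

lemma psh_res: "presheaf_of_modules S F \<Longrightarrow> openin (top_of S) U \<Longrightarrow> openin (top_of S) V \<Longrightarrow> V \<subseteq> U \<Longrightarrow>
    z \<in> carrier (sec F U) \<Longrightarrow> res F U V z \<in> carrier (sec F V)"
  using functorial_res[OF psh_functorial] .

lemma psh_comp: "presheaf_of_modules S F \<Longrightarrow> openin (top_of S) U \<Longrightarrow> openin (top_of S) V \<Longrightarrow> openin (top_of S) W \<Longrightarrow>
    W \<subseteq> V \<Longrightarrow> V \<subseteq> U \<Longrightarrow> z \<in> carrier (sec F U) \<Longrightarrow> res F V W (res F U V z) = res F U W z"
  using functorial_comp[OF psh_functorial] .

lemma psh_id: "presheaf_of_modules S F \<Longrightarrow> openin (top_of S) U \<Longrightarrow> z \<in> carrier (sec F U) \<Longrightarrow> res F U U z = z"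
  using functorial_id[OF psh_functorial] .

lemma psh_add: "presheaf_of_modules S F \<Longrightarrow> openin (top_of S) U \<Longrightarrow> openin (top_of S) V \<Longrightarrow> V \<subseteq> U \<Longrightarrow>
    y \<in> carrier (sec F U) \<Longrightarrow> z \<in> carrier (sec F U) \<Longrightarrow>
    res F U V (y \<oplus>\<^bsub>sec F U\<^esub> z) = res F U V y \<oplus>\<^bsub>sec F V\<^esub> res F U V z"
  by (simp add: presheaf_of_modules_def)

lemma psh_smult: "presheaf_of_modules S F \<Longrightarrow> openin (top_of S) U \<Longrightarrow> openin (top_of S) V \<Longrightarrow> V \<subseteq> U \<Longrightarrow>
    r \<in> carrier (O_sec S U) \<Longrightarrow> z \<in> carrier (sec F U) \<Longrightarrow>
    res F U V (r \<odot>\<^bsub>sec F U\<^esub> z) = O_res S U V r \<odot>\<^bsub>sec F V\<^esub> res F U V z"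
  by (simp add: presheaf_of_modules_def)

text \<open>Additivity suffices because groups cancel. The same form serves restriction maps, the
  action in either variable, and functionals.\<close>

lemma additive_zero:
  assumes "abelian_group G" "abelian_group H" "f \<in> carrier G \<rightarrow> carrier H"
    "\<And>u v. u \<in> carrier G \<Longrightarrow> v \<in> carrier G \<Longrightarrow> f (u \<oplus>\<^bsub>G\<^esub> v) = f u \<oplus>\<^bsub>H\<^esub> f v"
  shows "f \<zero>\<^bsub>G\<^esub> = \<zero>\<^bsub>H\<^esub>"
proof -
  interpret G: abelian_group G by fact
  interpret H: abelian_group H by fact
  have c: "f \<zero>\<^bsub>G\<^esub> \<in> carrier H" using assms(3) by auto
  have "f \<zero>\<^bsub>G\<^esub> \<oplus>\<^bsub>H\<^esub> f \<zero>\<^bsub>G\<^esub> = f \<zero>\<^bsub>G\<^esub>"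
    using assms(4)[OF G.zero_closed G.zero_closed] by simp
  then show ?thesis using H.add.l_cancel_one[OF c c] by simp
qed

lemma additive_minus:
  assumes "abelian_group G" "abelian_group H" "f \<in> carrier G \<rightarrow> carrier H"
    "\<And>u v. u \<in> carrier G \<Longrightarrow> v \<in> carrier G \<Longrightarrow> f (u \<oplus>\<^bsub>G\<^esub> v) = f u \<oplus>\<^bsub>H\<^esub> f v" "u \<in> carrier G"
  shows "f (\<ominus>\<^bsub>G\<^esub> u) = \<ominus>\<^bsub>H\<^esub> f u"
proof -
  interpret G: abelian_group G by fact
  interpret H: abelian_group H by fact
  have "f (\<ominus>\<^bsub>G\<^esub> u) \<oplus>\<^bsub>H\<^esub> f u = \<zero>\<^bsub>H\<^esub>"
    using assms(4)[OF G.a_inv_closed[OF assms(5)] assms(5)] additive_zero[OF assms(1-4)] assms(5)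
    by (simp add: G.l_neg)
  then show ?thesis using H.minus_equality[of "f (\<ominus>\<^bsub>G\<^esub> u)" "f u"] assms(3,5) by (auto simp: Pi_iff)
qed

lemma mod_ag: "module R M \<Longrightarrow> abelian_group M"
  unfolding module_def by blast

lemma mod_am: "module R M \<Longrightarrow> abelian_monoid M"
  unfolding module_def abelian_group_def by blast

lemma psh_zero:
  assumes P: "presheaf_of_modules S F" and U: "openin (top_of S) U" and V: "openin (top_of S) V" "V \<subseteq> U"
  shows "res F U V \<zero>\<^bsub>sec F U\<^esub> = \<zero>\<^bsub>sec F V\<^esub>"
  by (rule additive_zero[OF mod_ag[OF psh_module[OF P U]] mod_ag[OF psh_module[OF P V(1)]]])
    (use psh_res[OF P U V] psh_add[OF P U V] in simp_all)

lemma psh_minus: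
  assumes P: "presheaf_of_modules S F" and U: "openin (top_of S) U" and V: "openin (top_of S) V" "V \<subseteq> U"
    and z: "z \<in> carrier (sec F U)"
  shows "res F U V (\<ominus>\<^bsub>sec F U\<^esub> z) = \<ominus>\<^bsub>sec F V\<^esub> res F U V z"
  by (rule additive_minus[OF mod_ag[OF psh_module[OF P U]] mod_ag[OF psh_module[OF P V(1)]]])
    (use psh_res[OF P U V] psh_add[OF P U V] z in simp_all)

lemma psh_lincomb:
  assumes P: "presheaf_of_modules S F" and S: "is_ringed_space S"
    and U: "openin (top_of S) U" and V: "openin (top_of S) V" "V \<subseteq> U"
    and c: "c \<in> J \<rightarrow> carrier (O_sec S U)" "e \<in> J \<rightarrow> carrier (sec F U)"
  shows "res F U V (\<Oplus>\<^bsub>sec F U\<^esub>j\<in>J. c j \<odot>\<^bsub>sec F U\<^esub> e j) =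
    (\<Oplus>\<^bsub>sec F V\<^esub>j\<in>J. O_res S U V (c j) \<odot>\<^bsub>sec F V\<^esub> res F U V (e j))"
proof -
  interpret MU: module "O_sec S U" "sec F U" using psh_module[OF P U] .
  interpret MV: module "O_sec S V" "sec F V" using psh_module[OF P V(1)] .
  have "res F U V (\<Oplus>\<^bsub>sec F U\<^esub>j\<in>J. c j \<odot>\<^bsub>sec F U\<^esub> e j) =
    (\<Oplus>\<^bsub>sec F V\<^esub>j\<in>J. res F U V (c j \<odot>\<^bsub>sec F U\<^esub> e j))"
    using c psh_res[OF P U V] psh_add[OF P U V]
    by (intro MU.hom_finsum_to[OF MV.abelian_monoid_axioms] psh_zero[OF P U V]) (simp_all add: Pi_iff)
  also have "\<dots> = (\<Oplus>\<^bsub>sec F V\<^esub>j\<in>J. O_res S U V (c j) \<odot>\<^bsub>sec F V\<^esub> res F U V (e j))"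
    using c psh_res[OF P U V] psh_smult[OF P U V] rs_res[OF S U V]
    by (intro MV.finsum_cong' refl) (simp_all add: Pi_iff)
  finally show ?thesis .
qed

section \<open>Local bases and the uniqueness of the rank\<close>

lemma basis_on_iff:
  assumes P: "presheaf_of_modules S F" and U: "openin (top_of S) U"
  shows "basis_on S F U es \<longleftrightarrow> set es \<subseteq> carrier (sec F U) \<and>
    (\<forall>V\<in>opens S U. indep (O_sec S V) (sec F V) {..<length es} (\<lambda>i. res F U V (es ! i)) \<and>
      (\<forall>z\<in>carrier (sec F V). in_span (O_sec S V) (sec F V) {..<length es} (\<lambda>i. res F U V (es ! i)) z))"
  unfolding basis_on_def
proof (rule conj_cong[OF refl], rule ball_cong[OF refl])
  fix V assume es: "set es \<subseteq> carrier (sec F U)" and "V \<in> opens S U"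
  then have V: "openin (top_of S) V" "V \<subseteq> U" by simp_all
  have "(\<lambda>i. res F U V (es ! i)) \<in> {..<length es} \<rightarrow> carrier (sec F V)"
    using es psh_res[OF P U V] by (auto simp: subset_eq)
  then show "(\<forall>z\<in>carrier (sec F V). \<exists>!c. c \<in> {..<length es} \<rightarrow>\<^sub>E carrier (O_sec S V) \<and>
        z = (\<Oplus>\<^bsub>sec F V\<^esub>i\<in>{..<length es}. c i \<odot>\<^bsub>sec F V\<^esub> res F U V (es ! i))) =
    (indep (O_sec S V) (sec F V) {..<length es} (\<lambda>i. res F U V (es ! i)) \<and>
      (\<forall>z\<in>carrier (sec F V). in_span (O_sec S V) (sec F V) {..<length es} (\<lambda>i. res F U V (es ! i)) z))"
    by (intro module.unique_coefficients_iff[OF psh_module[OF P V(1)]]) simp_all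
qed

text \<open>\<open>basis_on\<close> speaks of lists, while the bases constructed for duals and
  direct sums come with their own index sets. An enumeration of the index set carries one to the
  other.\<close>

lemma basis_on_family:
  assumes P: "presheaf_of_modules S F" and U: "openin (top_of S) U" and I: "finite I"
    and e: "e \<in> I \<rightarrow> carrier (sec F U)"
    and b: "\<And>V. openin (top_of S) V \<Longrightarrow> V \<subseteq> U \<Longrightarrow> indep (O_sec S V) (sec F V) I (\<lambda>i. res F U V (e i))"
      "\<And>V z. openin (top_of S) V \<Longrightarrow> V \<subseteq> U \<Longrightarrow> z \<in> carrier (sec F V) \<Longrightarrow>
        in_span (O_sec S V) (sec F V) I (\<lambda>i. res F U V (e i)) z"
  obtains es where "basis_on S F U es" "length es = card I"
proof -
  obtain f where f: "bij_betw f {..<card I} I"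
    using ex_bij_betw_nat_finite[OF I] by (auto simp: lessThan_atLeast0)
  define es where "es = map (\<lambda>i. e (f i)) [0..<card I]"
  have len: "length es = card I" by (simp add: es_def)
  have nth: "es ! i = e (f i)" if "i < card I" for i using that by (simp add: es_def)
  \<comment> \<open>The list agrees with the enumerated family only at positions below
    \<open>card I\<close>, so the two predicates are compared through congruence of sums over that
    range.\<close>
  have cong: "indep R M {..<card I} (\<lambda>i. res F U V (es ! i)) = indep R M {..<card I} (\<lambda>i. res F U V (e (f i)))"
    "in_span R M {..<card I} (\<lambda>i. res F U V (es ! i)) z = in_span R M {..<card I} (\<lambda>i. res F U V (e (f i))) z"
    if "module R M" "\<And>i. i \<in> I \<Longrightarrow> res F U V (e i) \<in> carrier M" for R M V z
  proof -
    interpret module R M by fact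
    have "(\<Oplus>\<^bsub>M\<^esub>i\<in>{..<card I}. c i \<odot>\<^bsub>M\<^esub> res F U V (es ! i)) = (\<Oplus>\<^bsub>M\<^esub>i\<in>{..<card I}. c i \<odot>\<^bsub>M\<^esub> res F U V (e (f i)))"
      if "c \<in> {..<card I} \<rightarrow> carrier R" for c
      using that bij_betwE[OF f] \<open>\<And>i. i \<in> I \<Longrightarrow> res F U V (e i) \<in> carrier M\<close>
      by (intro M.finsum_cong' refl) (simp_all add: nth Pi_iff)
    then show "indep R M {..<card I} (\<lambda>i. res F U V (es ! i)) = indep R M {..<card I} (\<lambda>i. res F U V (e (f i)))"
      "in_span R M {..<card I} (\<lambda>i. res F U V (es ! i)) z = in_span R M {..<card I} (\<lambda>i. res F U V (e (f i))) z"
      by (simp_all add: indep_def in_span_def)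
  qed
  have "basis_on S F U es" unfolding basis_on_iff[OF P U] len
  proof (intro conjI ballI)
    show "set es \<subseteq> carrier (sec F U)" using e bij_betwE[OF f] by (auto simp: es_def)
    fix V assume "V \<in> opens S U"
    then have V: "openin (top_of S) V" "V \<subseteq> U" by simp_all
    interpret module "O_sec S V" "sec F V" using psh_module[OF P V(1)] .
    have r: "\<And>i. i \<in> I \<Longrightarrow> res F U V (e i) \<in> carrier (sec F V)" using e psh_res[OF P U V] by auto
    then have r': "(\<lambda>i. res F U V (e i)) \<in> I \<rightarrow> carrier (sec F V)" by auto
    show "indep (O_sec S V) (sec F V) {..<card I} (\<lambda>i. res F U V (es ! i))"
      using indep_reindex[OF f r' b(1)[OF V]] cong(1)[OF module_axioms r] by simp
    show "in_span (O_sec S V) (sec F V) {..<card I} (\<lambda>i. res F U V (es ! i)) z" if "z \<in> carrier (sec F V)" for z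
      using in_span_reindex[OF f r' b(2)[OF V that]] cong(2)[OF module_axioms r] by simp
  qed
  then show thesis using len that by blast
qed

text \<open>On the intersection of the two open sets each list is independent and the other one
  spans; the bound by spanning families is applied in both directions over a nonzero ring.\<close>

lemma basis_length_unique:
  assumes L: "locally_ringed_space S" and P: "presheaf_of_modules S F"
    and U: "openin (top_of S) U" "basis_on S F U es" and V: "openin (top_of S) V" "basis_on S F V fs"
    and x: "x \<in> U" "x \<in> V"
  shows "length es = length fs"
proof -
  define W where "W = U \<inter> V"
  have W: "openin (top_of S) W" "W \<subseteq> U" "W \<subseteq> V" "x \<in> W" using U V x by (auto simp: W_def)
  interpret module "O_sec S W" "sec F W" using psh_module[OF P W(1)] .
  have nt: "\<one>\<^bsub>O_sec S W\<^esub> \<noteq> \<zero>\<^bsub>O_sec S W\<^esub>" using nontrivial_sections[OF L W(1,4)] .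
  have e: "(\<lambda>i. res F U W (es ! i)) \<in> {..<length es} \<rightarrow> carrier (sec F W)"
    using psh_res[OF P U(1) W(1,2)] U(2) unfolding basis_on_def by (auto simp: subset_eq)
  have f: "(\<lambda>i. res F V W (fs ! i)) \<in> {..<length fs} \<rightarrow> carrier (sec F W)"
    using psh_res[OF P V(1) W(1,3)] V(2) unfolding basis_on_def by (auto simp: subset_eq)
  have be: "indep (O_sec S W) (sec F W) {..<length es} (\<lambda>i. res F U W (es ! i))"
    "\<And>z. z \<in> carrier (sec F W) \<Longrightarrow> in_span (O_sec S W) (sec F W) {..<length es} (\<lambda>i. res F U W (es ! i)) z"
    using U(2) W unfolding basis_on_iff[OF P U(1)] by simp_all
  have bf: "indep (O_sec S W) (sec F W) {..<length fs} (\<lambda>i. res F V W (fs ! i))"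
    "\<And>z. z \<in> carrier (sec F W) \<Longrightarrow> in_span (O_sec S W) (sec F W) {..<length fs} (\<lambda>i. res F V W (fs ! i)) z"
    using V(2) W unfolding basis_on_iff[OF P V(1)] by simp_all
  have "card {..<length es} \<le> card {..<length fs}"
    using indep_le_span[OF nt _ _ e be(1) f] bf(2) e by (auto simp: Pi_iff)
  moreover have "card {..<length fs} \<le> card {..<length es}"
    using indep_le_span[OF nt _ _ f bf(1) e] be(2) f by (auto simp: Pi_iff)
  ultimately show ?thesis by simp
qed

text \<open>\<open>sheaf_rank\<close> is a definite description, so uniqueness has to be shown. It
  is read off at a point; on an empty space every integer would be a rank.\<close>

lemma sheaf_rank_eqI:
  assumes "locally_ringed_space S" "presheaf_of_modules S F" "points S \<noteq> {}" "locally_free_of_rank S F n"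
  shows "sheaf_rank S F = n"
  unfolding sheaf_rank_def
proof (rule the_equality)
  show "locally_free_of_rank S F n" by fact
  fix k assume k: "locally_free_of_rank S F k"
  obtain x where x: "x \<in> points S" using assms(3) by blast
  obtain U es where U: "openin (top_of S) U" "x \<in> U" "basis_on S F U es" "int (length es) = n"
    using assms(4) x unfolding locally_free_of_rank_def by blast
  obtain V fs where V: "openin (top_of S) V" "x \<in> V" "basis_on S F V fs" "int (length fs) = k"
    using k x unfolding locally_free_of_rank_def by blast
  show "k = n" using basis_length_unique[OF assms(1,2) U(1,3) V(1,3) U(2) V(2)] U V by simp
qed

section \<open>The dual sheaf\<close>

text \<open>Reduces membership in the dual to four laws for an unrestricted \<open>f\<close>. The
  restricted function agrees with \<open>f\<close> only on carriers, so these must be known to be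
  closed under sums, scalars and restriction; this is where \<open>presheaf_of_modules S F\<close>
  enters.\<close>

lemma dual_sheaf_carrierI:
  assumes "\<And>V z. openin (top_of S) V \<Longrightarrow> V \<subseteq> U \<Longrightarrow> z \<in> carrier (sec F V) \<Longrightarrow> f V z \<in> carrier (O_sec S V)"
    "\<And>V y z. openin (top_of S) V \<Longrightarrow> V \<subseteq> U \<Longrightarrow> y \<in> carrier (sec F V) \<Longrightarrow> z \<in> carrier (sec F V) \<Longrightarrow>
      f V (y \<oplus>\<^bsub>sec F V\<^esub> z) = f V y \<oplus>\<^bsub>O_sec S V\<^esub> f V z"
    "\<And>V r z. openin (top_of S) V \<Longrightarrow> V \<subseteq> U \<Longrightarrow> r \<in> carrier (O_sec S V) \<Longrightarrow> z \<in> carrier (sec F V) \<Longrightarrow>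
      f V (r \<odot>\<^bsub>sec F V\<^esub> z) = r \<otimes>\<^bsub>O_sec S V\<^esub> f V z"
    "\<And>V W z. openin (top_of S) V \<Longrightarrow> V \<subseteq> U \<Longrightarrow> openin (top_of S) W \<Longrightarrow> W \<subseteq> V \<Longrightarrow> z \<in> carrier (sec F V) \<Longrightarrow>
      f W (res F V W z) = O_res S V W (f V z)"
    and P: "presheaf_of_modules S F"
  shows "(\<lambda>V\<in>opens S U. \<lambda>z\<in>carrier (sec F V). f V z) \<in> carrier (sec (dual_sheaf S F) U)"
proof -
  have c: "y \<oplus>\<^bsub>sec F V\<^esub> z \<in> carrier (sec F V)" "r \<odot>\<^bsub>sec F V\<^esub> y \<in> carrier (sec F V)"
    if "openin (top_of S) V" "y \<in> carrier (sec F V)" "z \<in> carrier (sec F V)" "r \<in> carrier (O_sec S V)" for V y z r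
  proof -
    interpret module "O_sec S V" "sec F V" using psh_module[OF P that(1)] .
    show "y \<oplus>\<^bsub>sec F V\<^esub> z \<in> carrier (sec F V)" "r \<odot>\<^bsub>sec F V\<^esub> y \<in> carrier (sec F V)" using that by simp_all
  qed
  have c1: "y \<oplus>\<^bsub>sec F V\<^esub> z \<in> carrier (sec F V)"
    if "openin (top_of S) V" "y \<in> carrier (sec F V)" "z \<in> carrier (sec F V)" for V y z
  proof -
    interpret module "O_sec S V" "sec F V" using psh_module[OF P that(1)] .
    show ?thesis using that by simp
  qed
  show ?thesis
    using assms(1-4) c c1 psh_res[OF P]
    by (auto simp add: dual_sheaf_def mod_hom_def O_mod_def ring.defs module.defs Pi_iff)
qed

lemma
  assumes "\<phi> \<in> carrier (sec (dual_sheaf S F) U)" "openin (top_of S) V" "V \<subseteq> U"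
  shows dual_closed: "z \<in> carrier (sec F V) \<Longrightarrow> \<phi> V z \<in> carrier (O_sec S V)"
    and dual_add: "y \<in> carrier (sec F V) \<Longrightarrow> z \<in> carrier (sec F V) \<Longrightarrow>
      \<phi> V (y \<oplus>\<^bsub>sec F V\<^esub> z) = \<phi> V y \<oplus>\<^bsub>O_sec S V\<^esub> \<phi> V z"
    and dual_smult: "r \<in> carrier (O_sec S V) \<Longrightarrow> z \<in> carrier (sec F V) \<Longrightarrow>
      \<phi> V (r \<odot>\<^bsub>sec F V\<^esub> z) = r \<otimes>\<^bsub>O_sec S V\<^esub> \<phi> V z"
    and dual_res: "openin (top_of S) W \<Longrightarrow> W \<subseteq> V \<Longrightarrow> z \<in> carrier (sec F V) \<Longrightarrow>
      \<phi> W (res F V W z) = O_res S V W (\<phi> V z)"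
proof -
  have V: "V \<in> opens S U" using assms by simp
  have "\<phi> \<in> (\<Pi>\<^sub>E V\<in>opens S U. mod_hom (O_sec S V) (sec F V) (O_mod S V) \<inter> extensional (carrier (sec F V)))"
    and r: "\<forall>V\<in>opens S U. \<forall>W\<in>opens S V. \<forall>z\<in>carrier (sec F V). \<phi> W (res F V W z) = O_res S V W (\<phi> V z)"
    using assms(1) by (simp_all add: dual_sheaf_def)
  then have h: "\<phi> V \<in> mod_hom (O_sec S V) (sec F V) (O_mod S V)" using V by (auto dest: PiE_mem)
  show "z \<in> carrier (sec F V) \<Longrightarrow> \<phi> V z \<in> carrier (O_sec S V)"
    "y \<in> carrier (sec F V) \<Longrightarrow> z \<in> carrier (sec F V) \<Longrightarrow>
      \<phi> V (y \<oplus>\<^bsub>sec F V\<^esub> z) = \<phi> V y \<oplus>\<^bsub>O_sec S V\<^esub> \<phi> V z"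
    "r \<in> carrier (O_sec S V) \<Longrightarrow> z \<in> carrier (sec F V) \<Longrightarrow>
      \<phi> V (r \<odot>\<^bsub>sec F V\<^esub> z) = r \<otimes>\<^bsub>O_sec S V\<^esub> \<phi> V z"
    using h by (simp_all add: mod_hom_def O_mod_def ring.defs module.defs Pi_iff)
  show "openin (top_of S) W \<Longrightarrow> W \<subseteq> V \<Longrightarrow> z \<in> carrier (sec F V) \<Longrightarrow>
      \<phi> W (res F V W z) = O_res S V W (\<phi> V z)"
    using r V by simp
qed

text \<open>Sections of the dual are extensional twice over, as families over open sets and as
  functions on each carrier, so agreement on actual sections settles equality.\<close>

lemma dual_eqI:
  assumes "\<phi> \<in> carrier (sec (dual_sheaf S F) U)" "\<psi> \<in> carrier (sec (dual_sheaf S F) U)"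
    "\<And>V z. openin (top_of S) V \<Longrightarrow> V \<subseteq> U \<Longrightarrow> z \<in> carrier (sec F V) \<Longrightarrow> \<phi> V z = \<psi> V z"
  shows "\<phi> = \<psi>"
proof (rule PiE_ext)
  show \<phi>: "\<phi> \<in> (\<Pi>\<^sub>E V\<in>opens S U. mod_hom (O_sec S V) (sec F V) (O_mod S V) \<inter> extensional (carrier (sec F V)))"
    and \<psi>: "\<psi> \<in> (\<Pi>\<^sub>E V\<in>opens S U. mod_hom (O_sec S V) (sec F V) (O_mod S V) \<inter> extensional (carrier (sec F V)))"
    using assms(1,2) by (simp_all add: dual_sheaf_def)
  fix V assume V: "V \<in> opens S U"
  show "\<phi> V = \<psi> V"
    by (rule extensionalityI[of _ "carrier (sec F V)"])
      (use PiE_mem[OF \<phi> V] PiE_mem[OF \<psi> V] V assms(3) in simp_all)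
qed

lemma
  assumes "openin (top_of S) V" "V \<subseteq> U" "z \<in> carrier (sec F V)"
  shows dual_eval_add: "(\<phi> \<oplus>\<^bsub>sec (dual_sheaf S F) U\<^esub> \<psi>) V z = \<phi> V z \<oplus>\<^bsub>O_sec S V\<^esub> \<psi> V z"
    and dual_eval_zero: "\<zero>\<^bsub>sec (dual_sheaf S F) U\<^esub> V z = \<zero>\<^bsub>O_sec S V\<^esub>"
    and dual_eval_smult: "(r \<odot>\<^bsub>sec (dual_sheaf S F) U\<^esub> \<phi>) V z = O_res S U V r \<otimes>\<^bsub>O_sec S V\<^esub> \<phi> V z"
    and dual_eval_res: "W \<subseteq> U \<Longrightarrow> V \<subseteq> W \<Longrightarrow> res (dual_sheaf S F) U W \<phi> V z = \<phi> V z"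
  using assms by (simp_all add: dual_sheaf_def)

lemma dual_ops_closed:
  assumes P: "presheaf_of_modules S F" and S: "is_ringed_space S" and U: "openin (top_of S) U"
  shows "\<zero>\<^bsub>sec (dual_sheaf S F) U\<^esub> \<in> carrier (sec (dual_sheaf S F) U)"
    and "\<phi> \<in> carrier (sec (dual_sheaf S F) U) \<Longrightarrow> \<psi> \<in> carrier (sec (dual_sheaf S F) U) \<Longrightarrow>
      \<phi> \<oplus>\<^bsub>sec (dual_sheaf S F) U\<^esub> \<psi> \<in> carrier (sec (dual_sheaf S F) U)"
    and "r \<in> carrier (O_sec S U) \<Longrightarrow> \<phi> \<in> carrier (sec (dual_sheaf S F) U) \<Longrightarrow>
      r \<odot>\<^bsub>sec (dual_sheaf S F) U\<^esub> \<phi> \<in> carrier (sec (dual_sheaf S F) U)"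
    and "openin (top_of S) W \<Longrightarrow> W \<subseteq> U \<Longrightarrow> \<phi> \<in> carrier (sec (dual_sheaf S F) U) \<Longrightarrow>
      res (dual_sheaf S F) U W \<phi> \<in> carrier (sec (dual_sheaf S F) W)"
proof -
  note cr = rs_cring[OF S]
  have z: "\<zero>\<^bsub>sec (dual_sheaf S F) U\<^esub> = (\<lambda>V\<in>opens S U. \<lambda>z\<in>carrier (sec F V). \<zero>\<^bsub>O_sec S V\<^esub>)"
    and a: "\<phi> \<oplus>\<^bsub>sec (dual_sheaf S F) U\<^esub> \<psi> =
      (\<lambda>V\<in>opens S U. \<lambda>z\<in>carrier (sec F V). \<phi> V z \<oplus>\<^bsub>O_sec S V\<^esub> \<psi> V z)"
    and m: "r \<odot>\<^bsub>sec (dual_sheaf S F) U\<^esub> \<phi> =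
      (\<lambda>V\<in>opens S U. \<lambda>z\<in>carrier (sec F V). O_res S U V r \<otimes>\<^bsub>O_sec S V\<^esub> \<phi> V z)"
    by (simp_all add: dual_sheaf_def)
  show "\<zero>\<^bsub>sec (dual_sheaf S F) U\<^esub> \<in> carrier (sec (dual_sheaf S F) U)"
    unfolding z
  proof (rule dual_sheaf_carrierI[OF _ _ _ _ P], goal_cases)
    case (1 V z)
    interpret cring "O_sec S V" using cr 1 by blast
    show ?case by simp
  next
    case (2 V y z)
    interpret cring "O_sec S V" using cr 2 by blast
    show ?case by simp
  next
    case (3 V r z)
    interpret cring "O_sec S V" using cr 3 by blast
    show ?case using 3 by simp
  next
    case (4 V W z)
    then show ?case using rs_zero[OF S 4(1,3,4)] by simp
  qed
  show "\<phi> \<oplus>\<^bsub>sec (dual_sheaf S F) U\<^esub> \<psi> \<in> carrier (sec (dual_sheaf S F) U)"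
    if f: "\<phi> \<in> carrier (sec (dual_sheaf S F) U)" and g: "\<psi> \<in> carrier (sec (dual_sheaf S F) U)"
    unfolding a
  proof (rule dual_sheaf_carrierI[OF _ _ _ _ P], goal_cases)
    case (1 V z)
    interpret cring "O_sec S V" using cr 1 by blast
    show ?case using dual_closed[OF f 1] dual_closed[OF g 1] by simp
  next
    case (2 V y z)
    interpret cring "O_sec S V" using cr 2 by blast
    show ?case using dual_closed[OF f 2(1,2)] dual_closed[OF g 2(1,2)] dual_add[OF f 2] dual_add[OF g 2] 2
      by (simp add: a_ac)
  next
    case (3 V r z)
    interpret cring "O_sec S V" using cr 3 by blast
    show ?case using dual_closed[OF f 3(1,2)] dual_closed[OF g 3(1,2)] dual_smult[OF f 3] dual_smult[OF g 3] 3
      by (simp add: r_distr)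
  next
    case (4 V W z)
    have VW: "W \<subseteq> U" using 4 by blast
    show ?case
      using dual_res[OF f 4] dual_res[OF g 4] ring_hom_add[OF rs_hom[OF S 4(1,3,4)]]
        dual_closed[OF f 4(1,2,5)] dual_closed[OF g 4(1,2,5)] by simp
  qed
  show "r \<odot>\<^bsub>sec (dual_sheaf S F) U\<^esub> \<phi> \<in> carrier (sec (dual_sheaf S F) U)"
    if r: "r \<in> carrier (O_sec S U)" and f: "\<phi> \<in> carrier (sec (dual_sheaf S F) U)"
    unfolding m
  proof (rule dual_sheaf_carrierI[OF _ _ _ _ P], goal_cases)
    case (1 V z)
    interpret cring "O_sec S V" using cr 1 by blast
    show ?case using dual_closed[OF f 1] rs_res[OF S U 1(1,2) r] by simp
  next
    case (2 V y z)
    interpret cring "O_sec S V" using cr 2 by blast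
    show ?case using dual_closed[OF f 2(1,2)] dual_add[OF f 2] rs_res[OF S U 2(1,2) r] 2
      by (simp add: r_distr)
  next
    case (3 V q z)
    interpret cring "O_sec S V" using cr 3 by blast
    show ?case using dual_closed[OF f 3(1,2)] dual_smult[OF f 3] rs_res[OF S U 3(1,2) r] 3
      by (simp add: m_lcomm)
  next
    case (4 V W z)
    show ?case
      using dual_res[OF f 4] ring_hom_mult[OF rs_hom[OF S 4(1,3,4)] rs_res[OF S U 4(1,2) r]]
        dual_closed[OF f 4(1,2,5)] rs_comp[OF S U 4(1,3,4,2) r] by simp
  qed
  show "res (dual_sheaf S F) U W \<phi> \<in> carrier (sec (dual_sheaf S F) W)"
    if W: "openin (top_of S) W" "W \<subseteq> U" and f: "\<phi> \<in> carrier (sec (dual_sheaf S F) U)"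
  proof -
    have "\<phi> \<in> (\<Pi>\<^sub>E V\<in>opens S U. mod_hom (O_sec S V) (sec F V) (O_mod S V) \<inter> extensional (carrier (sec F V)))"
      "\<forall>V\<in>opens S U. \<forall>W\<in>opens S V. \<forall>z\<in>carrier (sec F V). \<phi> W (res F V W z) = O_res S V W (\<phi> V z)"
      using f by (simp_all add: dual_sheaf_def)
    then show ?thesis using W by (auto simp: dual_sheaf_def PiE_iff)
  qed
qed

text \<open>Every law is checked after evaluation at a section, where it becomes a ring law in the
  structure sheaf. A scalar over \<open>U\<close> acts over \<open>V\<close> through its
  restriction, so restriction being a ring homomorphism is used throughout.\<close>

lemma dual_presheaf:
  assumes P: "presheaf_of_modules S F" and S: "is_ringed_space S"
  shows "presheaf_of_modules S (dual_sheaf S F)"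
proof -
  let ?D = "dual_sheaf S F"
  note cl = dual_ops_closed[OF P S]
  note cr = rs_cring[OF S]
  have mod: "module (O_sec S U) (sec ?D U)" if U: "openin (top_of S) U" for U
  proof -
    interpret R: cring "O_sec S U" using cr[OF U] .
    note ev = dual_eval_add dual_eval_zero dual_eval_smult
    have ag: "abelian_group (sec ?D U)"
    proof (rule abelian_groupI)
      show "\<zero>\<^bsub>sec ?D U\<^esub> \<in> carrier (sec ?D U)" by (rule cl(1)[OF U])
    next
      fix f g assume "f \<in> carrier (sec ?D U)" "g \<in> carrier (sec ?D U)"
      then show "f \<oplus>\<^bsub>sec ?D U\<^esub> g \<in> carrier (sec ?D U)" by (rule cl(2)[OF U])
    next
      fix f g h assume f: "f \<in> carrier (sec ?D U)" and g: "g \<in> carrier (sec ?D U)" and h: "h \<in> carrier (sec ?D U)"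
      show "f \<oplus>\<^bsub>sec ?D U\<^esub> g \<oplus>\<^bsub>sec ?D U\<^esub> h = f \<oplus>\<^bsub>sec ?D U\<^esub> (g \<oplus>\<^bsub>sec ?D U\<^esub> h)"
      proof (rule dual_eqI[where S=S and F=F and U=U], goal_cases)
        case (3 V z)
        interpret cring "O_sec S V" using cr 3 by blast
        show ?case using dual_closed[OF f 3] dual_closed[OF g 3] dual_closed[OF h 3]
          by (simp add: ev[OF 3] a_assoc)
      qed (intro cl(2)[OF U] f g h)+
    next
      fix f g assume f: "f \<in> carrier (sec ?D U)" and g: "g \<in> carrier (sec ?D U)"
      show "f \<oplus>\<^bsub>sec ?D U\<^esub> g = g \<oplus>\<^bsub>sec ?D U\<^esub> f"
      proof (rule dual_eqI[where S=S and F=F and U=U], goal_cases)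
        case (3 V z)
        interpret cring "O_sec S V" using cr 3 by blast
        show ?case using dual_closed[OF f 3] dual_closed[OF g 3]
          by (simp add: ev[OF 3] a_comm)
      qed (intro cl(2)[OF U] f g)+
    next
      fix f assume f: "f \<in> carrier (sec ?D U)"
      show "\<zero>\<^bsub>sec ?D U\<^esub> \<oplus>\<^bsub>sec ?D U\<^esub> f = f"
      proof (rule dual_eqI[where S=S and F=F and U=U], goal_cases)
        case (3 V z)
        interpret cring "O_sec S V" using cr 3 by blast
        show ?case using dual_closed[OF f 3] by (simp add: ev[OF 3])
      qed (intro cl(1,2)[OF U] f)+
      \<comment> \<open>The negative is taken to be the multiple by minus one, so that its
        membership in the dual is an instance of closure under scalars.\<close>
      let ?g = "(\<ominus>\<^bsub>O_sec S U\<^esub> \<one>\<^bsub>O_sec S U\<^esub>) \<odot>\<^bsub>sec ?D U\<^esub> f"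
      have g: "?g \<in> carrier (sec ?D U)" by (intro cl(3)[OF U] f) simp
      have "?g \<oplus>\<^bsub>sec ?D U\<^esub> f = \<zero>\<^bsub>sec ?D U\<^esub>"
      proof (rule dual_eqI[where S=S and F=F and U=U], goal_cases)
        case (3 V z)
        interpret cring "O_sec S V" using cr 3 by blast
        interpret h: ring_hom_cring "O_sec S U" "O_sec S V" "O_res S U V"
          by (intro ring_hom_cring.intro R.is_cring is_cring ring_hom_cring_axioms.intro rs_hom[OF S U 3(1,2)])
        show ?case using dual_closed[OF f 3] by (simp add: ev[OF 3] l_minus l_neg)
      qed (intro cl(1,2)[OF U] f g)+
      then show "\<exists>g\<in>carrier (sec ?D U). g \<oplus>\<^bsub>sec ?D U\<^esub> f = \<zero>\<^bsub>sec ?D U\<^esub>" using g by blast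
    qed
    show ?thesis
    proof (rule moduleI[OF R.is_cring ag])
      fix r f assume r: "r \<in> carrier (O_sec S U)" and f: "f \<in> carrier (sec ?D U)"
      then show "r \<odot>\<^bsub>sec ?D U\<^esub> f \<in> carrier (sec ?D U)" by (rule cl(3)[OF U])
    next
      fix r q f assume r: "r \<in> carrier (O_sec S U)" and q: "q \<in> carrier (O_sec S U)" and f: "f \<in> carrier (sec ?D U)"
      show "(r \<oplus>\<^bsub>O_sec S U\<^esub> q) \<odot>\<^bsub>sec ?D U\<^esub> f = r \<odot>\<^bsub>sec ?D U\<^esub> f \<oplus>\<^bsub>sec ?D U\<^esub> q \<odot>\<^bsub>sec ?D U\<^esub> f"
      proof (rule dual_eqI[where S=S and F=F and U=U], goal_cases)
        case (3 V z)
        interpret cring "O_sec S V" using cr 3 by blast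
        show ?case using dual_closed[OF f 3] rs_res[OF S U 3(1,2)] r q
          by (simp add: ev[OF 3] ring_hom_add[OF rs_hom[OF S U 3(1,2)]] l_distr)
      qed (intro cl(2,3)[OF U] f R.a_closed r q)+
      show "(r \<otimes>\<^bsub>O_sec S U\<^esub> q) \<odot>\<^bsub>sec ?D U\<^esub> f = r \<odot>\<^bsub>sec ?D U\<^esub> (q \<odot>\<^bsub>sec ?D U\<^esub> f)"
      proof (rule dual_eqI[where S=S and F=F and U=U], goal_cases)
        case (3 V z)
        interpret cring "O_sec S V" using cr 3 by blast
        show ?case using dual_closed[OF f 3] rs_res[OF S U 3(1,2)] r q
          by (simp add: ev[OF 3] ring_hom_mult[OF rs_hom[OF S U 3(1,2)]] m_assoc)
      qed (intro cl(2,3)[OF U] f R.m_closed r q)+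
    next
      fix r f g assume r: "r \<in> carrier (O_sec S U)" and f: "f \<in> carrier (sec ?D U)" and g: "g \<in> carrier (sec ?D U)"
      show "r \<odot>\<^bsub>sec ?D U\<^esub> (f \<oplus>\<^bsub>sec ?D U\<^esub> g) = r \<odot>\<^bsub>sec ?D U\<^esub> f \<oplus>\<^bsub>sec ?D U\<^esub> r \<odot>\<^bsub>sec ?D U\<^esub> g"
      proof (rule dual_eqI[where S=S and F=F and U=U], goal_cases)
        case (3 V z)
        interpret cring "O_sec S V" using cr 3 by blast
        show ?case using dual_closed[OF f 3] dual_closed[OF g 3] rs_res[OF S U 3(1,2)] r
          by (simp add: ev[OF 3] r_distr)
      qed (intro cl(2,3)[OF U] f g r)+
    next
      fix f assume f: "f \<in> carrier (sec ?D U)"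
      show "\<one>\<^bsub>O_sec S U\<^esub> \<odot>\<^bsub>sec ?D U\<^esub> f = f"
      proof (rule dual_eqI[where S=S and F=F and U=U], goal_cases)
        case (3 V z)
        interpret cring "O_sec S V" using cr 3 by blast
        show ?case using dual_closed[OF f 3]
          by (simp add: ev[OF 3] ring_hom_one[OF rs_hom[OF S U 3(1,2)]])
      qed (intro cl(2,3)[OF U] f R.one_closed)+
    qed
  qed
  have fn: "functorial (top_of S) (\<lambda>U. carrier (sec ?D U)) (res ?D)"
    unfolding functorial_def
  proof (intro conjI allI impI)
    fix U V assume "openin (top_of S) U \<and> openin (top_of S) V \<and> V \<subseteq> U"
    then show "res ?D U V \<in> carrier (sec ?D U) \<rightarrow> carrier (sec ?D V)" using cl(4) by simp
  next
    fix U f assume *: "openin (top_of S) U \<and> f \<in> carrier (sec ?D U)"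
    then have U: "openin (top_of S) U" and f: "f \<in> carrier (sec ?D U)" by simp_all
    show "res ?D U U f = f"
      by (rule dual_eqI[OF cl(4)[OF U U subset_refl f] f]) (simp add: dual_eval_res)
  next
    fix U V W f
    assume "openin (top_of S) U \<and> openin (top_of S) V \<and> openin (top_of S) W \<and> W \<subseteq> V \<and> V \<subseteq> U \<and> f \<in> carrier (sec ?D U)"
    then have U: "openin (top_of S) U" and V: "openin (top_of S) V" "V \<subseteq> U" and W: "openin (top_of S) W" "W \<subseteq> V"
      "W \<subseteq> U" and f: "f \<in> carrier (sec ?D U)" by auto
    show "res ?D V W (res ?D U V f) = res ?D U W f"
    proof (rule dual_eqI[OF cl(4)[OF V(1) W(1,2) cl(4)[OF U V f]] cl(4)[OF U W(1,3) f]])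
      fix Y z assume Y: "openin (top_of S) Y" "Y \<subseteq> W" "z \<in> carrier (sec F Y)"
      have "Y \<subseteq> V" "Y \<subseteq> U" using Y W by auto
      then show "res ?D V W (res ?D U V f) Y z = res ?D U W f Y z"
        using Y W V by (simp add: dual_eval_res)
    qed
  qed
  show ?thesis unfolding presheaf_of_modules_def
  proof (intro conjI allI impI ballI fn mod)
    fix U V f g assume U: "openin (top_of S) U" and "V \<in> opens S U"
      and f: "f \<in> carrier (sec ?D U)" and g: "g \<in> carrier (sec ?D U)"
    then have V: "openin (top_of S) V" "V \<subseteq> U" by simp_all
    show "res ?D U V (f \<oplus>\<^bsub>sec ?D U\<^esub> g) = res ?D U V f \<oplus>\<^bsub>sec ?D V\<^esub> res ?D U V g"
    proof (rule dual_eqI[OF cl(4)[OF U V cl(2)[OF U f g]] cl(2)[OF V(1) cl(4)[OF U V f] cl(4)[OF U V g]]])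
      fix Y z assume Y: "openin (top_of S) Y" "Y \<subseteq> V" "z \<in> carrier (sec F Y)"
      have "Y \<subseteq> U" using Y V by auto
      then show "res ?D U V (f \<oplus>\<^bsub>sec ?D U\<^esub> g) Y z = (res ?D U V f \<oplus>\<^bsub>sec ?D V\<^esub> res ?D U V g) Y z"
        using Y V by (simp add: dual_eval_res dual_eval_add)
    qed
  next
    fix U V r f assume U: "openin (top_of S) U" and "V \<in> opens S U"
      and r: "r \<in> carrier (O_sec S U)" and f: "f \<in> carrier (sec ?D U)"
    then have V: "openin (top_of S) V" "V \<subseteq> U" by simp_all
    show "res ?D U V (r \<odot>\<^bsub>sec ?D U\<^esub> f) = O_res S U V r \<odot>\<^bsub>sec ?D V\<^esub> res ?D U V f"
    proof (rule dual_eqI[OF cl(4)[OF U V cl(3)[OF U r f]] cl(3)[OF V(1) rs_res[OF S U V r] cl(4)[OF U V f]]])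
      fix Y z assume Y: "openin (top_of S) Y" "Y \<subseteq> V" "z \<in> carrier (sec F Y)"
      have "Y \<subseteq> U" using Y V by auto
      then show "res ?D U V (r \<odot>\<^bsub>sec ?D U\<^esub> f) Y z = (O_res S U V r \<odot>\<^bsub>sec ?D V\<^esub> res ?D U V f) Y z"
        using Y V rs_comp[OF S U V(1) Y(1,2) V(2) r] by (simp add: dual_eval_res dual_eval_smult)
    qed
  qed
qed

section \<open>Graded modules\<close>

text \<open>The same as \<open>graded_module\<close> with presheaves in place of sheaves. Duals are
  handled below as presheaves, and this form allows \<open>B\<close>, \<open>C\<close> and the dual
  of \<open>C\<close> to be treated alike.\<close>

definition graded_premodule :: "('x, 'r) ringed_space \<Rightarrow> ('x, 'r, 'a) graded_alg
    \<Rightarrow> ('x, 'r, 'a, 'm) graded_mod \<Rightarrow> bool" where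
  "graded_premodule S A M \<longleftrightarrow>
     (\<forall>p. presheaf_of_modules S (piece M p)) \<and>
     (\<forall>p q. bilinear_pairing S (alg_piece A p) (piece M q) (piece M (p + q)) (act M p q)) \<and>
     (\<forall>U. openin (top_of S) U \<longrightarrow>
        (\<forall>p. \<forall>z\<in>carrier (mod_sec M p U). act M 0 p U (alg_one A U) z = z) \<and>
        (\<forall>p q k. \<forall>x\<in>carrier (alg_sec A p U). \<forall>y\<in>carrier (alg_sec A q U). \<forall>z\<in>carrier (mod_sec M k U).
           act M (p + q) k U (alg_mult A p q U x y) z = act M p (q + k) U x (act M q k U y z)))"

lemma graded_module_premodule: "graded_module S A M \<Longrightarrow> graded_premodule S A M"
  unfolding graded_module_def graded_premodule_def sheaf_of_modules_def by (elim conjE) (intro conjI; simp)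

lemma alg_psh: "graded_algebra S A \<Longrightarrow> presheaf_of_modules S (alg_piece A p)"
  by (simp add: graded_algebra_def sheaf_of_modules_def)

lemma gpm_psh: "graded_premodule S A M \<Longrightarrow> presheaf_of_modules S (piece M p)"
  by (simp add: graded_premodule_def)

lemma gpm_pairing: "graded_premodule S A M \<Longrightarrow>
    bilinear_pairing S (alg_piece A p) (piece M q) (piece M (p + q)) (act M p q)"
  by (simp add: graded_premodule_def)

lemma
  assumes "bilinear_pairing S F G H \<mu>" "openin (top_of S) U"
  shows pairing_closed: "x \<in> carrier (sec F U) \<Longrightarrow> y \<in> carrier (sec G U) \<Longrightarrow> \<mu> U x y \<in> carrier (sec H U)"
    and pairing_add_right: "x \<in> carrier (sec F U) \<Longrightarrow> y \<in> carrier (sec G U) \<Longrightarrow> y' \<in> carrier (sec G U) \<Longrightarrow>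
      \<mu> U x (y \<oplus>\<^bsub>sec G U\<^esub> y') = \<mu> U x y \<oplus>\<^bsub>sec H U\<^esub> \<mu> U x y'"
    and pairing_add_left: "x \<in> carrier (sec F U) \<Longrightarrow> x' \<in> carrier (sec F U) \<Longrightarrow> y \<in> carrier (sec G U) \<Longrightarrow>
      \<mu> U (x \<oplus>\<^bsub>sec F U\<^esub> x') y = \<mu> U x y \<oplus>\<^bsub>sec H U\<^esub> \<mu> U x' y"
    and pairing_smult_right: "r \<in> carrier (O_sec S U) \<Longrightarrow> x \<in> carrier (sec F U) \<Longrightarrow> y \<in> carrier (sec G U) \<Longrightarrow>
      \<mu> U x (r \<odot>\<^bsub>sec G U\<^esub> y) = r \<odot>\<^bsub>sec H U\<^esub> \<mu> U x y"
    and pairing_smult_left: "r \<in> carrier (O_sec S U) \<Longrightarrow> x \<in> carrier (sec F U) \<Longrightarrow> y \<in> carrier (sec G U) \<Longrightarrow>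
      \<mu> U (r \<odot>\<^bsub>sec F U\<^esub> x) y = r \<odot>\<^bsub>sec H U\<^esub> \<mu> U x y"
    and pairing_res: "openin (top_of S) V \<Longrightarrow> V \<subseteq> U \<Longrightarrow> x \<in> carrier (sec F U) \<Longrightarrow> y \<in> carrier (sec G U) \<Longrightarrow>
      res H U V (\<mu> U x y) = \<mu> V (res F U V x) (res G U V y)"
  using assms by (auto simp: bilinear_pairing_def mod_hom_def Pi_iff)

text \<open>The target degree is a variable of its own with \<open>n = p + q\<close>, because
  degrees met later, such as \<open>- q\<close> and \<open>p + - (p + q)\<close>, agree only after
  arithmetic.\<close>

lemma
  assumes M: "graded_premodule S A M" and U: "openin (top_of S) U" and n: "n = p + q"
  shows act_closed: "x \<in> carrier (alg_sec A p U) \<Longrightarrow> z \<in> carrier (mod_sec M q U) \<Longrightarrow>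
      act M p q U x z \<in> carrier (mod_sec M n U)"
    and act_add_right: "x \<in> carrier (alg_sec A p U) \<Longrightarrow> y \<in> carrier (mod_sec M q U) \<Longrightarrow> z \<in> carrier (mod_sec M q U) \<Longrightarrow>
      act M p q U x (y \<oplus>\<^bsub>mod_sec M q U\<^esub> z) = act M p q U x y \<oplus>\<^bsub>mod_sec M n U\<^esub> act M p q U x z"
    and act_add_left: "x \<in> carrier (alg_sec A p U) \<Longrightarrow> x' \<in> carrier (alg_sec A p U) \<Longrightarrow> z \<in> carrier (mod_sec M q U) \<Longrightarrow>
      act M p q U (x \<oplus>\<^bsub>alg_sec A p U\<^esub> x') z = act M p q U x z \<oplus>\<^bsub>mod_sec M n U\<^esub> act M p q U x' z"
    and act_smult_right: "r \<in> carrier (O_sec S U) \<Longrightarrow> x \<in> carrier (alg_sec A p U) \<Longrightarrow> z \<in> carrier (mod_sec M q U) \<Longrightarrow>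
      act M p q U x (r \<odot>\<^bsub>mod_sec M q U\<^esub> z) = r \<odot>\<^bsub>mod_sec M n U\<^esub> act M p q U x z"
    and act_smult_left: "r \<in> carrier (O_sec S U) \<Longrightarrow> x \<in> carrier (alg_sec A p U) \<Longrightarrow> z \<in> carrier (mod_sec M q U) \<Longrightarrow>
      act M p q U (r \<odot>\<^bsub>alg_sec A p U\<^esub> x) z = r \<odot>\<^bsub>mod_sec M n U\<^esub> act M p q U x z"
    and act_res: "openin (top_of S) V \<Longrightarrow> V \<subseteq> U \<Longrightarrow> x \<in> carrier (alg_sec A p U) \<Longrightarrow> z \<in> carrier (mod_sec M q U) \<Longrightarrow>
      res (piece M n) U V (act M p q U x z) = act M p q V (res (alg_piece A p) U V x) (res (piece M q) U V z)"
  unfolding n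
  by (fact pairing_closed[OF gpm_pairing[OF M] U] pairing_add_right[OF gpm_pairing[OF M] U]
      pairing_add_left[OF gpm_pairing[OF M] U] pairing_smult_right[OF gpm_pairing[OF M] U]
      pairing_smult_left[OF gpm_pairing[OF M] U] pairing_res[OF gpm_pairing[OF M] U])+

lemma act_one: "graded_premodule S A M \<Longrightarrow> openin (top_of S) U \<Longrightarrow> z \<in> carrier (mod_sec M p U) \<Longrightarrow>
    act M 0 p U (alg_one A U) z = z"
  by (simp add: graded_premodule_def)

lemma act_assoc: "graded_premodule S A M \<Longrightarrow> openin (top_of S) U \<Longrightarrow> r = p + q \<Longrightarrow> l = q + k \<Longrightarrow>
    x \<in> carrier (alg_sec A p U) \<Longrightarrow> y \<in> carrier (alg_sec A q U) \<Longrightarrow> z \<in> carrier (mod_sec M k U) \<Longrightarrow>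
    act M r k U (alg_mult A p q U x y) z = act M p l U x (act M q k U y z)"
  by (simp add: graded_premodule_def)

lemma
  assumes A: "graded_algebra S A" and U: "openin (top_of S) U"
  shows alg_one_closed: "alg_one A U \<in> carrier (alg_sec A 0 U)"
    and alg_one_res: "openin (top_of S) V \<Longrightarrow> V \<subseteq> U \<Longrightarrow> res (alg_piece A 0) U V (alg_one A U) = alg_one A V"
    and alg_comm: "x \<in> carrier (alg_sec A p U) \<Longrightarrow> y \<in> carrier (alg_sec A q U) \<Longrightarrow>
      alg_mult A p q U x y = alg_mult A q p U y x"
    and alg_neg: "p < 0 \<Longrightarrow> carrier (alg_sec A p U) = {\<zero>\<^bsub>alg_sec A p U\<^esub>}"
    and alg_mult_one: "x \<in> carrier (alg_sec A p U) \<Longrightarrow> alg_mult A p 0 U x (alg_one A U) = x"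
proof -
  show 1: "alg_one A U \<in> carrier (alg_sec A 0 U)"
    "openin (top_of S) V \<Longrightarrow> V \<subseteq> U \<Longrightarrow> res (alg_piece A 0) U V (alg_one A U) = alg_one A V"
    "p < 0 \<Longrightarrow> carrier (alg_sec A p U) = {\<zero>\<^bsub>alg_sec A p U\<^esub>}"
    using A U by (simp_all add: graded_algebra_def)
  show c: "x \<in> carrier (alg_sec A p U) \<Longrightarrow> y \<in> carrier (alg_sec A q U) \<Longrightarrow>
      alg_mult A p q U x y = alg_mult A q p U y x" for p q x y
    using A U unfolding graded_algebra_def by meson
  show "alg_mult A p 0 U x (alg_one A U) = x" if x: "x \<in> carrier (alg_sec A p U)"
    using A U x c[OF x 1(1)] unfolding graded_algebra_def by simp
qed

lemma alg_pairing: "graded_algebra S A \<Longrightarrow>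
    bilinear_pairing S (alg_piece A p) (alg_piece A q) (alg_piece A (p + q)) (alg_mult A p q)"
  by (simp add: graded_algebra_def)

lemma alg_mult_closed:
  assumes "graded_algebra S A" "openin (top_of S) U" "n = p + q"
    "x \<in> carrier (alg_sec A p U)" "y \<in> carrier (alg_sec A q U)"
  shows "alg_mult A p q U x y \<in> carrier (alg_sec A n U)"
  unfolding assms(3) by (rule pairing_closed[OF alg_pairing[OF assms(1)] assms(2,4,5)])

lemma act_zero_right:
  assumes M: "graded_premodule S A M" and U: "openin (top_of S) U" and n: "n = p + q"
    and x: "x \<in> carrier (alg_sec A p U)"
  shows "act M p q U x \<zero>\<^bsub>mod_sec M q U\<^esub> = \<zero>\<^bsub>mod_sec M n U\<^esub>"
  by (rule additive_zero[OF mod_ag[OF psh_module[OF gpm_psh[OF M] U]] mod_ag[OF psh_module[OF gpm_psh[OF M] U]]])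
    (use act_closed[OF M U n x] act_add_right[OF M U n x] in simp_all)

lemma act_minus_right:
  assumes M: "graded_premodule S A M" and U: "openin (top_of S) U" and n: "n = p + q"
    and x: "x \<in> carrier (alg_sec A p U)" and z: "z \<in> carrier (mod_sec M q U)"
  shows "act M p q U x (\<ominus>\<^bsub>mod_sec M q U\<^esub> z) = \<ominus>\<^bsub>mod_sec M n U\<^esub> act M p q U x z"
  by (rule additive_minus[OF mod_ag[OF psh_module[OF gpm_psh[OF M] U]] mod_ag[OF psh_module[OF gpm_psh[OF M] U]]])
    (use act_closed[OF M U n x] act_add_right[OF M U n x] z in simp_all)

lemma act_zero_left:
  assumes A: "graded_algebra S A" and M: "graded_premodule S A M" and U: "openin (top_of S) U" and n: "n = p + q"
    and z: "z \<in> carrier (mod_sec M q U)"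
  shows "act M p q U \<zero>\<^bsub>alg_sec A p U\<^esub> z = \<zero>\<^bsub>mod_sec M n U\<^esub>"
  by (rule additive_zero[where f="\<lambda>x. act M p q U x z",
        OF mod_ag[OF psh_module[OF alg_psh[OF A] U]] mod_ag[OF psh_module[OF gpm_psh[OF M] U]]])
    (use act_closed[OF M U n _ z] act_add_left[OF M U n _ _ z] in simp_all)

lemma piece_graded_dual: "piece (graded_dual S A M) q = dual_sheaf S (piece M (- q))"
  by (simp add: graded_dual_def)

lemma act_graded_dual: "act (graded_dual S A M) p q U x \<phi> =
    (\<lambda>V\<in>opens S U. \<lambda>z\<in>carrier (mod_sec M (- (p + q)) V).
        \<phi> V (act M p (- (p + q)) V (res (alg_piece A p) U V x) z))"
  by (simp add: graded_dual_def)

text \<open>The adjoint action reverses the order of factors: \<open>x\<close> applied to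
  \<open>y\<close> applied to \<open>\<phi>\<close> evaluates \<open>\<phi>\<close> at
  \<open>y (x z)\<close>. Associativity of the action therefore rests on commutativity of
  \<open>A\<close>, which enters through \<open>alg_comm\<close>.\<close>

lemma graded_dual_premodule:
  assumes S: "is_ringed_space S" and A: "graded_algebra S A" and M: "graded_premodule S A M"
  shows "graded_premodule S A (graded_dual S A M)"
proof -
  let ?D = "graded_dual S A M"
  note Mp = gpm_psh[OF M]
  note Ap = alg_psh[OF A]
  note cl = dual_ops_closed[OF Mp S]
  \<comment> \<open>Acting by degree \<open>p\<close> carries the piece of degree
    \<open>- (p + q)\<close> into the piece of degree \<open>- q\<close>, on which the functional is
    defined.\<close>
  have deg: "- q = p + - (p + q)" for p q :: int by simp
  have closed: "act ?D p q U x \<phi> \<in> carrier (sec (dual_sheaf S (piece M (- (p + q)))) U)"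
    if U: "openin (top_of S) U" and x: "x \<in> carrier (alg_sec A p U)"
      and f: "\<phi> \<in> carrier (sec (dual_sheaf S (piece M (- q))) U)" for p q U x \<phi>
    unfolding act_graded_dual
  proof (rule dual_sheaf_carrierI[OF _ _ _ _ Mp], goal_cases)
    case (1 V z)
    show ?case by (rule dual_closed[OF f 1(1,2) act_closed[OF M 1(1) deg psh_res[OF Ap U 1(1,2) x] 1(3)]])
  next
    case (2 V y z)
    note x' = psh_res[OF Ap U 2(1,2) x]
    show ?case unfolding act_add_right[OF M 2(1) deg x' 2(3,4)]
      by (rule dual_add[OF f 2(1,2) act_closed[OF M 2(1) deg x' 2(3)] act_closed[OF M 2(1) deg x' 2(4)]])
  next
    case (3 V r z)
    note x' = psh_res[OF Ap U 3(1,2) x]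
    show ?case unfolding act_smult_right[OF M 3(1) deg 3(3) x' 3(4)]
      by (rule dual_smult[OF f 3(1,2,3) act_closed[OF M 3(1) deg x' 3(4)]])
  next
    case (4 V W z)
    note x' = psh_res[OF Ap U 4(1,2) x]
    show ?case
      unfolding dual_res[OF f 4(1-4) act_closed[OF M 4(1) deg x' 4(5)], symmetric]
        act_res[OF M 4(1) deg 4(3,4) x' 4(5)] psh_comp[OF Ap U 4(1,3,4,2) x] by (rule refl)
  qed
  have eval: "act ?D p q U x \<phi> V z = \<phi> V (act M p (- (p + q)) V (res (alg_piece A p) U V x) z)"
    if "openin (top_of S) V" "V \<subseteq> U" "z \<in> carrier (mod_sec M (- (p + q)) V)" for p q U x \<phi> V z
    using that by (simp add: act_graded_dual)
  have pair: "bilinear_pairing S (alg_piece A p) (piece ?D q) (piece ?D (p + q)) (act ?D p q)" for p q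
    unfolding bilinear_pairing_def piece_graded_dual mod_hom_def
  proof (intro allI impI conjI ballI CollectI funcsetI)
    fix U x f assume U: "openin (top_of S) U" and x: "x \<in> carrier (alg_sec A p U)"
      and f: "f \<in> carrier (sec (dual_sheaf S (piece M (- q))) U)"
    show c: "act ?D p q U x f \<in> carrier (sec (dual_sheaf S (piece M (- (p + q)))) U)"
      by (rule closed[OF U x f])
    fix g assume g: "g \<in> carrier (sec (dual_sheaf S (piece M (- q))) U)"
    show "act ?D p q U x (f \<oplus>\<^bsub>sec (dual_sheaf S (piece M (- q))) U\<^esub> g) =
        act ?D p q U x f \<oplus>\<^bsub>sec (dual_sheaf S (piece M (- (p + q)))) U\<^esub> act ?D p q U x g"
    proof (rule dual_eqI[OF closed[OF U x cl(2)[OF U f g]] cl(2)[OF U c closed[OF U x g]]])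
      fix V z assume V: "openin (top_of S) V" "V \<subseteq> U" "z \<in> carrier (mod_sec M (- (p + q)) V)"
      note x' = psh_res[OF Ap U V(1,2) x]
      show "act ?D p q U x (f \<oplus>\<^bsub>sec (dual_sheaf S (piece M (- q))) U\<^esub> g) V z =
        (act ?D p q U x f \<oplus>\<^bsub>sec (dual_sheaf S (piece M (- (p + q)))) U\<^esub> act ?D p q U x g) V z"
        unfolding eval[OF V] dual_eval_add[OF V] dual_eval_add[OF V(1,2) act_closed[OF M V(1) deg x' V(3)]]
        by (rule refl)
    qed
  next
    fix U x r f assume U: "openin (top_of S) U" and x: "x \<in> carrier (alg_sec A p U)"
      and r: "r \<in> carrier (O_sec S U)" and f: "f \<in> carrier (sec (dual_sheaf S (piece M (- q))) U)"
    show "act ?D p q U x (r \<odot>\<^bsub>sec (dual_sheaf S (piece M (- q))) U\<^esub> f) =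
        r \<odot>\<^bsub>sec (dual_sheaf S (piece M (- (p + q)))) U\<^esub> act ?D p q U x f"
    proof (rule dual_eqI[OF closed[OF U x cl(3)[OF U r f]] cl(3)[OF U r closed[OF U x f]]])
      fix V z assume V: "openin (top_of S) V" "V \<subseteq> U" "z \<in> carrier (mod_sec M (- (p + q)) V)"
      note x' = psh_res[OF Ap U V(1,2) x]
      show "act ?D p q U x (r \<odot>\<^bsub>sec (dual_sheaf S (piece M (- q))) U\<^esub> f) V z =
        (r \<odot>\<^bsub>sec (dual_sheaf S (piece M (- (p + q)))) U\<^esub> act ?D p q U x f) V z"
        unfolding eval[OF V] dual_eval_smult[OF V] dual_eval_smult[OF V(1,2) act_closed[OF M V(1) deg x' V(3)]]
        by (rule refl)
    qed
  next
    fix U f x y assume U: "openin (top_of S) U"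
      and f: "f \<in> carrier (sec (dual_sheaf S (piece M (- q))) U)"
      and x: "x \<in> carrier (alg_sec A p U)"
    show c: "act ?D p q U x f \<in> carrier (sec (dual_sheaf S (piece M (- (p + q)))) U)"
      by (rule closed[OF U x f])
    assume y: "y \<in> carrier (alg_sec A p U)"
    show "act ?D p q U (x \<oplus>\<^bsub>alg_sec A p U\<^esub> y) f =
        act ?D p q U x f \<oplus>\<^bsub>sec (dual_sheaf S (piece M (- (p + q)))) U\<^esub> act ?D p q U y f"
    proof (rule dual_eqI[OF closed[OF U _ f] cl(2)[OF U c closed[OF U y f]]])
      interpret am: module "O_sec S U" "alg_sec A p U" using psh_module[OF Ap U] .
      show "x \<oplus>\<^bsub>alg_sec A p U\<^esub> y \<in> carrier (alg_sec A p U)" using x y by simp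
      fix V z assume V: "openin (top_of S) V" "V \<subseteq> U" "z \<in> carrier (mod_sec M (- (p + q)) V)"
      note x' = psh_res[OF Ap U V(1,2) x]
      note y' = psh_res[OF Ap U V(1,2) y]
      show "act ?D p q U (x \<oplus>\<^bsub>alg_sec A p U\<^esub> y) f V z =
        (act ?D p q U x f \<oplus>\<^bsub>sec (dual_sheaf S (piece M (- (p + q)))) U\<^esub> act ?D p q U y f) V z"
        unfolding dual_eval_add[OF V] eval[OF V] psh_add[OF Ap U V(1,2) x y] act_add_left[OF M V(1) deg x' y' V(3)]
        by (rule dual_add[OF f V(1,2) act_closed[OF M V(1) deg x' V(3)] act_closed[OF M V(1) deg y' V(3)]])
    qed
  next
    fix U f r x assume U: "openin (top_of S) U"
      and f: "f \<in> carrier (sec (dual_sheaf S (piece M (- q))) U)"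
      and r: "r \<in> carrier (O_sec S U)" and x: "x \<in> carrier (alg_sec A p U)"
    show "act ?D p q U (r \<odot>\<^bsub>alg_sec A p U\<^esub> x) f =
        r \<odot>\<^bsub>sec (dual_sheaf S (piece M (- (p + q)))) U\<^esub> act ?D p q U x f"
    proof (rule dual_eqI[OF closed[OF U _ f] cl(3)[OF U r closed[OF U x f]]])
      interpret am: module "O_sec S U" "alg_sec A p U" using psh_module[OF Ap U] .
      show "r \<odot>\<^bsub>alg_sec A p U\<^esub> x \<in> carrier (alg_sec A p U)" using r x by simp
      fix V z assume V: "openin (top_of S) V" "V \<subseteq> U" "z \<in> carrier (mod_sec M (- (p + q)) V)"
      note x' = psh_res[OF Ap U V(1,2) x]
      note r' = rs_res[OF S U V(1,2) r]
      show "act ?D p q U (r \<odot>\<^bsub>alg_sec A p U\<^esub> x) f V z =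
        (r \<odot>\<^bsub>sec (dual_sheaf S (piece M (- (p + q)))) U\<^esub> act ?D p q U x f) V z"
        unfolding dual_eval_smult[OF V] eval[OF V] psh_smult[OF Ap U V(1,2) r x] act_smult_left[OF M V(1) deg r' x' V(3)]
        by (rule dual_smult[OF f V(1,2) r' act_closed[OF M V(1) deg x' V(3)]])
    qed
  next
    fix U W x f assume U: "openin (top_of S) U" and "W \<in> opens S U" and x: "x \<in> carrier (alg_sec A p U)"
      and f: "f \<in> carrier (sec (dual_sheaf S (piece M (- q))) U)"
    then have W: "openin (top_of S) W" "W \<subseteq> U" by simp_all
    show "res (dual_sheaf S (piece M (- (p + q)))) U W (act ?D p q U x f) =
        act ?D p q W (res (alg_piece A p) U W x) (res (dual_sheaf S (piece M (- q))) U W f)"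
    proof (rule dual_eqI[OF cl(4)[OF U W closed[OF U x f]] closed[OF W(1) psh_res[OF Ap U W x] cl(4)[OF U W f]]])
      fix V z assume V: "openin (top_of S) V" "V \<subseteq> W" "z \<in> carrier (mod_sec M (- (p + q)) V)"
      then have VU: "V \<subseteq> U" using W by blast
      note x' = psh_res[OF Ap U V(1) VU x]
      show "res (dual_sheaf S (piece M (- (p + q)))) U W (act ?D p q U x f) V z =
        act ?D p q W (res (alg_piece A p) U W x) (res (dual_sheaf S (piece M (- q))) U W f) V z"
        unfolding dual_eval_res[OF V(1) VU V(3) W(2) V(2)] eval[OF V] eval[OF V(1) VU V(3)]
          psh_comp[OF Ap U W(1) V(1,2) W(2) x]
          dual_eval_res[OF V(1) VU act_closed[OF M V(1) deg x' V(3)] W(2) V(2)] by (rule refl)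
    qed
  qed
  show ?thesis unfolding graded_premodule_def
  proof (intro conjI allI impI ballI pair)
    show "presheaf_of_modules S (piece ?D p)" for p
      unfolding piece_graded_dual by (rule dual_presheaf[OF Mp S])
  next
    fix U p f assume U: "openin (top_of S) U" and f: "f \<in> carrier (mod_sec ?D p U)"
    then have f: "f \<in> carrier (sec (dual_sheaf S (piece M (- p))) U)" by (simp only: piece_graded_dual)
    have "act ?D 0 p U (alg_one A U) f \<in> carrier (sec (dual_sheaf S (piece M (- p))) U)"
      using closed[OF U alg_one_closed[OF A U] f] by simp
    then show "act ?D 0 p U (alg_one A U) f = f"
    proof (rule dual_eqI[OF _ f])
      fix V z assume V: "openin (top_of S) V" "V \<subseteq> U" "z \<in> carrier (mod_sec M (- p) V)"
      show "act ?D 0 p U (alg_one A U) f V z = f V z"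
        using eval[of V U z 0 p] V act_one[OF M V(1,3)] alg_one_res[OF A U V(1,2)] by simp
    qed
  next
    fix U p q k x y f assume U: "openin (top_of S) U" and x: "x \<in> carrier (alg_sec A p U)"
      and y: "y \<in> carrier (alg_sec A q U)" and "f \<in> carrier (mod_sec ?D k U)"
    then have f: "f \<in> carrier (sec (dual_sheaf S (piece M (- k))) U)" by (simp only: piece_graded_dual)
    have d: "p + (q + k) = p + q + k" by simp
    show "act ?D (p + q) k U (alg_mult A p q U x y) f = act ?D p (q + k) U x (act ?D q k U y f)"
    proof (rule dual_eqI[OF closed[OF U alg_mult_closed[OF A U refl x y] f]
          closed[OF U x closed[OF U y f], unfolded d]])
      fix V z assume V: "openin (top_of S) V" "V \<subseteq> U" "z \<in> carrier (mod_sec M (- (p + q + k)) V)"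
      note V' = V[folded d]
      note x' = psh_res[OF Ap U V(1,2) x]
      note y' = psh_res[OF Ap U V(1,2) y]
      have z': "act M p (- (p + (q + k))) V (res (alg_piece A p) U V x) z \<in> carrier (mod_sec M (- (q + k)) V)"
        by (rule act_closed[OF M V(1) _ x' V'(3)]) simp
      have "act M (p + q) (- (p + q + k)) V (res (alg_piece A (p + q)) U V (alg_mult A p q U x y)) z =
        act M (p + q) (- (p + q + k)) V (alg_mult A q p V (res (alg_piece A q) U V y) (res (alg_piece A p) U V x)) z"
        unfolding pairing_res[OF alg_pairing[OF A] U V(1,2) x y] alg_comm[OF A V(1) x' y'] by (rule refl)
      also have "\<dots> = act M q (- (q + k)) V (res (alg_piece A q) U V y)
          (act M p (- (p + q + k)) V (res (alg_piece A p) U V x) z)"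
        by (rule act_assoc[OF M V(1) _ _ y' x' V(3)]) simp_all
      finally show "act ?D (p + q) k U (alg_mult A p q U x y) f V z = act ?D p (q + k) U x (act ?D q k U y f) V z"
        unfolding eval[OF V] eval[OF V'] eval[OF V(1,2) z'] by (simp only: d)
    qed
  qed
qed

section \<open>Submodules generated by homogeneous sections\<close>

text \<open>There is no case for scalars, because \<open>submodule_gen\<close> is an additive group
  generated by products and a scalar can be absorbed into the algebra factor. Negatives form a case
  because \<open>generate\<close> adjoins inverses of generators.\<close>

lemma submodule_gen_induct [consumes 4, case_names zero gen add minus]:
  assumes M: "graded_premodule S A M" and U: "openin (top_of S) U"
    and z: "z \<in> submodule_gen A M U G n" and G: "\<forall>j. G j \<subseteq> carrier (mod_sec M j U)"
    and "P \<zero>\<^bsub>mod_sec M n U\<^esub>"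
    and gen: "\<And>k j x y. k + j = n \<Longrightarrow> x \<in> carrier (alg_sec A k U) \<Longrightarrow> y \<in> G j \<Longrightarrow> P (act M k j U x y)"
    and add: "\<And>y z. y \<in> carrier (mod_sec M n U) \<Longrightarrow> z \<in> carrier (mod_sec M n U) \<Longrightarrow> P y \<Longrightarrow> P z \<Longrightarrow>
      P (y \<oplus>\<^bsub>mod_sec M n U\<^esub> z)"
    and minus: "\<And>y. y \<in> carrier (mod_sec M n U) \<Longrightarrow> P y \<Longrightarrow> P (\<ominus>\<^bsub>mod_sec M n U\<^esub> y)"
  shows "P z"
proof -
  interpret module "O_sec S U" "mod_sec M n U" using psh_module[OF gpm_psh[OF M] U] .
  have c: "act M k j U x y \<in> carrier (mod_sec M n U)"
    if "k + j = n" "x \<in> carrier (alg_sec A k U)" "y \<in> G j" for k j x y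
    using act_closed[OF M U that(1)[symmetric] that(2)] that(3) G by blast
  have "z \<in> carrier (mod_sec M n U) \<and> P z"
    using z unfolding submodule_gen_def
  proof (induction rule: generate.induct)
    case one
    then show ?case using assms(5) by simp
  next
    case (incl h)
    then show ?case using c gen by auto
  next
    case (inv h)
    then obtain k j x y where h: "k + j = n" "x \<in> carrier (alg_sec A k U)" "y \<in> G j" "h = act M k j U x y"
      by blast
    then show ?case using minus[OF c[OF h(1-3)] gen[OF h(1-3)]] M.a_inv_closed[OF c[OF h(1-3)]]
      by (simp add: a_inv_def)
  next
    case (eng y z)
    then show ?case using add[of y z] by simp
  qed
  then show ?thesis ..
qed

text \<open>Closure under scalars is not built into the definition. A scalar slides onto the algebra
  factor of each generating product, and \<open>alg_sec A k U\<close> is itself a module over the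
  ring of sections.\<close>

lemma
  assumes A: "graded_algebra S A" and M: "graded_premodule S A M" and U: "openin (top_of S) U"
    and G: "\<forall>j. G j \<subseteq> carrier (mod_sec M j U)"
  shows submodule_gen_submodule: "submodule (submodule_gen A M U G n) (O_sec S U) (mod_sec M n U)"
    and submodule_gen_incl: "k + j = n \<Longrightarrow> x \<in> carrier (alg_sec A k U) \<Longrightarrow> y \<in> G j \<Longrightarrow>
      act M k j U x y \<in> submodule_gen A M U G n"
proof -
  interpret module "O_sec S U" "mod_sec M n U" using psh_module[OF gpm_psh[OF M] U] .
  show i: "act M k j U x y \<in> submodule_gen A M U G n"
    if "k + j = n" "x \<in> carrier (alg_sec A k U)" "y \<in> G j" for k j x y
    unfolding submodule_gen_def using that by (intro generate.incl) blast
  have sub: "subgroup (submodule_gen A M U G n) (add_monoid (mod_sec M n U))"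
    unfolding submodule_gen_def
  proof (rule M.add.generate_is_subgroup, safe)
    fix k j x z assume "n = k + j" "x \<in> carrier (alg_sec A k U)" "z \<in> G j"
    then show "act M k j U x z \<in> carrier (mod_sec M (k + j) U)"
      using act_closed[OF M U refl] G by blast
  qed
  have e: "\<zero>\<^bsub>mod_sec M n U\<^esub> \<in> submodule_gen A M U G n"
    "y \<in> submodule_gen A M U G n \<Longrightarrow> z \<in> submodule_gen A M U G n \<Longrightarrow>
      y \<oplus>\<^bsub>mod_sec M n U\<^esub> z \<in> submodule_gen A M U G n"
    "y \<in> submodule_gen A M U G n \<Longrightarrow> \<ominus>\<^bsub>mod_sec M n U\<^esub> y \<in> submodule_gen A M U G n" for y z
    using subgroup.one_closed[OF sub] subgroup.m_closed[OF sub] subgroup.m_inv_closed[OF sub]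
    by (simp_all add: a_inv_def)
  show "submodule (submodule_gen A M U G n) (O_sec S U) (mod_sec M n U)"
  proof (rule submodule.intro[OF sub], rule submodule_axioms.intro)
    fix r z assume r: "r \<in> carrier (O_sec S U)" and z: "z \<in> submodule_gen A M U G n"
    show "r \<odot>\<^bsub>mod_sec M n U\<^esub> z \<in> submodule_gen A M U G n"
      using M U z G
    proof (induction rule: submodule_gen_induct)
      case zero
      then show ?case using r e(1) by simp
    next
      case (gen k j x y)
      interpret Ak: module "O_sec S U" "alg_sec A k U"
        by (rule psh_module[OF alg_psh[OF A] U])
      have y: "y \<in> carrier (mod_sec M j U)" using gen G by blast
      show ?case unfolding act_smult_left[OF M U gen(1)[symmetric] r gen(2) y, symmetric]
        by (rule i[OF gen(1) _ gen(3)]) (use r gen in simp)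
    next
      case (add y z)
      then show ?case using r e(2) by (simp add: smult_r_distr)
    next
      case (minus y)
      then show ?case using r e(3) by (simp add: smult_r_minus)
    qed
  qed
qed

lemma submodule_gen_mono:
  assumes "\<And>j. G j \<subseteq> H j"
  shows "submodule_gen A M U G n \<subseteq> submodule_gen A M U H n"
proof
  fix z assume "z \<in> submodule_gen A M U G n"
  then show "z \<in> submodule_gen A M U H n" unfolding submodule_gen_def
    by (induction rule: generate.induct) (use assms in \<open>blast intro: generate.intros\<close>)+
qed

lemma
  assumes A: "graded_algebra S A" and M: "graded_premodule S A M" and U: "openin (top_of S) U"
    and G: "\<forall>j. G j \<subseteq> carrier (mod_sec M j U)"
  shows submodule_gen_zero: "\<zero>\<^bsub>mod_sec M n U\<^esub> \<in> submodule_gen A M U G n"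
    and submodule_gen_add: "y \<in> submodule_gen A M U G n \<Longrightarrow> z \<in> submodule_gen A M U G n \<Longrightarrow>
      y \<oplus>\<^bsub>mod_sec M n U\<^esub> z \<in> submodule_gen A M U G n"
    and submodule_gen_minus: "y \<in> submodule_gen A M U G n \<Longrightarrow> \<ominus>\<^bsub>mod_sec M n U\<^esub> y \<in> submodule_gen A M U G n"
    and submodule_gen_smult: "r \<in> carrier (O_sec S U) \<Longrightarrow> y \<in> submodule_gen A M U G n \<Longrightarrow>
      r \<odot>\<^bsub>mod_sec M n U\<^esub> y \<in> submodule_gen A M U G n"
    and submodule_gen_self: "z \<in> G n \<Longrightarrow> z \<in> submodule_gen A M U G n"
proof -
  note sub = submodule_gen_submodule[OF A M U G]
  interpret module "O_sec S U" "mod_sec M n U" using psh_module[OF gpm_psh[OF M] U] .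
  show "y \<in> submodule_gen A M U G n \<Longrightarrow> z \<in> submodule_gen A M U G n \<Longrightarrow>
      y \<oplus>\<^bsub>mod_sec M n U\<^esub> z \<in> submodule_gen A M U G n"
    "y \<in> submodule_gen A M U G n \<Longrightarrow> \<ominus>\<^bsub>mod_sec M n U\<^esub> y \<in> submodule_gen A M U G n"
    "r \<in> carrier (O_sec S U) \<Longrightarrow> y \<in> submodule_gen A M U G n \<Longrightarrow>
      r \<odot>\<^bsub>mod_sec M n U\<^esub> y \<in> submodule_gen A M U G n"
    using submoduleE(3,4,5)[OF sub] by simp_all
  show "\<zero>\<^bsub>mod_sec M n U\<^esub> \<in> submodule_gen A M U G n"
    unfolding submodule_gen_def using generate.one[of "add_monoid (mod_sec M n U)"] by simp
  show "z \<in> submodule_gen A M U G n" if z: "z \<in> G n"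
  proof -
    \<comment> \<open>Multiplication by the unit of the algebra exhibits a generator as one of the
      generating products.\<close>
    have "act M 0 n U (alg_one A U) z \<in> submodule_gen A M U G n"
      by (rule submodule_gen_incl[OF A M U G _ alg_one_closed[OF A U] z]) simp
    moreover have "z \<in> carrier (mod_sec M n U)" using z G by blast
    ultimately show ?thesis by (simp add: act_one[OF M U])
  qed
qed

lemma submodule_gen_res:
  assumes A: "graded_algebra S A" and M: "graded_premodule S A M" and U: "openin (top_of S) U"
    and V: "openin (top_of S) V" "V \<subseteq> U" and G: "\<forall>j. G j \<subseteq> carrier (mod_sec M j U)"
    and z: "z \<in> submodule_gen A M U G n"
    and H: "\<forall>j. H j \<subseteq> carrier (mod_sec M j V)" "\<And>j y. y \<in> G j \<Longrightarrow> res (piece M j) U V y \<in> H j"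
  shows "res (piece M n) U V z \<in> submodule_gen A M V H n"
  using M U z G
proof (induction rule: submodule_gen_induct)
  case zero
  then show ?case unfolding psh_zero[OF gpm_psh[OF M] U V] by (rule submodule_gen_zero[OF A M V(1) H(1)])
next
  case (gen k j x y)
  have y: "y \<in> carrier (mod_sec M j U)" using gen G by blast
  show ?case unfolding act_res[OF M U gen(1)[symmetric] V gen(2) y]
    by (rule submodule_gen_incl[OF A M V(1) H(1) gen(1) psh_res[OF alg_psh[OF A] U V gen(2)] H(2)[OF gen(3)]])
next
  case (add y z)
  then show ?case unfolding psh_add[OF gpm_psh[OF M] U V add(1,2)]
    by (intro submodule_gen_add[OF A M V(1) H(1)])
next
  case (minus y)
  then show ?case unfolding psh_minus[OF gpm_psh[OF M] U V minus(1)]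
    by (intro submodule_gen_minus[OF A M V(1) H(1)])
qed

text \<open>By associativity, acting on a generating product changes only its algebra
  factor.\<close>

lemma submodule_gen_act:
  assumes A: "graded_algebra S A" and M: "graded_premodule S A M" and U: "openin (top_of S) U"
    and G: "\<forall>j. G j \<subseteq> carrier (mod_sec M j U)"
    and z: "z \<in> submodule_gen A M U G n" and a: "a \<in> carrier (alg_sec A i U)" and l: "l = i + n"
  shows "act M i n U a z \<in> submodule_gen A M U G l"
  using M U z G
proof (induction rule: submodule_gen_induct)
  case zero
  then show ?case unfolding act_zero_right[OF M U l a] by (rule submodule_gen_zero[OF A M U G])
next
  case (gen k j x y)
  have y: "y \<in> carrier (mod_sec M j U)" using gen G by blast
  have "act M i n U a (act M k j U x y) = act M (i + k) j U (alg_mult A i k U a x) y"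
    using act_assoc[OF M U refl gen(1)[symmetric] a gen(2) y] by simp
  also have "\<dots> \<in> submodule_gen A M U G l"
    by (rule submodule_gen_incl[OF A M U G _ alg_mult_closed[OF A U refl a gen(2)] gen(3)]) (use gen l in simp)
  finally show ?case .
next
  case (add y z)
  then show ?case unfolding act_add_right[OF M U l a add(1,2)]
    by (intro submodule_gen_add[OF A M U G])
next
  case (minus y)
  then show ?case unfolding act_minus_right[OF M U l a minus(1)]
    by (intro submodule_gen_minus[OF A M U G])
qed

text \<open>Transitivity of generation, where membership of the generators may require shrinking the
  neighbourhood of \<open>x\<close>; only finitely many generators are involved in a given element.\<close>

lemma submodule_gen_locally_trans:
  assumes A: "graded_algebra S A" and M: "graded_premodule S A M" and U: "openin (top_of S) U" "x \<in> U"
    and G: "\<forall>j. G j \<subseteq> carrier (mod_sec M j U)"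
    and z: "z \<in> submodule_gen A M U G n"
    and H: "\<And>W j. openin (top_of S) W \<Longrightarrow> W \<subseteq> U \<Longrightarrow> H W j \<subseteq> carrier (mod_sec M j W)"
      "\<And>V W j y. openin (top_of S) V \<Longrightarrow> openin (top_of S) W \<Longrightarrow> W \<subseteq> V \<Longrightarrow> V \<subseteq> U \<Longrightarrow> y \<in> H V j \<Longrightarrow>
        res (piece M j) V W y \<in> H W j"
    and loc: "\<And>j y. y \<in> G j \<Longrightarrow> \<exists>W. openin (top_of S) W \<and> x \<in> W \<and> W \<subseteq> U \<and>
        res (piece M j) U W y \<in> submodule_gen A M W (H W) j"
  shows "\<exists>W. openin (top_of S) W \<and> x \<in> W \<and> W \<subseteq> U \<and> res (piece M n) U W z \<in> submodule_gen A M W (H W) n"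
  using M U(1) z G
proof (induction rule: submodule_gen_induct)
  case zero
  have "\<zero>\<^bsub>mod_sec M n U\<^esub> \<in> submodule_gen A M U (H U) n"
    by (rule submodule_gen_zero[OF A M U(1)]) (use H(1)[OF U(1)] in simp)
  then show ?case using U psh_zero[OF gpm_psh[OF M] U(1) U(1)] by auto
next
  case (gen k j a y)
  have y: "y \<in> carrier (mod_sec M j U)" using gen G by blast
  obtain W where W: "openin (top_of S) W" "x \<in> W" "W \<subseteq> U"
    and m: "res (piece M j) U W y \<in> submodule_gen A M W (H W) j" using loc[OF gen(3)] by blast
  have "res (piece M n) U W (act M k j U a y) \<in> submodule_gen A M W (H W) n"
    unfolding act_res[OF M U(1) gen(1)[symmetric] W(1,3) gen(2) y]
    by (rule submodule_gen_act[OF A M W(1) _ m psh_res[OF alg_psh[OF A] U(1) W(1,3) gen(2)] gen(1)[symmetric]])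
      (use H(1)[OF W(1,3)] in simp)
  then show ?case using W by blast
next
  case (add y z)
  obtain V where V: "openin (top_of S) V" "x \<in> V" "V \<subseteq> U"
    and y: "res (piece M n) U V y \<in> submodule_gen A M V (H V) n" using add by blast
  obtain V' where V': "openin (top_of S) V'" "x \<in> V'" "V' \<subseteq> U"
    and z: "res (piece M n) U V' z \<in> submodule_gen A M V' (H V') n" using add by blast
  \<comment> \<open>The summands become generated on different neighbourhoods. On the intersection
    both stay generated, since \<open>H\<close> is stable under restriction.\<close>
  define W where "W = V \<inter> V'"
  have W: "openin (top_of S) W" "x \<in> W" "W \<subseteq> U" "W \<subseteq> V" "W \<subseteq> V'" using V V' by (auto simp: W_def)
  have HW: "\<forall>j. H W j \<subseteq> carrier (mod_sec M j W)" using H(1)[OF W(1,3)] by simp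
  have "res (piece M n) V W (res (piece M n) U V y) \<in> submodule_gen A M W (H W) n"
    by (rule submodule_gen_res[OF A M V(1) W(1,4) _ y HW]) (use H(1)[OF V(1,3)] H(2)[OF V(1) W(1,4) V(3)] in simp_all)
  moreover have "res (piece M n) V' W (res (piece M n) U V' z) \<in> submodule_gen A M W (H W) n"
    by (rule submodule_gen_res[OF A M V'(1) W(1,5) _ z HW]) (use H(1)[OF V'(1,3)] H(2)[OF V'(1) W(1,5) V'(3)] in simp_all)
  ultimately have "res (piece M n) U W (y \<oplus>\<^bsub>mod_sec M n U\<^esub> z) \<in> submodule_gen A M W (H W) n"
    unfolding psh_add[OF gpm_psh[OF M] U(1) W(1,3) add(1,2)]
      psh_comp[OF gpm_psh[OF M] U(1) V(1) W(1,4) V(3) add(1)] psh_comp[OF gpm_psh[OF M] U(1) V'(1) W(1,5) V'(3) add(2)]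
    by (rule submodule_gen_add[OF A M W(1) HW])
  then show ?case using W by blast
next
  case (minus y)
  then obtain W where W: "openin (top_of S) W" "x \<in> W" "W \<subseteq> U"
    and y: "res (piece M n) U W y \<in> submodule_gen A M W (H W) n" by blast
  have "res (piece M n) U W (\<ominus>\<^bsub>mod_sec M n U\<^esub> y) \<in> submodule_gen A M W (H W) n"
    unfolding psh_minus[OF gpm_psh[OF M] U(1) W(1,3) minus(1)]
    by (rule submodule_gen_minus[OF A M W(1) _ y]) (use H(1)[OF W(1,3)] in simp)
  then show ?case using W by blast
qed

section \<open>Truncations of a graded module\<close>

abbreviation truncation_gens :: "('x, 'r, 'a, 'm) graded_mod \<Rightarrow> int \<Rightarrow> 'x set \<Rightarrow> int \<Rightarrow> 'm set" where
  "truncation_gens D m V \<equiv> (\<lambda>i. if m \<le> - i then carrier (mod_sec D i V) else {})"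

lemma Delta_sec: "mod_sec (Delta S A m D) n U = (mod_sec D n U)\<lparr>carrier :=
     {z \<in> carrier (mod_sec D n U). \<forall>x\<in>U. \<exists>V\<in>opens S U. x \<in> V \<and>
        res (piece D n) U V z \<in> submodule_gen A D V (truncation_gens D m V) n}\<rparr>"
  and Delta_res: "res (piece (Delta S A m D) n) = res (piece D n)"
  by (simp_all add: Delta_def)

lemma Delta_carrier_iff: "z \<in> carrier (mod_sec (Delta S A m D) n U) \<longleftrightarrow> z \<in> carrier (mod_sec D n U) \<and>
    (\<forall>x\<in>U. \<exists>V. openin (top_of S) V \<and> V \<subseteq> U \<and> x \<in> V \<and>
        res (piece D n) U V z \<in> submodule_gen A D V (truncation_gens D m V) n)"
  by (auto simp: Delta_sec)

lemma truncation_gens_carrier: "\<forall>j. truncation_gens D m V j \<subseteq> carrier (mod_sec D j V)"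
  by simp

lemma truncation_gens_res: "graded_premodule S A D \<Longrightarrow> openin (top_of S) U \<Longrightarrow> openin (top_of S) V \<Longrightarrow> V \<subseteq> U \<Longrightarrow>
    y \<in> truncation_gens D m U j \<Longrightarrow> res (piece D j) U V y \<in> truncation_gens D m V j"
  using psh_res[OF gpm_psh] by (auto split: if_splits)

lemma truncation_gen_res:
  assumes A: "graded_algebra S A" and D: "graded_premodule S A D" and U: "openin (top_of S) U"
    and V: "openin (top_of S) V" "V \<subseteq> U" and W: "openin (top_of S) W" "W \<subseteq> V" and z: "z \<in> carrier (mod_sec D n U)"
    and g: "res (piece D n) U V z \<in> submodule_gen A D V (truncation_gens D m V) n"
  shows "res (piece D n) U W z \<in> submodule_gen A D W (truncation_gens D m W) n"
  using submodule_gen_res[OF A D V(1) W truncation_gens_carrier g truncation_gens_carrier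
      truncation_gens_res[OF D V(1) W]]
  unfolding psh_comp[OF gpm_psh[OF D] U V(1) W V(2) z] .

text \<open>The carrier is cut out by a local condition, so closure is proved near each point: for a
  sum, the neighbourhoods of the two summands are intersected first, and then closure of the
  generated submodule applies.\<close>

lemma Delta_submodule:
  assumes SR: "is_ringed_space S" and A: "graded_algebra S A" and D: "graded_premodule S A D" and U: "openin (top_of S) U"
  shows "submodule (carrier (mod_sec (Delta S A m D) n U)) (O_sec S U) (mod_sec D n U)"
proof -
  interpret module "O_sec S U" "mod_sec D n U" using psh_module[OF gpm_psh[OF D] U] .
  note P = gpm_psh[OF D]
  let ?C = "carrier (mod_sec (Delta S A m D) n U)"
  note mem = Delta_carrier_iff[of _ S A m D n U]
  note tc = truncation_gens_carrier
  show ?thesis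
  proof (rule submoduleI)
    show "?C \<subseteq> carrier (mod_sec D n U)" by (auto simp: Delta_sec)
    show "\<zero>\<^bsub>mod_sec D n U\<^esub> \<in> ?C"
      unfolding mem
    proof (intro conjI ballI exI)
      show "res (piece D n) U U \<zero>\<^bsub>mod_sec D n U\<^esub> \<in> submodule_gen A D U (truncation_gens D m U) n"
        unfolding psh_zero[OF P U U subset_refl] by (rule submodule_gen_zero[OF A D U tc])
    qed (use U in simp_all)
  next
    fix y assume y: "y \<in> ?C"
    then have yc: "y \<in> carrier (mod_sec D n U)" by (simp add: mem)
    show "\<ominus>\<^bsub>mod_sec D n U\<^esub> y \<in> ?C" unfolding mem
    proof (intro conjI ballI)
      show "\<ominus>\<^bsub>mod_sec D n U\<^esub> y \<in> carrier (mod_sec D n U)" using yc by simp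
      fix x assume "x \<in> U"
      then obtain V where V: "openin (top_of S) V" "V \<subseteq> U" "x \<in> V"
        and g: "res (piece D n) U V y \<in> submodule_gen A D V (truncation_gens D m V) n" using y mem by blast
      show "\<exists>V. openin (top_of S) V \<and> V \<subseteq> U \<and> x \<in> V \<and>
        res (piece D n) U V (\<ominus>\<^bsub>mod_sec D n U\<^esub> y) \<in> submodule_gen A D V (truncation_gens D m V) n"
      proof (intro exI[of _ V] conjI V)
        show "res (piece D n) U V (\<ominus>\<^bsub>mod_sec D n U\<^esub> y) \<in> submodule_gen A D V (truncation_gens D m V) n"
          unfolding psh_minus[OF P U V(1,2) yc] by (rule submodule_gen_minus[OF A D V(1) tc g])
      qed
    qed
    fix r assume r: "r \<in> carrier (O_sec S U)"
    show "r \<odot>\<^bsub>mod_sec D n U\<^esub> y \<in> ?C" unfolding mem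
    proof (intro conjI ballI)
      show "r \<odot>\<^bsub>mod_sec D n U\<^esub> y \<in> carrier (mod_sec D n U)" using yc r by simp
      fix x assume "x \<in> U"
      then obtain V where V: "openin (top_of S) V" "V \<subseteq> U" "x \<in> V"
        and g: "res (piece D n) U V y \<in> submodule_gen A D V (truncation_gens D m V) n" using y mem by blast
      have r': "O_res S U V r \<in> carrier (O_sec S V)" by (rule rs_res[OF SR U V(1,2) r])
      show "\<exists>V. openin (top_of S) V \<and> V \<subseteq> U \<and> x \<in> V \<and>
        res (piece D n) U V (r \<odot>\<^bsub>mod_sec D n U\<^esub> y) \<in> submodule_gen A D V (truncation_gens D m V) n"
      proof (intro exI[of _ V] conjI V)
        show "res (piece D n) U V (r \<odot>\<^bsub>mod_sec D n U\<^esub> y) \<in> submodule_gen A D V (truncation_gens D m V) n"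
          unfolding psh_smult[OF P U V(1,2) r yc] by (rule submodule_gen_smult[OF A D V(1) tc r' g])
      qed
    qed
  next
    fix y z assume y: "y \<in> ?C" and z: "z \<in> ?C"
    then have yc: "y \<in> carrier (mod_sec D n U)" and zc: "z \<in> carrier (mod_sec D n U)" by (simp_all add: mem)
    show "y \<oplus>\<^bsub>mod_sec D n U\<^esub> z \<in> ?C" unfolding mem
    proof (intro conjI ballI)
      show "y \<oplus>\<^bsub>mod_sec D n U\<^esub> z \<in> carrier (mod_sec D n U)" using yc zc by simp
      fix x assume x: "x \<in> U"
      obtain V where V: "openin (top_of S) V" "V \<subseteq> U" "x \<in> V"
        and g: "res (piece D n) U V y \<in> submodule_gen A D V (truncation_gens D m V) n" using x y mem by blast
      obtain V' where V': "openin (top_of S) V'" "V' \<subseteq> U" "x \<in> V'"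
        and g': "res (piece D n) U V' z \<in> submodule_gen A D V' (truncation_gens D m V') n" using x z mem by blast
      define W where "W = V \<inter> V'"
      have W: "openin (top_of S) W" "x \<in> W" "W \<subseteq> U" "W \<subseteq> V" "W \<subseteq> V'" using V V' by (auto simp: W_def)
      have "res (piece D n) U W (y \<oplus>\<^bsub>mod_sec D n U\<^esub> z) \<in> submodule_gen A D W (truncation_gens D m W) n"
        unfolding psh_add[OF P U W(1,3) yc zc]
        by (rule submodule_gen_add[OF A D W(1) tc truncation_gen_res[OF A D U V(1,2) W(1,4) yc g]
              truncation_gen_res[OF A D U V'(1,2) W(1,5) zc g']])
      then show "\<exists>V. openin (top_of S) V \<and> V \<subseteq> U \<and> x \<in> V \<and>
        res (piece D n) U V (y \<oplus>\<^bsub>mod_sec D n U\<^esub> z) \<in> submodule_gen A D V (truncation_gens D m V) n"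
        by (intro exI[of _ W] conjI W)
    qed
  qed
qed

text \<open>\<open>Delta\<close> changes carriers only, so the laws are inherited from
  \<open>D\<close>. What remains is that the local condition survives restriction to
  \<open>V\<close>, for which each witnessing neighbourhood is intersected with
  \<open>V\<close>.\<close>

lemma Delta_presheaf:
  assumes S: "is_ringed_space S" and A: "graded_algebra S A" and D: "graded_premodule S A D"
  shows "presheaf_of_modules S (piece (Delta S A m D) n)"
proof -
  note P = gpm_psh[OF D, of n]
  let ?C = "\<lambda>U. carrier (mod_sec (Delta S A m D) n U)"
  have sub: "?C U \<subseteq> carrier (mod_sec D n U)" for U by (auto simp: Delta_sec)
  have up: "mod_sec (Delta S A m D) n U = (mod_sec D n U)\<lparr>carrier := ?C U\<rparr>" for U by (simp add: Delta_sec)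
  have md: "module (O_sec S U) (mod_sec (Delta S A m D) n U)" if "openin (top_of S) U" for U
    using submodule.submodule_is_module[OF Delta_submodule[OF S A D that] psh_module[OF P that], of m]
    unfolding up[symmetric] .
  have cl: "res (piece D n) U V z \<in> ?C V"
    if U: "openin (top_of S) U" and V: "openin (top_of S) V" "V \<subseteq> U" and z: "z \<in> ?C U" for U V z
  proof -
    have zc: "z \<in> carrier (mod_sec D n U)" using z sub by blast
    have "\<exists>W. openin (top_of S) W \<and> W \<subseteq> V \<and> x \<in> W \<and> res (piece D n) V W (res (piece D n) U V z) \<in>
        submodule_gen A D W (truncation_gens D m W) n" if x: "x \<in> V" for x
    proof -
      obtain Y where Y: "openin (top_of S) Y" "Y \<subseteq> U" "x \<in> Y"
        and g: "res (piece D n) U Y z \<in> submodule_gen A D Y (truncation_gens D m Y) n"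
        using z x V unfolding Delta_carrier_iff by blast
      define W where "W = V \<inter> Y"
      have W: "openin (top_of S) W" "x \<in> W" "W \<subseteq> V" "W \<subseteq> Y" using V Y x by (auto simp: W_def)
      have "res (piece D n) V W (res (piece D n) U V z) \<in> submodule_gen A D W (truncation_gens D m W) n"
        unfolding psh_comp[OF P U V(1) W(1,3) V(2) zc] by (rule truncation_gen_res[OF A D U Y(1,2) W(1,4) zc g])
      then show ?thesis using W by blast
    qed
    then show ?thesis unfolding Delta_carrier_iff using psh_res[OF P U V zc] by blast
  qed
  have op: "y \<oplus>\<^bsub>mod_sec (Delta S A m D) n U\<^esub> z = y \<oplus>\<^bsub>mod_sec D n U\<^esub> z"
    "r \<odot>\<^bsub>mod_sec (Delta S A m D) n U\<^esub> z = r \<odot>\<^bsub>mod_sec D n U\<^esub> z" for y z r U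
    by (simp_all add: Delta_sec)
  show ?thesis unfolding presheaf_of_modules_def Delta_res op functorial_def
  proof (intro conjI allI impI ballI md funcsetI, goal_cases)
    case (1 U) then show ?case .
  next
    case (2 U V z) then show ?case using cl by blast
  next
    case (3 U z) then show ?case using psh_id[OF P] sub by blast
  next
    case (4 U V W z) then show ?case using psh_comp[OF P] sub by blast
  next
    case (5 U V y z)
    have "y \<in> carrier (mod_sec D n U)" "z \<in> carrier (mod_sec D n U)" using 5 sub by blast+
    then show ?case using psh_add[OF P] 5 by simp
  next
    case (6 U V r z)
    have "z \<in> carrier (mod_sec D n U)" using 6 sub by blast
    then show ?case using psh_smult[OF P] 6 by simp
  qed
qed

text \<open>A finite sum formally depends on the whole module record, including the smaller carrier.
  Viewing the identity as an additive map from the truncation to \<open>D\<close> shows that the two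
  sums agree; this lets independence pass between the two modules.\<close>

lemma Delta_lincomb:
  assumes S: "is_ringed_space S" and A: "graded_algebra S A" and D: "graded_premodule S A D"
    and U: "openin (top_of S) U" and c: "c \<in> J \<rightarrow> carrier (O_sec S U)"
    and e: "e \<in> J \<rightarrow> carrier (mod_sec (Delta S A m D) n U)"
  shows "(\<Oplus>\<^bsub>mod_sec (Delta S A m D) n U\<^esub>j\<in>J. c j \<odot>\<^bsub>mod_sec (Delta S A m D) n U\<^esub> e j) =
    (\<Oplus>\<^bsub>mod_sec D n U\<^esub>j\<in>J. c j \<odot>\<^bsub>mod_sec D n U\<^esub> e j)"
proof -
  interpret E: module "O_sec S U" "mod_sec (Delta S A m D) n U"
    using psh_module[OF Delta_presheaf[OF S A D] U] .
  interpret D: module "O_sec S U" "mod_sec D n U" using psh_module[OF gpm_psh[OF D] U] .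
  have "(\<lambda>j. c j \<odot>\<^bsub>mod_sec (Delta S A m D) n U\<^esub> e j) \<in> J \<rightarrow> carrier (mod_sec (Delta S A m D) n U)"
    using c e by (auto simp: Pi_iff)
  from E.hom_finsum_to[OF D.abelian_monoid_axioms _ _ _ this, of "\<lambda>z. z"] show ?thesis
    by (simp add: Delta_sec)
qed

section \<open>Stalks and sheafification\<close>

text \<open>Stated for two sheaves with values in a third, this covers both the addition and the scalar
  multiplication on stalks.\<close>

lemma germ_binary:
  assumes F: "functorial T F \<rho>" and G: "functorial T G \<sigma>" and H: "functorial T H \<tau>"
    and f: "\<And>U s t. openin T U \<Longrightarrow> s \<in> F U \<Longrightarrow> t \<in> G U \<Longrightarrow> f U s t \<in> H U"
    and fr: "\<And>U V s t. openin T U \<Longrightarrow> openin T V \<Longrightarrow> V \<subseteq> U \<Longrightarrow> s \<in> F U \<Longrightarrow> t \<in> G U \<Longrightarrow>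
      \<tau> U V (f U s t) = f V (\<rho> U V s) (\<sigma> U V t)"
    and U: "openin T U" "x \<in> U" and s: "s \<in> F U" and t: "t \<in> G U"
  shows "(\<Union>(V, s)\<in>germ T F \<rho> x U s. \<Union>(W, t)\<in>germ T G \<sigma> x U t.
      germ T H \<tau> x (V \<inter> W) (f (V \<inter> W) (\<rho> V (V \<inter> W) s) (\<sigma> W (V \<inter> W) t))) = germ T H \<tau> x U (f U s t)"
    (is "?L = ?R")
proof -
  have eq: "germ T H \<tau> x (V \<inter> W) (f (V \<inter> W) (\<rho> V (V \<inter> W) s') (\<sigma> W (V \<inter> W) t')) = ?R"
    if s': "(V, s') \<in> germ T F \<rho> x U s" and t': "(W, t') \<in> germ T G \<sigma> x U t" for V s' W t'
  proof -
    obtain Y where V: "openin T V" "x \<in> V" "s' \<in> F V" and Y: "openin T Y" "x \<in> Y" "Y \<subseteq> U \<inter> V" "\<rho> U Y s = \<rho> V Y s'"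
      using s' by (auto simp: germ_def)
    obtain Z where W: "openin T W" "x \<in> W" "t' \<in> G W" and Z: "openin T Z" "x \<in> Z" "Z \<subseteq> U \<inter> W" "\<sigma> U Z t = \<sigma> W Z t'"
      using t' by (auto simp: germ_def)
    define X where "X = Y \<inter> Z"
    have X: "openin T X" "x \<in> X" "X \<subseteq> Y" "X \<subseteq> Z" "X \<subseteq> U" "X \<subseteq> V" "X \<subseteq> W" "X \<subseteq> V \<inter> W"
      using Y Z by (auto simp: X_def)
    have VW: "openin T (V \<inter> W)" using V W by blast
    have YU: "Y \<subseteq> U" "Y \<subseteq> V" "Z \<subseteq> U" "Z \<subseteq> W" using Y Z by auto
    have s1: "\<rho> V (V \<inter> W) s' \<in> F (V \<inter> W)" using functorial_res[OF F V(1) VW _ V(3)] by simp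
    have t1: "\<sigma> W (V \<inter> W) t' \<in> G (V \<inter> W)" using functorial_res[OF G W(1) VW _ W(3)] by simp
    have "\<rho> (V \<inter> W) X (\<rho> V (V \<inter> W) s') = \<rho> V X s'"
      by (rule functorial_comp[OF F V(1) VW X(1,8) _ V(3)]) simp
    also have "\<dots> = \<rho> U X s"
      using functorial_comp[OF F V(1) Y(1) X(1,3) YU(2) V(3)] functorial_comp[OF F U(1) Y(1) X(1,3) YU(1) s] Y(4) by simp
    finally have 1: "\<rho> (V \<inter> W) X (\<rho> V (V \<inter> W) s') = \<rho> U X s" .
    have "\<sigma> (V \<inter> W) X (\<sigma> W (V \<inter> W) t') = \<sigma> W X t'"
      by (rule functorial_comp[OF G W(1) VW X(1,8) _ W(3)]) simp
    also have "\<dots> = \<sigma> U X t"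
      using functorial_comp[OF G W(1) Z(1) X(1,4) YU(4) W(3)] functorial_comp[OF G U(1) Z(1) X(1,4) YU(3) t] Z(4) by simp
    finally have 2: "\<sigma> (V \<inter> W) X (\<sigma> W (V \<inter> W) t') = \<sigma> U X t" .
    show ?thesis
    proof (rule germ_eqI[OF H VW f[OF VW s1 t1] U(1) f[OF U(1) s t] X(1,2)])
      show "X \<subseteq> V \<inter> W \<inter> U" using X by blast
      show "\<tau> (V \<inter> W) X (f (V \<inter> W) (\<rho> V (V \<inter> W) s') (\<sigma> W (V \<inter> W) t')) = \<tau> U X (f U s t)"
        unfolding fr[OF VW X(1,8) s1 t1] fr[OF U(1) X(1,5) s t] 1 2 by (rule refl)
    qed
  qed
  have "?L = (\<Union>(V, s)\<in>germ T F \<rho> x U s. \<Union>(W, t)\<in>germ T G \<sigma> x U t. ?R)"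
    by (intro SUP_cong refl) (auto simp: eq)
  also have "\<dots> = ?R"
    using germ_self[OF F U(1) s U(2)] germ_self[OF G U(1) t U(2)] by auto
  finally show ?thesis .
qed

lemma germ_restrict:
  assumes "functorial T F \<rho>" "openin T U" "s \<in> F U" "openin T V" "V \<subseteq> U" "x \<in> V"
  shows "germ T F \<rho> x V (\<rho> U V s) = germ T F \<rho> x U s"
  using functorial_res[OF assms(1,2,4,5,3)] assms
  by (intro germ_eqI[where W=V]) (auto simp: functorial_id)

context
  fixes S :: "('x, 'r) ringed_space" and F :: "('x, 'r, 'm) mod_sheaf"
  assumes SR: "is_ringed_space S" and P: "presheaf_of_modules S F"
begin

lemma stalk_add:
  assumes "openin (top_of S) U" "x \<in> U" "s \<in> carrier (sec F U)" "t \<in> carrier (sec F U)"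
  shows "mod_germ S F x U s \<oplus>\<^bsub>mod_stalk S F x\<^esub> mod_germ S F x U t = mod_germ S F x U (s \<oplus>\<^bsub>sec F U\<^esub> t)"
proof -
  have c: "s \<oplus>\<^bsub>sec F U\<^esub> t \<in> carrier (sec F U)"
    if "openin (top_of S) U" "s \<in> carrier (sec F U)" "t \<in> carrier (sec F U)" for U s t
  proof -
    interpret module "O_sec S U" "sec F U" using psh_module[OF P that(1)] .
    show ?thesis using that by simp
  qed
  show ?thesis
    using germ_binary[OF psh_functorial[OF P] psh_functorial[OF P] psh_functorial[OF P],
        of "\<lambda>U. ring.add (sec F U)", OF c psh_add[OF P] assms]
    by (simp add: mod_stalk_def germ_op_def)
qed

lemma stalk_smult:
  assumes "openin (top_of S) U" "x \<in> U" "r \<in> carrier (O_sec S U)" "t \<in> carrier (sec F U)"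
  shows "O_germ S x U r \<odot>\<^bsub>mod_stalk S F x\<^esub> mod_germ S F x U t = mod_germ S F x U (r \<odot>\<^bsub>sec F U\<^esub> t)"
proof -
  have c: "r \<odot>\<^bsub>sec F U\<^esub> t \<in> carrier (sec F U)"
    if "openin (top_of S) U" "r \<in> carrier (O_sec S U)" "t \<in> carrier (sec F U)" for U r t
  proof -
    interpret module "O_sec S U" "sec F U" using psh_module[OF P that(1)] .
    show ?thesis using that by simp
  qed
  show ?thesis
    using germ_binary[OF rs_functorial[OF SR] psh_functorial[OF P] psh_functorial[OF P],
        of "\<lambda>U. smult (sec F U)", OF c psh_smult[OF P] assms]
    by (simp add: mod_stalk_def)
qed

lemma stalk_carrier: "k \<in> carrier (mod_stalk S F x) \<longleftrightarrow>
    (\<exists>U s. openin (top_of S) U \<and> x \<in> U \<and> s \<in> carrier (sec F U) \<and> k = mod_germ S F x U s)"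
  by (auto simp: mod_stalk_def germs_def)

lemma stalk_carrierI: "openin (top_of S) U \<Longrightarrow> x \<in> U \<Longrightarrow> s \<in> carrier (sec F U) \<Longrightarrow>
    mod_germ S F x U s \<in> carrier (mod_stalk S F x)"
  unfolding stalk_carrier by blast

text \<open>\<open>mod_stalk\<close> takes its zero from the global sections; restriction shows that
  the zero section over any neighbourhood has the same germ.\<close>

lemma stalk_zero:
  assumes U: "openin (top_of S) U" "x \<in> U"
  shows "\<zero>\<^bsub>mod_stalk S F x\<^esub> = mod_germ S F x U \<zero>\<^bsub>sec F U\<^esub>"
proof -
  have o: "openin (top_of S) (points S)" "U \<subseteq> points S" using openin_subset[OF U(1)] by simp_all
  interpret module "O_sec S (points S)" "sec F (points S)" using psh_module[OF P o(1)] .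
  have "mod_germ S F x U (res F (points S) U \<zero>\<^bsub>sec F (points S)\<^esub>) = mod_germ S F x (points S) \<zero>\<^bsub>sec F (points S)\<^esub>"
    by (rule germ_restrict[OF psh_functorial[OF P] o(1) _ U(1) o(2) U(2)]) simp
  then show ?thesis unfolding psh_zero[OF P o(1) U(1) o(2)] by (simp add: mod_stalk_def)
qed

lemma stalk_common:
  assumes "k \<in> carrier (mod_stalk S F x)" "l \<in> carrier (mod_stalk S F x)"
  obtains U s t where "openin (top_of S) U" "x \<in> U" "s \<in> carrier (sec F U)" "t \<in> carrier (sec F U)"
    "k = mod_germ S F x U s" "l = mod_germ S F x U t"
proof -
  obtain U s where U: "openin (top_of S) U" "x \<in> U" "s \<in> carrier (sec F U)" "k = mod_germ S F x U s"
    using assms(1) unfolding stalk_carrier by blast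
  obtain V t where V: "openin (top_of S) V" "x \<in> V" "t \<in> carrier (sec F V)" "l = mod_germ S F x V t"
    using assms(2) unfolding stalk_carrier by blast
  have o: "openin (top_of S) (U \<inter> V)" "x \<in> U \<inter> V" "U \<inter> V \<subseteq> U" "U \<inter> V \<subseteq> V" using U V by auto
  show thesis
    by (rule that[OF o(1,2) psh_res[OF P U(1) o(1,3) U(3)] psh_res[OF P V(1) o(1,4) V(3)]])
      (simp_all only: U(4) V(4) germ_restrict[OF psh_functorial[OF P] U(1,3) o(1,3,2)]
        germ_restrict[OF psh_functorial[OF P] V(1,3) o(1,4,2)])
qed

text \<open>An abelian monoid is enough for the finite sums of germs in which expansions are
  compared; for this reason \<open>hom_finsum_to\<close> asks no more of its target. Associativity
  requires three germs represented over one open set, hence the second intersection.\<close>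

lemma stalk_abelian_monoid:
  assumes x: "x \<in> points S"
  shows "abelian_monoid (mod_stalk S F x)"
proof (rule abelian_monoidI)
  have "\<zero>\<^bsub>sec F (points S)\<^esub> \<in> carrier (sec F (points S))"
  proof -
    interpret module "O_sec S (points S)" "sec F (points S)" using psh_module[OF P openin_topspace] .
    show ?thesis by simp
  qed
  then show "\<zero>\<^bsub>mod_stalk S F x\<^esub> \<in> carrier (mod_stalk S F x)"
    unfolding stalk_zero[OF openin_topspace x] by (rule stalk_carrierI[OF openin_topspace x])
next
  fix k l assume "k \<in> carrier (mod_stalk S F x)" "l \<in> carrier (mod_stalk S F x)"
  then obtain U s t where U: "openin (top_of S) U" "x \<in> U" "s \<in> carrier (sec F U)" "t \<in> carrier (sec F U)"
    and kl: "k = mod_germ S F x U s" "l = mod_germ S F x U t" by (rule stalk_common)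
  interpret module "O_sec S U" "sec F U" using psh_module[OF P U(1)] .
  show "k \<oplus>\<^bsub>mod_stalk S F x\<^esub> l \<in> carrier (mod_stalk S F x)"
    unfolding kl stalk_add[OF U] by (rule stalk_carrierI[OF U(1,2) M.a_closed[OF U(3,4)]])
  show "k \<oplus>\<^bsub>mod_stalk S F x\<^esub> l = l \<oplus>\<^bsub>mod_stalk S F x\<^esub> k"
    unfolding kl stalk_add[OF U] stalk_add[OF U(1,2,4,3)] M.a_comm[OF U(3,4)] by (rule refl)
next
  fix k assume "k \<in> carrier (mod_stalk S F x)"
  then obtain U s where U: "openin (top_of S) U" "x \<in> U" "s \<in> carrier (sec F U)" and k: "k = mod_germ S F x U s"
    unfolding stalk_carrier by blast
  interpret module "O_sec S U" "sec F U" using psh_module[OF P U(1)] .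
  show "\<zero>\<^bsub>mod_stalk S F x\<^esub> \<oplus>\<^bsub>mod_stalk S F x\<^esub> k = k"
    unfolding k stalk_zero[OF U(1,2)] stalk_add[OF U(1,2) M.zero_closed U(3)] M.l_zero[OF U(3)] by (rule refl)
next
  fix k l m assume "k \<in> carrier (mod_stalk S F x)" "l \<in> carrier (mod_stalk S F x)" and m: "m \<in> carrier (mod_stalk S F x)"
  then obtain U s t where U: "openin (top_of S) U" "x \<in> U" "s \<in> carrier (sec F U)" "t \<in> carrier (sec F U)"
    and kl: "k = mod_germ S F x U s" "l = mod_germ S F x U t" using stalk_common by blast
  obtain V r where V: "openin (top_of S) V" "x \<in> V" "r \<in> carrier (sec F V)" "m = mod_germ S F x V r"
    using m unfolding stalk_carrier by blast
  define W where "W = U \<inter> V"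
  have W: "openin (top_of S) W" "x \<in> W" "W \<subseteq> U" "W \<subseteq> V" using U V by (auto simp: W_def)
  have g: "k = mod_germ S F x W (res F U W s)" "l = mod_germ S F x W (res F U W t)" "m = mod_germ S F x W (res F V W r)"
    unfolding kl V(4) using germ_restrict[OF psh_functorial[OF P] U(1) _ W(1,3,2)] U(3,4)
      germ_restrict[OF psh_functorial[OF P] V(1) _ W(1,4,2)] V(3) by simp_all
  note c = psh_res[OF P U(1) W(1,3) U(3)] psh_res[OF P U(1) W(1,3) U(4)] psh_res[OF P V(1) W(1,4) V(3)]
  interpret module "O_sec S W" "sec F W" using psh_module[OF P W(1)] .
  show "k \<oplus>\<^bsub>mod_stalk S F x\<^esub> l \<oplus>\<^bsub>mod_stalk S F x\<^esub> m = k \<oplus>\<^bsub>mod_stalk S F x\<^esub> (l \<oplus>\<^bsub>mod_stalk S F x\<^esub> m)"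
    unfolding g using c by (simp add: stalk_add[OF W(1,2)] M.a_assoc)
qed

section \<open>Sections of the sheafification\<close>

lemma sheafification_carrier: "s \<in> carrier (sec (sheafification S F) U) \<longleftrightarrow>
    s \<in> (\<Pi>\<^sub>E x\<in>U. carrier (mod_stalk S F x)) \<and>
    (\<forall>x\<in>U. \<exists>V z. openin (top_of S) V \<and> V \<subseteq> U \<and> x \<in> V \<and> z \<in> carrier (sec F V) \<and> (\<forall>y\<in>V. s y = mod_germ S F y V z))"
  by (simp add: sheafification_def) blast

lemma sheafification_carrierI:
  assumes U: "openin (top_of S) U"
    and loc: "\<And>x. x \<in> U \<Longrightarrow> \<exists>V z. openin (top_of S) V \<and> V \<subseteq> U \<and> x \<in> V \<and> z \<in> carrier (sec F V) \<and>
      (\<forall>y\<in>V. f y = mod_germ S F y V z)"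
  shows "(\<lambda>x\<in>U. f x) \<in> carrier (sec (sheafification S F) U)"
  unfolding sheafification_carrier
proof (intro conjI ballI)
  have "f x \<in> carrier (mod_stalk S F x)" if x: "x \<in> U" for x
  proof -
    obtain V z where V: "openin (top_of S) V" "x \<in> V" "z \<in> carrier (sec F V)" "f x = mod_germ S F x V z"
      using loc[OF x] by blast
    show ?thesis unfolding V(4) by (rule stalk_carrierI[OF V(1-3)])
  qed
  then show "(\<lambda>x\<in>U. f x) \<in> (\<Pi>\<^sub>E x\<in>U. carrier (mod_stalk S F x))" by simp
  fix x assume x: "x \<in> U"
  obtain V z where V: "openin (top_of S) V" "V \<subseteq> U" "x \<in> V" "z \<in> carrier (sec F V)" "\<forall>y\<in>V. f y = mod_germ S F y V z"
    using loc[OF x] by blast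
  have "\<forall>y\<in>V. (\<lambda>x\<in>U. f x) y = mod_germ S F y V z" using V by (simp add: subset_eq)
  then show "\<exists>V z. openin (top_of S) V \<and> V \<subseteq> U \<and> x \<in> V \<and> z \<in> carrier (sec F V) \<and>
      (\<forall>y\<in>V. (\<lambda>x\<in>U. f x) y = mod_germ S F y V z)" using V by blast
qed

lemma sheafification_local:
  assumes s: "s \<in> carrier (sec (sheafification S F) U)" and x: "x \<in> U"
  obtains V z where "openin (top_of S) V" "V \<subseteq> U" "x \<in> V" "z \<in> carrier (sec F V)" "\<And>y. y \<in> V \<Longrightarrow> s y = mod_germ S F y V z"
  using bspec[OF conjunct2[OF s[unfolded sheafification_carrier]] x] by (elim exE conjE) (rule that, assumption+, erule bspec)

lemma sheafification_val:
  assumes s: "s \<in> carrier (sec (sheafification S F) U)" and x: "x \<in> U"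
  shows "s x \<in> carrier (mod_stalk S F x)"
  by (rule PiE_mem[OF conjunct1[OF s[unfolded sheafification_carrier]] x])

lemma sheafification_ops:
  "\<zero>\<^bsub>sec (sheafification S F) U\<^esub> = (\<lambda>x\<in>U. \<zero>\<^bsub>mod_stalk S F x\<^esub>)"
  "s \<oplus>\<^bsub>sec (sheafification S F) U\<^esub> t = (\<lambda>x\<in>U. s x \<oplus>\<^bsub>mod_stalk S F x\<^esub> t x)"
  "r \<odot>\<^bsub>sec (sheafification S F) U\<^esub> s = (\<lambda>x\<in>U. O_germ S x U r \<odot>\<^bsub>mod_stalk S F x\<^esub> s x)"
  "res (sheafification S F) U V s = restrict s V"
  by (simp_all add: sheafification_def)

lemma sheafification_abelian_monoid:
  assumes U: "openin (top_of S) U"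
  shows "abelian_monoid (sec (sheafification S F) U)"
proof -
  have am: "abelian_monoid (mod_stalk S F x)" if "x \<in> U" for x
    using stalk_abelian_monoid openin_subset[OF U] that by blast
  note val = sheafification_val
  have ext: "s = (\<lambda>x\<in>U. s x)" if "s \<in> carrier (sec (sheafification S F) U)" for s
    using that unfolding sheafification_carrier PiE_def by (simp add: extensional_restrict)
  show ?thesis
  proof (rule abelian_monoidI)
    fix s t assume s: "s \<in> carrier (sec (sheafification S F) U)" and t: "t \<in> carrier (sec (sheafification S F) U)"
    show "s \<oplus>\<^bsub>sec (sheafification S F) U\<^esub> t \<in> carrier (sec (sheafification S F) U)"
      unfolding sheafification_ops
    proof (rule sheafification_carrierI[OF U])
      fix x assume x: "x \<in> U"
      obtain V z where V: "openin (top_of S) V" "V \<subseteq> U" "x \<in> V" "z \<in> carrier (sec F V)"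
        "\<And>y. y \<in> V \<Longrightarrow> s y = mod_germ S F y V z" using sheafification_local[OF s x] by blast
      obtain V' z' where V': "openin (top_of S) V'" "V' \<subseteq> U" "x \<in> V'" "z' \<in> carrier (sec F V')"
        "\<And>y. y \<in> V' \<Longrightarrow> t y = mod_germ S F y V' z'" using sheafification_local[OF t x] by blast
      define W where "W = V \<inter> V'"
      have W: "openin (top_of S) W" "W \<subseteq> U" "x \<in> W" "W \<subseteq> V" "W \<subseteq> V'" using V V' by (auto simp: W_def)
      note c = psh_res[OF P V(1) W(1,4) V(4)] psh_res[OF P V'(1) W(1,5) V'(4)]
      interpret module "O_sec S W" "sec F W" using psh_module[OF P W(1)] .
      have "s y \<oplus>\<^bsub>mod_stalk S F y\<^esub> t y = mod_germ S F y W (res F V W z \<oplus>\<^bsub>sec F W\<^esub> res F V' W z')"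
        if y: "y \<in> W" for y
      proof -
        have yV: "y \<in> V" "y \<in> V'" using y W by auto
        show ?thesis
          unfolding V(5)[OF yV(1)] V'(5)[OF yV(2)] stalk_add[OF W(1) y c, symmetric]
            germ_restrict[OF psh_functorial[OF P] V(1,4) W(1,4) y] germ_restrict[OF psh_functorial[OF P] V'(1,4) W(1,5) y]
          by (rule refl)
      qed
      then show "\<exists>V z. openin (top_of S) V \<and> V \<subseteq> U \<and> x \<in> V \<and> z \<in> carrier (sec F V) \<and>
        (\<forall>y\<in>V. s y \<oplus>\<^bsub>mod_stalk S F y\<^esub> t y = mod_germ S F y V z)"
        using W M.a_closed[OF c] by blast
    qed
  next
    show "\<zero>\<^bsub>sec (sheafification S F) U\<^esub> \<in> carrier (sec (sheafification S F) U)"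
      unfolding sheafification_ops
    proof (rule sheafification_carrierI[OF U])
      fix x assume x: "x \<in> U"
      interpret module "O_sec S U" "sec F U" using psh_module[OF P U] .
      have "\<forall>y\<in>U. \<zero>\<^bsub>mod_stalk S F y\<^esub> = mod_germ S F y U \<zero>\<^bsub>sec F U\<^esub>" using stalk_zero[OF U] by blast
      then show "\<exists>V z. openin (top_of S) V \<and> V \<subseteq> U \<and> x \<in> V \<and> z \<in> carrier (sec F V) \<and>
        (\<forall>y\<in>V. \<zero>\<^bsub>mod_stalk S F y\<^esub> = mod_germ S F y V z)"
        using x U M.zero_closed by blast
    qed
  next
    fix s t r assume s: "s \<in> carrier (sec (sheafification S F) U)" and t: "t \<in> carrier (sec (sheafification S F) U)" and r: "r \<in> carrier (sec (sheafification S F) U)"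
    show "s \<oplus>\<^bsub>sec (sheafification S F) U\<^esub> t \<oplus>\<^bsub>sec (sheafification S F) U\<^esub> r = s \<oplus>\<^bsub>sec (sheafification S F) U\<^esub> (t \<oplus>\<^bsub>sec (sheafification S F) U\<^esub> r)"
      unfolding sheafification_ops
    proof (rule restrict_ext)
      fix x assume x: "x \<in> U"
      interpret abelian_monoid "mod_stalk S F x" using am[OF x] .
      show "(\<lambda>x\<in>U. s x \<oplus>\<^bsub>mod_stalk S F x\<^esub> t x) x \<oplus>\<^bsub>mod_stalk S F x\<^esub> r x =
        s x \<oplus>\<^bsub>mod_stalk S F x\<^esub> (\<lambda>x\<in>U. t x \<oplus>\<^bsub>mod_stalk S F x\<^esub> r x) x"
        using x val[OF s x] val[OF t x] val[OF r x] by (simp add: a_assoc)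
    qed
  next
    fix s assume s: "s \<in> carrier (sec (sheafification S F) U)"
    have "(\<lambda>x\<in>U. (\<lambda>x\<in>U. \<zero>\<^bsub>mod_stalk S F x\<^esub>) x \<oplus>\<^bsub>mod_stalk S F x\<^esub> s x) = (\<lambda>x\<in>U. s x)"
    proof (rule restrict_ext)
      fix x assume x: "x \<in> U"
      interpret abelian_monoid "mod_stalk S F x" using am[OF x] .
      show "(\<lambda>x\<in>U. \<zero>\<^bsub>mod_stalk S F x\<^esub>) x \<oplus>\<^bsub>mod_stalk S F x\<^esub> s x = s x"
        using x val[OF s x] by simp
    qed
    then show "\<zero>\<^bsub>sec (sheafification S F) U\<^esub> \<oplus>\<^bsub>sec (sheafification S F) U\<^esub> s = s" unfolding sheafification_ops using ext[OF s] by simp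
  next
    fix s t assume s: "s \<in> carrier (sec (sheafification S F) U)" and t: "t \<in> carrier (sec (sheafification S F) U)"
    show "s \<oplus>\<^bsub>sec (sheafification S F) U\<^esub> t = t \<oplus>\<^bsub>sec (sheafification S F) U\<^esub> s"
      unfolding sheafification_ops
    proof (rule restrict_ext)
      fix x assume x: "x \<in> U"
      interpret abelian_monoid "mod_stalk S F x" using am[OF x] .
      show "s x \<oplus>\<^bsub>mod_stalk S F x\<^esub> t x = t x \<oplus>\<^bsub>mod_stalk S F x\<^esub> s x"
        using val[OF s x] val[OF t x] by (simp add: a_comm)
    qed
  qed
qed

lemma sheafification_smult_closed:
  assumes U: "openin (top_of S) U" and r: "r \<in> carrier (O_sec S U)" and s: "s \<in> carrier (sec (sheafification S F) U)"
  shows "r \<odot>\<^bsub>sec (sheafification S F) U\<^esub> s \<in> carrier (sec (sheafification S F) U)"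
  unfolding sheafification_ops
proof (rule sheafification_carrierI[OF U])
  fix x assume x: "x \<in> U"
  obtain V z where V: "openin (top_of S) V" "V \<subseteq> U" "x \<in> V" "z \<in> carrier (sec F V)"
    "\<And>y. y \<in> V \<Longrightarrow> s y = mod_germ S F y V z" using sheafification_local[OF s x] by blast
  note r' = rs_res[OF SR U V(1,2) r]
  interpret module "O_sec S V" "sec F V" using psh_module[OF P V(1)] .
  have "O_germ S y U r \<odot>\<^bsub>mod_stalk S F y\<^esub> s y = mod_germ S F y V (O_res S U V r \<odot>\<^bsub>sec F V\<^esub> z)"
    if y: "y \<in> V" for y
    unfolding V(5)[OF y] stalk_smult[OF V(1) y r' V(4), symmetric]
      germ_restrict[OF rs_functorial[OF SR] U r V(1,2) y] by (rule refl)
  then show "\<exists>V z. openin (top_of S) V \<and> V \<subseteq> U \<and> x \<in> V \<and> z \<in> carrier (sec F V) \<and>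
    (\<forall>y\<in>V. O_germ S y U r \<odot>\<^bsub>mod_stalk S F y\<^esub> s y = mod_germ S F y V z)"
    using V smult_closed[OF r' V(4)] by blast
qed

lemma sheafification_res_closed:
  assumes U: "openin (top_of S) U" and W: "openin (top_of S) W" "W \<subseteq> U" and s: "s \<in> carrier (sec (sheafification S F) U)"
  shows "res (sheafification S F) U W s \<in> carrier (sec (sheafification S F) W)"
  unfolding sheafification_ops
proof (rule sheafification_carrierI[OF W(1)])
  fix x assume x: "x \<in> W"
  then have xU: "x \<in> U" using W by blast
  obtain V z where V: "openin (top_of S) V" "V \<subseteq> U" "x \<in> V" "z \<in> carrier (sec F V)"
    "\<And>y. y \<in> V \<Longrightarrow> s y = mod_germ S F y V z" using sheafification_local[OF s xU] by blast
  have o: "openin (top_of S) (V \<inter> W)" "V \<inter> W \<subseteq> V" "V \<inter> W \<subseteq> W" "x \<in> V \<inter> W" using V W x by auto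
  have "s y = mod_germ S F y (V \<inter> W) (res F V (V \<inter> W) z)" if y: "y \<in> V \<inter> W" for y
    using V(5)[of y] y germ_restrict[OF psh_functorial[OF P] V(1,4) o(1,2) y] by simp
  then show "\<exists>V z. openin (top_of S) V \<and> V \<subseteq> W \<and> x \<in> V \<and> z \<in> carrier (sec F V) \<and>
    (\<forall>y\<in>V. s y = mod_germ S F y V z)"
    using o psh_res[OF P V(1) o(1,2) V(4)] by blast
qed

text \<open>Members of a basis of the sheafification are given near \<open>x\<close> by presheaf
  sections \<open>g i\<close>. The germs of a presheaf section form a section of the sheafification
  and can be expanded in the basis. At \<open>x\<close> this is an equality of two germs of presheaf
  sections, and therefore an equality of these sections over some smaller \<open>Y\<close>.\<close>

lemma sheafification_local_generators:
  assumes U: "openin (top_of S) U" "x \<in> U" and b: "basis_on S (sheafification S F) U es"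
  obtains V g where "openin (top_of S) V" "x \<in> V" "V \<subseteq> U" "g \<in> {..<length es} \<rightarrow> carrier (sec F V)"
    "\<And>W z. openin (top_of S) W \<Longrightarrow> x \<in> W \<Longrightarrow> W \<subseteq> V \<Longrightarrow> z \<in> carrier (sec F W) \<Longrightarrow>
      \<exists>Y. openin (top_of S) Y \<and> x \<in> Y \<and> Y \<subseteq> W \<and>
        in_span (O_sec S Y) (sec F Y) {..<length es} (\<lambda>i. res F V Y (g i)) (res F W Y z)"
proof -
  let ?I = "{..<length es}"
  have es: "es ! i \<in> carrier (sec (sheafification S F) U)" if "i \<in> ?I" for i using b that by (auto simp: basis_on_def)
  have "\<forall>i\<in>?I. \<exists>V z. openin (top_of S) V \<and> V \<subseteq> U \<and> x \<in> V \<and> z \<in> carrier (sec F V) \<and>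
    (\<forall>y\<in>V. (es ! i) y = mod_germ S F y V z)"
    using es U(2) unfolding sheafification_carrier by blast
  from bchoice[OF this] obtain N where "\<forall>i\<in>?I. \<exists>z. openin (top_of S) (N i) \<and> N i \<subseteq> U \<and> x \<in> N i \<and>
    z \<in> carrier (sec F (N i)) \<and> (\<forall>y\<in>N i. (es ! i) y = mod_germ S F y (N i) z)" ..
  from bchoice[OF this] obtain z where Nz: "\<forall>i\<in>?I. openin (top_of S) (N i) \<and> N i \<subseteq> U \<and> x \<in> N i \<and>
    z i \<in> carrier (sec F (N i)) \<and> (\<forall>y\<in>N i. (es ! i) y = mod_germ S F y (N i) (z i))" ..
  have N: "\<And>i. i \<in> ?I \<Longrightarrow> openin (top_of S) (N i)" "\<And>i. i \<in> ?I \<Longrightarrow> N i \<subseteq> U"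
    "\<And>i. i \<in> ?I \<Longrightarrow> x \<in> N i" and z: "\<And>i. i \<in> ?I \<Longrightarrow> z i \<in> carrier (sec F (N i))"
    "\<And>i y. i \<in> ?I \<Longrightarrow> y \<in> N i \<Longrightarrow> (es ! i) y = mod_germ S F y (N i) (z i)"
    using Nz by simp_all
  define V where "V = U \<inter> \<Inter>(N ` ?I)"
  \<comment> \<open>Including \<open>U\<close> in the family keeps the intersection open and
    nonempty also when \<open>es\<close> is empty.\<close>
  have "openin (top_of S) (\<Inter>(insert U (N ` ?I)))"
    using N(1) U(1) by (intro openin_Inter) auto
  then have V: "openin (top_of S) V" "x \<in> V" "V \<subseteq> U" using N(3) U by (auto simp: V_def)
  have VN: "\<And>i. i \<in> ?I \<Longrightarrow> V \<subseteq> N i" by (auto simp: V_def)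
  define g where "g i = res F (N i) V (z i)" for i
  have g: "\<And>i. i \<in> ?I \<Longrightarrow> g i \<in> carrier (sec F V)"
    unfolding g_def using psh_res[OF P N(1) V(1) VN z(1)] by blast
  have esg: "(es ! i) y = mod_germ S F y V (g i)" if "i \<in> ?I" "y \<in> V" for i y
    using z(2)[OF that(1)] VN[OF that(1)] that(2) germ_restrict[OF psh_functorial[OF P] N(1)[OF that(1)] z(1)[OF that(1)] V(1) VN[OF that(1)] that(2)]
    unfolding g_def by auto
  show thesis
  proof (rule that[OF V])
    show "g \<in> ?I \<rightarrow> carrier (sec F V)" using g by blast
    fix W d assume W: "openin (top_of S) W" "x \<in> W" "W \<subseteq> V" and d: "d \<in> carrier (sec F W)"
    have WU: "W \<subseteq> U" using W V by blast
    interpret MW: module "O_sec S W" "sec F W" using psh_module[OF P W(1)] .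
    interpret FW: abelian_monoid "sec (sheafification S F) W" using sheafification_abelian_monoid[OF W(1)] .
    have xS: "x \<in> points S" using openin_subset[OF W(1)] W(2) by blast
    interpret K: abelian_monoid "mod_stalk S F x" using stalk_abelian_monoid[OF xS] .
    \<comment> \<open>The presheaf section \<open>d\<close> defines a section of the sheafification
      over \<open>W\<close>, which makes the basis applicable to it.\<close>
    have "(\<lambda>y\<in>W. mod_germ S F y W d) \<in> carrier (sec (sheafification S F) W)"
    proof (rule sheafification_carrierI[OF W(1)])
      show "\<exists>V z. openin (top_of S) V \<and> V \<subseteq> W \<and> y \<in> V \<and> z \<in> carrier (sec F V) \<and>
        (\<forall>ya\<in>V. mod_germ S F ya W d = mod_germ S F ya V z)" if "y \<in> W" for y
        using that W(1) d by blast
    qed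
    then have "\<exists>!c. c \<in> ?I \<rightarrow>\<^sub>E carrier (O_sec S W) \<and> (\<lambda>y\<in>W. mod_germ S F y W d) =
        (\<Oplus>\<^bsub>sec (sheafification S F) W\<^esub>i\<in>?I. c i \<odot>\<^bsub>sec (sheafification S F) W\<^esub> res (sheafification S F) U W (es ! i))"
      using b W(1) WU unfolding basis_on_def by blast
    then obtain c where c: "c \<in> ?I \<rightarrow>\<^sub>E carrier (O_sec S W)" and
      eq: "(\<lambda>y\<in>W. mod_germ S F y W d) = (\<Oplus>\<^bsub>sec (sheafification S F) W\<^esub>i\<in>?I. c i \<odot>\<^bsub>sec (sheafification S F) W\<^esub> res (sheafification S F) U W (es ! i))"
      by (elim ex1E) blast
    have cR: "\<And>i. i \<in> ?I \<Longrightarrow> c i \<in> carrier (O_sec S W)" using c by (auto dest: PiE_mem)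
    have gW: "\<And>i. i \<in> ?I \<Longrightarrow> res F V W (g i) \<in> carrier (sec F W)" using psh_res[OF P V(1) W(1,3) g] by blast
    define w where "w = (\<Oplus>\<^bsub>sec F W\<^esub>i\<in>?I. c i \<odot>\<^bsub>sec F W\<^esub> res F V W (g i))"
    have wW: "w \<in> carrier (sec F W)" unfolding w_def using cR gW by (intro MW.lincomb_closed) auto
    have "mod_germ S F x W d = (\<lambda>y\<in>W. mod_germ S F y W d) x" using W(2) by simp
    also have "\<dots> = (\<Oplus>\<^bsub>mod_stalk S F x\<^esub>i\<in>?I. (c i \<odot>\<^bsub>sec (sheafification S F) W\<^esub> res (sheafification S F) U W (es ! i)) x)"
      unfolding eq
    proof (rule FW.hom_finsum_to[OF K.abelian_monoid_axioms, where f="\<lambda>s. s x"])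
      show "(\<lambda>s. s x) \<in> carrier (sec (sheafification S F) W) \<rightarrow> carrier (mod_stalk S F x)"
        using sheafification_val[OF _ W(2)] by (intro funcsetI)
      show "(\<lambda>i. c i \<odot>\<^bsub>sec (sheafification S F) W\<^esub> res (sheafification S F) U W (es ! i)) \<in> ?I \<rightarrow> carrier (sec (sheafification S F) W)"
        using sheafification_smult_closed[OF W(1) cR sheafification_res_closed[OF U(1) W(1) WU es]] by blast
    qed (use W(2) in \<open>simp_all add: sheafification_ops\<close>)
    also have "\<dots> = (\<Oplus>\<^bsub>mod_stalk S F x\<^esub>i\<in>?I. mod_germ S F x W (c i \<odot>\<^bsub>sec F W\<^esub> res F V W (g i)))"
    proof (rule K.finsum_cong'[OF refl])
      show "(\<lambda>i. mod_germ S F x W (c i \<odot>\<^bsub>sec F W\<^esub> res F V W (g i))) \<in> ?I \<rightarrow> carrier (mod_stalk S F x)"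
        using stalk_carrierI[OF W(1,2) MW.smult_closed[OF cR gW]] by blast
      fix i assume i: "i \<in> ?I"
      have xV: "x \<in> V" using W by blast
      have "(c i \<odot>\<^bsub>sec (sheafification S F) W\<^esub> res (sheafification S F) U W (es ! i)) x = O_germ S x W (c i) \<odot>\<^bsub>mod_stalk S F x\<^esub> (es ! i) x"
        using W(2) by (simp add: sheafification_ops)
      also have "\<dots> = mod_germ S F x W (c i \<odot>\<^bsub>sec F W\<^esub> res F V W (g i))"
        unfolding esg[OF i xV] stalk_smult[OF W(1,2) cR[OF i] gW[OF i], symmetric]
          germ_restrict[OF psh_functorial[OF P] V(1) g[OF i] W(1,3,2)] by (rule refl)
      finally show "(c i \<odot>\<^bsub>sec (sheafification S F) W\<^esub> res (sheafification S F) U W (es ! i)) x = mod_germ S F x W (c i \<odot>\<^bsub>sec F W\<^esub> res F V W (g i))" .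
    qed
    also have "\<dots> = mod_germ S F x W w"
      unfolding w_def
    proof (rule MW.hom_finsum_to[OF K.abelian_monoid_axioms, where f="mod_germ S F x W", symmetric])
      show "mod_germ S F x W \<in> carrier (sec F W) \<rightarrow> carrier (mod_stalk S F x)"
        using stalk_carrierI[OF W(1,2)] by blast
      show "(\<lambda>i. c i \<odot>\<^bsub>sec F W\<^esub> res F V W (g i)) \<in> ?I \<rightarrow> carrier (sec F W)"
        using MW.smult_closed[OF cR gW] by blast
    qed (simp_all only: stalk_zero[OF W(1,2)] stalk_add[OF W(1,2)])
    finally have "mod_germ S F x W d = mod_germ S F x W w" .
    \<comment> \<open>Here the presheaf is recovered: equal germs at \<open>x\<close> mean equal
      restrictions to some neighbourhood of \<open>x\<close>.\<close>
    then obtain Y where Y: "openin (top_of S) Y" "x \<in> Y" "Y \<subseteq> W \<inter> W" "res F W Y d = res F W Y w"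
      by (rule germ_eqD[OF psh_functorial[OF P] W(1) wW W(2)])
    have YW: "Y \<subseteq> W" using Y by blast
    have YV: "Y \<subseteq> V" using YW W by blast
    interpret MY: module "O_sec S Y" "sec F Y" using psh_module[OF P Y(1)] .
    have "res F W Y w = (\<Oplus>\<^bsub>sec F Y\<^esub>i\<in>?I. O_res S W Y (c i) \<odot>\<^bsub>sec F Y\<^esub> res F W Y (res F V W (g i)))"
      unfolding w_def using cR gW by (intro psh_lincomb[OF P SR W(1) Y(1) YW]) auto
    also have "\<dots> = (\<Oplus>\<^bsub>sec F Y\<^esub>i\<in>?I. O_res S W Y (c i) \<odot>\<^bsub>sec F Y\<^esub> res F V Y (g i))"
    proof (rule MY.finsum_cong'[OF refl])
      show "(\<lambda>i. O_res S W Y (c i) \<odot>\<^bsub>sec F Y\<^esub> res F V Y (g i)) \<in> ?I \<rightarrow> carrier (sec F Y)"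
        using MY.smult_closed[OF rs_res[OF SR W(1) Y(1) YW cR] psh_res[OF P V(1) Y(1) YV g]] by blast
    qed (simp only: psh_comp[OF P V(1) W(1) Y(1) YW W(3) g])
    finally have "res F W Y d = (\<Oplus>\<^bsub>sec F Y\<^esub>i\<in>?I. O_res S W Y (c i) \<odot>\<^bsub>sec F Y\<^esub> res F V Y (g i))"
      unfolding Y(4) .
    moreover have "(\<lambda>i. O_res S W Y (c i)) \<in> ?I \<rightarrow> carrier (O_sec S Y)"
      using rs_res[OF SR W(1) Y(1) YW cR] by blast
    ultimately have "in_span (O_sec S Y) (sec F Y) ?I (\<lambda>i. res F V Y (g i)) (res F W Y d)"
      unfolding in_span_def by (rule bexI)
    then show "\<exists>Y. openin (top_of S) Y \<and> x \<in> Y \<and> Y \<subseteq> W \<and>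
        in_span (O_sec S Y) (sec F Y) ?I (\<lambda>i. res F V Y (g i)) (res F W Y d)"
      using Y(1,2) YW by blast
  qed
qed

end

section \<open>Tensoring with the structure sheaf\<close>

lemma
  assumes E: "E \<subseteq> carrier (free_Abelian_group P)"
  shows frag_gen_zero: "0 \<in> generate (free_Abelian_group P) E"
    and frag_gen_add: "u \<in> generate (free_Abelian_group P) E \<Longrightarrow> v \<in> generate (free_Abelian_group P) E \<Longrightarrow>
      u + v \<in> generate (free_Abelian_group P) E"
    and frag_gen_minus: "u \<in> generate (free_Abelian_group P) E \<Longrightarrow> - u \<in> generate (free_Abelian_group P) E"
    and frag_gen_diff: "u \<in> generate (free_Abelian_group P) E \<Longrightarrow> v \<in> generate (free_Abelian_group P) E \<Longrightarrow>
      u - v \<in> generate (free_Abelian_group P) E"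
proof -
  let ?G = "free_Abelian_group P"
  let ?H = "generate ?G E"
  have sub: "subgroup ?H ?G" by (rule group.generate_is_subgroup[OF group_free_Abelian_group E])
  show 0: "0 \<in> ?H" using subgroup.one_closed[OF sub] by simp
  show a: "u + v \<in> ?H" if "u \<in> ?H" "v \<in> ?H" for u v using subgroup.m_closed[OF sub that] by simp
  have HG: "u \<in> carrier ?G" if "u \<in> ?H" for u using subgroup.subset[OF sub] that by blast
  show m: "- u \<in> ?H" if "u \<in> ?H" for u
    using subgroup.m_inv_closed[OF sub that] HG[OF that] by simp
  show "u - v \<in> ?H" if "u \<in> ?H" "v \<in> ?H" using a[OF that(1) m[OF that(2)]] by simp
qed

lemma frag_gen_incl: "u \<in> E \<Longrightarrow> u \<in> generate (free_Abelian_group P) E"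
  by (rule generate.incl)

lemma frag_class_eqI:
  assumes E: "E \<subseteq> carrier (free_Abelian_group P)" and "u - v \<in> generate (free_Abelian_group P) E"
  shows "frag_class P E u = frag_class P E v"
proof -
  have "w - v \<in> generate (free_Abelian_group P) E" if "w - u \<in> generate (free_Abelian_group P) E" for w
    using frag_gen_add[OF E that assms(2)] by simp
  moreover have "w - u \<in> generate (free_Abelian_group P) E" if "w - v \<in> generate (free_Abelian_group P) E" for w
    using frag_gen_diff[OF E that assms(2)] by simp
  ultimately show ?thesis unfolding frag_class_def by blast
qed

lemma frag_class_self:
  assumes "E \<subseteq> carrier (free_Abelian_group P)"
  shows "u \<in> frag_class P E u"
  using frag_gen_zero[OF assms] by (simp add: frag_class_def)

lemma frag_class_eqD:
  assumes "E \<subseteq> carrier (free_Abelian_group P)" "frag_class P E u = frag_class P E v"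
  shows "u - v \<in> generate (free_Abelian_group P) E"
  using frag_class_self[OF assms(1), of u] unfolding assms(2) by (simp add: frag_class_def)

lemma frag_quotient_add:
  assumes E: "E \<subseteq> carrier (free_Abelian_group P)"
  shows "frag_class P E u \<oplus>\<^bsub>frag_quotient P E \<sigma>\<^esub> frag_class P E v = frag_class P E (u + v)"
proof -
  have "frag_class P E (u' + v') = frag_class P E (u + v)"
    if "u' \<in> frag_class P E u" "v' \<in> frag_class P E v" for u' v'
  proof (rule frag_class_eqI[OF E])
    show "u' + v' - (u + v) \<in> generate (free_Abelian_group P) E"
      using frag_gen_add[OF E, of "u' - u" "v' - v"] that by (simp add: frag_class_def algebra_simps)
  qed
  then have "(\<Union>u'\<in>frag_class P E u. \<Union>v'\<in>frag_class P E v. frag_class P E (u' + v')) =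
    (\<Union>u'\<in>frag_class P E u. \<Union>v'\<in>frag_class P E v. frag_class P E (u + v))"
    by (intro SUP_cong refl)
  also have "\<dots> = frag_class P E (u + v)"
    using frag_class_self[OF E, of u] frag_class_self[OF E, of v] by blast
  finally show ?thesis by (simp add: frag_quotient_def)
qed

text \<open>Maps on \<open>frag_quotient\<close> are written as unions over all representatives.
  Once the extension of \<open>f\<close> sends every relation into the subgroup generated by the
  target relations, all members of the union are the same class. Both the scalar action and the
  restriction maps of the tensor presheaf are of this kind.\<close>

lemma frag_class_extend:
  assumes E: "E \<subseteq> carrier (free_Abelian_group P)" and E': "E' \<subseteq> carrier (free_Abelian_group P')"
    and f: "\<And>e. e \<in> E \<Longrightarrow> frag_extend f e \<in> generate (free_Abelian_group P') E'"
  shows "(\<Union>u'\<in>frag_class P E u. frag_class P' E' (frag_extend f u')) = frag_class P' E' (frag_extend f u)"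
proof -
  have g: "frag_extend f w \<in> generate (free_Abelian_group P') E'" if "w \<in> generate (free_Abelian_group P) E" for w
    using that
  proof (induction rule: generate.induct)
    case one then show ?case using frag_gen_zero[OF E'] by simp
  next
    case (incl h) then show ?case by (rule f)
  next
    case (inv h)
    \<comment> \<open>The group inverse is identified with negation only for elements supported in
      \<open>P\<close>.\<close>
    from subsetD[OF E inv] have "Poly_Mapping.keys h \<subseteq> P" by simp
    then show ?case using frag_gen_minus[OF E' f[OF inv]] by (simp add: frag_extend_minus)
  next
    case (eng h k) then show ?case using frag_gen_add[OF E'] by (simp add: frag_extend_add)
  qed
  have "frag_class P' E' (frag_extend f u') = frag_class P' E' (frag_extend f u)" if "u' \<in> frag_class P E u" for u'
    by (rule frag_class_eqI[OF E']) (use g[of "u' - u"] that in \<open>simp add: frag_class_def frag_extend_diff\<close>)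
  then have "(\<Union>u'\<in>frag_class P E u. frag_class P' E' (frag_extend f u')) =
    (\<Union>u'\<in>frag_class P E u. frag_class P' E' (frag_extend f u))" by (intro SUP_cong refl)
  also have "\<dots> = frag_class P' E' (frag_extend f u)" using frag_class_self[OF E, of u] by blast
  finally show ?thesis .
qed

lemma keys_diff_frag_of:
  shows "Poly_Mapping.keys (frag_of u - frag_of v) \<subseteq> {u, v}"
    and "Poly_Mapping.keys (frag_of u - frag_of v - frag_of w) \<subseteq> {u, v, w}"
proof -
  show 1: "Poly_Mapping.keys (frag_of u - frag_of v) \<subseteq> {u, v}"
    using keys_diff[of "frag_of u" "frag_of v"] by (auto simp: keys_frag_of)
  show "Poly_Mapping.keys (frag_of u - frag_of v - frag_of w) \<subseteq> {u, v, w}"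
    using keys_diff[of "frag_of u - frag_of v" "frag_of w"] 1 by (auto simp: keys_frag_of)
qed

text \<open>Transports the presheaf laws along a surjective family of maps compatible with all
  operations. The tensor presheaf then inherits them from the degree \<open>n\<close> piece of
  \<open>D\<close>, and no module axiom has to be verified on classes of symbols.\<close>

lemma presheaf_image:
  fixes F :: "('x, 'r, 'm) mod_sheaf" and G :: "('x, 'r, 'n) mod_sheaf"
  assumes P: "presheaf_of_modules S F" and SR: "is_ringed_space S"
    and surj: "\<And>U. openin (top_of S) U \<Longrightarrow> carrier (sec G U) = \<tau> U ` carrier (sec F U)"
    and zero: "\<And>U. openin (top_of S) U \<Longrightarrow> \<zero>\<^bsub>sec G U\<^esub> = \<tau> U \<zero>\<^bsub>sec F U\<^esub>"
    and add: "\<And>U y z. openin (top_of S) U \<Longrightarrow> y \<in> carrier (sec F U) \<Longrightarrow> z \<in> carrier (sec F U) \<Longrightarrow>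
      \<tau> U y \<oplus>\<^bsub>sec G U\<^esub> \<tau> U z = \<tau> U (y \<oplus>\<^bsub>sec F U\<^esub> z)"
    and smult: "\<And>U r z. openin (top_of S) U \<Longrightarrow> r \<in> carrier (O_sec S U) \<Longrightarrow> z \<in> carrier (sec F U) \<Longrightarrow>
      r \<odot>\<^bsub>sec G U\<^esub> \<tau> U z = \<tau> U (r \<odot>\<^bsub>sec F U\<^esub> z)"
    and res: "\<And>U V z. openin (top_of S) U \<Longrightarrow> openin (top_of S) V \<Longrightarrow> V \<subseteq> U \<Longrightarrow> z \<in> carrier (sec F U) \<Longrightarrow>
      res G U V (\<tau> U z) = \<tau> V (res F U V z)"
  shows "presheaf_of_modules S G"
proof -
  have md: "module (O_sec S U) (sec G U)" if U: "openin (top_of S) U" for U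
  proof -
    interpret MF: module "O_sec S U" "sec F U" using psh_module[OF P U] .
    note [simp] = surj[OF U] zero[OF U] add[OF U] smult[OF U]
    have "abelian_group (sec G U)"
    proof (rule abelian_groupI)
      fix k assume "k \<in> carrier (sec G U)"
      then obtain z where z: "z \<in> carrier (sec F U)" "k = \<tau> U z" by auto
      have "\<tau> U (\<ominus>\<^bsub>sec F U\<^esub> z) \<oplus>\<^bsub>sec G U\<^esub> k = \<zero>\<^bsub>sec G U\<^esub>"
        using z by (simp add: MF.M.l_neg)
      then show "\<exists>l\<in>carrier (sec G U). l \<oplus>\<^bsub>sec G U\<^esub> k = \<zero>\<^bsub>sec G U\<^esub>" using z by auto
    qed (auto simp: MF.M.a_ac intro!: imageI)
    then show ?thesis
      by (rule moduleI[OF MF.R.is_cring])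
        (auto simp: MF.smult_l_distr MF.smult_r_distr MF.smult_assoc1 intro!: imageI)
  qed
  show ?thesis unfolding presheaf_of_modules_def functorial_def
  proof (intro conjI allI impI ballI md funcsetI, goal_cases)
    case (2 U V k)
    then show ?case using psh_res[OF P] by (auto simp: surj res)
  next
    case (3 U k)
    then show ?case using psh_id[OF P] by (auto simp: surj res)
  next
    case (4 U V W k)
    then obtain z where z: "z \<in> carrier (sec F U)" "k = \<tau> U z" by (auto simp: surj)
    have o: "openin (top_of S) U" "openin (top_of S) V" "openin (top_of S) W" "W \<subseteq> V" "V \<subseteq> U" "W \<subseteq> U"
      using 4 by auto
    show ?case unfolding z(2) res[OF o(1,2,5) z(1)] res[OF o(1,3,6) z(1)]
        res[OF o(2,3,4) psh_res[OF P o(1,2,5) z(1)]] psh_comp[OF P o(1-5) z(1)] by (rule refl)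
  next
    case (5 U V k l)
    then have o: "openin (top_of S) U" "openin (top_of S) V" "V \<subseteq> U" by auto
    from 5 obtain y z where y: "y \<in> carrier (sec F U)" "k = \<tau> U y" and z: "z \<in> carrier (sec F U)" "l = \<tau> U z"
      by (auto simp: surj)
    interpret MF: module "O_sec S U" "sec F U" using psh_module[OF P o(1)] .
    show ?case unfolding y(2) z(2) add[OF o(1) y(1) z(1)] res[OF o y(1)] res[OF o z(1)]
        res[OF o MF.M.a_closed[OF y(1) z(1)]] psh_add[OF P o y(1) z(1)]
        add[OF o(2) psh_res[OF P o y(1)] psh_res[OF P o z(1)]] by (rule refl)
  next
    case (6 U V r k)
    then have o: "openin (top_of S) U" "openin (top_of S) V" "V \<subseteq> U" and r: "r \<in> carrier (O_sec S U)" by auto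
    from 6 obtain z where z: "z \<in> carrier (sec F U)" "k = \<tau> U z" by (auto simp: surj)
    interpret MF: module "O_sec S U" "sec F U" using psh_module[OF P o(1)] .
    show ?case unfolding z(2) smult[OF o(1) r z(1)] res[OF o z(1)]
        res[OF o MF.smult_closed[OF r z(1)]] psh_smult[OF P o r z(1)]
        smult[OF o(2) rs_res[OF SR o r] psh_res[OF P o z(1)]] by (rule refl)
  qed simp
qed

section \<open>The tensor product with the degree-zero quotient of the algebra\<close>

context
  fixes S :: "('x, 'r) ringed_space" and A :: "('x, 'r, 'a) graded_alg" and D :: "('x, 'r, 'a, 'm) graded_mod"
    and n :: int
  assumes SR: "is_ringed_space S" and A: "graded_algebra S A" and D: "graded_premodule S A D"
begin

abbreviation "gens \<equiv> graded_tensor_gens D (structure_module A) n"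
abbreviation "rels \<equiv> graded_tensor_rels A D (structure_module A) n"
abbreviation "tpsh \<equiv> graded_tensor_presheaf A D (structure_module A) n"
abbreviation "relgroup U \<equiv> generate (free_Abelian_group (gens U)) (rels U)"

text \<open>The map sending \<open>d\<close> to the tensor of \<open>d\<close> with one. It turns
  out to be onto, so the tensor presheaf is described as a quotient of \<open>D\<close> in degree
  \<open>n\<close>.\<close>

definition unit_tensor :: "'x set \<Rightarrow> 'm \<Rightarrow> (int \<times> 'm \<times> 'a \<Rightarrow>\<^sub>0 int) set" where
  "unit_tensor U d = frag_class (gens U) (rels U) (frag_of (n, d, alg_one A U))"

lemma sm_ops: "y \<oplus>\<^bsub>mod_sec (structure_module A) q U\<^esub> z = y \<oplus>\<^bsub>alg_sec A q U\<^esub> z"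
  "res (piece (structure_module A) q) = res (alg_piece A q)"
  "mod_sec (structure_module A) 0 U = alg_sec A 0 U"
  by (simp_all add: structure_module_def)

lemma sm_carrier: "carrier (mod_sec (structure_module A) q U) =
    (if q = 0 then carrier (alg_sec A 0 U) else {\<zero>\<^bsub>alg_sec A q U\<^esub>})"
  by (simp add: structure_module_def)

lemma sm_act: "act (structure_module A) p q U x z =
    (if p = 0 \<and> q = 0 then alg_mult A 0 0 U x z else \<zero>\<^bsub>alg_sec A (p + q) U\<^esub>)"
  by (simp add: structure_module_def)

lemma alg_zero_closed: "openin (top_of S) U \<Longrightarrow> \<zero>\<^bsub>alg_sec A q U\<^esub> \<in> carrier (alg_sec A q U)"
  using abelian_group.axioms(1)[OF mod_ag[OF psh_module[OF alg_psh[OF A]]]] abelian_monoid.zero_closed by blast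

lemma gens_iff: "(i, x, y) \<in> gens U \<longleftrightarrow> x \<in> carrier (mod_sec D i U) \<and>
    y \<in> carrier (mod_sec (structure_module A) (n - i) U)"
  by (simp add: graded_tensor_gens_def)

lemma sm_add_closed:
  assumes U: "openin (top_of S) U" and y: "y \<in> carrier (mod_sec (structure_module A) q U)"
    and z: "z \<in> carrier (mod_sec (structure_module A) q U)"
  shows "y \<oplus>\<^bsub>mod_sec (structure_module A) q U\<^esub> z \<in> carrier (mod_sec (structure_module A) q U)"
proof (cases "q = 0")
  case True
  interpret module "O_sec S U" "alg_sec A 0 U" using psh_module[OF alg_psh[OF A] U] .
  show ?thesis using y z True by (simp add: sm_ops(1) sm_carrier)
next
  case False
  interpret module "O_sec S U" "alg_sec A q U" using psh_module[OF alg_psh[OF A] U] .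
  show ?thesis using y z False by (simp add: sm_ops(1) sm_carrier)
qed

lemma sm_act_closed:
  assumes U: "openin (top_of S) U" and a: "a \<in> carrier (alg_sec A k U)" and q: "q' = k + q"
    and z: "z \<in> carrier (mod_sec (structure_module A) q U)"
  shows "act (structure_module A) k q U a z \<in> carrier (mod_sec (structure_module A) q' U)"
  using alg_mult_closed[OF A U, of 0 0 0 a z] a z alg_zero_closed[OF U, of 0]
  by (auto simp: sm_act sm_carrier q split: if_splits)

lemma sm_res_closed:
  assumes U: "openin (top_of S) U" and V: "openin (top_of S) V" "V \<subseteq> U"
    and z: "z \<in> carrier (mod_sec (structure_module A) q U)"
  shows "res (alg_piece A q) U V z \<in> carrier (mod_sec (structure_module A) q V)"
  using psh_res[OF alg_psh[OF A] U V] psh_zero[OF alg_psh[OF A] U V] z by (auto simp: sm_carrier split: if_splits)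

lemma D_ops_closed:
  assumes U: "openin (top_of S) U"
  shows "y \<in> carrier (mod_sec D i U) \<Longrightarrow> z \<in> carrier (mod_sec D i U) \<Longrightarrow> y \<oplus>\<^bsub>mod_sec D i U\<^esub> z \<in> carrier (mod_sec D i U)"
    and "r \<in> carrier (O_sec S U) \<Longrightarrow> y \<in> carrier (mod_sec D i U) \<Longrightarrow> r \<odot>\<^bsub>mod_sec D i U\<^esub> y \<in> carrier (mod_sec D i U)"
    and "\<zero>\<^bsub>mod_sec D i U\<^esub> \<in> carrier (mod_sec D i U)"
proof -
  interpret module "O_sec S U" "mod_sec D i U" using psh_module[OF gpm_psh[OF D] U] .
  show "y \<in> carrier (mod_sec D i U) \<Longrightarrow> z \<in> carrier (mod_sec D i U) \<Longrightarrow> y \<oplus>\<^bsub>mod_sec D i U\<^esub> z \<in> carrier (mod_sec D i U)"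
    "r \<in> carrier (O_sec S U) \<Longrightarrow> y \<in> carrier (mod_sec D i U) \<Longrightarrow> r \<odot>\<^bsub>mod_sec D i U\<^esub> y \<in> carrier (mod_sec D i U)"
    "\<zero>\<^bsub>mod_sec D i U\<^esub> \<in> carrier (mod_sec D i U)"
    by simp_all
qed

lemma rels_cases:
  assumes "u \<in> rels U"
  obtains (left) i x x' y where "u = frag_of (i, x \<oplus>\<^bsub>mod_sec D i U\<^esub> x', y) - frag_of (i, x, y) - frag_of (i, x', y)"
      "x \<in> carrier (mod_sec D i U)" "x' \<in> carrier (mod_sec D i U)"
      "y \<in> carrier (mod_sec (structure_module A) (n - i) U)"
  | (right) i x y y' where "u = frag_of (i, x, y \<oplus>\<^bsub>mod_sec (structure_module A) (n - i) U\<^esub> y') - frag_of (i, x, y) - frag_of (i, x, y')"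
      "x \<in> carrier (mod_sec D i U)" "y \<in> carrier (mod_sec (structure_module A) (n - i) U)"
      "y' \<in> carrier (mod_sec (structure_module A) (n - i) U)"
  | (act) k i a x y where "u = frag_of (k + i, act D k i U a x, y) -
        frag_of (i, x, act (structure_module A) k (n - (k + i)) U a y)"
      "a \<in> carrier (alg_sec A k U)" "x \<in> carrier (mod_sec D i U)"
      "y \<in> carrier (mod_sec (structure_module A) (n - (k + i)) U)"
  using assms unfolding graded_tensor_rels_def by blast

lemma
  shows rels_left: "x \<in> carrier (mod_sec D i U) \<Longrightarrow> x' \<in> carrier (mod_sec D i U) \<Longrightarrow>
      y \<in> carrier (mod_sec (structure_module A) (n - i) U) \<Longrightarrow>
      frag_of (i, x \<oplus>\<^bsub>mod_sec D i U\<^esub> x', y) - frag_of (i, x, y) - frag_of (i, x', y) \<in> relgroup U"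
    and rels_right: "x \<in> carrier (mod_sec D i U) \<Longrightarrow> y \<in> carrier (mod_sec (structure_module A) (n - i) U) \<Longrightarrow>
      y' \<in> carrier (mod_sec (structure_module A) (n - i) U) \<Longrightarrow>
      frag_of (i, x, y \<oplus>\<^bsub>mod_sec (structure_module A) (n - i) U\<^esub> y') - frag_of (i, x, y) - frag_of (i, x, y') \<in> relgroup U"
    and rels_act: "a \<in> carrier (alg_sec A k U) \<Longrightarrow> x \<in> carrier (mod_sec D i U) \<Longrightarrow>
      y \<in> carrier (mod_sec (structure_module A) (n - (k + i)) U) \<Longrightarrow>
      frag_of (k + i, act D k i U a x, y) - frag_of (i, x, act (structure_module A) k (n - (k + i)) U a y) \<in> relgroup U"
  unfolding graded_tensor_rels_def by (rule frag_gen_incl, blast)+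

lemma rels_subset:
  assumes U: "openin (top_of S) U"
  shows "rels U \<subseteq> carrier (free_Abelian_group (gens U))"
proof
  fix u assume "u \<in> rels U"
  then show "u \<in> carrier (free_Abelian_group (gens U))"
  proof (cases rule: rels_cases)
    case (left i x x' y)
    have "Poly_Mapping.keys u \<subseteq> {(i, x \<oplus>\<^bsub>mod_sec D i U\<^esub> x', y), (i, x, y), (i, x', y)}"
      unfolding left(1) by (rule keys_diff_frag_of)
    moreover have "(i, x \<oplus>\<^bsub>mod_sec D i U\<^esub> x', y) \<in> gens U" "(i, x, y) \<in> gens U" "(i, x', y) \<in> gens U"
      using left D_ops_closed[OF U] by (simp_all add: gens_iff)
    ultimately show ?thesis by auto
  next
    case (right i x y y')
    have "Poly_Mapping.keys u \<subseteq> {(i, x, y \<oplus>\<^bsub>mod_sec (structure_module A) (n - i) U\<^esub> y'), (i, x, y), (i, x, y')}"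
      unfolding right(1) by (rule keys_diff_frag_of)
    moreover have "(i, x, y \<oplus>\<^bsub>mod_sec (structure_module A) (n - i) U\<^esub> y') \<in> gens U" "(i, x, y) \<in> gens U" "(i, x, y') \<in> gens U"
      using right sm_add_closed[OF U] by (simp_all add: gens_iff)
    ultimately show ?thesis by auto
  next
    case (act k i a x y)
    have "Poly_Mapping.keys u \<subseteq> {(k + i, graded_mod.act D k i U a x, y), (i, x, graded_mod.act (structure_module A) k (n - (k + i)) U a y)}"
      unfolding act(1) by (rule keys_diff_frag_of)
    moreover have "(k + i, graded_mod.act D k i U a x, y) \<in> gens U" "(i, x, graded_mod.act (structure_module A) k (n - (k + i)) U a y) \<in> gens U"
      using act act_closed[OF D U refl] sm_act_closed[OF U act(2) _ act(4), of "n - i"] by (simp_all add: gens_iff)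
    ultimately show ?thesis by auto
  qed
qed

lemma unit_tensor_add:
  assumes U: "openin (top_of S) U" and d: "d \<in> carrier (mod_sec D n U)" "d' \<in> carrier (mod_sec D n U)"
  shows "unit_tensor U d \<oplus>\<^bsub>sec tpsh U\<^esub> unit_tensor U d' = unit_tensor U (d \<oplus>\<^bsub>mod_sec D n U\<^esub> d')"
proof -
  have "alg_one A U \<in> carrier (mod_sec (structure_module A) (n - n) U)"
    using alg_one_closed[OF A U] by (simp add: sm_carrier)
  from frag_gen_minus[OF rels_subset[OF U] rels_left[OF d this]]
  have "frag_of (n, d, alg_one A U) + frag_of (n, d', alg_one A U) - frag_of (n, d \<oplus>\<^bsub>mod_sec D n U\<^esub> d', alg_one A U) \<in> relgroup U"
    by (simp add: algebra_simps)
  from frag_class_eqI[OF rels_subset[OF U] this] show ?thesis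
    by (simp add: unit_tensor_def graded_tensor_presheaf_def frag_quotient_add[OF rels_subset[OF U]])
qed

text \<open>Scalars act on symbols through the first factor. The content is that this action sends
  each relation to a consequence of the relations; for the balancing relation, linearity of the
  action of \<open>A\<close> on \<open>D\<close> is used.\<close>

lemma unit_tensor_smult:
  assumes U: "openin (top_of S) U" and r: "r \<in> carrier (O_sec S U)" and d: "d \<in> carrier (mod_sec D n U)"
  shows "r \<odot>\<^bsub>sec tpsh U\<^esub> unit_tensor U d = unit_tensor U (r \<odot>\<^bsub>mod_sec D n U\<^esub> d)"
proof -
  let ?f = "\<lambda>g. frag_of ((\<lambda>(i, x, y). (i, r \<odot>\<^bsub>mod_sec D i U\<^esub> x, y)) g)"
  have "frag_extend ?f e \<in> relgroup U" if "e \<in> rels U" for e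
    using that
  proof (cases rule: rels_cases)
    case (left i x x' y)
    interpret module "O_sec S U" "mod_sec D i U" using psh_module[OF gpm_psh[OF D] U] .
    show ?thesis using left r rels_left[of "r \<odot>\<^bsub>mod_sec D i U\<^esub> x" i U "r \<odot>\<^bsub>mod_sec D i U\<^esub> x'" y]
      by (simp add: frag_extend_diff smult_r_distr)
  next
    case (right i x y y')
    interpret module "O_sec S U" "mod_sec D i U" using psh_module[OF gpm_psh[OF D] U] .
    show ?thesis using right r rels_right[of "r \<odot>\<^bsub>mod_sec D i U\<^esub> x" i U y y']
      by (simp add: frag_extend_diff)
  next
    case (act k i a x y)
    show ?thesis using act r D_ops_closed(2)[OF U r act(3)] rels_act[of a k U "r \<odot>\<^bsub>mod_sec D i U\<^esub> x" i y]
        act_smult_right[OF D U refl r act(2,3)]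
      by (simp add: frag_extend_diff)
  qed
  from frag_class_extend[OF rels_subset[OF U] rels_subset[OF U] this, of "frag_of (n, d, alg_one A U)"]
  show ?thesis by (simp add: unit_tensor_def graded_tensor_presheaf_def frag_quotient_def)
qed

lemma unit_tensor_res:
  assumes U: "openin (top_of S) U" and V: "openin (top_of S) V" "V \<subseteq> U" and d: "d \<in> carrier (mod_sec D n U)"
  shows "res tpsh U V (unit_tensor U d) = unit_tensor V (res (piece D n) U V d)"
proof -
  let ?f = "\<lambda>(i, x, y). frag_of (i, res (piece D i) U V x, res (piece (structure_module A) (n - i)) U V y)"
  note Dr = psh_res[OF gpm_psh[OF D] U V]
  have "frag_extend ?f e \<in> relgroup V" if "e \<in> rels U" for e
    using that
  proof (cases rule: rels_cases)
    case (left i x x' y)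
    show ?thesis using left rels_left[OF Dr[OF left(2)] Dr[OF left(3)] sm_res_closed[OF U V left(4)]]
        psh_add[OF gpm_psh[OF D] U V left(2,3)]
      by (simp add: frag_extend_diff sm_ops(2))
  next
    case (right i x y y')
    have y: "y \<in> carrier (alg_sec A (n - i) U)" "y' \<in> carrier (alg_sec A (n - i) U)"
      using right(3,4) alg_zero_closed[OF U] by (auto simp: sm_carrier split: if_splits)
    show ?thesis using right rels_right[OF Dr[OF right(2)] sm_res_closed[OF U V right(3)] sm_res_closed[OF U V right(4)]]
        psh_add[OF alg_psh[OF A] U V y]
      by (simp add: frag_extend_diff sm_ops(1,2))
  next
    case (act k i a x y)
    \<comment> \<open>If both degrees are zero, this is compatibility of multiplication with
      restriction; otherwise both sides are the zero of degree \<open>n - i\<close>.\<close>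
    have "res (alg_piece A (n - i)) U V (graded_mod.act (structure_module A) k (n - (k + i)) U a y) =
      graded_mod.act (structure_module A) k (n - (k + i)) V (res (alg_piece A k) U V a) (res (alg_piece A (n - (k + i))) U V y)"
    proof (cases "k = 0 \<and> n - (k + i) = 0")
      case True
      then show ?thesis
        using pairing_res[OF alg_pairing[OF A] U V, of a 0 y 0] act(2,4) by (simp add: sm_act sm_carrier)
    next
      case False
      have "k + (n - (k + i)) = n - i" by simp
      then show ?thesis using False psh_zero[OF alg_psh[OF A] U V] by (simp only: sm_act if_False)
    qed
    then show ?thesis using act rels_act[OF psh_res[OF alg_psh[OF A] U V act(2)] Dr[OF act(3)] sm_res_closed[OF U V act(4)]]
        act_res[OF D U refl V act(2,3)]
      by (simp add: frag_extend_diff sm_ops(2))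
  qed
  from frag_class_extend[OF rels_subset[OF U] rels_subset[OF V(1)] this, of "frag_of (n, d, alg_one A U)"]
  show ?thesis using alg_one_res[OF A U V]
    by (simp add: unit_tensor_def graded_tensor_presheaf_def sm_ops(2))
qed

text \<open>The additivity relation for zero plus zero is the negative of the symbol itself.\<close>

lemma frag_of_zero_left:
  assumes U: "openin (top_of S) U" and y: "y \<in> carrier (mod_sec (structure_module A) (n - i) U)"
  shows "frag_of (i, \<zero>\<^bsub>mod_sec D i U\<^esub>, y) \<in> relgroup U"
proof -
  interpret module "O_sec S U" "mod_sec D i U" using psh_module[OF gpm_psh[OF D] U] .
  show ?thesis using frag_gen_minus[OF rels_subset[OF U] rels_left[OF M.zero_closed M.zero_closed y]] by simp
qed

lemma frag_of_zero_right:
  assumes U: "openin (top_of S) U" and x: "x \<in> carrier (mod_sec D i U)" and i: "i \<noteq> n"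
  shows "frag_of (i, x, \<zero>\<^bsub>alg_sec A (n - i) U\<^esub>) \<in> relgroup U"
proof -
  interpret module "O_sec S U" "alg_sec A (n - i) U" using psh_module[OF alg_psh[OF A] U] .
  have z: "\<zero>\<^bsub>alg_sec A (n - i) U\<^esub> \<in> carrier (mod_sec (structure_module A) (n - i) U)"
    using i by (simp add: sm_carrier)
  show ?thesis using frag_gen_minus[OF rels_subset[OF U] rels_right[OF x z z]] by (simp add: sm_ops(1))
qed

text \<open>A symbol whose first factor has degree \<open>n\<close> has a second factor
  \<open>y\<close> of degree zero, and the balancing relation moves \<open>y\<close> across: the
  tensor of \<open>x\<close> and \<open>y\<close> is that of \<open>y x\<close> and one. In all
  other degrees the second factor is zero, because the structure sheaf is concentrated in degree
  zero.\<close>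

lemma unit_tensor_surj:
  assumes U: "openin (top_of S) U"
  shows "carrier (sec tpsh U) = unit_tensor U ` carrier (mod_sec D n U)"
proof -
  note E = rels_subset[OF U]
  note one = alg_one_closed[OF A U]
  have one': "alg_one A U \<in> carrier (mod_sec (structure_module A) (n - n) U)" using one by (simp add: sm_carrier)
  have ex: "\<exists>d\<in>carrier (mod_sec D n U). u - frag_of (n, d, alg_one A U) \<in> relgroup U"
    if "Poly_Mapping.keys u \<subseteq> gens U" for u
    using that
  proof (induction u rule: frag_induction)
    case zero
    show ?case
      using frag_gen_minus[OF E frag_of_zero_left[OF U one']] D_ops_closed(3)[OF U] by auto
  next
    case (one g)
    obtain i x y where g: "g = (i, x, y)" by (cases g)
    with one have x: "x \<in> carrier (mod_sec D i U)" and y: "y \<in> carrier (mod_sec (structure_module A) (n - i) U)"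
      by (simp_all add: gens_iff)
    show ?case
    proof (cases "i = n")
      case True
      have y0: "y \<in> carrier (alg_sec A 0 U)" using y True by (simp add: sm_carrier)
      have xn: "x \<in> carrier (mod_sec D n U)" using x True by simp
      have "frag_of (0 + n, graded_mod.act D 0 n U y x, alg_one A U) -
          frag_of (n, x, graded_mod.act (structure_module A) 0 (n - (0 + n)) U y (alg_one A U)) \<in> relgroup U"
        using one' by (intro rels_act[OF y0 xn]) simp
      then have "frag_of (n, graded_mod.act D 0 n U y x, alg_one A U) - frag_of (n, x, y) \<in> relgroup U"
        using alg_mult_one[OF A U y0] by (simp add: sm_act)
      from frag_gen_minus[OF E this]
      have "frag_of g - frag_of (n, graded_mod.act D 0 n U y x, alg_one A U) \<in> relgroup U"
        using g True by simp
      moreover have "graded_mod.act D 0 n U y x \<in> carrier (mod_sec D n U)"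
        by (rule act_closed[OF D U _ y0 xn]) simp
      ultimately show ?thesis by blast
    next
      case False
      then have y0: "y = \<zero>\<^bsub>alg_sec A (n - i) U\<^esub>" using y by (simp add: sm_carrier)
      have "frag_of g - frag_of (n, \<zero>\<^bsub>mod_sec D n U\<^esub>, alg_one A U) \<in> relgroup U"
        unfolding g y0 by (rule frag_gen_diff[OF E frag_of_zero_right[OF U x False] frag_of_zero_left[OF U one']])
      then show ?thesis using D_ops_closed(3)[OF U] by blast
    qed
  next
    case (diff u v)
    then obtain d d' where d: "d \<in> carrier (mod_sec D n U)" "u - frag_of (n, d, alg_one A U) \<in> relgroup U"
      and d': "d' \<in> carrier (mod_sec D n U)" "v - frag_of (n, d', alg_one A U) \<in> relgroup U" by blast
    interpret module "O_sec S U" "mod_sec D n U" using psh_module[OF gpm_psh[OF D] U] .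
    \<comment> \<open>\<open>e\<close> is the difference of \<open>d\<close> and \<open>d'\<close>;
      the additivity relation for its sum with \<open>d'\<close> then yields the difference of the
      two symbols.\<close>
    define e where "e = d \<oplus>\<^bsub>mod_sec D n U\<^esub> (\<ominus>\<^bsub>mod_sec D n U\<^esub> d')"
    have e: "e \<in> carrier (mod_sec D n U)" "e \<oplus>\<^bsub>mod_sec D n U\<^esub> d' = d"
      using d d' by (simp_all add: e_def M.a_assoc M.l_neg)
    have "frag_of (n, d, alg_one A U) - frag_of (n, e, alg_one A U) - frag_of (n, d', alg_one A U) \<in> relgroup U"
      using rels_left[OF e(1) d'(1) one'] e(2) by simp
    from frag_gen_add[OF E frag_gen_diff[OF E d(2) d'(2)] this]
    have "u - v - frag_of (n, e, alg_one A U) \<in> relgroup U" by (simp add: algebra_simps)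
    then show ?case using e(1) by blast
  qed
  show ?thesis
  proof
    show "carrier (sec tpsh U) \<subseteq> unit_tensor U ` carrier (mod_sec D n U)"
    proof
      fix k assume "k \<in> carrier (sec tpsh U)"
      then obtain u where u: "u \<in> carrier (free_Abelian_group (gens U))" "k = frag_class (gens U) (rels U) u"
        by (auto simp: graded_tensor_presheaf_def frag_quotient_def)
      then have "Poly_Mapping.keys u \<subseteq> gens U" by simp
      from ex[OF this] obtain d where d: "d \<in> carrier (mod_sec D n U)" "u - frag_of (n, d, alg_one A U) \<in> relgroup U" by blast
      have "k = unit_tensor U d" unfolding u(2) unit_tensor_def by (rule frag_class_eqI[OF E d(2)])
      then show "k \<in> unit_tensor U ` carrier (mod_sec D n U)" using d(1) by blast
    qed
    show "unit_tensor U ` carrier (mod_sec D n U) \<subseteq> carrier (sec tpsh U)"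
    proof
      fix k assume "k \<in> unit_tensor U ` carrier (mod_sec D n U)"
      then obtain d where d: "d \<in> carrier (mod_sec D n U)" "k = unit_tensor U d" by blast
      have "frag_of (n, d, alg_one A U) \<in> carrier (free_Abelian_group (gens U))"
        using d one' by (simp only: frag_of_in_free_Abelian_group gens_iff)
      then show "k \<in> carrier (sec tpsh U)"
        unfolding d(2) unit_tensor_def graded_tensor_presheaf_def frag_quotient_def by simp
    qed
  qed
qed

lemma unit_tensor_zero:
  assumes U: "openin (top_of S) U"
  shows "\<zero>\<^bsub>sec tpsh U\<^esub> = unit_tensor U \<zero>\<^bsub>mod_sec D n U\<^esub>"
proof -
  have one': "alg_one A U \<in> carrier (mod_sec (structure_module A) (n - n) U)"
    using alg_one_closed[OF A U] by (simp add: sm_carrier)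
  have "0 - frag_of (n, \<zero>\<^bsub>mod_sec D n U\<^esub>, alg_one A U) \<in> relgroup U"
    using frag_gen_minus[OF rels_subset[OF U] frag_of_zero_left[OF U one']] by simp
  from frag_class_eqI[OF rels_subset[OF U] this] show ?thesis
    by (simp add: unit_tensor_def graded_tensor_presheaf_def frag_quotient_def)
qed

lemma graded_tensor_presheaf_of_modules: "presheaf_of_modules S tpsh"
  by (rule presheaf_image[OF gpm_psh[OF D, of n] SR unit_tensor_surj unit_tensor_zero unit_tensor_add
        unit_tensor_smult unit_tensor_res])

text \<open>Multiplication \<open>x \<otimes> y \<mapsto> y x\<close> inverts \<open>d \<mapsto> d \<otimes> 1\<close> modulo the part of \<open>D\<^sub>n\<close> generated in degrees
  below \<open>n\<close>.\<close>

lemma unit_tensor_eqD: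
  assumes U: "openin (top_of S) U" and d: "d \<in> carrier (mod_sec D n U)" and d': "d' \<in> carrier (mod_sec D n U)"
    and eq: "unit_tensor U d = unit_tensor U d'"
  shows "d \<oplus>\<^bsub>mod_sec D n U\<^esub> (\<ominus>\<^bsub>mod_sec D n U\<^esub> d') \<in>
    submodule_gen A D U (\<lambda>j. if j < n then carrier (mod_sec D j U) else {}) n"
    (is "_ \<in> ?N")
proof -
  interpret module "O_sec S U" "mod_sec D n U" using psh_module[OF gpm_psh[OF D] U] .
  have G: "\<forall>j. (if j < n then carrier (mod_sec D j U) else {}) \<subseteq> carrier (mod_sec D j U)" by simp
  note N0 = submodule_gen_zero[OF A D U G, of n] and Na = submodule_gen_add[OF A D U G, of _ n]
    and Nm = submodule_gen_minus[OF A D U G, of _ n]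
  \<comment> \<open>On symbols whose first factor has degree \<open>n\<close>, \<open>\<Phi>\<close>
    multiplies the second factor into the first; on the others it is zero. The universal property of
    the free abelian group extends it to \<open>h\<close>. Additivity relations are sent to zero,
    balancing relations only into \<open>?N\<close>.\<close>
  define \<Phi> where "\<Phi> = (\<lambda>(i, x, y). if i = n then act D 0 n U y x else \<zero>\<^bsub>mod_sec D n U\<^esub>)"
  have ac: "act D 0 n U y x \<in> carrier (mod_sec D n U)" if "x \<in> carrier (mod_sec D n U)" "y \<in> carrier (alg_sec A 0 U)" for x y
    by (rule act_closed[OF D U _ that(2,1)]) simp
  have img: "\<Phi> ` gens U \<subseteq> carrier (add_monoid (mod_sec D n U))"
    using ac by (auto simp: \<Phi>_def gens_iff sm_carrier)
  obtain h where h: "h \<in> hom (free_Abelian_group (gens U)) (add_monoid (mod_sec D n U))"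
    and hf: "\<And>x. x \<in> gens U \<Longrightarrow> h (frag_of x) = \<Phi> x"
    using comm_group.free_Abelian_group_universal[OF M.a_comm_group img] by blast
  note E = rels_subset[OF U]
  note grp = group_free_Abelian_group M.a_group
  have hc: "h u \<in> carrier (mod_sec D n U)" if "u \<in> carrier (free_Abelian_group (gens U))" for u
    using hom_in_carrier[OF h that] by simp
  have hplus: "h (u + v) = h u \<oplus>\<^bsub>mod_sec D n U\<^esub> h v"
    if "u \<in> carrier (free_Abelian_group (gens U))" "v \<in> carrier (free_Abelian_group (gens U))" for u v
    using hom_mult[OF h that] by simp
  interpret gh: group_hom "free_Abelian_group (gens U)" "add_monoid (mod_sec D n U)" h
    by (intro group_hom.intro grp group_hom_axioms.intro h)
  have hinv: "h (- u) = \<ominus>\<^bsub>mod_sec D n U\<^esub> h u" if "u \<in> carrier (free_Abelian_group (gens U))" for u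
    using gh.hom_inv[OF that] that by (simp add: a_inv_def)
  have hdiff: "h (u - v) = h u \<oplus>\<^bsub>mod_sec D n U\<^esub> (\<ominus>\<^bsub>mod_sec D n U\<^esub> h v)"
    if "u \<in> carrier (free_Abelian_group (gens U))" "v \<in> carrier (free_Abelian_group (gens U))" for u v
  proof -
    have "- v \<in> carrier (free_Abelian_group (gens U))" using that(2) by simp
    from hplus[OF that(1) this] show ?thesis using hinv[OF that(2)] by simp
  qed
  have dc: "u - v \<in> carrier (free_Abelian_group (gens U))"
    if "u \<in> carrier (free_Abelian_group (gens U))" "v \<in> carrier (free_Abelian_group (gens U))" for u v
    using that keys_diff[of u v] by auto
  have mz: "\<ominus>\<^bsub>mod_sec D n U\<^esub> \<zero>\<^bsub>mod_sec D n U\<^esub> = \<zero>\<^bsub>mod_sec D n U\<^esub>"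
    using M.minus_equality[of "\<zero>\<^bsub>mod_sec D n U\<^esub>" "\<zero>\<^bsub>mod_sec D n U\<^esub>"] by simp
  have rel: "h u \<in> ?N" if u: "u \<in> rels U" for u
    using u
  proof (cases rule: rels_cases)
    case (left i x x' y)
    have g: "(i, x \<oplus>\<^bsub>mod_sec D i U\<^esub> x', y) \<in> gens U" "(i, x, y) \<in> gens U" "(i, x', y) \<in> gens U"
      using left D_ops_closed(1)[OF U] by (simp_all add: gens_iff)
    then have fg: "frag_of (i, x \<oplus>\<^bsub>mod_sec D i U\<^esub> x', y) \<in> carrier (free_Abelian_group (gens U))"
      "frag_of (i, x, y) \<in> carrier (free_Abelian_group (gens U))"
      "frag_of (i, x', y) \<in> carrier (free_Abelian_group (gens U))" by simp_all
    have "h u = \<zero>\<^bsub>mod_sec D n U\<^esub>"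
    proof (cases "i = n")
      case True
      then have y: "y \<in> carrier (alg_sec A 0 U)" and x: "x \<in> carrier (mod_sec D n U)" "x' \<in> carrier (mod_sec D n U)"
        using left by (simp_all add: sm_carrier)
      show ?thesis unfolding left(1) hdiff[OF dc[OF fg(1,2)] fg(3)] hdiff[OF fg(1,2)] hf[OF g(1)] hf[OF g(2)] hf[OF g(3)]
        using True act_add_right[OF D U _ y x, of n] ac[OF x(1) y] ac[OF x(2) y]
        by (simp add: \<Phi>_def M.a_ac M.r_neg M.r_neg1 M.r_neg2)
    next
      case False
      then show ?thesis unfolding left(1) hdiff[OF dc[OF fg(1,2)] fg(3)] hdiff[OF fg(1,2)] hf[OF g(1)] hf[OF g(2)] hf[OF g(3)]
        by (simp add: \<Phi>_def mz)
    qed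
    then show ?thesis using N0 by simp
  next
    case (right i x y y')
    let ?s = "y \<oplus>\<^bsub>mod_sec (structure_module A) (n - i) U\<^esub> y'"
    have g: "(i, x, ?s) \<in> gens U" "(i, x, y) \<in> gens U" "(i, x, y') \<in> gens U"
      using right sm_add_closed[OF U] by (simp_all add: gens_iff)
    then have fg: "frag_of (i, x, ?s) \<in> carrier (free_Abelian_group (gens U))"
      "frag_of (i, x, y) \<in> carrier (free_Abelian_group (gens U))"
      "frag_of (i, x, y') \<in> carrier (free_Abelian_group (gens U))" by simp_all
    have "h u = \<zero>\<^bsub>mod_sec D n U\<^esub>"
    proof (cases "i = n")
      case True
      then have y: "y \<in> carrier (alg_sec A 0 U)" "y' \<in> carrier (alg_sec A 0 U)" and x: "x \<in> carrier (mod_sec D n U)"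
        using right by (simp_all add: sm_carrier)
      show ?thesis unfolding right(1) hdiff[OF dc[OF fg(1,2)] fg(3)] hdiff[OF fg(1,2)] hf[OF g(1)] hf[OF g(2)] hf[OF g(3)]
        using True act_add_left[OF D U _ y x, of n] ac[OF x y(1)] ac[OF x y(2)]
        by (simp add: \<Phi>_def sm_ops M.a_ac M.r_neg M.r_neg1 M.r_neg2)
    next
      case False
      then show ?thesis unfolding right(1) hdiff[OF dc[OF fg(1,2)] fg(3)] hdiff[OF fg(1,2)] hf[OF g(1)] hf[OF g(2)] hf[OF g(3)]
        by (simp add: \<Phi>_def mz)
    qed
    then show ?thesis using N0 by simp
  next
    case (act k i a x y)
    let ?l = "(k + i, graded_mod.act D k i U a x, y)"
    let ?r = "(i, x, graded_mod.act (structure_module A) k (n - (k + i)) U a y)"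
    have g: "?l \<in> gens U" "?r \<in> gens U"
      using act act_closed[OF D U refl] sm_act_closed[OF U act(2) _ act(4), of "n - i"] by (simp_all add: gens_iff)
    then have fg: "frag_of ?l \<in> carrier (free_Abelian_group (gens U))" "frag_of ?r \<in> carrier (free_Abelian_group (gens U))"
      by simp_all
    have hu: "h u = \<Phi> ?l \<oplus>\<^bsub>mod_sec D n U\<^esub> (\<ominus>\<^bsub>mod_sec D n U\<^esub> \<Phi> ?r)"
      unfolding act(1) hdiff[OF fg] hf[OF g(1)] hf[OF g(2)] by (rule refl)
    have Pl: "\<Phi> ?l \<in> carrier (mod_sec D n U)" "\<Phi> ?r \<in> carrier (mod_sec D n U)" using img g by auto
    show ?thesis
    proof (cases "k = 0")
      \<comment> \<open>Balancing by an element of degree zero is respected exactly, thanks to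
        commutativity of \<open>A\<close> in degree zero.\<close>
      case k: True
      have "\<Phi> ?l = \<Phi> ?r"
      proof (cases "i = n")
        case True
        then have x: "x \<in> carrier (mod_sec D n U)" and a: "a \<in> carrier (alg_sec A 0 U)" and y: "y \<in> carrier (alg_sec A 0 U)"
          using act k by (simp_all add: sm_carrier)
        have "graded_mod.act D 0 n U y (graded_mod.act D 0 n U a x) = graded_mod.act D 0 n U (alg_mult A 0 0 U y a) x"
          using act_assoc[OF D U _ _ y a x, of 0 n] by simp
        also have "\<dots> = graded_mod.act D 0 n U (alg_mult A 0 0 U a y) x" by (simp only: alg_comm[OF A U a y])
        finally show ?thesis using k True by (simp add: \<Phi>_def sm_act)
      next
        case False
        then show ?thesis using k by (simp add: \<Phi>_def)
      qed
      then show ?thesis unfolding hu using Pl N0 by (simp add: M.r_neg)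
    next
      \<comment> \<open>Elements of nonzero degree act as zero on the structure sheaf, so the right
        symbol contributes nothing. What survives is a product of an algebra element of degree
        \<open>k\<close> with \<open>x\<close> of degree \<open>n - k\<close>, which is the source
        of the error term in \<open>?N\<close>.\<close>
      case k: False
      have "\<Phi> ?r = \<zero>\<^bsub>mod_sec D n U\<^esub>"
      proof (cases "i = n")
        case True
        then show ?thesis using k act_zero_left[OF A D U, of n 0 n x] act(3) by (simp add: \<Phi>_def sm_act)
      next
        case False
        then show ?thesis by (simp add: \<Phi>_def)
      qed
      then have hu': "h u = \<Phi> ?l" unfolding hu using Pl by simp
      show ?thesis
      proof (cases "k + i = n")
        case True
        then have y: "y \<in> carrier (alg_sec A 0 U)" using act(4) by (simp add: sm_carrier)
        have "\<Phi> ?l = graded_mod.act D (0 + k) i U (alg_mult A 0 k U y a) x"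
          using act_assoc[OF D U _ _ y act(2,3), of "0 + k" n] True by (simp add: \<Phi>_def)
        also have "\<dots> \<in> ?N"
        proof (cases "i < n")
          case True
          show ?thesis
            by (rule submodule_gen_incl[OF A D U G _ alg_mult_closed[OF A U refl y act(2)]])
              (use True \<open>k + i = n\<close> act(3) in simp_all)
        next
          case False
          \<comment> \<open>A first factor of degree at least \<open>n\<close> leaves only negative
            \<open>k\<close>, and the algebra vanishes in negative degrees.\<close>
          then have "k < 0" using k True by simp
          then have "alg_mult A 0 k U y a = \<zero>\<^bsub>alg_sec A (0 + k) U\<^esub>"
            using alg_mult_closed[OF A U, of "0 + k" 0 k y a] y act(2) alg_neg[OF A U, of "0 + k"] by simp
          then show ?thesis using act_zero_left[OF A D U _ act(3), of n "0 + k"] True N0 by simp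
        qed
        finally show ?thesis unfolding hu' .
      next
        case False
        then show ?thesis unfolding hu' using N0 by (simp add: \<Phi>_def)
      qed
    qed
  qed
  have sub: "u \<in> carrier (free_Abelian_group (gens U)) \<and> h u \<in> ?N" if "u \<in> relgroup U" for u
    using that
  proof (induction rule: generate.induct)
    case one
    then show ?case using gh.hom_one N0 by simp
  next
    case (incl e)
    then show ?case using E rel by blast
  next
    case (inv e)
    then have e: "e \<in> carrier (free_Abelian_group (gens U))" using E by blast
    then show ?case using hinv[OF e] Nm[OF rel[OF inv]] by simp
  next
    case (eng u v)
    then show ?case using hplus[of u v] Na[of "h u" "h v"] keys_add[of u v] by auto
  qed
  have g: "(n, d, alg_one A U) \<in> gens U" "(n, d', alg_one A U) \<in> gens U"
    using d d' alg_one_closed[OF A U] by (simp_all add: gens_iff sm_carrier)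
  then have fg: "frag_of (n, d, alg_one A U) \<in> carrier (free_Abelian_group (gens U))"
    "frag_of (n, d', alg_one A U) \<in> carrier (free_Abelian_group (gens U))" by simp_all
  have "frag_of (n, d, alg_one A U) - frag_of (n, d', alg_one A U) \<in> relgroup U"
    using eq unfolding unit_tensor_def by (rule frag_class_eqD[OF E])
  then have "h (frag_of (n, d, alg_one A U) - frag_of (n, d', alg_one A U)) \<in> ?N" using sub by blast
  then show ?thesis unfolding hdiff[OF fg] hf[OF g(1)] hf[OF g(2)]
    using act_one[OF D U d] act_one[OF D U d'] by (simp add: \<Phi>_def)
qed

end

section \<open>Generators of the truncations\<close>

context module
begin

lemma in_span_smult:
  assumes "finite J" "e \<in> J \<rightarrow> carrier M" "r \<in> carrier R" "in_span R M J e y"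
  shows "in_span R M J e (r \<odot>\<^bsub>M\<^esub> y)"
proof -
  from assms(4) obtain c where c: "c \<in> J \<rightarrow> carrier R" "y = (\<Oplus>\<^bsub>M\<^esub>j\<in>J. c j \<odot>\<^bsub>M\<^esub> e j)"
    by (auto simp: in_span_def)
  have "(\<lambda>j. r \<otimes> c j) \<in> J \<rightarrow> carrier R" using c assms(3) by (simp add: Pi_iff)
  then show ?thesis unfolding in_span_def c(2) lincomb_smult[OF assms(1,3) c(1) assms(2)]
    by (rule bexI[rotated]) (rule refl)
qed

lemma in_span_self:
  assumes "finite J" "e \<in> J \<rightarrow> carrier M" "j \<in> J"
  shows "in_span R M J e (e j)"
proof -
  have ej: "e j \<in> carrier M" using assms by auto
  have "(\<Oplus>\<^bsub>M\<^esub>i\<in>J. (if j = i then \<one> else \<zero>) \<odot>\<^bsub>M\<^esub> e i) = (\<Oplus>\<^bsub>M\<^esub>i\<in>J. if j = i then e i else \<zero>\<^bsub>M\<^esub>)"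
    using assms(2) by (intro M.finsum_cong') (auto simp: Pi_iff)
  also have "\<dots> = e j" using assms by (intro M.finsum_singleton) auto
  finally have "e j = (\<Oplus>\<^bsub>M\<^esub>i\<in>J. (if j = i then \<one> else \<zero>) \<odot>\<^bsub>M\<^esub> e i)" ..
  moreover have "(\<lambda>i. if j = i then \<one> else \<zero>) \<in> J \<rightarrow> carrier R" by simp
  ultimately show ?thesis unfolding in_span_def by (rule bexI[where x="\<lambda>i. if j = i then \<one> else \<zero>"])
qed

lemma submodule_finsum:
  assumes sub: "submodule H R M" and f: "\<And>i. i \<in> I \<Longrightarrow> f i \<in> H"
  shows "(\<Oplus>\<^bsub>M\<^esub>i\<in>I. f i) \<in> H"
  using f
proof (induction I rule: infinite_finite_induct)
  case (infinite I)
  then show ?case using submoduleE(1)[OF sub] subgroup.one_closed[OF submodule.axioms(1)[OF sub]]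
    by (simp add: M.finsum_infinite)
next
  case empty
  then show ?case using subgroup.one_closed[OF submodule.axioms(1)[OF sub]] by simp
next
  case (insert i I)
  have "f i \<in> carrier M" "f \<in> I \<rightarrow> carrier M" using insert.prems submoduleE(1)[OF sub] by auto
  then show ?case using insert submoduleE(5)[OF sub] by (simp add: M.finsum_insert)
qed

lemma in_span_submodule:
  assumes "finite J" "e \<in> J \<rightarrow> carrier M"
  shows "submodule {z. in_span R M J e z} R M"
  by (rule submoduleI)
    (use in_span_closed[OF _ assms(2)] in_span_zero[OF assms(2)] in_span_minus[OF assms]
      in_span_add[OF assms(2)] in_span_smult[OF assms] in auto)

end

text \<open>Generation of the degree \<open>n\<close> piece by these sections expresses that
  \<open>E\<close> generates \<open>D\<close> in degree \<open>n\<close> modulo the products of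
  positive-degree algebra elements with lower pieces, without forming that quotient.\<close>

abbreviation minimal_gens :: "('x, 'r, 'a, 'm) graded_mod \<Rightarrow> int \<Rightarrow> 'x set \<Rightarrow> 'm set \<Rightarrow> int \<Rightarrow> 'm set" where
  "minimal_gens D n Y E \<equiv> (\<lambda>j. if j < n then carrier (mod_sec D j Y) else if j = n then E else {})"

text \<open>A local basis of the sheafified tensor product yields presheaf generators near
  \<open>x\<close>, and by surjectivity of \<open>unit_tensor\<close> these lift to sections
  \<open>g i\<close> of \<open>D\<close>. An arbitrary \<open>d\<close> then has, after restriction,
  the same image as a combination of the lifts, and \<open>unit_tensor_eqD\<close> identifies the
  difference as generated in lower degrees.\<close>

lemma socle_local_generators:
  fixes S :: "('x, 'r) ringed_space" and A :: "('x, 'r, 'a) graded_alg" and D :: "('x, 'r, 'a, 'm) graded_mod"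
  assumes SR: "is_ringed_space S" and A: "graded_algebra S A" and D: "graded_premodule S A D"
    and lf: "locally_free_of_rank S (graded_tensor S A D (structure_module A) n) k" and x: "x \<in> points S"
  shows "\<exists>U g. openin (top_of S) U \<and> x \<in> U \<and> (\<forall>i<nat k. g i \<in> carrier (mod_sec D n U)) \<and>
    (\<forall>W d. openin (top_of S) W \<and> x \<in> W \<and> W \<subseteq> U \<and> d \<in> carrier (mod_sec D n W) \<longrightarrow>
      (\<exists>Y. openin (top_of S) Y \<and> x \<in> Y \<and> Y \<subseteq> W \<and> res (piece D n) W Y d \<in>
        submodule_gen A D Y (minimal_gens D n Y ((\<lambda>i. res (piece D n) U Y (g i)) ` {..<nat k})) n))"
proof -
  let ?T = "graded_tensor_presheaf A D (structure_module A) n"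
  let ?\<tau> = "unit_tensor A D n"
  note cx = SR A D
  note PT = graded_tensor_presheaf_of_modules[OF cx, of n]
  note P = gpm_psh[OF D, of n]
  obtain U0 es where U0: "openin (top_of S) U0" "x \<in> U0" "basis_on S (sheafification S ?T) U0 es" "int (length es) = k"
    using lf x unfolding locally_free_of_rank_def graded_tensor_def by blast
  have len: "length es = nat k" using U0(4) by simp
  let ?I = "{..<nat k}"
  obtain U g' where U: "openin (top_of S) U" "x \<in> U" "U \<subseteq> U0" and g': "g' \<in> ?I \<rightarrow> carrier (sec ?T U)"
    and span: "\<And>W z. openin (top_of S) W \<Longrightarrow> x \<in> W \<Longrightarrow> W \<subseteq> U \<Longrightarrow> z \<in> carrier (sec ?T W) \<Longrightarrow>
      \<exists>Y. openin (top_of S) Y \<and> x \<in> Y \<and> Y \<subseteq> W \<and>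
        in_span (O_sec S Y) (sec ?T Y) ?I (\<lambda>i. res ?T U Y (g' i)) (res ?T W Y z)"
    by (rule sheafification_local_generators[OF SR PT U0(1-3), unfolded len]) (rule that)
  have "\<forall>i\<in>?I. \<exists>d. d \<in> carrier (mod_sec D n U) \<and> g' i = ?\<tau> U d"
  proof
    fix i assume "i \<in> ?I"
    then have "g' i \<in> carrier (sec ?T U)" using g' by (rule Pi_mem[rotated])
    then show "\<exists>d. d \<in> carrier (mod_sec D n U) \<and> g' i = ?\<tau> U d"
      unfolding unit_tensor_surj[OF cx U(1)] by blast
  qed
  from bchoice[OF this] obtain g where g: "\<forall>i\<in>?I. g i \<in> carrier (mod_sec D n U) \<and> g' i = ?\<tau> U (g i)" ..
  have gc: "g i \<in> carrier (mod_sec D n U)" "g' i = ?\<tau> U (g i)" if "i \<in> ?I" for i using g that by blast+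
  show ?thesis
  proof (rule exI[of _ U], rule exI[of _ g], intro conjI allI impI U(1,2))
    show "g i \<in> carrier (mod_sec D n U)" if "i < nat k" for i using gc(1) that by simp
    fix W d assume "openin (top_of S) W \<and> x \<in> W \<and> W \<subseteq> U \<and> d \<in> carrier (mod_sec D n W)"
    then have W: "openin (top_of S) W" "x \<in> W" "W \<subseteq> U" and d: "d \<in> carrier (mod_sec D n W)" by simp_all
    have "?\<tau> W d \<in> carrier (sec ?T W)" unfolding unit_tensor_surj[OF cx W(1)] using d by blast
    from span[OF W this] obtain Y where Y: "openin (top_of S) Y" "x \<in> Y" "Y \<subseteq> W"
      and sp: "in_span (O_sec S Y) (sec ?T Y) ?I (\<lambda>i. res ?T U Y (g' i)) (res ?T W Y (?\<tau> W d))" by blast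
    have YU: "Y \<subseteq> U" using Y W by blast
    from sp obtain c where c: "c \<in> ?I \<rightarrow> carrier (O_sec S Y)"
      and eq: "res ?T W Y (?\<tau> W d) = (\<Oplus>\<^bsub>sec ?T Y\<^esub>i\<in>?I. c i \<odot>\<^bsub>sec ?T Y\<^esub> res ?T U Y (g' i))"
      unfolding in_span_def by blast
    interpret DY: module "O_sec S Y" "mod_sec D n Y" using psh_module[OF P Y(1)] .
    interpret TY: module "O_sec S Y" "sec ?T Y" using psh_module[OF PT Y(1)] .
    let ?e = "\<lambda>i. res (piece D n) U Y (g i)"
    have e: "?e i \<in> carrier (mod_sec D n Y)" if "i \<in> ?I" for i
      by (rule psh_res[OF P U(1) Y(1) YU gc(1)[OF that]])
    have cR: "c i \<in> carrier (O_sec S Y)" if "i \<in> ?I" for i using c that by auto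
    have \<tau>c: "?\<tau> Y z \<in> carrier (sec ?T Y)" if "z \<in> carrier (mod_sec D n Y)" for z
      unfolding unit_tensor_surj[OF cx Y(1)] using that by blast
    \<comment> \<open>The expansion of the image of \<open>d\<close>, lifted coefficient by
      coefficient to \<open>D\<close>.\<close>
    define w where "w = (\<Oplus>\<^bsub>mod_sec D n Y\<^esub>i\<in>?I. c i \<odot>\<^bsub>mod_sec D n Y\<^esub> ?e i)"
    have wc: "w \<in> carrier (mod_sec D n Y)" unfolding w_def using c e by (intro DY.lincomb_closed) auto
    have "?\<tau> Y w = (\<Oplus>\<^bsub>sec ?T Y\<^esub>i\<in>?I. ?\<tau> Y (c i \<odot>\<^bsub>mod_sec D n Y\<^esub> ?e i))"
      unfolding w_def
    proof (rule DY.hom_finsum_to[OF TY.abelian_monoid_axioms])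
      show "?\<tau> Y \<in> carrier (mod_sec D n Y) \<rightarrow> carrier (sec ?T Y)" using \<tau>c by blast
      show "(\<lambda>i. c i \<odot>\<^bsub>mod_sec D n Y\<^esub> ?e i) \<in> ?I \<rightarrow> carrier (mod_sec D n Y)"
        using DY.smult_closed[OF cR e] by blast
    qed (simp_all only: unit_tensor_zero[OF cx Y(1)] unit_tensor_add[OF cx Y(1)])
    also have "\<dots> = (\<Oplus>\<^bsub>sec ?T Y\<^esub>i\<in>?I. c i \<odot>\<^bsub>sec ?T Y\<^esub> res ?T U Y (g' i))"
    proof (rule TY.finsum_cong'[OF refl])
      fix i assume i: "i \<in> ?I"
      show t: "?\<tau> Y (c i \<odot>\<^bsub>mod_sec D n Y\<^esub> ?e i) = c i \<odot>\<^bsub>sec ?T Y\<^esub> res ?T U Y (g' i)"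
        unfolding gc(2)[OF i] unit_tensor_res[OF cx U(1) Y(1) YU gc(1)[OF i]]
          unit_tensor_smult[OF cx Y(1) cR[OF i] e[OF i]] by (rule refl)
    next
      show "(\<lambda>i. c i \<odot>\<^bsub>sec ?T Y\<^esub> res ?T U Y (g' i)) \<in> ?I \<rightarrow> carrier (sec ?T Y)"
      proof
        fix i assume i: "i \<in> ?I"
        show "c i \<odot>\<^bsub>sec ?T Y\<^esub> res ?T U Y (g' i) \<in> carrier (sec ?T Y)"
          unfolding gc(2)[OF i] unit_tensor_res[OF cx U(1) Y(1) YU gc(1)[OF i]]
          by (rule TY.smult_closed[OF cR[OF i] \<tau>c[OF e[OF i]]])
      qed
    qed
    finally have "?\<tau> Y (res (piece D n) W Y d) = ?\<tau> Y w"
      using eq unit_tensor_res[OF cx W(1) Y(1,3) d] by simp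
    note dY = psh_res[OF P W(1) Y(1,3) d]
    let ?M = "minimal_gens D n Y (?e ` ?I)"
    have M: "\<forall>j. ?M j \<subseteq> carrier (mod_sec D j Y)" using e by auto
    have "res (piece D n) W Y d \<oplus>\<^bsub>mod_sec D n Y\<^esub> (\<ominus>\<^bsub>mod_sec D n Y\<^esub> w) \<in>
        submodule_gen A D Y (\<lambda>j. if j < n then carrier (mod_sec D j Y) else {}) n"
      by (rule unit_tensor_eqD[OF cx Y(1) dY wc]) fact
    also have "\<dots> \<subseteq> submodule_gen A D Y ?M n" by (rule submodule_gen_mono) auto
    finally have 1: "res (piece D n) W Y d \<oplus>\<^bsub>mod_sec D n Y\<^esub> (\<ominus>\<^bsub>mod_sec D n Y\<^esub> w) \<in> submodule_gen A D Y ?M n" .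
    have 2: "w \<in> submodule_gen A D Y ?M n" unfolding w_def
    proof (rule DY.submodule_finsum[OF submodule_gen_submodule[OF A D Y(1) M]])
      fix i assume i: "i \<in> ?I"
      show "c i \<odot>\<^bsub>mod_sec D n Y\<^esub> ?e i \<in> submodule_gen A D Y ?M n"
        by (rule submodule_gen_smult[OF A D Y(1) M cR[OF i] submodule_gen_self[OF A D Y(1) M]]) (use i in auto)
    qed
    have "res (piece D n) W Y d = res (piece D n) W Y d \<oplus>\<^bsub>mod_sec D n Y\<^esub> (\<ominus>\<^bsub>mod_sec D n Y\<^esub> w) \<oplus>\<^bsub>mod_sec D n Y\<^esub> w"
      using dY wc by (simp add: DY.M.a_assoc DY.M.l_neg)
    then have "res (piece D n) W Y d \<in> submodule_gen A D Y ?M n"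
      using submodule_gen_add[OF A D Y(1) M 1 2] by simp
    then show "\<exists>Y. openin (top_of S) Y \<and> x \<in> Y \<and> Y \<subseteq> W \<and> res (piece D n) W Y d \<in>
        submodule_gen A D Y (minimal_gens D n Y ((\<lambda>i. res (piece D n) U Y (g i)) ` ?I)) n"
      using Y by blast
  qed
qed

section \<open>The graded Nakayama lemma on shrinking neighbourhoods\<close>

text \<open>The lifts of degree at most \<open>u\<close>, restricted to \<open>W\<close>. The
  dependence on \<open>W\<close> makes this an admissible system of generators for
  \<open>submodule_gen_locally_trans\<close>. Since the dual has reversed degrees, the truncation at
  \<open>m\<close> corresponds to \<open>u = - m\<close>.\<close>

definition trunc_system :: "('x, 'r, 'a, 'm) graded_mod \<Rightarrow> 'x set \<Rightarrow> (int \<Rightarrow> nat) \<Rightarrow> (int \<Rightarrow> nat \<Rightarrow> 'm) \<Rightarrow> int \<Rightarrow>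
    'x set \<Rightarrow> int \<Rightarrow> 'm set" where
  "trunc_system D U N g u W j = (if j \<le> u then (\<lambda>i. res (piece D j) U W (g j i)) ` {..<N j} else {})"

context
  fixes S :: "('x, 'r) ringed_space" and A :: "('x, 'r, 'a) graded_alg" and D :: "('x, 'r, 'a, 'm) graded_mod"
    and U :: "'x set" and x :: 'x and N :: "int \<Rightarrow> nat" and g :: "int \<Rightarrow> nat \<Rightarrow> 'm"
  assumes SR: "is_ringed_space S" and A: "graded_algebra S A" and D: "graded_premodule S A D"
    and U: "openin (top_of S) U" "x \<in> U"
    and g: "\<And>n i. i < N n \<Longrightarrow> g n i \<in> carrier (mod_sec D n U)"
begin

abbreviation "K \<equiv> trunc_system D U N g"

lemma trunc_system_closed:
  assumes "openin (top_of S) W" "W \<subseteq> U"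
  shows "K u W j \<subseteq> carrier (mod_sec D j W)"
  using psh_res[OF gpm_psh[OF D] U(1) assms g] by (auto simp: trunc_system_def)

lemma trunc_system_res:
  assumes "openin (top_of S) V" "openin (top_of S) W" "W \<subseteq> V" "V \<subseteq> U" "y \<in> K u V j"
  shows "res (piece D j) V W y \<in> K u W j"
proof -
  obtain i where i: "j \<le> u" "i < N j" "y = res (piece D j) U V (g j i)"
    using assms(5) by (auto simp: trunc_system_def split: if_splits)
  have "res (piece D j) V W y = res (piece D j) U W (g j i)"
    unfolding i(3) by (rule psh_comp[OF gpm_psh[OF D] U(1) assms(1-4) g[OF i(2)]])
  then show ?thesis using i by (simp add: trunc_system_def)
qed

lemma trunc_system_mono: "u \<le> v \<Longrightarrow> K u W j \<subseteq> K v W j"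
  by (auto simp: trunc_system_def)

text \<open>Generation modulo lower degrees is converted into generation by induction from the
  degrees where \<open>D\<close> vanishes: the sections of lower degree that occur are generated by
  lifts after further shrinking. In \<open>gen\<close> each degree has its own \<open>U'\<close>,
  since there are infinitely many degrees and only the neighbourhood \<open>U\<close> carrying the
  lifts is common to all. The conclusion retains the bound \<open>K n\<close>, allowing only lifts
  of degree at most \<open>n\<close>.\<close>

lemma graded_nakayama:
  assumes low: "\<And>n V. n < n0 \<Longrightarrow> openin (top_of S) V \<Longrightarrow> carrier (mod_sec D n V) = {\<zero>\<^bsub>mod_sec D n V\<^esub>}"
    and gen: "\<And>n. \<exists>U'. openin (top_of S) U' \<and> x \<in> U' \<and> (\<forall>W d. openin (top_of S) W \<and> x \<in> W \<and> W \<subseteq> U \<and> W \<subseteq> U' \<and>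
      d \<in> carrier (mod_sec D n W) \<longrightarrow> (\<exists>Y. openin (top_of S) Y \<and> x \<in> Y \<and> Y \<subseteq> W \<and> res (piece D n) W Y d \<in>
        submodule_gen A D Y (minimal_gens D n Y ((\<lambda>i. res (piece D n) U Y (g n i)) ` {..<N n})) n))"
    and V: "openin (top_of S) V" "x \<in> V" "V \<subseteq> U" and d: "d \<in> carrier (mod_sec D n V)"
  shows "\<exists>W. openin (top_of S) W \<and> x \<in> W \<and> W \<subseteq> V \<and> res (piece D n) V W d \<in> submodule_gen A D W (K n W) n"
  using V d
\<comment> \<open>The measure is zero exactly for \<open>n < n0\<close>. The summand one makes it
  drop strictly when passing from degree \<open>n0\<close> into the vanishing range.\<close>
proof (induction "nat (n - n0 + 1)" arbitrary: n V d rule: less_induct)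
  case less
  note V = less.prems(1-3) and d = less.prems(4)
  note P = gpm_psh[OF D]
  show ?case
  proof (cases "n < n0")
    case True
    then have "d = \<zero>\<^bsub>mod_sec D n V\<^esub>" using low[OF True V(1)] d by simp
    then have "res (piece D n) V V d = \<zero>\<^bsub>mod_sec D n V\<^esub>" using psh_zero[OF P V(1) V(1)] by simp
    moreover have "\<zero>\<^bsub>mod_sec D n V\<^esub> \<in> submodule_gen A D V (K n V) n"
      by (rule submodule_gen_zero[OF A D V(1)]) (use trunc_system_closed[OF V(1,3)] in blast)
    ultimately show ?thesis using V by (intro exI[of _ V]) simp
  next
    case False
    obtain U' where U': "openin (top_of S) U'" "x \<in> U'" and gen': "\<forall>W d. openin (top_of S) W \<and> x \<in> W \<and> W \<subseteq> U \<and> W \<subseteq> U' \<and>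
      d \<in> carrier (mod_sec D n W) \<longrightarrow> (\<exists>Y. openin (top_of S) Y \<and> x \<in> Y \<and> Y \<subseteq> W \<and> res (piece D n) W Y d \<in>
        submodule_gen A D Y (minimal_gens D n Y ((\<lambda>i. res (piece D n) U Y (g n i)) ` {..<N n})) n)"
      using gen[of n] by blast
    define V' where "V' = V \<inter> U'"
    have V': "openin (top_of S) V'" "x \<in> V'" "V' \<subseteq> V" "V' \<subseteq> U" "V' \<subseteq> U'" using V U' by (auto simp: V'_def)
    note d' = psh_res[OF P V(1) V'(1,3) d]
    obtain Y where Y: "openin (top_of S) Y" "x \<in> Y" "Y \<subseteq> V'"
      and m: "res (piece D n) V' Y (res (piece D n) V V' d) \<in>
        submodule_gen A D Y (minimal_gens D n Y ((\<lambda>i. res (piece D n) U Y (g n i)) ` {..<N n})) n"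
      using gen'[rule_format, of V' "res (piece D n) V V' d"] V' d' by blast
    have YU: "Y \<subseteq> U" "Y \<subseteq> V" using Y V' by auto
    let ?E = "(\<lambda>i. res (piece D n) U Y (g n i)) ` {..<N n}"
    have m: "res (piece D n) V Y d \<in> submodule_gen A D Y (minimal_gens D n Y ?E) n"
      using m unfolding psh_comp[OF P V(1) V'(1) Y(1,3) V'(3) d] .
    have E: "?E = K n Y n" by (simp add: trunc_system_def)
    have Gc: "\<forall>j. minimal_gens D n Y ?E j \<subseteq> carrier (mod_sec D j Y)"
      unfolding E using trunc_system_closed[OF Y(1) YU(1)] by auto
    have "\<exists>W. openin (top_of S) W \<and> x \<in> W \<and> W \<subseteq> Y \<and> res (piece D n) Y W (res (piece D n) V Y d) \<in> submodule_gen A D W (K n W) n"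
    proof (rule submodule_gen_locally_trans[OF A D Y(1,2) Gc m])
      show "K n W j \<subseteq> carrier (mod_sec D j W)" if "openin (top_of S) W" "W \<subseteq> Y" for W j
        using trunc_system_closed[OF that(1)] that(2) YU by blast
      show "res (piece D j) X W y \<in> K n W j"
        if "openin (top_of S) X" "openin (top_of S) W" "W \<subseteq> X" "X \<subseteq> Y" "y \<in> K n X j" for X W j y
        by (rule trunc_system_res[OF that(1-3) subset_trans[OF that(4) YU(1)] that(5)])
      fix j y assume y: "y \<in> minimal_gens D n Y ?E j"
      show "\<exists>W. openin (top_of S) W \<and> x \<in> W \<and> W \<subseteq> Y \<and> res (piece D j) Y W y \<in> submodule_gen A D W (K n W) j"
      proof (cases "j < n")
        case True
        then have yc: "y \<in> carrier (mod_sec D j Y)" using y by simp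
        have "nat (j - n0 + 1) < nat (n - n0 + 1)" using True False by linarith
        from less.hyps[OF this Y(1,2) YU(1) yc] obtain W where W: "openin (top_of S) W" "x \<in> W" "W \<subseteq> Y"
          and w: "res (piece D j) Y W y \<in> submodule_gen A D W (K j W) j" by blast
        have "submodule_gen A D W (K j W) j \<subseteq> submodule_gen A D W (K n W) j"
          by (rule submodule_gen_mono) (rule trunc_system_mono, use True in simp)
        then show ?thesis using W w by blast
      next
        case False
        then have jn: "j = n" and yE: "y \<in> K n Y n" using y E by (auto split: if_splits)
        have "y \<in> carrier (mod_sec D n Y)" using trunc_system_closed[OF Y(1) YU(1)] yE by blast
        then have "res (piece D n) Y Y y = y" by (rule psh_id[OF P Y(1)])
        moreover have "y \<in> submodule_gen A D Y (K n Y) n"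
          by (rule submodule_gen_self[where G="K n Y", OF A D Y(1) _ yE]) (use trunc_system_closed[OF Y(1) YU(1)] in blast)
        ultimately show ?thesis using Y jn by auto
      qed
    qed
    then obtain W where W: "openin (top_of S) W" "x \<in> W" "W \<subseteq> Y"
      and w: "res (piece D n) Y W (res (piece D n) V Y d) \<in> submodule_gen A D W (K n W) n" by blast
    have "res (piece D n) V W d \<in> submodule_gen A D W (K n W) n"
      using w unfolding psh_comp[OF P V(1) Y(1) W(1,3) YU(2) d] .
    then show ?thesis using W YU by blast
  qed
qed

lemma Delta_local_generators:
  assumes nak: "\<And>n V d. openin (top_of S) V \<Longrightarrow> x \<in> V \<Longrightarrow> V \<subseteq> U \<Longrightarrow> d \<in> carrier (mod_sec D n V) \<Longrightarrow>
      \<exists>W. openin (top_of S) W \<and> x \<in> W \<and> W \<subseteq> V \<and> res (piece D n) V W d \<in> submodule_gen A D W (K n W) n"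
    and V: "openin (top_of S) V" "x \<in> V" "V \<subseteq> U" and d: "d \<in> carrier (mod_sec (Delta S A m D) n V)"
  shows "\<exists>W. openin (top_of S) W \<and> x \<in> W \<and> W \<subseteq> V \<and> res (piece D n) V W d \<in> submodule_gen A D W (K (- m) W) n"
proof -
  note P = gpm_psh[OF D]
  have dc: "d \<in> carrier (mod_sec D n V)" using d by (simp add: Delta_carrier_iff)
  obtain Y where Y: "openin (top_of S) Y" "Y \<subseteq> V" "x \<in> Y"
    and m: "res (piece D n) V Y d \<in> submodule_gen A D Y (truncation_gens D m Y) n"
    using d V(2) unfolding Delta_carrier_iff by blast
  have YU: "Y \<subseteq> U" using Y V by blast
  have "\<exists>W. openin (top_of S) W \<and> x \<in> W \<and> W \<subseteq> Y \<and> res (piece D n) Y W (res (piece D n) V Y d) \<in> submodule_gen A D W (K (- m) W) n"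
  proof (rule submodule_gen_locally_trans[OF A D Y(1,3) truncation_gens_carrier m])
    show "K (- m) W j \<subseteq> carrier (mod_sec D j W)" if "openin (top_of S) W" "W \<subseteq> Y" for W j
      using trunc_system_closed[OF that(1)] that(2) YU by blast
    show "res (piece D j) X W y \<in> K (- m) W j"
      if "openin (top_of S) X" "openin (top_of S) W" "W \<subseteq> X" "X \<subseteq> Y" "y \<in> K (- m) X j" for X W j y
      by (rule trunc_system_res[OF that(1-3) subset_trans[OF that(4) YU] that(5)])
    fix j y assume y: "y \<in> truncation_gens D m Y j"
    then have jm: "m \<le> - j" and yc: "y \<in> carrier (mod_sec D j Y)" by (auto split: if_splits)
    from nak[OF Y(1,3) YU yc] obtain W where W: "openin (top_of S) W" "x \<in> W" "W \<subseteq> Y"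
      and w: "res (piece D j) Y W y \<in> submodule_gen A D W (K j W) j" by blast
    have "submodule_gen A D W (K j W) j \<subseteq> submodule_gen A D W (K (- m) W) j"
      by (rule submodule_gen_mono) (rule trunc_system_mono, use jm in simp)
    then show "\<exists>W. openin (top_of S) W \<and> x \<in> W \<and> W \<subseteq> Y \<and> res (piece D j) Y W y \<in> submodule_gen A D W (K (- m) W) j"
      using W w by blast
  qed
  then obtain W where W: "openin (top_of S) W" "x \<in> W" "W \<subseteq> Y"
    and w: "res (piece D n) Y W (res (piece D n) V Y d) \<in> submodule_gen A D W (K (- m) W) n" by blast
  have "res (piece D n) V W d \<in> submodule_gen A D W (K (- m) W) n"
    using w unfolding psh_comp[OF P V(1) Y(1) W(1,3) Y(2) dc] .
  then show ?thesis using W Y by blast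
qed

text \<open>Passes from generation over \<open>A\<close> to a finite spanning family over the ring
  of sections: in each product of an algebra section with a lift, the algebra factor of degree
  \<open>n - j\<close> is expanded in a local basis. A triple \<open>(j, i, l)\<close> stands for
  the product of the \<open>l\<close>-th basis element with the \<open>i\<close>-th lift of degree
  \<open>j\<close>.\<close>

lemma trunc_system_span:
  assumes W: "openin (top_of S) W" "W \<subseteq> U" and fin: "finite {j. N j \<noteq> 0}"
    and r: "\<And>j. N j \<noteq> 0 \<Longrightarrow> basis_on S (alg_piece A (n - j)) (UA j) (\<alpha> j)"
    and UA: "\<And>j. N j \<noteq> 0 \<Longrightarrow> openin (top_of S) (UA j)" "\<And>j. N j \<noteq> 0 \<Longrightarrow> W \<subseteq> UA j"
    and z: "z \<in> submodule_gen A D W (K u W) n"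
  defines "L \<equiv> (SIGMA j:{j. N j \<noteq> 0 \<and> j \<le> u}. {..<N j} \<times> {..<length (\<alpha> j)})"
    and "\<gamma> \<equiv> (\<lambda>(j, i, l). act D (n - j) j W (res (alg_piece A (n - j)) (UA j) W (\<alpha> j ! l)) (res (piece D j) U W (g j i)))"
  shows "in_span (O_sec S W) (mod_sec D n W) L \<gamma> z" "finite L" "\<gamma> \<in> L \<rightarrow> carrier (mod_sec D n W)"
proof -
  interpret DW: module "O_sec S W" "mod_sec D n W" using psh_module[OF gpm_psh[OF D] W(1)] .
  have \<alpha>: "res (alg_piece A (n - j)) (UA j) W (\<alpha> j ! l) \<in> carrier (alg_sec A (n - j) W)"
    if "N j \<noteq> 0" "l < length (\<alpha> j)" for j l
  proof (rule psh_res[OF alg_psh[OF A] UA(1)[OF that(1)] W(1) UA(2)[OF that(1)]])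
    show "\<alpha> j ! l \<in> carrier (alg_sec A (n - j) (UA j))"
      using r[OF that(1)] nth_mem[OF that(2)] unfolding basis_on_def by blast
  qed
  have gW: "res (piece D j) U W (g j i) \<in> carrier (mod_sec D j W)" if "i < N j" for i j
    by (rule psh_res[OF gpm_psh[OF D] U(1) W g[OF that]])
  have \<gamma>c: "\<gamma> (j, i, l) \<in> carrier (mod_sec D n W)" if "N j \<noteq> 0" "i < N j" "l < length (\<alpha> j)" for j i l
    unfolding \<gamma>_def using act_closed[OF D W(1) _ \<alpha>[OF that(1,3)] gW[OF that(2)], of n] by simp
  show L: "finite L" unfolding L_def using fin by (intro finite_SigmaI) (auto intro: finite_subset[OF _ fin])
  show \<gamma>: "\<gamma> \<in> L \<rightarrow> carrier (mod_sec D n W)" using \<gamma>c unfolding L_def by auto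
  have Kc: "\<forall>j. K u W j \<subseteq> carrier (mod_sec D j W)" using trunc_system_closed[OF W] by blast
  show "in_span (O_sec S W) (mod_sec D n W) L \<gamma> z"
    using D W(1) z Kc
  proof (induction rule: submodule_gen_induct)
    case zero
    show ?case by (rule DW.in_span_zero[OF \<gamma>])
  next
    case (gen k j a y)
    obtain i where i: "j \<le> u" "i < N j" "y = res (piece D j) U W (g j i)"
      using gen(3) by (auto simp: trunc_system_def split: if_splits)
    have Nj: "N j \<noteq> 0" using i by simp
    have k: "k = n - j" using gen(1) by simp
    have n: "n = (n - j) + j" by simp
    let ?I = "{..<length (\<alpha> j)}"
    let ?\<alpha> = "\<lambda>l. res (alg_piece A (n - j)) (UA j) W (\<alpha> j ! l)"
    interpret AW: module "O_sec S W" "alg_sec A (n - j) W" using psh_module[OF alg_psh[OF A] W(1)] .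
    have "in_span (O_sec S W) (alg_sec A (n - j) W) ?I ?\<alpha> a"
      using r[OF Nj] W(1) UA(2)[OF Nj] gen(2) k unfolding basis_on_iff[OF alg_psh[OF A] UA(1)[OF Nj]] by simp
    then obtain c where c: "c \<in> ?I \<rightarrow> carrier (O_sec S W)"
      and a: "a = (\<Oplus>\<^bsub>alg_sec A (n - j) W\<^esub>l\<in>?I. c l \<odot>\<^bsub>alg_sec A (n - j) W\<^esub> ?\<alpha> l)"
      unfolding in_span_def by blast
    have y: "y \<in> carrier (mod_sec D j W)" unfolding i(3) by (rule gW[OF i(2)])
    have ca: "c l \<odot>\<^bsub>alg_sec A (n - j) W\<^esub> ?\<alpha> l \<in> carrier (alg_sec A (n - j) W)" if "l \<in> ?I" for l
      using c \<alpha>[OF Nj, of l] that by (intro AW.smult_closed) auto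
    have "act D (n - j) j W a y = (\<Oplus>\<^bsub>mod_sec D n W\<^esub>l\<in>?I. act D (n - j) j W (c l \<odot>\<^bsub>alg_sec A (n - j) W\<^esub> ?\<alpha> l) y)"
      unfolding a
    proof (rule AW.hom_finsum_to[OF DW.abelian_monoid_axioms, where f="\<lambda>a. act D (n - j) j W a y"])
      show "(\<lambda>a. act D (n - j) j W a y) \<in> carrier (alg_sec A (n - j) W) \<rightarrow> carrier (mod_sec D n W)"
        using act_closed[OF D W(1) n _ y] by blast
      show "(\<lambda>l. c l \<odot>\<^bsub>alg_sec A (n - j) W\<^esub> ?\<alpha> l) \<in> ?I \<rightarrow> carrier (alg_sec A (n - j) W)" using ca by blast
      show "act D (n - j) j W \<zero>\<^bsub>alg_sec A (n - j) W\<^esub> y = \<zero>\<^bsub>mod_sec D n W\<^esub>" by (rule act_zero_left[OF A D W(1) n y])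
      show "act D (n - j) j W (u \<oplus>\<^bsub>alg_sec A (n - j) W\<^esub> v) y = act D (n - j) j W u y \<oplus>\<^bsub>mod_sec D n W\<^esub> act D (n - j) j W v y"
        if "u \<in> carrier (alg_sec A (n - j) W)" "v \<in> carrier (alg_sec A (n - j) W)" for u v
        by (rule act_add_left[OF D W(1) n that y])
    qed
    also have "\<dots> \<in> {z. in_span (O_sec S W) (mod_sec D n W) L \<gamma> z}"
    proof (rule DW.submodule_finsum[OF DW.in_span_submodule[OF L \<gamma>]])
      fix l assume l: "l \<in> ?I"
      have cl: "c l \<in> carrier (O_sec S W)" using c l by auto
      have l': "l < length (\<alpha> j)" using l by simp
      have "act D (n - j) j W (c l \<odot>\<^bsub>alg_sec A (n - j) W\<^esub> ?\<alpha> l) y = c l \<odot>\<^bsub>mod_sec D n W\<^esub> \<gamma> (j, i, l)"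
        unfolding act_smult_left[OF D W(1) n cl \<alpha>[OF Nj l'] y] by (simp add: \<gamma>_def i(3))
      moreover have "(j, i, l) \<in> L" using Nj i l by (simp add: L_def)
      ultimately show "act D (n - j) j W (c l \<odot>\<^bsub>alg_sec A (n - j) W\<^esub> ?\<alpha> l) y \<in> {z. in_span (O_sec S W) (mod_sec D n W) L \<gamma> z}"
        using DW.in_span_smult[OF L \<gamma> cl DW.in_span_self[OF L \<gamma>]] by simp
    qed
    finally show ?case unfolding k by simp
  next
    case (add y z)
    then show ?case by (intro DW.in_span_add[OF \<gamma>])
  next
    case (minus y)
    then show ?case by (intro DW.in_span_minus[OF L \<gamma>])
  qed
qed

end

section \<open>Bounds for the rank of a truncation\<close>

lemma finite_common_open:
  assumes "openin T V" "x \<in> V" "finite I" "\<And>i. i \<in> I \<Longrightarrow> openin T (N i)" "\<And>i. i \<in> I \<Longrightarrow> x \<in> N i"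
  obtains W where "openin T W" "x \<in> W" "W \<subseteq> V" "\<And>i. i \<in> I \<Longrightarrow> W \<subseteq> N i"
proof
  show "openin T (\<Inter>(insert V (N ` I)))" by (rule openin_Inter) (use assms in auto)
qed (use assms in auto)

text \<open>The right-hand side is the number of triples in the spanning family of
  \<open>trunc_system_span\<close> over one small neighbourhood of \<open>x\<close>. A basis of the
  truncation is independent there, so its length is bounded by that number.\<close>

lemma Delta_rank_le_generators:
  fixes S :: "('x, 'r) ringed_space" and A :: "('x, 'r, 'a) graded_alg" and D :: "('x, 'r, 'a, 'm) graded_mod"
    and a \<tau> :: "int \<Rightarrow> int"
  assumes L: "locally_ringed_space S" and A: "graded_algebra S A" and D: "graded_premodule S A D"
    and x: "x \<in> points S"
    and low: "\<And>n V. n < n0 \<Longrightarrow> openin (top_of S) V \<Longrightarrow> carrier (mod_sec D n V) = {\<zero>\<^bsub>mod_sec D n V\<^esub>}"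
    and soc: "\<And>n. locally_free_of_rank S (graded_tensor S A D (structure_module A) n) (\<tau> n)"
    and \<tau>: "finite {n. \<tau> n \<noteq> 0}" "\<And>n. \<tau> n \<ge> 0"
    and alg: "\<And>p. locally_free_of_rank S (alg_piece A p) (a p)"
    and rk: "locally_free_of_rank S (piece (Delta S A m D) n) H"
  shows "H \<le> (\<Sum>j\<in>{j. \<tau> j \<noteq> 0 \<and> j \<le> - m}. \<tau> j * a (n - j))"
proof -
  have SR: "is_ringed_space S" using L by (simp add: locally_ringed_space_def)
  note P = gpm_psh[OF D]
  define N where "N j = nat (\<tau> j)" for j
  have NF: "N j \<noteq> 0 \<longleftrightarrow> \<tau> j \<noteq> 0" for j using \<tau>(2)[of j] by (simp add: N_def)
  let ?F = "{j. N j \<noteq> 0}"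
  have fin: "finite ?F" unfolding NF by (rule \<tau>(1))
  \<comment> \<open>The conclusion of \<open>socle_local_generators\<close> packed into a predicate,
    so that neighbourhoods and lifts can be chosen for all degrees at once.\<close>
  define Q where "Q n U' g' \<longleftrightarrow> openin (top_of S) U' \<and> x \<in> U' \<and> (\<forall>i<N n. g' i \<in> carrier (mod_sec D n U')) \<and>
    (\<forall>W d. openin (top_of S) W \<and> x \<in> W \<and> W \<subseteq> U' \<and> d \<in> carrier (mod_sec D n W) \<longrightarrow>
      (\<exists>Y. openin (top_of S) Y \<and> x \<in> Y \<and> Y \<subseteq> W \<and> res (piece D n) W Y d \<in>
        submodule_gen A D Y (minimal_gens D n Y ((\<lambda>i. res (piece D n) U' Y (g' i)) ` {..<N n})) n))" for n U' g'
  have "\<forall>n. \<exists>U' g'. Q n U' g'"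
    unfolding Q_def N_def using socle_local_generators[OF SR A D soc x] by blast
  from choice[OF this] obtain V where "\<forall>n. \<exists>g'. Q n (V n) g'" ..
  from choice[OF this] obtain g0 where Q: "\<forall>n. Q n (V n) (g0 n)" ..
  have V: "openin (top_of S) (V k)" "x \<in> V k" for k using Q unfolding Q_def by blast+
  have g0: "g0 k i \<in> carrier (mod_sec D k (V k))" if "i < N k" for k i using Q that unfolding Q_def by blast
  have gen0: "\<exists>Y. openin (top_of S) Y \<and> x \<in> Y \<and> Y \<subseteq> W \<and> res (piece D k) W Y d \<in>
        submodule_gen A D Y (minimal_gens D k Y ((\<lambda>i. res (piece D k) (V k) Y (g0 k i)) ` {..<N k})) k"
    if "openin (top_of S) W" "x \<in> W" "W \<subseteq> V k" "d \<in> carrier (mod_sec D k W)" for k W d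
  proof -
    have "Q k (V k) (g0 k)" using Q by blast
    then show ?thesis unfolding Q_def using that by simp
  qed
  have "\<forall>j. \<exists>UA es. openin (top_of S) UA \<and> x \<in> UA \<and> basis_on S (alg_piece A (n - j)) UA es \<and> int (length es) = a (n - j)"
    using alg x unfolding locally_free_of_rank_def by blast
  from choice[OF this] obtain UA where "\<forall>j. \<exists>es. openin (top_of S) (UA j) \<and> x \<in> UA j \<and>
      basis_on S (alg_piece A (n - j)) (UA j) es \<and> int (length es) = a (n - j)" ..
  from choice[OF this] obtain \<alpha> where al: "\<forall>j. openin (top_of S) (UA j) \<and> x \<in> UA j \<and>
      basis_on S (alg_piece A (n - j)) (UA j) (\<alpha> j) \<and> int (length (\<alpha> j)) = a (n - j)" ..
  have UA: "openin (top_of S) (UA j)" "x \<in> UA j" and \<alpha>: "basis_on S (alg_piece A (n - j)) (UA j) (\<alpha> j)"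
    "int (length (\<alpha> j)) = a (n - j)" for j using al by blast+
  obtain U1 es where U1: "openin (top_of S) U1" "x \<in> U1" "basis_on S (piece (Delta S A m D) n) U1 es" "int (length es) = H"
    using rk x unfolding locally_free_of_rank_def by blast
  \<comment> \<open>Only the finitely many degrees with \<open>N j \<noteq> 0\<close> constrain
    \<open>U\<close>. The other degrees keep their own \<open>V k\<close>, which is absorbed by the
    \<open>U'\<close> of the Nakayama hypothesis.\<close>
  obtain U where U: "openin (top_of S) U" "x \<in> U" "U \<subseteq> U1" and UVA: "\<And>j. j \<in> ?F \<Longrightarrow> U \<subseteq> V j \<inter> UA j"
    by (rule finite_common_open[OF U1(1,2) fin, of "\<lambda>j. V j \<inter> UA j"]) (use V UA in auto)
  define g where "g k i = res (piece D k) (V k) U (g0 k i)" for k i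
  have UV: "U \<subseteq> V k" if "i < N k" for k i using UVA[of k] that by auto
  have g: "g k i \<in> carrier (mod_sec D k U)" if "i < N k" for k i
    unfolding g_def by (rule psh_res[OF P V(1) U(1) UV[OF that] g0[OF that]])
  \<comment> \<open>In a degree without lifts \<open>U\<close> need not lie in \<open>V k\<close>,
    but then both images are empty.\<close>
  have gY: "(\<lambda>i. res (piece D k) (V k) Y (g0 k i)) ` {..<N k} = (\<lambda>i. res (piece D k) U Y (g k i)) ` {..<N k}"
    if "openin (top_of S) Y" "Y \<subseteq> U" for k Y
  proof (rule image_cong[OF refl])
    fix i assume "i \<in> {..<N k}"
    then have i: "i < N k" by simp
    show "res (piece D k) (V k) Y (g0 k i) = res (piece D k) U Y (g k i)"
      unfolding g_def by (rule psh_comp[OF P V(1) U(1) that UV[OF i] g0[OF i], symmetric])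
  qed
  have gen: "\<exists>U'. openin (top_of S) U' \<and> x \<in> U' \<and> (\<forall>W d. openin (top_of S) W \<and> x \<in> W \<and> W \<subseteq> U \<and> W \<subseteq> U' \<and>
      d \<in> carrier (mod_sec D k W) \<longrightarrow> (\<exists>Y. openin (top_of S) Y \<and> x \<in> Y \<and> Y \<subseteq> W \<and> res (piece D k) W Y d \<in>
        submodule_gen A D Y (minimal_gens D k Y ((\<lambda>i. res (piece D k) U Y (g k i)) ` {..<N k})) k))" for k
  proof (rule exI[of _ "V k"], intro conjI allI impI V)
    fix W d assume "openin (top_of S) W \<and> x \<in> W \<and> W \<subseteq> U \<and> W \<subseteq> V k \<and> d \<in> carrier (mod_sec D k W)"
    then have W: "openin (top_of S) W" "x \<in> W" "W \<subseteq> U" "W \<subseteq> V k" and d: "d \<in> carrier (mod_sec D k W)" by simp_all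
    obtain Y where Y: "openin (top_of S) Y" "x \<in> Y" "Y \<subseteq> W" and m: "res (piece D k) W Y d \<in>
        submodule_gen A D Y (minimal_gens D k Y ((\<lambda>i. res (piece D k) (V k) Y (g0 k i)) ` {..<N k})) k"
      using gen0[OF W(1,2,4) d] by blast
    have "Y \<subseteq> U" using Y W by blast
    from m[unfolded gY[OF Y(1) this]] show "\<exists>Y. openin (top_of S) Y \<and> x \<in> Y \<and> Y \<subseteq> W \<and> res (piece D k) W Y d \<in>
        submodule_gen A D Y (minimal_gens D k Y ((\<lambda>i. res (piece D k) U Y (g k i)) ` {..<N k})) k"
      using Y by blast
  qed
  let ?K = "trunc_system D U N g"
  note nak = graded_nakayama[where N=N and g=g, OF SR A D U(1,2) g low gen]
  note PE = Delta_presheaf[OF SR A D, of m n]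
  let ?I = "{..<length es}"
  have es: "es ! i \<in> carrier (mod_sec (Delta S A m D) n U1)" if "i \<in> ?I" for i
    using U1(3) that unfolding basis_on_def by auto
  define d where "d i = res (piece D n) U1 U (es ! i)" for i
  have dE: "d i \<in> carrier (mod_sec (Delta S A m D) n U)" if "i \<in> ?I" for i
    using psh_res[OF PE U1(1) U(1,3) es[OF that]] by (simp add: d_def Delta_res)
  have dD: "d i \<in> carrier (mod_sec D n U)" if "i \<in> ?I" for i
    using dE[OF that] by (simp add: Delta_carrier_iff)
  \<comment> \<open>Each basis element becomes generated by lifts on a neighbourhood of its own; as
    there are finitely many, \<open>W\<close> below serves for all of them.\<close>
  have "\<forall>i\<in>?I. \<exists>W. openin (top_of S) W \<and> x \<in> W \<and> W \<subseteq> U \<and>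
      res (piece D n) U W (d i) \<in> submodule_gen A D W (?K (- m) W) n"
    using Delta_local_generators[where N=N and g=g, OF SR A D U(1,2) g nak U(1,2) subset_refl dE] by simp
  from bchoice[OF this] obtain Y where Y: "\<forall>i\<in>?I. openin (top_of S) (Y i) \<and> x \<in> Y i \<and> Y i \<subseteq> U \<and>
      res (piece D n) U (Y i) (d i) \<in> submodule_gen A D (Y i) (?K (- m) (Y i)) n" ..
  obtain W where W: "openin (top_of S) W" "x \<in> W" "W \<subseteq> U" and WY: "\<And>i. i \<in> ?I \<Longrightarrow> W \<subseteq> Y i"
    by (rule finite_common_open[OF U(1,2), of ?I Y]) (use Y in auto)
  have WU1: "W \<subseteq> U1" using W U by blast
  define e where "e i = res (piece D n) U1 W (es ! i)" for i
  have Kc: "\<forall>j. ?K u X j \<subseteq> carrier (mod_sec D j X)" if "openin (top_of S) X" "X \<subseteq> U" for u X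
    using trunc_system_closed[where N=N and g=g, OF SR A D U(1,2) g that] by blast
  have eg: "e i \<in> submodule_gen A D W (?K (- m) W) n" if i: "i \<in> ?I" for i
  proof -
    have Yi: "openin (top_of S) (Y i)" "x \<in> Y i" "Y i \<subseteq> U"
      and m: "res (piece D n) U (Y i) (d i) \<in> submodule_gen A D (Y i) (?K (- m) (Y i)) n" using Y i by blast+
    have "res (piece D n) (Y i) W (res (piece D n) U (Y i) (d i)) \<in> submodule_gen A D W (?K (- m) W) n"
      by (rule submodule_gen_res[OF A D Yi(1) W(1) WY[OF i] Kc[OF Yi(1,3)] m Kc[OF W(1,3)]])
        (rule trunc_system_res[where N=N and g=g, OF SR A D U(1,2) g Yi(1) W(1) WY[OF i] Yi(3)])
    moreover have "res (piece D n) (Y i) W (res (piece D n) U (Y i) (d i)) = e i"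
      unfolding psh_comp[OF P U(1) Yi(1) W(1) WY[OF i] Yi(3) dD[OF i]]
      using psh_comp[OF PE U1(1) U(1) W(1,3) U(3) es[OF i]] by (simp add: d_def e_def Delta_res)
    ultimately show ?thesis by simp
  qed
  define Lx where "Lx = (SIGMA j:{j. N j \<noteq> 0 \<and> j \<le> - m}. {..<N j} \<times> {..<length (\<alpha> j)})"
  define \<gamma> where "\<gamma> = (\<lambda>(j, i, l). act D (n - j) j W (res (alg_piece A (n - j)) (UA j) W (\<alpha> j ! l)) (res (piece D j) U W (g j i)))"
  have WA: "W \<subseteq> UA j" if "N j \<noteq> 0" for j using UVA[of j] W(3) that by auto
  have sp: "in_span (O_sec S W) (mod_sec D n W) Lx \<gamma> (e i)" "finite Lx" "\<gamma> \<in> Lx \<rightarrow> carrier (mod_sec D n W)"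
    if "i \<in> ?I" for i
    unfolding Lx_def \<gamma>_def
    by (rule trunc_system_span[where N=N and g=g, OF SR A D U(1,2) g W(1,3) fin \<alpha>(1) UA(1) WA eg[OF that]]; assumption)+
  have "length es \<le> card Lx"
  \<comment> \<open>The facts in \<open>sp\<close> are stated for an index in \<open>?I\<close>, so
    the empty basis is treated apart.\<close>
  proof (cases "length es = 0")
    case True
    then show ?thesis by simp
  next
    case False
    then have ne: "0 \<in> ?I" by simp
    interpret DW: module "O_sec S W" "mod_sec D n W" using psh_module[OF P W(1)] .
    have eE: "e \<in> ?I \<rightarrow> carrier (mod_sec (Delta S A m D) n W)"
      using psh_res[OF PE U1(1) W(1) WU1 es] by (simp add: e_def Delta_res)
    have eD: "e \<in> ?I \<rightarrow> carrier (mod_sec D n W)" using eE by (auto simp: Delta_carrier_iff)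
    \<comment> \<open>Independence is known in the truncation, spanning in \<open>D\<close>. Linear
      combinations agree in both, so independence is carried over to \<open>D\<close> before the
      comparison.\<close>
    have "indep (O_sec S W) (mod_sec (Delta S A m D) n W) ?I (\<lambda>i. res (piece (Delta S A m D) n) U1 W (es ! i))"
      using U1(3) W(1) WU1 unfolding basis_on_iff[OF PE U1(1)] by simp
    then have "indep (O_sec S W) (mod_sec (Delta S A m D) n W) ?I e" by (simp add: e_def[abs_def] Delta_res)
    then have "indep (O_sec S W) (mod_sec D n W) ?I e"
      unfolding indep_def using Delta_lincomb[OF SR A D W(1) _ eE] by (simp add: Delta_sec)
    from DW.indep_le_span[OF nontrivial_sections[OF L W(1,2)] sp(2)[OF ne] _ eD this sp(3)[OF ne] sp(1)]
    show ?thesis by simp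
  qed
  also have "card Lx = (\<Sum>j\<in>{j. N j \<noteq> 0 \<and> j \<le> - m}. N j * length (\<alpha> j))"
    unfolding Lx_def by (subst card_SigmaI) (use finite_subset[OF _ fin] in auto)
  finally have "int (length es) \<le> (\<Sum>j\<in>{j. N j \<noteq> 0 \<and> j \<le> - m}. int (N j) * int (length (\<alpha> j)))"
    by (simp flip: of_nat_mult of_nat_sum)
  also have "\<dots> = (\<Sum>j\<in>{j. \<tau> j \<noteq> 0 \<and> j \<le> - m}. \<tau> j * a (n - j))"
    unfolding NF by (rule sum.cong[OF refl]) (use \<tau>(2) in \<open>simp add: \<alpha>(2) N_def\<close>)
  finally show ?thesis using U1(4) by simp
qed

section \<open>Evaluation of functionals and the bound by the rank of the covering module\<close>

lemma dual_eval_lincomb: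
  assumes P: "presheaf_of_modules S F" and S: "is_ringed_space S"
    and U: "openin (top_of S) U" and V: "openin (top_of S) V" "V \<subseteq> U" and z: "z \<in> carrier (sec F V)"
    and c: "c \<in> J \<rightarrow> carrier (O_sec S U)" and e: "e \<in> J \<rightarrow> carrier (sec (dual_sheaf S F) U)"
  shows "(\<Oplus>\<^bsub>sec (dual_sheaf S F) U\<^esub>j\<in>J. c j \<odot>\<^bsub>sec (dual_sheaf S F) U\<^esub> e j) V z =
    (\<Oplus>\<^bsub>O_sec S V\<^esub>j\<in>J. O_res S U V (c j) \<otimes>\<^bsub>O_sec S V\<^esub> e j V z)"
proof -
  interpret DU: module "O_sec S U" "sec (dual_sheaf S F) U" using psh_module[OF dual_presheaf[OF P S] U] .
  interpret R: cring "O_sec S V" using rs_cring[OF S V(1)] .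
  have "(\<Oplus>\<^bsub>sec (dual_sheaf S F) U\<^esub>j\<in>J. c j \<odot>\<^bsub>sec (dual_sheaf S F) U\<^esub> e j) V z =
    (\<Oplus>\<^bsub>O_sec S V\<^esub>j\<in>J. (c j \<odot>\<^bsub>sec (dual_sheaf S F) U\<^esub> e j) V z)"
  proof (rule DU.hom_finsum_to[OF R.abelian_monoid_axioms, where f="\<lambda>\<phi>. \<phi> V z"])
    show "(\<lambda>\<phi>. \<phi> V z) \<in> carrier (sec (dual_sheaf S F) U) \<rightarrow> carrier (O_sec S V)"
      using dual_closed[OF _ V z] by blast
    show "(\<lambda>j. c j \<odot>\<^bsub>sec (dual_sheaf S F) U\<^esub> e j) \<in> J \<rightarrow> carrier (sec (dual_sheaf S F) U)"
      using c e by (simp add: Pi_iff)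
  qed (simp_all only: dual_eval_zero[OF V z] dual_eval_add[OF V z])
  then show ?thesis by (simp only: dual_eval_smult[OF V z])
qed

lemma dual_lincomb:
  assumes P: "presheaf_of_modules S F" and U: "openin (top_of S) U" and S: "is_ringed_space S"
    and f: "\<phi> \<in> carrier (sec (dual_sheaf S F) V)" "openin (top_of S) V" "U \<subseteq> V"
    and c: "c \<in> J \<rightarrow> carrier (O_sec S U)" and e: "e \<in> J \<rightarrow> carrier (sec F U)"
  shows "\<phi> U (\<Oplus>\<^bsub>sec F U\<^esub>j\<in>J. c j \<odot>\<^bsub>sec F U\<^esub> e j) = (\<Oplus>\<^bsub>O_sec S U\<^esub>j\<in>J. c j \<otimes>\<^bsub>O_sec S U\<^esub> \<phi> U (e j))"
proof -
  interpret FU: module "O_sec S U" "sec F U" using psh_module[OF P U] .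
  have eM: "e j \<in> carrier (sec F U)" "c j \<in> carrier (O_sec S U)" if "j \<in> J" for j using c e that by auto
  have cl: "\<phi> U \<in> carrier (sec F U) \<rightarrow> carrier (O_sec S U)" using dual_closed[OF f(1) U f(3)] by blast
  have "\<phi> U (\<Oplus>\<^bsub>sec F U\<^esub>j\<in>J. c j \<odot>\<^bsub>sec F U\<^esub> e j) = (\<Oplus>\<^bsub>O_sec S U\<^esub>j\<in>J. \<phi> U (c j \<odot>\<^bsub>sec F U\<^esub> e j))"
    by (rule FU.hom_finsum_to[OF FU.R.abelian_monoid_axioms cl
        additive_zero[OF FU.M.abelian_group_axioms FU.R.abelian_group_axioms cl dual_add[OF f(1) U f(3)]] dual_add[OF f(1) U f(3)]])
      (use eM in \<open>simp_all add: Pi_iff\<close>)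
  also have "\<dots> = (\<Oplus>\<^bsub>O_sec S U\<^esub>j\<in>J. c j \<otimes>\<^bsub>O_sec S U\<^esub> \<phi> U (e j))"
    by (rule FU.R.finsum_cong'[OF refl]) (use eM dual_closed[OF f(1) U f(3)] dual_smult[OF f(1) U f(3)] in \<open>simp_all add: Pi_iff\<close>)
  finally show ?thesis .
qed

text \<open>A functional on a quotient of \<open>B\<close> is determined by its values on a basis of \<open>B\<close>, so evaluation
  embeds the dual of the quotient into a free module of rank \<open>b\<close>.\<close>

lemma Delta_dual_rank_le:
  fixes S :: "('x, 'r) ringed_space" and A :: "('x, 'r, 'a) graded_alg" and B :: "('x, 'r, 'a, 'b) graded_mod"
    and C :: "('x, 'r, 'a, 'c) graded_mod"
  assumes L: "locally_ringed_space S" and A: "graded_algebra S A" and B: "graded_premodule S A B"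
    and hq: "homogeneous_quotient S A B C" and x: "x \<in> points S"
    and Bk: "locally_free_of_rank S (piece B p) k"
    and rk: "locally_free_of_rank S (piece (Delta S A m (graded_dual S A C)) (- p)) H"
  shows "H \<le> k"
proof (rule ccontr)
  assume neg: "\<not> H \<le> k"
  have SR: "is_ringed_space S" using L by (simp add: locally_ringed_space_def)
  have C: "graded_premodule S A C" by (rule graded_module_premodule[OF conjunct1[OF hq[unfolded homogeneous_quotient_def]]])
  let ?D = "graded_dual S A C"
  note D = graded_dual_premodule[OF SR A C]
  note PC = gpm_psh[OF C, of p] and PB = gpm_psh[OF B, of p]
  have pD: "piece ?D (- p) = dual_sheaf S (piece C p)" by (simp add: piece_graded_dual)
  note PE = Delta_presheaf[OF SR A D, of m "- p"]
  from conjunct2[OF hq[unfolded homogeneous_quotient_def]] obtain \<pi> where \<pi>: "\<forall>U. openin (top_of S) U \<longrightarrow>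
        (\<forall>p. \<pi> p U \<in> mod_hom (O_sec S U) (mod_sec B p U) (mod_sec C p U)) \<and>
        (\<forall>p q. \<forall>x\<in>carrier (alg_sec A p U). \<forall>z\<in>carrier (mod_sec B q U).
           \<pi> (p + q) U (act B p q U x z) = act C p q U x (\<pi> q U z)) \<and>
        (\<forall>p. \<forall>V\<in>opens S U. \<forall>z\<in>carrier (mod_sec B p U).
           res (piece C p) U V (\<pi> p U z) = \<pi> p V (res (piece B p) U V z)) \<and>
        (\<forall>p. \<forall>w\<in>carrier (mod_sec C p U). \<forall>x\<in>U. \<exists>V\<in>opens S U. x \<in> V \<and>
           (\<exists>z\<in>carrier (mod_sec B p V). res (piece C p) U V w = \<pi> p V z))"
    ..
  have \<pi>h: "\<pi> p U \<in> mod_hom (O_sec S U) (mod_sec B p U) (mod_sec C p U)" if "openin (top_of S) U" for U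
    using \<pi> that by simp
  have \<pi>r: "res (piece C p) U V (\<pi> p U z) = \<pi> p V (res (piece B p) U V z)"
    if "openin (top_of S) U" "openin (top_of S) V" "V \<subseteq> U" "z \<in> carrier (mod_sec B p U)" for U V z
    using \<pi> that by simp
  have \<pi>s: "\<exists>V. openin (top_of S) V \<and> V \<subseteq> U \<and> y \<in> V \<and> (\<exists>z\<in>carrier (mod_sec B p V). res (piece C p) U V w = \<pi> p V z)"
    if "openin (top_of S) U" "w \<in> carrier (mod_sec C p U)" "y \<in> U" for U w y
  proof -
    have "\<forall>w\<in>carrier (mod_sec C p U). \<forall>x\<in>U. \<exists>V\<in>opens S U. x \<in> V \<and>
           (\<exists>z\<in>carrier (mod_sec B p V). res (piece C p) U V w = \<pi> p V z)" using \<pi> that(1) by simp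
    from bspec[OF bspec[OF this that(2)] that(3)] show ?thesis by blast
  qed
  have \<pi>c: "\<pi> p U z \<in> carrier (mod_sec C p U)" if "openin (top_of S) U" "z \<in> carrier (mod_sec B p U)" for U z
    using \<pi>h[OF that(1)] that(2) by (auto simp: mod_hom_def)
  obtain U1 bs where U1: "openin (top_of S) U1" "x \<in> U1" "basis_on S (piece B p) U1 bs" "int (length bs) = k"
    using Bk x unfolding locally_free_of_rank_def by blast
  obtain U2 es where U2: "openin (top_of S) U2" "x \<in> U2" "basis_on S (piece (Delta S A m ?D) (- p)) U2 es" "int (length es) = H"
    using rk x unfolding locally_free_of_rank_def by blast
  let ?I = "{..<length bs}" and ?J = "{..<length es}"
  have lt: "card ?I < card ?J" using neg U1(4) U2(4) by simp
  define W where "W = U1 \<inter> U2"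
  have W: "openin (top_of S) W" "x \<in> W" "W \<subseteq> U1" "W \<subseteq> U2" using U1 U2 by (auto simp: W_def)
  interpret R: cring "O_sec S W" using rs_cring[OF SR W(1)] .
  let ?\<D> = "sec (dual_sheaf S (piece C p))"
  define e where "e j = res (piece ?D (- p)) U2 W (es ! j)" for j
  have eE: "e \<in> ?J \<rightarrow> carrier (mod_sec (Delta S A m ?D) (- p) W)"
  proof
    fix j assume "j \<in> ?J"
    then have "es ! j \<in> carrier (mod_sec (Delta S A m ?D) (- p) U2)" using U2(3) unfolding basis_on_def by auto
    from psh_res[OF PE U2(1) W(1,4) this] show "e j \<in> carrier (mod_sec (Delta S A m ?D) (- p) W)"
      by (simp add: e_def Delta_res)
  qed
  have eD: "e \<in> ?J \<rightarrow> carrier (?\<D> W)"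
  proof
    fix j assume "j \<in> ?J"
    then have "e j \<in> carrier (mod_sec ?D (- p) W)" using eE unfolding Pi_iff Delta_carrier_iff by blast
    then show "e j \<in> carrier (?\<D> W)" by (simp only: pD)
  qed
  have ind: "indep (O_sec S W) (mod_sec (Delta S A m ?D) (- p) W) ?J e"
  proof -
    have "indep (O_sec S W) (mod_sec (Delta S A m ?D) (- p) W) ?J (\<lambda>i. res (piece (Delta S A m ?D) (- p)) U2 W (es ! i))"
      using U2(3) W(1,4) unfolding basis_on_iff[OF PE U2(1)] by simp
    then show ?thesis by (simp add: e_def[abs_def] Delta_res)
  qed
  define \<beta> where "\<beta> V i = res (piece B p) U1 V (bs ! i)" for V i
  have \<beta>: "\<beta> V i \<in> carrier (mod_sec B p V)" if "openin (top_of S) V" "V \<subseteq> U1" "i \<in> ?I" for V i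
  proof -
    have "bs ! i \<in> carrier (mod_sec B p U1)" using U1(3) that(3) unfolding basis_on_def by auto
    then show ?thesis unfolding \<beta>_def by (rule psh_res[OF PB U1(1) that(1,2)])
  qed
  have \<beta>r: "res (piece B p) W V (\<beta> W i) = \<beta> V i" if "openin (top_of S) V" "V \<subseteq> W" "i \<in> ?I" for V i
  proof -
    have "bs ! i \<in> carrier (mod_sec B p U1)" using U1(3) that(3) unfolding basis_on_def by auto
    then show ?thesis unfolding \<beta>_def by (rule psh_comp[OF PB U1(1) W(1) that(1,2) W(3)])
  qed
  \<comment> \<open>The evaluation matrix: a row for each basis element of \<open>B\<close> in
    degree \<open>p\<close>, a column for each basis functional of the truncation.\<close>
  define M where "M i j = e j W (\<pi> p W (\<beta> W i))" for i j
  have MR: "M i j \<in> carrier (O_sec S W)" if "i \<in> ?I" "j \<in> ?J" for i j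
    unfolding M_def using dual_closed[OF _ W(1) subset_refl \<pi>c[OF W(1) \<beta>[OF W(1,3) that(1)]]] eD that(2) by blast
  obtain v where v: "v \<in> ?J \<rightarrow> carrier (O_sec S W)" "\<exists>j\<in>?J. v j \<noteq> \<zero>\<^bsub>O_sec S W\<^esub>"
    and Mv: "\<And>i. i \<in> ?I \<Longrightarrow> (\<Oplus>\<^bsub>O_sec S W\<^esub>j\<in>?J. M i j \<otimes>\<^bsub>O_sec S W\<^esub> v j) = \<zero>\<^bsub>O_sec S W\<^esub>"
    by (rule R.homogeneous_system_nonzero_solution[OF nontrivial_sections[OF L W(1,2)] _ _ lt MR]) auto
  have vR: "v j \<in> carrier (O_sec S W)" if "j \<in> ?J" for j using v(1) that by auto
  \<comment> \<open>The kernel vector \<open>v\<close> of the evaluation matrix gives a combination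
    of functionals that vanishes on the images of all basis elements of \<open>B\<close>.\<close>
  define \<phi> where "\<phi> = (\<Oplus>\<^bsub>?\<D> W\<^esub>j\<in>?J. v j \<odot>\<^bsub>?\<D> W\<^esub> e j)"
  interpret DW: module "O_sec S W" "?\<D> W" using psh_module[OF dual_presheaf[OF PC SR] W(1)] .
  have \<phi>: "\<phi> \<in> carrier (?\<D> W)" unfolding \<phi>_def by (rule DW.lincomb_closed[OF v(1) eD])
  have \<phi>0: "\<phi> W (\<pi> p W (\<beta> W i)) = \<zero>\<^bsub>O_sec S W\<^esub>" if i: "i \<in> ?I" for i
  proof -
    have "\<phi> W (\<pi> p W (\<beta> W i)) = (\<Oplus>\<^bsub>O_sec S W\<^esub>j\<in>?J. O_res S W W (v j) \<otimes>\<^bsub>O_sec S W\<^esub> e j W (\<pi> p W (\<beta> W i)))"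
      unfolding \<phi>_def by (rule dual_eval_lincomb[OF PC SR W(1) W(1) subset_refl \<pi>c[OF W(1) \<beta>[OF W(1,3) i]] v(1) eD])
    also have "\<dots> = (\<Oplus>\<^bsub>O_sec S W\<^esub>j\<in>?J. M i j \<otimes>\<^bsub>O_sec S W\<^esub> v j)"
      by (rule R.finsum_cong'[OF refl])
        (use MR[OF i] vR rs_id[OF SR W(1) vR] in \<open>simp_all add: M_def Pi_iff R.m_comm\<close>)
    finally show ?thesis using Mv[OF i] by simp
  qed
  \<comment> \<open>The basis of \<open>B\<close> restricts to a basis over every smaller
    \<open>Y\<close>, so vanishing on it propagates to the whole image of \<open>B\<close> over
    \<open>Y\<close>.\<close>
  have kill: "\<phi> Y (\<pi> p Y z) = \<zero>\<^bsub>O_sec S Y\<^esub>" if Y: "openin (top_of S) Y" "Y \<subseteq> W" and z: "z \<in> carrier (mod_sec B p Y)" for Y z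
  proof -
    have YU: "Y \<subseteq> U1" using Y W by blast
    interpret RY: cring "O_sec S Y" using rs_cring[OF SR Y(1)] .
    interpret BY: module "O_sec S Y" "mod_sec B p Y" using psh_module[OF PB Y(1)] .
    interpret CY: module "O_sec S Y" "mod_sec C p Y" using psh_module[OF PC Y(1)] .
    have "in_span (O_sec S Y) (mod_sec B p Y) ?I (\<lambda>i. res (piece B p) U1 Y (bs ! i)) z"
      using U1(3) Y(1) YU z unfolding basis_on_iff[OF PB U1(1)] by simp
    then obtain c where c: "c \<in> ?I \<rightarrow> carrier (O_sec S Y)"
      and zc: "z = (\<Oplus>\<^bsub>mod_sec B p Y\<^esub>i\<in>?I. c i \<odot>\<^bsub>mod_sec B p Y\<^esub> \<beta> Y i)"
      unfolding in_span_def \<beta>_def by blast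
    have cR: "c i \<in> carrier (O_sec S Y)" if "i \<in> ?I" for i using c that by auto
    note \<beta>Y = \<beta>[OF Y(1) YU]
    have \<pi>Y: "\<pi> p Y \<in> carrier (mod_sec B p Y) \<rightarrow> carrier (mod_sec C p Y)" using \<pi>c[OF Y(1)] by blast
    have \<pi>a: "\<pi> p Y (u \<oplus>\<^bsub>mod_sec B p Y\<^esub> w) = \<pi> p Y u \<oplus>\<^bsub>mod_sec C p Y\<^esub> \<pi> p Y w"
      if "u \<in> carrier (mod_sec B p Y)" "w \<in> carrier (mod_sec B p Y)" for u w
      using \<pi>h[OF Y(1)] that by (simp add: mod_hom_def)
    have \<pi>m: "\<pi> p Y (r \<odot>\<^bsub>mod_sec B p Y\<^esub> w) = r \<odot>\<^bsub>mod_sec C p Y\<^esub> \<pi> p Y w"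
      if "r \<in> carrier (O_sec S Y)" "w \<in> carrier (mod_sec B p Y)" for r w
      using \<pi>h[OF Y(1)] that by (simp add: mod_hom_def)
    have "\<pi> p Y z = (\<Oplus>\<^bsub>mod_sec C p Y\<^esub>i\<in>?I. \<pi> p Y (c i \<odot>\<^bsub>mod_sec B p Y\<^esub> \<beta> Y i))"
      unfolding zc
      by (rule BY.hom_finsum_to[OF CY.abelian_monoid_axioms \<pi>Y
          additive_zero[OF BY.M.abelian_group_axioms CY.M.abelian_group_axioms \<pi>Y \<pi>a] \<pi>a])
        (use cR \<beta>Y in \<open>simp_all add: Pi_iff\<close>)
    also have "\<dots> = (\<Oplus>\<^bsub>mod_sec C p Y\<^esub>i\<in>?I. c i \<odot>\<^bsub>mod_sec C p Y\<^esub> \<pi> p Y (\<beta> Y i))"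
      by (rule CY.M.finsum_cong'[OF refl]) (use cR \<beta>Y \<pi>c[OF Y(1)] \<pi>m in \<open>simp_all add: Pi_iff\<close>)
    finally have "\<phi> Y (\<pi> p Y z) = \<phi> Y (\<Oplus>\<^bsub>mod_sec C p Y\<^esub>i\<in>?I. c i \<odot>\<^bsub>mod_sec C p Y\<^esub> \<pi> p Y (\<beta> Y i))" by simp
    also have "\<dots> = (\<Oplus>\<^bsub>O_sec S Y\<^esub>i\<in>?I. c i \<otimes>\<^bsub>O_sec S Y\<^esub> \<phi> Y (\<pi> p Y (\<beta> Y i)))"
      by (rule dual_lincomb[OF PC Y(1) SR \<phi> W(1) Y(2) c]) (use \<beta>Y \<pi>c[OF Y(1)] in blast)
    also have "\<dots> = \<zero>\<^bsub>O_sec S Y\<^esub>"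
    proof (rule RY.add.finprod_one_eqI[simplified])
      fix i assume i: "i \<in> ?I"
      have "\<phi> Y (\<pi> p Y (\<beta> Y i)) = \<phi> Y (res (piece C p) W Y (\<pi> p W (\<beta> W i)))"
        unfolding \<pi>r[OF W(1) Y \<beta>[OF W(1,3) i]] \<beta>r[OF Y i] by (rule refl)
      also have "\<dots> = O_res S W Y (\<phi> W (\<pi> p W (\<beta> W i)))"
        by (rule dual_res[OF \<phi> W(1) subset_refl Y \<pi>c[OF W(1) \<beta>[OF W(1,3) i]]])
      also have "\<dots> = \<zero>\<^bsub>O_sec S Y\<^esub>" unfolding \<phi>0[OF i] by (rule rs_zero[OF SR W(1) Y])
      finally show "c i \<otimes>\<^bsub>O_sec S Y\<^esub> \<phi> Y (\<pi> p Y (\<beta> Y i)) = \<zero>\<^bsub>O_sec S Y\<^esub>" using cR[OF i] by simp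
    qed
    finally show ?thesis .
  qed
  have "\<phi> = \<zero>\<^bsub>?\<D> W\<^esub>"
  proof (rule dual_eqI[OF \<phi> DW.M.zero_closed])
    fix V w assume V: "openin (top_of S) V" "V \<subseteq> W" and w: "w \<in> carrier (mod_sec C p V)"
    interpret RV: cring "O_sec S V" using rs_cring[OF SR V(1)] .
    \<comment> \<open>Sections of \<open>C\<close> come from \<open>B\<close> only locally, so the
      value of \<open>\<phi>\<close> is shown to vanish locally; separatedness of the structure
      sheaf does the rest.\<close>
    have "\<phi> V w = \<zero>\<^bsub>O_sec S V\<^esub>"
    proof (rule rs_separated[OF SR V(1) dual_closed[OF \<phi> V w] RV.zero_closed])
      fix y assume "y \<in> V"
      from \<pi>s[OF V(1) w this] obtain Y z where Y: "openin (top_of S) Y" "Y \<subseteq> V" "y \<in> Y"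
        and z: "z \<in> carrier (mod_sec B p Y)" "res (piece C p) V Y w = \<pi> p Y z" by blast
      have "O_res S V Y (\<phi> V w) = \<phi> Y (res (piece C p) V Y w)"
        by (rule dual_res[OF \<phi> V Y(1,2) w, symmetric])
      also have "\<dots> = \<zero>\<^bsub>O_sec S Y\<^esub>" unfolding z(2) by (rule kill[OF Y(1) subset_trans[OF Y(2) V(2)] z(1)])
      also have "\<dots> = O_res S V Y \<zero>\<^bsub>O_sec S V\<^esub>" by (rule rs_zero[OF SR V(1) Y(1,2), symmetric])
      finally show "\<exists>Y. openin (top_of S) Y \<and> Y \<subseteq> V \<and> y \<in> Y \<and> O_res S V Y (\<phi> V w) = O_res S V Y \<zero>\<^bsub>O_sec S V\<^esub>"
        using Y by blast
    qed
    then show "\<phi> V w = \<zero>\<^bsub>?\<D> W\<^esub> V w" by (simp only: dual_eval_zero[OF V w])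
  qed
  \<comment> \<open>The combination vanishes in the dual, hence also in the truncation, where it
    contradicts independence because some \<open>v j\<close> is nonzero.\<close>
  then have "(\<Oplus>\<^bsub>mod_sec (Delta S A m ?D) (- p) W\<^esub>j\<in>?J. v j \<odot>\<^bsub>mod_sec (Delta S A m ?D) (- p) W\<^esub> e j) =
      \<zero>\<^bsub>mod_sec (Delta S A m ?D) (- p) W\<^esub>"
    unfolding Delta_lincomb[OF SR A D W(1) v(1) eE] \<phi>_def by (simp add: Delta_sec pD)
  then show False using ind v unfolding indep_def by blast
qed

section \<open>Ranks of duals and direct sums\<close>

lemma (in cring) finsum_delta:
  assumes "finite J" "j \<in> J" "f \<in> J \<rightarrow> carrier R"
  shows "(\<Oplus>i\<in>J. f i \<otimes> (if i = j then \<one> else \<zero>)) = f j"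
proof -
  have fR: "f i \<in> carrier R" if "i \<in> J" for i using assms(3) that by auto
  have "(\<Oplus>i\<in>J. f i \<otimes> (if i = j then \<one> else \<zero>)) = (\<Oplus>i\<in>J. if j = i then f i else \<zero>)"
    by (rule finsum_cong'[OF refl]) (use fR in auto)
  also have "\<dots> = f j" using assms by (intro finsum_singleton) auto
  finally show ?thesis .
qed

text \<open>The coordinate functions of a local basis form a basis of the dual over the same open
  set. This equates the rank of each piece of \<open>Lambda\<close> with that of the truncation it
  is dual to.\<close>

lemma dual_locally_free:
  assumes SR: "is_ringed_space S" and P: "presheaf_of_modules S F" and lf: "locally_free_of_rank S F k"
  shows "locally_free_of_rank S (dual_sheaf S F) k"
  unfolding locally_free_of_rank_def
proof
  fix x assume "x \<in> points S"
  then obtain U es where U: "openin (top_of S) U" "x \<in> U" "basis_on S F U es" "int (length es) = k"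
    using lf unfolding locally_free_of_rank_def by blast
  let ?I = "{..<length es}"
  note PD = dual_presheaf[OF P SR]
  define e where "e V i = res F U V (es ! i)" for V i
  have esU: "es ! i \<in> carrier (sec F U)" if "i \<in> ?I" for i using U(3) that unfolding basis_on_def by auto
  have eV: "e V i \<in> carrier (sec F V)" if "openin (top_of S) V" "V \<subseteq> U" "i \<in> ?I" for V i
    unfolding e_def by (rule psh_res[OF P U(1) that(1,2) esU[OF that(3)]])
  have eP: "e V \<in> ?I \<rightarrow> carrier (sec F V)" if "openin (top_of S) V" "V \<subseteq> U" for V using eV[OF that] by blast
  have er: "res F V W (e V i) = e W i" if "openin (top_of S) V" "V \<subseteq> U" "openin (top_of S) W" "W \<subseteq> V" "i \<in> ?I" for V W i
    unfolding e_def by (rule psh_comp[OF P U(1) that(1,3,4,2) esU[OF that(5)]])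
  have ind: "indep (O_sec S V) (sec F V) ?I (e V)" and spn: "z \<in> carrier (sec F V) \<Longrightarrow> in_span (O_sec S V) (sec F V) ?I (e V) z"
    if "openin (top_of S) V" "V \<subseteq> U" for V z
    using U(3) that unfolding basis_on_iff[OF P U(1)] e_def[abs_def] by simp_all
  \<comment> \<open>Coordinates are chosen by description over each open set separately. Their
    uniqueness, recorded in \<open>cfu\<close>, makes them linear and compatible with
    restriction.\<close>
  define cf where "cf V z = (SOME c. c \<in> ?I \<rightarrow> carrier (O_sec S V) \<and>
      z = (\<Oplus>\<^bsub>sec F V\<^esub>i\<in>?I. c i \<odot>\<^bsub>sec F V\<^esub> e V i))" for V z
  have cf: "cf V z \<in> ?I \<rightarrow> carrier (O_sec S V) \<and> z = (\<Oplus>\<^bsub>sec F V\<^esub>i\<in>?I. cf V z i \<odot>\<^bsub>sec F V\<^esub> e V i)"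
    if "openin (top_of S) V" "V \<subseteq> U" "z \<in> carrier (sec F V)" for V z
  proof -
    have "\<exists>c. c \<in> ?I \<rightarrow> carrier (O_sec S V) \<and> z = (\<Oplus>\<^bsub>sec F V\<^esub>i\<in>?I. c i \<odot>\<^bsub>sec F V\<^esub> e V i)"
      using spn[OF that] unfolding in_span_def by blast
    then show ?thesis unfolding cf_def by (rule someI_ex)
  qed
  have cfR: "cf V z i \<in> carrier (O_sec S V)" if "openin (top_of S) V" "V \<subseteq> U" "z \<in> carrier (sec F V)" "i \<in> ?I" for V z i
    using cf[OF that(1-3)] that(4) by (auto dest: Pi_mem)
  have cfu: "cf V z i = c i"
    if V: "openin (top_of S) V" "V \<subseteq> U" and c: "c \<in> ?I \<rightarrow> carrier (O_sec S V)"
      and z: "z = (\<Oplus>\<^bsub>sec F V\<^esub>i\<in>?I. c i \<odot>\<^bsub>sec F V\<^esub> e V i)" and i: "i \<in> ?I" for V z c i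
  proof -
    interpret FV: module "O_sec S V" "sec F V" using psh_module[OF P V(1)] .
    have zc: "z \<in> carrier (sec F V)" unfolding z by (rule FV.lincomb_closed[OF c eP[OF V]])
    show ?thesis
      by (rule FV.indep_unique[OF _ eP[OF V] ind[OF V] conjunct1[OF cf[OF V zc]] c _ i])
        (simp_all only: finite_lessThan conjunct2[OF cf[OF V zc], symmetric] z[symmetric])
  qed
  define \<phi> where "\<phi> i = (\<lambda>V\<in>opens S U. \<lambda>z\<in>carrier (sec F V). cf V z i)" for i
  have \<phi>ev: "\<phi> i V z = cf V z i" if "openin (top_of S) V" "V \<subseteq> U" "z \<in> carrier (sec F V)" for i V z
    using that by (simp add: \<phi>_def)
  have \<phi>: "\<phi> i \<in> carrier (sec (dual_sheaf S F) U)" if i: "i \<in> ?I" for i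
    unfolding \<phi>_def
  proof (rule dual_sheaf_carrierI[OF _ _ _ _ P], goal_cases)
    case (1 V z)
    then show ?case using cfR i by blast
  next
    case (2 V y z)
    interpret FV: module "O_sec S V" "sec F V" using psh_module[OF P 2(1)] .
    note cy = cf[OF 2(1-3)] and cz = cf[OF 2(1,2,4)]
    have "y \<oplus>\<^bsub>sec F V\<^esub> z = (\<Oplus>\<^bsub>sec F V\<^esub>i\<in>?I. cf V y i \<odot>\<^bsub>sec F V\<^esub> e V i) \<oplus>\<^bsub>sec F V\<^esub>
        (\<Oplus>\<^bsub>sec F V\<^esub>i\<in>?I. cf V z i \<odot>\<^bsub>sec F V\<^esub> e V i)"
      by (simp only: conjunct2[OF cy, symmetric] conjunct2[OF cz, symmetric])
    also have "\<dots> = (\<Oplus>\<^bsub>sec F V\<^esub>i\<in>?I. (cf V y i \<oplus>\<^bsub>O_sec S V\<^esub> cf V z i) \<odot>\<^bsub>sec F V\<^esub> e V i)"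
      by (rule FV.lincomb_add[OF conjunct1[OF cy] conjunct1[OF cz] eP[OF 2(1,2)]])
    finally show ?case
      by (intro cfu[OF 2(1,2) _ _ i]) (use cfR[OF 2(1-3)] cfR[OF 2(1,2,4)] in \<open>simp_all add: Pi_iff\<close>)
  next
    case (3 V r z)
    interpret FV: module "O_sec S V" "sec F V" using psh_module[OF P 3(1)] .
    note cz = cf[OF 3(1,2,4)]
    have "r \<odot>\<^bsub>sec F V\<^esub> z = r \<odot>\<^bsub>sec F V\<^esub> (\<Oplus>\<^bsub>sec F V\<^esub>i\<in>?I. cf V z i \<odot>\<^bsub>sec F V\<^esub> e V i)"
      by (simp only: conjunct2[OF cz, symmetric])
    also have "\<dots> = (\<Oplus>\<^bsub>sec F V\<^esub>i\<in>?I. (r \<otimes>\<^bsub>O_sec S V\<^esub> cf V z i) \<odot>\<^bsub>sec F V\<^esub> e V i)"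
      by (rule FV.lincomb_smult[OF _ 3(3) conjunct1[OF cz] eP[OF 3(1,2)]]) simp
    finally show ?case
      by (intro cfu[OF 3(1,2) _ _ i]) (use cfR[OF 3(1,2,4)] 3(3) in \<open>simp_all add: Pi_iff\<close>)
  next
    case (4 V W z)
    have WU: "W \<subseteq> U" using 4 by blast
    interpret FW: module "O_sec S W" "sec F W" using psh_module[OF P 4(3)] .
    note cz = cf[OF 4(1,2,5)]
    have rR: "O_res S V W (cf V z i) \<in> carrier (O_sec S W)" if "i \<in> ?I" for i
      by (rule rs_res[OF SR 4(1,3,4) cfR[OF 4(1,2,5) that]])
    have "res F V W z = res F V W (\<Oplus>\<^bsub>sec F V\<^esub>i\<in>?I. cf V z i \<odot>\<^bsub>sec F V\<^esub> e V i)"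
      by (simp only: conjunct2[OF cz, symmetric])
    also have "\<dots> = (\<Oplus>\<^bsub>sec F W\<^esub>i\<in>?I. O_res S V W (cf V z i) \<odot>\<^bsub>sec F W\<^esub> res F V W (e V i))"
      by (rule psh_lincomb[OF P SR 4(1,3,4) conjunct1[OF cz] eP[OF 4(1,2)]])
    also have "\<dots> = (\<Oplus>\<^bsub>sec F W\<^esub>i\<in>?I. O_res S V W (cf V z i) \<odot>\<^bsub>sec F W\<^esub> e W i)"
      by (rule FW.M.finsum_cong'[OF refl]) (use rR eV[OF 4(3) WU] er[OF 4(1,2,3,4)] in \<open>simp_all add: Pi_iff\<close>)
    finally show ?case
      by (intro cfu[OF 4(3) WU _ _ i]) (use rR in \<open>simp_all add: Pi_iff\<close>)
  qed
  have \<phi>e: "\<phi> i V (e V j) = (if i = j then \<one>\<^bsub>O_sec S V\<^esub> else \<zero>\<^bsub>O_sec S V\<^esub>)"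
    if V: "openin (top_of S) V" "V \<subseteq> U" and i: "i \<in> ?I" and j: "j \<in> ?I" for i j V
  proof -
    interpret FV: module "O_sec S V" "sec F V" using psh_module[OF P V(1)] .
    have "(\<Oplus>\<^bsub>sec F V\<^esub>i\<in>?I. (if i = j then \<one>\<^bsub>O_sec S V\<^esub> else \<zero>\<^bsub>O_sec S V\<^esub>) \<odot>\<^bsub>sec F V\<^esub> e V i) =
      (\<Oplus>\<^bsub>sec F V\<^esub>i\<in>?I. if j = i then e V i else \<zero>\<^bsub>sec F V\<^esub>)"
      by (rule FV.M.finsum_cong'[OF refl]) (use eV[OF V] in auto)
    also have "\<dots> = e V j" by (rule FV.M.finsum_singleton[OF j _ eP[OF V]]) simp
    finally have "e V j = (\<Oplus>\<^bsub>sec F V\<^esub>i\<in>?I. (if i = j then \<one>\<^bsub>O_sec S V\<^esub> else \<zero>\<^bsub>O_sec S V\<^esub>) \<odot>\<^bsub>sec F V\<^esub> e V i)" ..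
    from cfu[OF V _ this i] show ?thesis unfolding \<phi>ev[OF V eV[OF V j]] by (simp add: Pi_iff)
  qed
  obtain fs where fs: "basis_on S (dual_sheaf S F) U fs" "length fs = card ?I"
  proof (rule basis_on_family[OF PD U(1), of ?I \<phi>])
    show "\<phi> \<in> ?I \<rightarrow> carrier (sec (dual_sheaf S F) U)" using \<phi> by blast
  next
    fix V assume V: "openin (top_of S) V" "V \<subseteq> U"
    interpret RV: cring "O_sec S V" using rs_cring[OF SR V(1)] .
    have \<phi>V: "(\<lambda>i. res (dual_sheaf S F) U V (\<phi> i)) \<in> ?I \<rightarrow> carrier (sec (dual_sheaf S F) V)"
      using psh_res[OF PD U(1) V \<phi>] by blast
    have ev: "(\<Oplus>\<^bsub>sec (dual_sheaf S F) V\<^esub>i\<in>?I. c i \<odot>\<^bsub>sec (dual_sheaf S F) V\<^esub> res (dual_sheaf S F) U V (\<phi> i)) Y z =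
      (\<Oplus>\<^bsub>O_sec S Y\<^esub>i\<in>?I. O_res S V Y (c i) \<otimes>\<^bsub>O_sec S Y\<^esub> \<phi> i Y z)"
      if Y: "openin (top_of S) Y" "Y \<subseteq> V" and z: "z \<in> carrier (sec F Y)" and c: "c \<in> ?I \<rightarrow> carrier (O_sec S V)" for Y z c
      unfolding dual_eval_lincomb[OF P SR V(1) Y z c \<phi>V] dual_eval_res[OF Y(1) subset_trans[OF Y(2) V(2)] z V(2) Y(2)]
      by (rule refl)
    show "indep (O_sec S V) (sec (dual_sheaf S F) V) ?I (\<lambda>i. res (dual_sheaf S F) U V (\<phi> i))"
      unfolding indep_def
    proof (intro ballI impI)
      fix c j assume c: "c \<in> ?I \<rightarrow> carrier (O_sec S V)" and j: "j \<in> ?I"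
        and 0: "(\<Oplus>\<^bsub>sec (dual_sheaf S F) V\<^esub>i\<in>?I. c i \<odot>\<^bsub>sec (dual_sheaf S F) V\<^esub> res (dual_sheaf S F) U V (\<phi> i)) =
          \<zero>\<^bsub>sec (dual_sheaf S F) V\<^esub>"
      note ej = eV[OF V j]
      have "\<zero>\<^bsub>O_sec S V\<^esub> = (\<Oplus>\<^bsub>O_sec S V\<^esub>i\<in>?I. O_res S V V (c i) \<otimes>\<^bsub>O_sec S V\<^esub> \<phi> i V (e V j))"
        using ev[OF V(1) subset_refl ej c] unfolding 0 dual_eval_zero[OF V(1) subset_refl ej] .
      also have "\<dots> = (\<Oplus>\<^bsub>O_sec S V\<^esub>i\<in>?I. c i \<otimes>\<^bsub>O_sec S V\<^esub> (if i = j then \<one>\<^bsub>O_sec S V\<^esub> else \<zero>\<^bsub>O_sec S V\<^esub>))"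
        by (rule RV.finsum_cong'[OF refl]) (use c \<phi>e[OF V _ j] rs_id[OF SR V(1)] in \<open>simp_all add: Pi_iff\<close>)
      also have "\<dots> = c j" by (rule RV.finsum_delta[OF _ j c]) simp
      finally show "c j = \<zero>\<^bsub>O_sec S V\<^esub>" ..
    qed
    fix \<psi> assume \<psi>: "\<psi> \<in> carrier (sec (dual_sheaf S F) V)"
    \<comment> \<open>The coefficients of a functional in the dual basis are its values on the
      original basis.\<close>
    define c where "c i = \<psi> V (e V i)" for i
    have c: "c \<in> ?I \<rightarrow> carrier (O_sec S V)" unfolding c_def using dual_closed[OF \<psi> V(1) subset_refl eV[OF V]] by blast
    interpret DV: module "O_sec S V" "sec (dual_sheaf S F) V" using psh_module[OF PD V(1)] .
    have "\<psi> = (\<Oplus>\<^bsub>sec (dual_sheaf S F) V\<^esub>i\<in>?I. c i \<odot>\<^bsub>sec (dual_sheaf S F) V\<^esub> res (dual_sheaf S F) U V (\<phi> i))"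
    proof (rule dual_eqI[OF \<psi> DV.lincomb_closed[OF c \<phi>V]])
      fix Y z assume Y: "openin (top_of S) Y" "Y \<subseteq> V" and z: "z \<in> carrier (sec F Y)"
      have YU: "Y \<subseteq> U" using Y V by blast
      interpret RY: cring "O_sec S Y" using rs_cring[OF SR Y(1)] .
      note cz = cf[OF Y(1) YU z]
      have "\<psi> Y z = \<psi> Y (\<Oplus>\<^bsub>sec F Y\<^esub>i\<in>?I. cf Y z i \<odot>\<^bsub>sec F Y\<^esub> e Y i)"
        by (simp only: conjunct2[OF cz, symmetric])
      also have "\<dots> = (\<Oplus>\<^bsub>O_sec S Y\<^esub>i\<in>?I. cf Y z i \<otimes>\<^bsub>O_sec S Y\<^esub> \<psi> Y (e Y i))"
        by (rule dual_lincomb[OF P Y(1) SR \<psi> V(1) Y(2) conjunct1[OF cz] eP[OF Y(1) YU]])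
      also have "\<dots> = (\<Oplus>\<^bsub>O_sec S Y\<^esub>i\<in>?I. O_res S V Y (c i) \<otimes>\<^bsub>O_sec S Y\<^esub> \<phi> i Y z)"
      proof (rule RY.finsum_cong'[OF refl])
        have cY: "O_res S V Y (c i) \<in> carrier (O_sec S Y)" if "i \<in> ?I" for i
          by (rule rs_res[OF SR V(1) Y]) (use c that in auto)
        note zR = cfR[OF Y(1) YU z]
        show "(\<lambda>i. O_res S V Y (c i) \<otimes>\<^bsub>O_sec S Y\<^esub> \<phi> i Y z) \<in> ?I \<rightarrow> carrier (O_sec S Y)"
          unfolding \<phi>ev[OF Y(1) YU z] using cY zR by blast
        fix i assume i: "i \<in> ?I"
        have "\<psi> Y (e Y i) = O_res S V Y (c i)"
          unfolding c_def er[OF V Y i, symmetric] by (rule dual_res[OF \<psi> V(1) subset_refl Y eV[OF V i]])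
        then show "cf Y z i \<otimes>\<^bsub>O_sec S Y\<^esub> \<psi> Y (e Y i) = O_res S V Y (c i) \<otimes>\<^bsub>O_sec S Y\<^esub> \<phi> i Y z"
          unfolding \<phi>ev[OF Y(1) YU z] using RY.m_comm[OF zR[OF i] cY[OF i]] by simp
      qed
      finally show "\<psi> Y z = (\<Oplus>\<^bsub>sec (dual_sheaf S F) V\<^esub>i\<in>?I. c i \<odot>\<^bsub>sec (dual_sheaf S F) V\<^esub> res (dual_sheaf S F) U V (\<phi> i)) Y z"
        unfolding ev[OF Y z c] .
    qed
    then show "in_span (O_sec S V) (sec (dual_sheaf S F) V) ?I (\<lambda>i. res (dual_sheaf S F) U V (\<phi> i)) \<psi>"
      unfolding in_span_def using c by (rule bexI)
  qed auto
  have "int (length fs) = k" using fs(2) U(4) by simp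
  then show "\<exists>U fs. openin (top_of S) U \<and> x \<in> U \<and> basis_on S (dual_sheaf S F) U fs \<and> int (length fs) = k"
    using U(1,2) fs(1) by blast
qed

section \<open>Vanishing pieces and the sign of ranks\<close>

lemma dual_of_zero:
  assumes P: "presheaf_of_modules S F" and SR: "is_ringed_space S" and U: "openin (top_of S) U"
    and z: "\<And>V. openin (top_of S) V \<Longrightarrow> carrier (sec F V) = {\<zero>\<^bsub>sec F V\<^esub>}"
  shows "carrier (sec (dual_sheaf S F) U) = {\<zero>\<^bsub>sec (dual_sheaf S F) U\<^esub>}"
proof -
  interpret DU: module "O_sec S U" "sec (dual_sheaf S F) U" using psh_module[OF dual_presheaf[OF P SR] U] .
  have "\<phi> = \<zero>\<^bsub>sec (dual_sheaf S F) U\<^esub>" if \<phi>: "\<phi> \<in> carrier (sec (dual_sheaf S F) U)" for \<phi>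
  proof (rule dual_eqI[OF \<phi> DU.M.zero_closed])
    fix V y assume V: "openin (top_of S) V" "V \<subseteq> U" and y: "y \<in> carrier (sec F V)"
    interpret FV: module "O_sec S V" "sec F V" using psh_module[OF P V(1)] .
    have "\<phi> V \<zero>\<^bsub>sec F V\<^esub> = \<zero>\<^bsub>O_sec S V\<^esub>"
      by (rule additive_zero[OF FV.M.abelian_group_axioms FV.R.abelian_group_axioms _ dual_add[OF \<phi> V]])
        (use dual_closed[OF \<phi> V] in blast)
    moreover have "y = \<zero>\<^bsub>sec F V\<^esub>" using y z[OF V(1)] by simp
    ultimately show "\<phi> V y = \<zero>\<^bsub>sec (dual_sheaf S F) U\<^esub> V y" unfolding dual_eval_zero[OF V y] by simp
  qed
  then show ?thesis using DU.M.zero_closed by blast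
qed

text \<open>A zero module is spanned by the empty family, so over a nonzero ring an independent
  family in it is empty. This determines values of rank functions that are given abstractly, in
  degrees where the sheaf vanishes.\<close>

lemma rank_zero:
  assumes L: "locally_ringed_space S" and P: "presheaf_of_modules S F" and x: "points S \<noteq> {}"
    and lf: "locally_free_of_rank S F k" and z: "\<And>V. openin (top_of S) V \<Longrightarrow> carrier (sec F V) = {\<zero>\<^bsub>sec F V\<^esub>}"
  shows "k = 0"
proof -
  obtain x U es where U: "openin (top_of S) U" "x \<in> U" "basis_on S F U es" "int (length es) = k"
    using lf x unfolding locally_free_of_rank_def by blast
  interpret FU: module "O_sec S U" "sec F U" using psh_module[OF P U(1)] .
  have e: "(\<lambda>i. res F U U (es ! i)) \<in> {..<length es} \<rightarrow> carrier (sec F U)"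
    using psh_res[OF P U(1) U(1)] U(3) unfolding basis_on_def by (auto simp: subset_eq)
  have "card {..<length es} \<le> card ({}::nat set)"
  proof (rule FU.indep_le_span[OF nontrivial_sections[OF L U(1,2)] _ _ e])
    show "indep (O_sec S U) (sec F U) {..<length es} (\<lambda>i. res F U U (es ! i))"
      using U(1,3) unfolding basis_on_iff[OF P U(1)] by simp
    fix i assume "i \<in> {..<length es}"
    then have "res F U U (es ! i) = \<zero>\<^bsub>sec F U\<^esub>" using e z[OF U(1)] by auto
    then show "in_span (O_sec S U) (sec F U) {} (\<lambda>_::nat. \<zero>\<^bsub>sec F U\<^esub>) (res F U U (es ! i))"
      using FU.in_span_zero[of _ "{}::nat set"] by simp
  qed auto
  then show ?thesis using U(4) by simp
qed

lemma rank_nonneg: "points S \<noteq> {} \<Longrightarrow> locally_free_of_rank S F k \<Longrightarrow> k \<ge> 0"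
  unfolding locally_free_of_rank_def by fastforce

section \<open>Direct sums of graded pieces\<close>

lemma total_ops:
  "\<zero>\<^bsub>sec (total_sheaf F) U\<^esub> = (\<lambda>p. \<zero>\<^bsub>sec (F p) U\<^esub>)"
  "f \<oplus>\<^bsub>sec (total_sheaf F) U\<^esub> g = (\<lambda>p. f p \<oplus>\<^bsub>sec (F p) U\<^esub> g p)"
  "r \<odot>\<^bsub>sec (total_sheaf F) U\<^esub> f = (\<lambda>p. r \<odot>\<^bsub>sec (F p) U\<^esub> f p)"
  "res (total_sheaf F) U V f = (\<lambda>p. res (F p) U V (f p))"
  "f \<in> carrier (sec (total_sheaf F) U) \<longleftrightarrow> (\<forall>p. f p \<in> carrier (sec (F p) U)) \<and> finite {p. f p \<noteq> \<zero>\<^bsub>sec (F p) U\<^esub>}"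
  by (simp_all add: total_sheaf_def)

lemma total_module:
  assumes P: "\<And>p. presheaf_of_modules S (F p)" and U: "openin (top_of S) U" and SR: "is_ringed_space S"
  shows "module (O_sec S U) (sec (total_sheaf F) U)"
proof -
  interpret R: cring "O_sec S U" using rs_cring[OF SR U] .
  note md = psh_module[OF P U]
  have F: "abelian_group (sec (F p) U)" for p using mod_ag[OF md] .
  note amF = abelian_group.axioms(1)[OF F]
  note z = abelian_monoid.zero_closed[OF amF] and a = abelian_monoid.a_closed[OF amF]
  have ag: "abelian_group (sec (total_sheaf F) U)"
  proof (rule abelian_groupI)
    fix f g assume f: "f \<in> carrier (sec (total_sheaf F) U)" and g: "g \<in> carrier (sec (total_sheaf F) U)"
    have "{p. f p \<oplus>\<^bsub>sec (F p) U\<^esub> g p \<noteq> \<zero>\<^bsub>sec (F p) U\<^esub>} \<subseteq>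
        {p. f p \<noteq> \<zero>\<^bsub>sec (F p) U\<^esub>} \<union> {p. g p \<noteq> \<zero>\<^bsub>sec (F p) U\<^esub>}"
      using abelian_monoid.l_zero[OF amF z] by auto
    then show "f \<oplus>\<^bsub>sec (total_sheaf F) U\<^esub> g \<in> carrier (sec (total_sheaf F) U)"
      using f g a unfolding total_ops by (auto intro: finite_subset)
    show "f \<oplus>\<^bsub>sec (total_sheaf F) U\<^esub> g = g \<oplus>\<^bsub>sec (total_sheaf F) U\<^esub> f"
      using f g abelian_monoid.a_comm[OF amF] unfolding total_ops by auto
  next
    show "\<zero>\<^bsub>sec (total_sheaf F) U\<^esub> \<in> carrier (sec (total_sheaf F) U)" unfolding total_ops using z by simp
  next
    fix f g h assume "f \<in> carrier (sec (total_sheaf F) U)" "g \<in> carrier (sec (total_sheaf F) U)"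
      "h \<in> carrier (sec (total_sheaf F) U)"
    then show "f \<oplus>\<^bsub>sec (total_sheaf F) U\<^esub> g \<oplus>\<^bsub>sec (total_sheaf F) U\<^esub> h =
        f \<oplus>\<^bsub>sec (total_sheaf F) U\<^esub> (g \<oplus>\<^bsub>sec (total_sheaf F) U\<^esub> h)"
      using abelian_monoid.a_assoc[OF amF] unfolding total_ops by auto
  next
    fix f assume f: "f \<in> carrier (sec (total_sheaf F) U)"
    then show "\<zero>\<^bsub>sec (total_sheaf F) U\<^esub> \<oplus>\<^bsub>sec (total_sheaf F) U\<^esub> f = f"
      using abelian_monoid.l_zero[OF amF] unfolding total_ops by auto
    have mz: "\<ominus>\<^bsub>sec (F p) U\<^esub> \<zero>\<^bsub>sec (F p) U\<^esub> = \<zero>\<^bsub>sec (F p) U\<^esub>" for p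
      using abelian_group.minus_equality[OF F abelian_monoid.l_zero[OF amF z] z z] .
    have "{p. \<ominus>\<^bsub>sec (F p) U\<^esub> f p \<noteq> \<zero>\<^bsub>sec (F p) U\<^esub>} \<subseteq> {p. f p \<noteq> \<zero>\<^bsub>sec (F p) U\<^esub>}" using mz by auto
    then have "(\<lambda>p. \<ominus>\<^bsub>sec (F p) U\<^esub> f p) \<in> carrier (sec (total_sheaf F) U)"
      using f abelian_group.a_inv_closed[OF F] unfolding total_ops by (auto intro: finite_subset)
    moreover have "(\<lambda>p. \<ominus>\<^bsub>sec (F p) U\<^esub> f p) \<oplus>\<^bsub>sec (total_sheaf F) U\<^esub> f = \<zero>\<^bsub>sec (total_sheaf F) U\<^esub>"
      using f abelian_group.l_neg[OF F] unfolding total_ops by auto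
    ultimately show "\<exists>g\<in>carrier (sec (total_sheaf F) U). g \<oplus>\<^bsub>sec (total_sheaf F) U\<^esub> f = \<zero>\<^bsub>sec (total_sheaf F) U\<^esub>"
      by blast
  qed
  show ?thesis
  proof (rule moduleI[OF R.is_cring ag])
    fix r f assume r: "r \<in> carrier (O_sec S U)" and f: "f \<in> carrier (sec (total_sheaf F) U)"
    have "{p. r \<odot>\<^bsub>sec (F p) U\<^esub> f p \<noteq> \<zero>\<^bsub>sec (F p) U\<^esub>} \<subseteq> {p. f p \<noteq> \<zero>\<^bsub>sec (F p) U\<^esub>}"
      using module.smult_r_null[OF md r] by auto
    then show "r \<odot>\<^bsub>sec (total_sheaf F) U\<^esub> f \<in> carrier (sec (total_sheaf F) U)"
      using f module.smult_closed[OF md r] unfolding total_ops by (auto intro: finite_subset)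
  next
    fix r q f assume r: "r \<in> carrier (O_sec S U)" and q: "q \<in> carrier (O_sec S U)" and f: "f \<in> carrier (sec (total_sheaf F) U)"
    show "(r \<oplus>\<^bsub>O_sec S U\<^esub> q) \<odot>\<^bsub>sec (total_sheaf F) U\<^esub> f =
        r \<odot>\<^bsub>sec (total_sheaf F) U\<^esub> f \<oplus>\<^bsub>sec (total_sheaf F) U\<^esub> q \<odot>\<^bsub>sec (total_sheaf F) U\<^esub> f"
      using f module.smult_l_distr[OF md r q] unfolding total_ops by auto
    show "(r \<otimes>\<^bsub>O_sec S U\<^esub> q) \<odot>\<^bsub>sec (total_sheaf F) U\<^esub> f = r \<odot>\<^bsub>sec (total_sheaf F) U\<^esub> (q \<odot>\<^bsub>sec (total_sheaf F) U\<^esub> f)"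
      using f module.smult_assoc1[OF md r q] unfolding total_ops by auto
  next
    fix r f g assume r: "r \<in> carrier (O_sec S U)" and f: "f \<in> carrier (sec (total_sheaf F) U)"
      and g: "g \<in> carrier (sec (total_sheaf F) U)"
    show "r \<odot>\<^bsub>sec (total_sheaf F) U\<^esub> (f \<oplus>\<^bsub>sec (total_sheaf F) U\<^esub> g) =
        r \<odot>\<^bsub>sec (total_sheaf F) U\<^esub> f \<oplus>\<^bsub>sec (total_sheaf F) U\<^esub> r \<odot>\<^bsub>sec (total_sheaf F) U\<^esub> g"
      using f g module.smult_r_distr[OF md r] unfolding total_ops by auto
  next
    fix f assume "f \<in> carrier (sec (total_sheaf F) U)"
    then show "\<one>\<^bsub>O_sec S U\<^esub> \<odot>\<^bsub>sec (total_sheaf F) U\<^esub> f = f"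
      using module.smult_one[OF md] unfolding total_ops by auto
  qed
qed

lemma total_presheaf:
  assumes P: "\<And>p. presheaf_of_modules S (F p)" and SR: "is_ringed_space S"
  shows "presheaf_of_modules S (total_sheaf F)"
  unfolding presheaf_of_modules_def functorial_def
proof (intro conjI allI impI ballI total_module[OF P _ SR] funcsetI, goal_cases)
  case (1 U)
  then show ?case .
next
  case (2 U V f)
  then have o: "openin (top_of S) U" "openin (top_of S) V" "V \<subseteq> U" and f: "f \<in> carrier (sec (total_sheaf F) U)" by auto
  have "{p. res (F p) U V (f p) \<noteq> \<zero>\<^bsub>sec (F p) V\<^esub>} \<subseteq> {p. f p \<noteq> \<zero>\<^bsub>sec (F p) U\<^esub>}" using psh_zero[OF P o] by auto
  then show ?case using f psh_res[OF P o] unfolding total_ops by (auto intro: finite_subset)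
next
  case (3 U f)
  then show ?case using psh_id[OF P] unfolding total_ops by auto
next
  case (4 U V W f)
  then show ?case using psh_comp[OF P] unfolding total_ops by auto
next
  case (5 U V f g)
  then show ?case using psh_add[OF P] unfolding total_ops by auto
next
  case (6 U V r f)
  then show ?case using psh_smult[OF P] unfolding total_ops by auto
qed

text \<open>Local bases of the pieces in \<open>T\<close> are restricted to a common neighbourhood
  and placed in their degrees; the index set of pairs has the required size. Finiteness of
  \<open>T\<close> provides both the neighbourhood and a finite basis.\<close>

lemma total_locally_free:
  fixes F :: "int \<Rightarrow> ('x, 'r, 'm) mod_sheaf"
  assumes P: "\<And>p. presheaf_of_modules S (F p)" and SR: "is_ringed_space S"
    and T: "finite T" and lf: "\<And>p. p \<in> T \<Longrightarrow> locally_free_of_rank S (F p) (k p)"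
    and z: "\<And>p V. p \<notin> T \<Longrightarrow> openin (top_of S) V \<Longrightarrow> carrier (sec (F p) V) = {\<zero>\<^bsub>sec (F p) V\<^esub>}"
  shows "locally_free_of_rank S (total_sheaf F) (\<Sum>p\<in>T. k p)"
  unfolding locally_free_of_rank_def
proof
  fix x assume x: "x \<in> points S"
  note PT = total_presheaf[OF P SR]
  have "\<forall>p\<in>T. \<exists>U es. openin (top_of S) U \<and> x \<in> U \<and> basis_on S (F p) U es \<and> int (length es) = k p"
    using lf x unfolding locally_free_of_rank_def by blast
  from bchoice[OF this] obtain N where "\<forall>p\<in>T. \<exists>es. openin (top_of S) (N p) \<and> x \<in> N p \<and> basis_on S (F p) (N p) es \<and> int (length es) = k p" ..
  from bchoice[OF this] obtain es where Nes: "\<forall>p\<in>T. openin (top_of S) (N p) \<and> x \<in> N p \<and>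
      basis_on S (F p) (N p) (es p) \<and> int (length (es p)) = k p" ..
  have N: "openin (top_of S) (N p)" "x \<in> N p" "basis_on S (F p) (N p) (es p)" "int (length (es p)) = k p" if "p \<in> T" for p
    using Nes that by blast+
  obtain U where U: "openin (top_of S) U" "x \<in> U" and UN: "\<And>p. p \<in> T \<Longrightarrow> U \<subseteq> N p"
    by (rule finite_common_open[OF openin_topspace x T, of N]) (use N in auto)
  define b where "b p V i = res (F p) (N p) V (es p ! i)" for p V i
  have esN: "es p ! i \<in> carrier (sec (F p) (N p))" if "p \<in> T" "i < length (es p)" for p i
    using N(3)[OF that(1)] that(2) unfolding basis_on_def by auto
  have bV: "b p V i \<in> carrier (sec (F p) V)" if "p \<in> T" "i < length (es p)" "openin (top_of S) V" "V \<subseteq> U" for p V i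
    unfolding b_def using UN[OF that(1)] that(4) by (intro psh_res[OF P N(1)[OF that(1)] that(3) _ esN[OF that(1,2)]]) blast
  have br: "res (F p) U V (b p U i) = b p V i" if "p \<in> T" "i < length (es p)" "openin (top_of S) V" "V \<subseteq> U" for p V i
    unfolding b_def by (rule psh_comp[OF P N(1)[OF that(1)] U(1) that(3,4) UN[OF that(1)] esN[OF that(1,2)]])
  have bind: "indep (O_sec S V) (sec (F p) V) {..<length (es p)} (b p V)"
    and bspan: "w \<in> carrier (sec (F p) V) \<Longrightarrow> in_span (O_sec S V) (sec (F p) V) {..<length (es p)} (b p V) w"
    if "p \<in> T" "openin (top_of S) V" "V \<subseteq> U" for p V w
    using N(3)[OF that(1)] that(2) subset_trans[OF that(3) UN[OF that(1)]]
    unfolding basis_on_iff[OF P N(1)[OF that(1)]] b_def[abs_def] by simp_all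
  let ?I = "SIGMA p:T. {..<length (es p)}"
  have I: "finite ?I" using T by (intro finite_SigmaI) auto
  define e where "e V = (\<lambda>(p, i). \<lambda>q. if q = p then b p V i else \<zero>\<^bsub>sec (F q) V\<^esub>)" for V
  have zc: "\<zero>\<^bsub>sec (F q) V\<^esub> \<in> carrier (sec (F q) V)" if "openin (top_of S) V" for q V
    by (rule abelian_monoid.zero_closed[OF mod_am[OF psh_module[OF P that]]])
  have eV: "e V \<in> ?I \<rightarrow> carrier (sec (total_sheaf F) V)" if V: "openin (top_of S) V" "V \<subseteq> U" for V
  proof
    fix pi assume "pi \<in> ?I"
    then obtain p i where pi: "pi = (p, i)" "p \<in> T" "i < length (es p)" by auto
    have "{q. (if q = p then b p V i else \<zero>\<^bsub>sec (F q) V\<^esub>) \<noteq> \<zero>\<^bsub>sec (F q) V\<^esub>} \<subseteq> {p}" by auto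
    then show "e V pi \<in> carrier (sec (total_sheaf F) V)"
      unfolding total_ops pi(1) e_def using bV[OF pi(2,3) V] zc[OF V(1)] by (auto intro: finite_subset)
  qed
  have eres: "res (total_sheaf F) U V (e U pi) = e V pi" if V: "openin (top_of S) V" "V \<subseteq> U" and "pi \<in> ?I" for V pi
  proof -
    obtain p i where pi: "pi = (p, i)" "p \<in> T" "i < length (es p)" using \<open>pi \<in> ?I\<close> by auto
    show ?thesis unfolding total_ops pi(1) e_def using br[OF pi(2,3) V] psh_zero[OF P U(1) V] by auto
  qed
  \<comment> \<open>A combination is examined one component at a time: in degree \<open>q\<close>
    only the pairs with first entry \<open>q\<close> contribute, which reduces both independence and
    spanning to the single piece.\<close>
  have ev: "(\<Oplus>\<^bsub>sec (total_sheaf F) V\<^esub>pi\<in>?I. c pi \<odot>\<^bsub>sec (total_sheaf F) V\<^esub> e V pi) q =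
      (\<Oplus>\<^bsub>sec (F q) V\<^esub>i\<in>{..<length (es q)}. c (q, i) \<odot>\<^bsub>sec (F q) V\<^esub> b q V i)"
    if V: "openin (top_of S) V" "V \<subseteq> U" and c: "c \<in> ?I \<rightarrow> carrier (O_sec S V)" and q: "q \<in> T" for V c q
  proof -
    interpret TV: module "O_sec S V" "sec (total_sheaf F) V" using psh_module[OF PT V(1)] .
    interpret FV: module "O_sec S V" "sec (F q) V" using psh_module[OF P V(1)] .
    have cR: "c (p, i) \<in> carrier (O_sec S V)" if "p \<in> T" "i < length (es p)" for p i using c that by auto
    let ?G = "sec (F q) V" and ?J = "{..<length (es q)}"
    have bq: "b q V i \<in> carrier ?G" if "i \<in> ?J" for i using bV[OF q _ V] that by simp
    have "(\<Oplus>\<^bsub>sec (total_sheaf F) V\<^esub>pi\<in>?I. c pi \<odot>\<^bsub>sec (total_sheaf F) V\<^esub> e V pi) q =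
      (\<Oplus>\<^bsub>?G\<^esub>pi\<in>?I. (c pi \<odot>\<^bsub>sec (total_sheaf F) V\<^esub> e V pi) q)"
    proof (rule TV.hom_finsum_to[OF FV.M.abelian_monoid_axioms, where f="\<lambda>f. f q"])
      show "(\<lambda>pi. c pi \<odot>\<^bsub>sec (total_sheaf F) V\<^esub> e V pi) \<in> ?I \<rightarrow> carrier (sec (total_sheaf F) V)"
        using TV.smult_closed c eV[OF V] by (auto simp: Pi_iff)
    qed (auto simp: total_ops)
    also have "\<dots> = (\<Oplus>\<^bsub>?G\<^esub>pi\<in>Pair q ` ?J. c pi \<odot>\<^bsub>?G\<^esub> b q V (snd pi))"
    proof (rule FV.M.add.finprod_mono_neutral_cong_right[OF I])
      show "Pair q ` ?J \<subseteq> ?I" using q by auto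
      show "(c pi \<odot>\<^bsub>sec (total_sheaf F) V\<^esub> e V pi) q = \<zero>\<^bsub>?G\<^esub>" if "pi \<in> ?I - Pair q ` ?J" for pi
        using that cR by (auto simp: total_ops e_def)
      show "(c pi \<odot>\<^bsub>sec (total_sheaf F) V\<^esub> e V pi) q = c pi \<odot>\<^bsub>?G\<^esub> b q V (snd pi)" if "pi \<in> Pair q ` ?J" for pi
        using that by (auto simp: total_ops e_def)
      show "(\<lambda>pi. (c pi \<odot>\<^bsub>sec (total_sheaf F) V\<^esub> e V pi) q) \<in> ?I \<rightarrow> carrier ?G"
        using cR bq by (auto simp: total_ops e_def)
    qed
    also have "\<dots> = (\<Oplus>\<^bsub>?G\<^esub>i\<in>?J. c (q, i) \<odot>\<^bsub>?G\<^esub> b q V (snd (q, i)))"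
      by (rule FV.M.finsum_reindex) (use cR[OF q] bq in \<open>auto simp: inj_on_def\<close>)
    finally show ?thesis by simp
  qed
  obtain fs where fs: "basis_on S (total_sheaf F) U fs" "length fs = card ?I"
  proof (rule basis_on_family[OF PT U(1) I eV[OF U(1) subset_refl]])
    fix V assume V: "openin (top_of S) V" "V \<subseteq> U"
    interpret TV: module "O_sec S V" "sec (total_sheaf F) V" using psh_module[OF PT V(1)] .
    have er: "(\<Oplus>\<^bsub>sec (total_sheaf F) V\<^esub>pi\<in>?I. c pi \<odot>\<^bsub>sec (total_sheaf F) V\<^esub> res (total_sheaf F) U V (e U pi)) =
        (\<Oplus>\<^bsub>sec (total_sheaf F) V\<^esub>pi\<in>?I. c pi \<odot>\<^bsub>sec (total_sheaf F) V\<^esub> e V pi)"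
      if "c \<in> ?I \<rightarrow> carrier (O_sec S V)" for c
    proof (rule TV.M.finsum_cong'[OF refl])
      show "(\<lambda>pi. c pi \<odot>\<^bsub>sec (total_sheaf F) V\<^esub> e V pi) \<in> ?I \<rightarrow> carrier (sec (total_sheaf F) V)"
        using TV.smult_closed that eV[OF V] by (auto simp: Pi_iff)
    qed (simp only: eres[OF V])
    show "indep (O_sec S V) (sec (total_sheaf F) V) ?I (\<lambda>pi. res (total_sheaf F) U V (e U pi))"
      unfolding indep_def
    proof (intro ballI impI)
      fix c pi assume c: "c \<in> ?I \<rightarrow> carrier (O_sec S V)" and "pi \<in> ?I"
        and 0: "(\<Oplus>\<^bsub>sec (total_sheaf F) V\<^esub>pi\<in>?I. c pi \<odot>\<^bsub>sec (total_sheaf F) V\<^esub> res (total_sheaf F) U V (e U pi)) =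
          \<zero>\<^bsub>sec (total_sheaf F) V\<^esub>"
      then obtain q i where pi: "pi = (q, i)" "q \<in> T" "i < length (es q)" by auto
      have "(\<Oplus>\<^bsub>sec (F q) V\<^esub>i\<in>{..<length (es q)}. c (q, i) \<odot>\<^bsub>sec (F q) V\<^esub> b q V i) = \<zero>\<^bsub>sec (F q) V\<^esub>"
        unfolding ev[OF V c pi(2), symmetric] er[OF c, symmetric] 0 total_ops(1) by (rule refl)
      moreover have "(\<lambda>i. c (q, i)) \<in> {..<length (es q)} \<rightarrow> carrier (O_sec S V)" using c pi(2) by auto
      ultimately show "c pi = \<zero>\<^bsub>O_sec S V\<^esub>" using bind[OF pi(2) V] pi unfolding indep_def by auto
    qed
    fix f assume f: "f \<in> carrier (sec (total_sheaf F) V)"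
    have fq: "f q \<in> carrier (sec (F q) V)" for q using f by (simp add: total_ops)
    have "\<forall>q\<in>T. \<exists>c. c \<in> {..<length (es q)} \<rightarrow> carrier (O_sec S V) \<and>
        f q = (\<Oplus>\<^bsub>sec (F q) V\<^esub>i\<in>{..<length (es q)}. c i \<odot>\<^bsub>sec (F q) V\<^esub> b q V i)"
      using bspan[OF _ V fq] unfolding in_span_def by blast
    from bchoice[OF this] obtain c where c: "\<forall>q\<in>T. c q \<in> {..<length (es q)} \<rightarrow> carrier (O_sec S V) \<and>
        f q = (\<Oplus>\<^bsub>sec (F q) V\<^esub>i\<in>{..<length (es q)}. c q i \<odot>\<^bsub>sec (F q) V\<^esub> b q V i)" ..
    let ?c = "\<lambda>(q, i). c q i"
    have cI: "?c \<in> ?I \<rightarrow> carrier (O_sec S V)" using c by auto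
    have sc: "(\<Oplus>\<^bsub>sec (total_sheaf F) V\<^esub>pi\<in>?I. ?c pi \<odot>\<^bsub>sec (total_sheaf F) V\<^esub> e V pi) \<in> carrier (sec (total_sheaf F) V)"
      by (rule TV.lincomb_closed[OF cI eV[OF V]])
    have "f = (\<Oplus>\<^bsub>sec (total_sheaf F) V\<^esub>pi\<in>?I. ?c pi \<odot>\<^bsub>sec (total_sheaf F) V\<^esub> e V pi)"
    proof
      fix q show "f q = (\<Oplus>\<^bsub>sec (total_sheaf F) V\<^esub>pi\<in>?I. ?c pi \<odot>\<^bsub>sec (total_sheaf F) V\<^esub> e V pi) q"
      proof (cases "q \<in> T")
        case True
        then show ?thesis unfolding ev[OF V cI True] using c by simp
      next
        \<comment> \<open>In a degree outside \<open>T\<close> the carrier has only the zero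
          element, so both components agree without any computation of the sum.\<close>
        case False
        have "(\<Oplus>\<^bsub>sec (total_sheaf F) V\<^esub>pi\<in>?I. ?c pi \<odot>\<^bsub>sec (total_sheaf F) V\<^esub> e V pi) q \<in> carrier (sec (F q) V)"
          using sc unfolding total_ops by blast
        then show ?thesis using fq[of q] unfolding z[OF False V(1)] by simp
      qed
    qed
    then have "f = (\<Oplus>\<^bsub>sec (total_sheaf F) V\<^esub>pi\<in>?I. ?c pi \<odot>\<^bsub>sec (total_sheaf F) V\<^esub> res (total_sheaf F) U V (e U pi))"
      unfolding er[OF cI] .
    then show "in_span (O_sec S V) (sec (total_sheaf F) V) ?I (\<lambda>pi. res (total_sheaf F) U V (e U pi)) f"
      unfolding in_span_def using cI by (rule bexI)
  qed
  have "int (length fs) = (\<Sum>p\<in>T. k p)"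
    unfolding fs(2) using T N(4) by (simp add: card_SigmaI)
  then show "\<exists>U fs. openin (top_of S) U \<and> x \<in> U \<and> basis_on S (total_sheaf F) U fs \<and> int (length fs) = (\<Sum>p\<in>T. k p)"
    using U fs(1) by blast
qed

section \<open>Maximality\<close>

text \<open>\<open>betaI\<close> runs over the support of \<open>hI\<close>, the rank over
  \<open>P\<close>. Both are extended by zero terms to the union, where the comparison is termwise.
  Equal sums force all the nonnegative differences to vanish, and off the union both functions are
  zero.\<close>

lemma sum_le_betaI:
  assumes "finite P" "\<And>p. p \<notin> P \<Longrightarrow> f p = 0" "\<And>p. 0 \<le> f p" "\<And>p. f p \<le> hI a b t m p"
    and fin: "finite {p. hI a b t m p \<noteq> 0}"
  shows "(\<Sum>p\<in>P. f p) \<le> betaI a b t m \<and> ((\<Sum>p\<in>P. f p) = betaI a b t m \<longleftrightarrow> f = hI a b t m)"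
proof -
  let ?h = "hI a b t m"
  let ?Q = "P \<union> {p. ?h p \<noteq> 0}"
  have Q: "finite ?Q" using assms(1) fin by simp
  have f: "(\<Sum>p\<in>P. f p) = (\<Sum>p\<in>?Q. f p)"
    by (rule sum.mono_neutral_left[OF Q]) (use assms(2) in auto)
  have h: "betaI a b t m = (\<Sum>p\<in>?Q. ?h p)"
    unfolding betaI_def by (rule sum.mono_neutral_left[OF Q]) auto
  have "(\<Sum>p\<in>?Q. f p) \<le> (\<Sum>p\<in>?Q. ?h p)" by (rule sum_mono) (rule assms(4))
  moreover have "(\<Sum>p\<in>?Q. f p) = (\<Sum>p\<in>?Q. ?h p) \<longleftrightarrow> f = ?h"
  proof
    assume eq: "(\<Sum>p\<in>?Q. f p) = (\<Sum>p\<in>?Q. ?h p)"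
    \<comment> \<open>A sum of nonnegative integers vanishes only if every term does; it is applied
      to the differences.\<close>
    have "(\<Sum>p\<in>?Q. ?h p - f p) = 0 \<longleftrightarrow> (\<forall>p\<in>?Q. ?h p - f p = 0)"
    proof (rule sum_nonneg_eq_0_iff[OF Q])
      show "0 \<le> ?h p - f p" for p using assms(4)[of p] by linarith
    qed
    then have *: "\<forall>p\<in>?Q. ?h p - f p = 0" using eq by (simp only: sum_subtractf diff_self simp_thms)
    show "f = ?h"
    proof
      fix p show "f p = ?h p"
      proof (cases "p \<in> ?Q")
        case True
        from bspec[OF * this] show ?thesis by linarith
      next
        case False
        then show ?thesis using assms(2)[of p] by simp
      qed
    qed
  qed (simp only:)
  ultimately show ?thesis unfolding f h by (rule conjI)
qed

theorem mainTheorem18: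
  fixes S :: "('x, 'r) ringed_space"
    and A :: "('x, 'r, 'a) graded_alg"
    and B :: "('x, 'r, 'a, 'b) graded_mod"
    and C :: "('x, 'r, 'a, 'c) graded_mod"
    and a b t :: "int \<Rightarrow> int"
    and h :: "int \<Rightarrow> int \<Rightarrow> int"
  assumes "noetherian_scheme S" and "points S \<noteq> {}"
    and "graded_algebra S A" and "degree_zero_is_O S A"
    and "quasi_coherent S (total_sheaf (alg_piece A))"
    and "finitely_generated_algebra S A"
    and "\<And>p. locally_free_of_rank S (alg_piece A p) (a p)"
    and "graded_module S A B" and "locally_finitely_generated S A B"
    and "\<And>p. locally_free_of_rank S (piece B p) (b p)"
    and "b 0 \<noteq> 0" and "\<And>p. p < 0 \<Longrightarrow> b p = 0"
    and "\<And>p. t p \<ge> 0" and "finite {p. t p \<noteq> 0}" and "\<exists>p. t p \<noteq> 0"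
    and "C \<in> HLambda S A B h" and "has_socle_type S A C t"
  shows "(\<forall>m p. h m p \<le> hI a b t m p) \<and>
    (\<forall>m. sheaf_rank S (total_sheaf (piece (Lambda S A m C))) \<le> betaI a b t m \<and>
       (sheaf_rank S (total_sheaf (piece (Lambda S A m C))) = betaI a b t m \<longleftrightarrow> h m = hI a b t m))"
proof -
  have L: "locally_ringed_space S" using assms(1) by (simp add: noetherian_scheme_def scheme_def)
  have SR: "is_ringed_space S" using L by (simp add: locally_ringed_space_def)
  note A = assms(3) and ar = assms(7) and br = assms(10)
  have B: "graded_premodule S A B" by (rule graded_module_premodule[OF assms(8)])
  obtain x where x: "x \<in> points S" using assms(2) by blast
  let ?D = "graded_dual S A C"
  let ?P = "{p. \<exists>U. openin (top_of S) U \<and> carrier (mod_sec C p U) \<noteq> {\<zero>\<^bsub>mod_sec C p U\<^esub>}}"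
  have hq: "homogeneous_quotient S A B C" and Pfin: "finite ?P"
    and hr: "\<And>m p. locally_free_of_rank S (piece (Delta S A m ?D) (- p)) (h m p)"
    using assms(16) by (simp_all add: HLambda_def Let_def)
  have C: "graded_premodule S A C"
    by (rule graded_module_premodule[OF conjunct1[OF hq[unfolded homogeneous_quotient_def]]])
  note D = graded_dual_premodule[OF SR A C]
  note PE = Delta_presheaf[OF SR A D]
  have Dz: "carrier (mod_sec ?D (- p) V) = {\<zero>\<^bsub>mod_sec ?D (- p) V\<^esub>}" if "p \<notin> ?P" "openin (top_of S) V" for p V
    using dual_of_zero[OF gpm_psh[OF C] SR that(2), of p] that(1) by (simp add: piece_graded_dual)
  have Ez: "carrier (mod_sec (Delta S A m ?D) (- p) V) = {\<zero>\<^bsub>mod_sec (Delta S A m ?D) (- p) V\<^esub>}"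
    if "p \<notin> ?P" "openin (top_of S) V" for m p V
  proof -
    interpret module "O_sec S V" "mod_sec (Delta S A m ?D) (- p) V" using psh_module[OF PE that(2)] .
    have "carrier (mod_sec (Delta S A m ?D) (- p) V) \<subseteq> carrier (mod_sec ?D (- p) V)" by (auto simp: Delta_sec)
    also have "\<dots> = {\<zero>\<^bsub>mod_sec (Delta S A m ?D) (- p) V\<^esub>}" unfolding Dz[OF that] by (simp add: Delta_sec)
    finally show ?thesis using M.zero_closed by blast
  qed
  \<comment> \<open>\<open>p0\<close> bounds the degrees in which \<open>C\<close> lives, so the
    dual vanishes below degree \<open>- p0\<close>; there the Nakayama induction starts.\<close>
  obtain p0 where p0: "\<And>p. p \<in> ?P \<Longrightarrow> p \<le> p0" using bdd_above_finite[OF Pfin] unfolding bdd_above_def by blast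
  have low: "carrier (mod_sec ?D n V) = {\<zero>\<^bsub>mod_sec ?D n V\<^esub>}" if "n < - p0" "openin (top_of S) V" for n V
  proof -
    have "- n \<notin> ?P" using p0[of "- n"] that(1) by auto
    from Dz[OF this that(2)] show ?thesis by simp
  qed
  \<comment> \<open>The degree \<open>n\<close> piece of the tensor product has rank
    \<open>t (- n)\<close>; the sign is that of the grading on the dual.\<close>
  have soc: "locally_free_of_rank S (graded_tensor S A ?D (structure_module A) n) (t (- n))" for n
    using assms(17)[unfolded has_socle_type_def, rule_format, of "- n"] by simp
  have a0: "a p = 0" if "p < 0" for p
    by (rule rank_zero[OF L alg_psh[OF A] assms(2) ar]) (rule alg_neg[OF A _ that])
  have anonneg: "0 \<le> a p" for p by (rule rank_nonneg[OF assms(2) ar])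
  have bnonneg: "0 \<le> b p" for p by (rule rank_nonneg[OF assms(2) br])
  have hnonneg: "0 \<le> h m p" for m p by (rule rank_nonneg[OF assms(2) hr])
  define s where "s = Max {q. t q \<noteq> 0}"
  have s: "q \<le> s" if "t q \<noteq> 0" for q unfolding s_def using assms(14) that by simp
  have hb: "h m p \<le> b p" for m p by (rule Delta_dual_rank_le[OF L A B hq x br hr])
  have hg: "h m p \<le> g_fun a t m p" for m p
  proof -
    have fin: "finite {n. t (- n) \<noteq> 0}"
      using finite_imageI[OF assms(14), of uminus] by (rule finite_subset[rotated]) force
    have "h m p \<le> (\<Sum>j\<in>{j. t (- j) \<noteq> 0 \<and> j \<le> - m}. t (- j) * a (- p - j))"
      by (rule Delta_rank_le_generators[OF L A D x low soc fin assms(13) ar hr])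
    \<comment> \<open>Substituting \<open>q = - j\<close> undoes the grading of the dual:
      \<open>j \<le> - m\<close> becomes \<open>m \<le> q\<close> and \<open>a (- p - j)\<close>
      becomes \<open>a (q - p)\<close>.\<close>
    also have "\<dots> = (\<Sum>q\<in>{q. t q \<noteq> 0 \<and> m \<le> q}. t q * a (q - p))"
      by (rule sum.reindex_bij_witness[of _ uminus uminus]) (auto intro: arg_cong[of _ _ a])
    \<comment> \<open>Degrees with \<open>t q = 0\<close> contribute nothing, and no others lie
      above the upper limit \<open>s\<close>.\<close>
    also have "\<dots> = g_fun a t m p"
      unfolding g_fun_def s_def[symmetric] by (rule sum.mono_neutral_left) (use s in auto)
    finally show ?thesis .
  qed
  have le: "h m p \<le> hI a b t m p" for m p using hb hg by (simp add: hI_def)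
  \<comment> \<open>A sum over an infinite support would be zero by convention, so finiteness gives
    \<open>betaI\<close> its meaning. Below degree zero the minimum is zero because \<open>b\<close>
    vanishes and \<open>g_fun\<close> is nonnegative; above \<open>s\<close> every
    \<open>a (q - p)\<close> has a negative argument, so \<open>g_fun\<close> vanishes.\<close>
  have hIfin: "finite {p. hI a b t m p \<noteq> 0}" for m
  proof (rule finite_subset)
    show "{p. hI a b t m p \<noteq> 0} \<subseteq> {0..s}"
    proof
      fix p assume p: "p \<in> {p. hI a b t m p \<noteq> 0}"
      have g0: "g_fun a t m p \<ge> 0"
        unfolding g_fun_def by (intro sum_nonneg mult_nonneg_nonneg assms(13) anonneg)
      have "p \<ge> 0"
      proof (rule ccontr)
        assume "\<not> p \<ge> 0"
        then have "b p = 0" using assms(12) by simp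
        then show False using p g0 by (simp add: hI_def)
      qed
      moreover have "p \<le> s"
      proof (rule ccontr)
        assume "\<not> p \<le> s"
        then have "g_fun a t m p = 0"
          unfolding g_fun_def s_def[symmetric] by (intro sum.neutral) (use a0 in auto)
        then show False using p bnonneg[of p] by (simp add: hI_def)
      qed
      ultimately show "p \<in> {0..s}" by simp
    qed
  qed simp
  \<comment> \<open>Each piece of \<open>Lambda\<close> is the dual of a truncated piece and has the
    same rank. Outside the finite set \<open>?P\<close> of degrees where \<open>C\<close> is nonzero
    all these pieces vanish, so the rank of the direct sum is a finite sum.\<close>
  have rank: "sheaf_rank S (total_sheaf (piece (Lambda S A m C))) = (\<Sum>p\<in>?P. h m p)" for m
  proof -
    have pc: "piece (Lambda S A m C) p = dual_sheaf S (piece (Delta S A m ?D) (- p))" for p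
      by (simp add: Lambda_def piece_graded_dual)
    have PL: "presheaf_of_modules S (piece (Lambda S A m C) p)" for p
      unfolding pc by (rule dual_presheaf[OF PE SR])
    have "locally_free_of_rank S (total_sheaf (piece (Lambda S A m C))) (\<Sum>p\<in>?P. h m p)"
    proof (rule total_locally_free[OF PL SR Pfin])
      show "locally_free_of_rank S (piece (Lambda S A m C) p) (h m p)" for p
        unfolding pc by (rule dual_locally_free[OF SR PE hr])
      show "carrier (sec (piece (Lambda S A m C) p) V) = {\<zero>\<^bsub>sec (piece (Lambda S A m C) p) V\<^esub>}"
        if "p \<notin> ?P" "openin (top_of S) V" for p V
        unfolding pc by (rule dual_of_zero[OF PE SR that(2) Ez[OF that(1)]])
    qed
    then show ?thesis by (rule sheaf_rank_eqI[OF L total_presheaf[OF PL SR] assms(2)])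
  qed
  \<comment> \<open>\<open>h\<close> is an arbitrary function prescribing ranks; where the
    truncations are zero its value is forced to be zero by \<open>rank_zero\<close>, so nothing is
    lost by summing over \<open>?P\<close>.\<close>
  have h0: "h m p = 0" if "p \<notin> ?P" for m p
    by (rule rank_zero[OF L PE assms(2) hr Ez[OF that]])
  show ?thesis
  proof (intro conjI allI)
    show "h m p \<le> hI a b t m p" for m p by (rule le)
    note * = sum_le_betaI[OF Pfin h0 hnonneg le hIfin]
    show "sheaf_rank S (total_sheaf (piece (Lambda S A m C))) \<le> betaI a b t m" for m
      unfolding rank using * by blast
    show "sheaf_rank S (total_sheaf (piece (Lambda S A m C))) = betaI a b t m \<longleftrightarrow> h m = hI a b t m" for m
      unfolding rank using * by blast
  qed
qed

end
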